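(* Let $p$ be a positive integer. The isometry group of $X_p(\mathbb R)$ is $\mathbf{PO}(p,\infty)=\mathbf O(p,\infty)/\{\pm I\}$; that is, the natural action homomorphism $\pi:\mathbf O(p,\infty)\to\mathrm{Isom}(X_p(\mathbb R))$ is surjective with kernel $\{\pm I\}$.
   Context: Let $\mathcal H$ be a separable infinite-dimensional real Hilbert space, $E_0\subset\mathcal H$ a subspace of dimension $p$, $\Phi=\mathrm{Id}$ on $E_0$ and $-\mathrm{Id}$ on $E_0^\perp$, $B(x,y)=\langle x,\Phi y\rangle$. $X_p(\mathbb R)$ is the set of $p$-dimensional subspaces $E$ of $\mathcal H$ with $B|_{E\times E}$ positive definite. $\mathbf O(p,\infty)$ is the group of invertible bounded operators $h$ of $\mathcal H$ with ${}^th\Phi h=\Phi$; it acts transitively on $X_p(\mathbb R)$ by $E\mapsto h(E)$, and $\pi(h)$ denotes the resulting map of $X_p(\mathbb R)$. Metric: let $\mathfrak p$ be the space of symmetric Hilbert–Schmidt operators $A$ with $A\Phi+\Phi A=0$. The map $A\mapsto\frac{d}{dt}|_{t=0}\exp(tA)E_0$ identifies $\mathfrak p$ with $T_{E_0}X_p(\mathbb R)$, and $X_p(\mathbb R)$ carries the $\mathbf O(p,\infty)$-invariant Riemannian metric with $\|A\|^2=\mathrm{Trace}({}^tAA)$ at $E_0$. $\mathrm{Isom}(X_p(\mathbb R))$ is the group of (bijective) isometries of the associated distance. *)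

theory Defs
  imports "HOL-Analysis.Analysis" "HOL-Algebra.Coset" "HOL-Algebra.Bij"
begin

definition infinite_dimensional :: "'a::real_vector itself \<Rightarrow> bool" where
  "infinite_dimensional _ \<longleftrightarrow> \<not> (\<exists>S::'a set. finite S \<and> span S = UNIV)"

definition hform :: "('a::real_inner \<Rightarrow>\<^sub>L 'a) \<Rightarrow> 'a \<Rightarrow> 'a \<Rightarrow> real" where
  "hform \<Phi> x y = x \<bullet> \<Phi> y"

(* dim is 0 on subspaces without a finite basis, so this is the intended set only for p > 0. *)
definition X_space :: "nat \<Rightarrow> ('a::real_inner \<Rightarrow>\<^sub>L 'a) \<Rightarrow> 'a set set" where
  "X_space p \<Phi> = {E. subspace E \<and> dim E = p \<and> (\<forall>x\<in>E. x \<noteq> 0 \<longrightarrow> hform \<Phi> x x > 0)}"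

definition O_group :: "('a::real_inner \<Rightarrow>\<^sub>L 'a) \<Rightarrow> ('a \<Rightarrow>\<^sub>L 'a) monoid" where
  "O_group \<Phi> =
    \<lparr>carrier = {h. (\<exists>g. g o\<^sub>L h = id_blinfun \<and> h o\<^sub>L g = id_blinfun) \<and>
                   adjoint (blinfun_apply h) \<circ> blinfun_apply \<Phi> \<circ> blinfun_apply h
                     = blinfun_apply \<Phi>},
     mult = (o\<^sub>L),
     one = id_blinfun\<rparr>"

definition PO_group :: "('a::real_inner \<Rightarrow>\<^sub>L 'a) \<Rightarrow> ('a \<Rightarrow>\<^sub>L 'a) set monoid" where
  "PO_group \<Phi> = O_group \<Phi> Mod {id_blinfun, - id_blinfun}"


definition orthonormal_basis :: "'a::real_inner set \<Rightarrow> bool" where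
  "orthonormal_basis b \<longleftrightarrow>
     pairwise orthogonal b \<and> (\<forall>e\<in>b. norm e = 1) \<and> closure (span b) = UNIV"

definition hilbert_schmidt :: "('a::real_inner \<Rightarrow>\<^sub>L 'a) \<Rightarrow> bool" where
  "hilbert_schmidt A \<longleftrightarrow> (\<forall>b. orthonormal_basis b \<longrightarrow> (\<lambda>e. (norm (A e))\<^sup>2) summable_on b)"

(* For trace class operators the value does not depend on the basis. *)
definition op_trace :: "('a::real_inner \<Rightarrow> 'a) \<Rightarrow> real" where
  "op_trace T = infsum (\<lambda>e. e \<bullet> T e) (SOME b. orthonormal_basis b)"

definition hs_norm :: "('a::real_inner \<Rightarrow>\<^sub>L 'a) \<Rightarrow> real" where
  "hs_norm A = sqrt (op_trace (adjoint (blinfun_apply A) \<circ> blinfun_apply A))"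

definition p_space :: "('a::real_inner \<Rightarrow>\<^sub>L 'a) \<Rightarrow> ('a \<Rightarrow>\<^sub>L 'a) set" where
  "p_space \<Phi> = {A. adjoint (blinfun_apply A) = blinfun_apply A \<and> hilbert_schmidt A \<and>
                   (A o\<^sub>L \<Phi>) + (\<Phi> o\<^sub>L A) = 0}"

definition op_exp :: "('a::real_normed_vector \<Rightarrow>\<^sub>L 'a) \<Rightarrow> 'a \<Rightarrow>\<^sub>L 'a" where
  "op_exp A = (\<Sum>n. (1 / fact n) *\<^sub>R (((\<lambda>T. A o\<^sub>L T) ^^ n) id_blinfun))"

definition orth_proj :: "'a::real_inner set \<Rightarrow> 'a \<Rightarrow>\<^sub>L 'a" where
  "orth_proj E = Blinfun (\<lambda>x. THE y. y \<in> E \<and> (\<forall>z\<in>E. orthogonal (x - y) z))"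

(* The manifold structure of the Grassmannian of p-dimensional subspaces is the one induced by
   the embedding of E as orth_proj E in the Banach space of bounded operators.  A tangent vector
   at E is therefore an operator v, the derivative of orth_proj along a curve through E.  The
   norm below is the invariant Riemannian one: v is the image under h of the vector at E0 that
   corresponds to A, and the value is independent of the choice of h with h(E0) = E.  *)
definition riem_norm ::
    "'a::real_inner set \<Rightarrow> ('a \<Rightarrow>\<^sub>L 'a) \<Rightarrow> 'a set \<Rightarrow> ('a \<Rightarrow>\<^sub>L 'a) \<Rightarrow> real" where
  "riem_norm E0 \<Phi> E v =
     (THE r. \<exists>h\<in>carrier (O_group \<Phi>). \<exists>A\<in>p_space \<Phi>.
        blinfun_apply h ` E0 = E \<and>
        ((\<lambda>t. orth_proj (blinfun_apply h ` blinfun_apply (op_exp (t *\<^sub>R A)) ` E0))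
           has_vector_derivative v) (at 0) \<and>
        r = hs_norm A)"

(* piecewise_C1_differentiable_on admits derivatives that are unbounded near a break point, and
   the value of integral is 0 for a function that is not integrable; has_integral therefore
   restricts to curves that do have the (finite) length L. *)
definition curve_of_length ::
    "nat \<Rightarrow> 'a::real_inner set \<Rightarrow> ('a \<Rightarrow>\<^sub>L 'a) \<Rightarrow> (real \<Rightarrow> 'a set) \<Rightarrow> real \<Rightarrow> bool" where
  "curve_of_length p E0 \<Phi> \<gamma> L \<longleftrightarrow>
     (\<forall>t\<in>{0..1}. \<gamma> t \<in> X_space p \<Phi>) \<and>
     (\<lambda>t. orth_proj (\<gamma> t)) piecewise_C1_differentiable_on {0..1} \<and>
     ((\<lambda>t. riem_norm E0 \<Phi> (\<gamma> t) (vector_derivative (\<lambda>s. orth_proj (\<gamma> s)) (at t)))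
        has_integral L) {0..1}"

definition X_dist ::
    "nat \<Rightarrow> 'a::real_inner set \<Rightarrow> ('a \<Rightarrow>\<^sub>L 'a) \<Rightarrow> 'a set \<Rightarrow> 'a set \<Rightarrow> real" where
  "X_dist p E0 \<Phi> E F = Inf {L. \<exists>\<gamma>. curve_of_length p E0 \<Phi> \<gamma> L \<and> \<gamma> 0 = E \<and> \<gamma> 1 = F}"

definition Isom_group ::
    "nat \<Rightarrow> 'a::real_inner set \<Rightarrow> ('a \<Rightarrow>\<^sub>L 'a) \<Rightarrow> ('a set \<Rightarrow> 'a set) monoid" where
  "Isom_group p E0 \<Phi> = (BijGroup (X_space p \<Phi>))
     \<lparr>carrier := {f \<in> Bij (X_space p \<Phi>).
        \<forall>E\<in>X_space p \<Phi>. \<forall>F\<in>X_space p \<Phi>. X_dist p E0 \<Phi> (f E) (f F) = X_dist p E0 \<Phi> E F}\<rparr>"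

definition action_hom ::
    "nat \<Rightarrow> ('a::real_inner \<Rightarrow>\<^sub>L 'a) \<Rightarrow> ('a \<Rightarrow>\<^sub>L 'a) \<Rightarrow> 'a set \<Rightarrow> 'a set" where
  "action_hom p \<Phi> h = (\<lambda>E\<in>X_space p \<Phi>. blinfun_apply h ` E)"

end

theory Submission
  imports Defs
begin

text \<open>Write \<open>B\<close> for the form of \<open>\<Phi>\<close>.  Every element of \<open>X\<close> is \<open>exp A\<close> applied to \<open>E0\<close> for some \<open>A\<close>
  in \<open>pp\<close>, and it is at distance \<open>\<parallel>A\<parallel>\<close> from \<open>E0\<close>: the geodesic gives the upper bound, and a Busemann
  function, which is Lipschitz along every curve, gives the lower bound.  The geodesic symmetries are induced
  by \<open>B\<close>-orthogonal reflections and satisfy \<open>d (s\<^sub>m x) x = 2 d m x\<close>, so an isometry commutes with them by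
  Vaisala's argument for the Mazur-Ulam theorem.  Hence an isometry fixing \<open>E0\<close> permutes the
  geodesics through \<open>E0\<close>; its differential \<open>T\<close> is linear and isometric because the distance
  is infinitesimally Euclidean, and it intertwines the transvections, so that it preserves commutation
  of operators because the action is faithful up to sign.  Elements of rank one are characterised by
  commutation and the inner product, so \<open>T\<close> preserves them; as the orthogonal complement of \<open>E0\<close> is
  infinite-dimensional and \<open>E0\<close> is not, \<open>T\<close> is the conjugation with an orthogonal operator that
  preserves \<open>E0\<close>.\<close>

section \<open>Closed subspaces and adjoints\<close>

text \<open>Since \<open>E0\<close> has finite dimension, an element of \<open>pp\<close> has finite
  rank and a singular value decomposition with \<open>p\<close> values, so exponentials, geodesics
  and norms become explicit finite sums. The tangent vectors of the definition are derivatives of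
  orthogonal projections, on which the group does not act by conjugation; projections along the
  complement for the form repair this. The isometry comes without any differentiability, so its
  differential has to be read off from geodesics. A linear bijection that preserves matrices of rank
  one multiplies them by fixed matrices on both sides, or, for square matrices, does so after a
  transposition. The second kind is what the different sizes of \<open>E0\<close> and its complement
  exclude. Infinite dimension helps twice more: finitely many elements of \<open>pp\<close>
  annihilate a common vector, which removes the ambiguity of sign in commutators, and elements with
  a vanishing singular value are recognised by the size of their centraliser.\<close>

lemma closed_subspace_projection:
  fixes M :: "'a::{real_inner,complete_space} set"
  assumes cl: "closed M" and sub: "subspace M"
  shows "\<exists>y\<in>M. \<forall>z\<in>M. (x - y) \<bullet> z = 0"
proof -
  define d where "d = Inf ((\<lambda>y. (norm (x - y))\<^sup>2) ` M)"
  have ne: "(\<lambda>y. (norm (x - y))\<^sup>2) ` M \<noteq> {}" using subspace_0[OF sub] by auto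
  have bdd: "bdd_below ((\<lambda>y. (norm (x - y))\<^sup>2) ` M)" by (rule bdd_belowI[of _ 0]) auto
  have dle: "d \<le> (norm (x - y))\<^sup>2" if "y \<in> M" for y
    unfolding d_def by (rule cInf_lower[OF _ bdd]) (use that in auto)
  have "\<exists>y\<in>M. (norm (x - y))\<^sup>2 < d + 1 / real (Suc n)" for n
    using cInf_lessD[OF ne, of "d + 1 / real (Suc n)"] unfolding d_def[symmetric] by auto
  then obtain y where yM: "\<And>n. y n \<in> M" and yd: "\<And>n. (norm (x - y n))\<^sup>2 < d + 1 / real (Suc n)"
    by metis
  \<comment> \<open>Parallelogram law: the midpoint of two near-minimisers lies in \<open>M\<close>,
    so its squared distance to \<open>x\<close> is at least \<open>d\<close>, and this forces the
    two to be close.\<close>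
  have par: "(norm (y n - y m))\<^sup>2 \<le> 2 / real (Suc n) + 2 / real (Suc m)" for n m
  proof -
    have "(1/2) *\<^sub>R (y n + y m) \<in> M" using yM sub by (simp add: subspace_add subspace_scale)
    from dle[OF this] have 1: "d \<le> (norm (x - (1/2) *\<^sub>R (y n + y m)))\<^sup>2" .
    have "(norm (y n - y m))\<^sup>2 = 2 * (norm (x - y n))\<^sup>2 + 2 * (norm (x - y m))\<^sup>2
        - 4 * (norm (x - (1/2) *\<^sub>R (y n + y m)))\<^sup>2"
      unfolding power2_norm_eq_inner by (simp add: inner_diff inner_add inner_commute algebra_simps)
    moreover have "2 / real (Suc n) = 2 * (1 / real (Suc n))" "2 / real (Suc m) = 2 * (1 / real (Suc m))" by simp_all
    ultimately show ?thesis using 1 yd[of n] yd[of m] by linarith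
  qed
  have "Cauchy y"
  proof (rule CauchyI)
    fix e :: real assume e: "0 < e"
    obtain N where N: "4 / e\<^sup>2 < real N" using reals_Archimedean2 by blast
    have N': "4 / real (Suc N) < e\<^sup>2"
    proof -
      have "4 < real N * e\<^sup>2" using N e by (simp add: divide_simps)
      also have "\<dots> \<le> real (Suc N) * e\<^sup>2" by (simp add: mult_right_mono)
      finally show ?thesis by (simp add: divide_simps mult.commute)
    qed
    show "\<exists>M. \<forall>m\<ge>M. \<forall>n\<ge>M. norm (y m - y n) < e"
    proof (intro exI[of _ N] allI impI)
      fix m n assume mn: "m \<ge> N" "n \<ge> N"
      have "2 / real (Suc m) \<le> 2 / real (Suc N)" "2 / real (Suc n) \<le> 2 / real (Suc N)"
        using mn by (auto intro!: divide_left_mono)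
      then have "(norm (y m - y n))\<^sup>2 < e\<^sup>2" using par[of m n] N' by simp
      then show "norm (y m - y n) < e" using e power_less_imp_less_base by fastforce
    qed
  qed
  then obtain l where l: "y \<longlonglongrightarrow> l" using Cauchy_convergent convergent_def by blast
  have lM: "l \<in> M" using closed_sequentially[OF cl _ l] yM by blast
  have "(\<lambda>n. (norm (x - y n))\<^sup>2) \<longlonglongrightarrow> (norm (x - l))\<^sup>2" by (intro tendsto_intros l)
  moreover have "(\<lambda>n. d + 1 / real (Suc n)) \<longlonglongrightarrow> d + 0"
    by (intro tendsto_intros LIMSEQ_Suc lim_1_over_n)
  ultimately have "(norm (x - l))\<^sup>2 \<le> d + 0"
    by (rule LIMSEQ_le) (use yd in \<open>auto intro: less_imp_le\<close>)
  then have ld: "(norm (x - l))\<^sup>2 \<le> d" by simp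
  show ?thesis
  proof (intro bexI[OF _ lM] ballI)
    fix z assume z: "z \<in> M"
    \<comment> \<open>The coefficient at which the quadratic polynomial in the displacement of
      \<open>l\<close> along \<open>z\<close> is smallest.\<close>
    define t where "t = ((x - l) \<bullet> z) / (z \<bullet> z)"
    show "(x - l) \<bullet> z = 0"
    proof (cases "z = 0")
      case False
      then have zz: "z \<bullet> z > 0" by simp
      have "l + t *\<^sub>R z \<in> M" using z lM sub by (simp add: subspace_add subspace_scale)
      from dle[OF this] ld have "(norm (x - l))\<^sup>2 \<le> (norm (x - (l + t *\<^sub>R z)))\<^sup>2" by (rule order_trans[rotated])
      also have "\<dots> = (norm (x - l))\<^sup>2 - 2 * t * ((x - l) \<bullet> z) + t * t * (z \<bullet> z)"
        unfolding power2_norm_eq_inner by (simp add: inner_diff inner_add inner_commute algebra_simps)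
      finally have "2 * t * ((x - l) \<bullet> z) \<le> t * t * (z \<bullet> z)" by simp
      also have "t * t * (z \<bullet> z) = t * ((x - l) \<bullet> z)" using zz by (simp add: t_def)
      finally have "t * ((x - l) \<bullet> z) \<le> 0" by simp
      then have "((x - l) \<bullet> z) * ((x - l) \<bullet> z) \<le> 0" using zz by (simp add: t_def divide_le_0_iff)
      moreover have "((x - l) \<bullet> z) * ((x - l) \<bullet> z) \<ge> 0" by simp
      ultimately show ?thesis by (metis antisym mult_eq_0_iff)
    qed simp
  qed
qed

lemma riesz_representation:
  fixes f :: "'a::{real_inner,complete_space} \<Rightarrow> real"
  assumes f: "bounded_linear f"
  shows "\<exists>y. \<forall>x. f x = x \<bullet> y"
proof -
  interpret f: bounded_linear f by (rule f)
  define M where "M = {x. f x = 0}"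
  have sub: "subspace M" unfolding M_def subspace_def by (auto simp: f.add f.scaleR)
  have cl: "closed M" unfolding M_def
    by (intro closed_Collect_eq continuous_intros f.continuous_on)
  show ?thesis
  proof (cases "\<forall>x. f x = 0")
    case True then show ?thesis by (intro exI[of _ 0]) auto
  next
    case False
    then obtain x where x: "f x \<noteq> 0" by auto
    obtain y where y: "y \<in> M" "\<And>z. z \<in> M \<Longrightarrow> (x - y) \<bullet> z = 0"
      using closed_subspace_projection[OF cl sub, of x] by blast
    define w where "w = x - y"
    have fw: "f w \<noteq> 0" using x y by (simp add: w_def f.diff M_def)
    then have w0: "w \<noteq> 0" using f.zero by auto
    have "f z = z \<bullet> ((f w / (w \<bullet> w)) *\<^sub>R w)" for z
    proof -
      have "z - (f z / f w) *\<^sub>R w \<in> M" using fw by (simp add: M_def f.diff f.scaleR)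
      then have "w \<bullet> (z - (f z / f w) *\<^sub>R w) = 0" using y(2) by (simp add: w_def)
      then have "w \<bullet> z = (f z / f w) * (w \<bullet> w)" by (simp add: inner_diff)
      then show ?thesis using fw w0 by (simp add: inner_commute)
    qed
    then show ?thesis by blast
  qed
qed

text \<open>\<open>adjoint\<close> is given by a choice operator and has its defining property only
  once some adjoint is known to exist; for bounded operators on a complete space this is Riesz
  representation.\<close>

lemma inner_adjoint_blinfun:
  fixes A :: "'a::{real_inner,complete_space} \<Rightarrow>\<^sub>L 'b::real_inner"
  shows "A x \<bullet> y = x \<bullet> adjoint (blinfun_apply A) y"
proof -
  have "\<exists>z. \<forall>x. A x \<bullet> y = x \<bullet> z" for y
    by (rule riesz_representation) (intro bounded_linear_intros)
  then have "\<exists>g. \<forall>x y. A x \<bullet> y = x \<bullet> g y" by metis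
  then have "\<forall>x y. A x \<bullet> y = x \<bullet> adjoint (blinfun_apply A) y"
    unfolding adjoint_def by (rule someI_ex)
  then show ?thesis by blast
qed

section \<open>Orthonormal bases and Parseval's identity\<close>

lemma subspace_closure:
  fixes S :: "'a::real_normed_vector set"
  assumes "subspace S"
  shows "subspace (closure S)"
proof (rule subspaceI)
  show "0 \<in> closure S" using subspace_0[OF assms] closure_subset by blast
next
  fix x y assume "x \<in> closure S" "y \<in> closure S"
  then obtain f g where "\<And>n. f n \<in> S" "f \<longlonglongrightarrow> x" "\<And>n. g n \<in> S" "g \<longlonglongrightarrow> y"
    unfolding closure_sequential by blast
  then show "x + y \<in> closure S" unfolding closure_sequential
    by (intro exI[of _ "\<lambda>n. f n + g n"]) (auto intro: tendsto_add subspace_add[OF assms])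
next
  fix c x assume "x \<in> closure S"
  then obtain f where "\<And>n. f n \<in> S" "f \<longlonglongrightarrow> x" unfolding closure_sequential by blast
  then show "c *\<^sub>R x \<in> closure S" unfolding closure_sequential
    by (intro exI[of _ "\<lambda>n. c *\<^sub>R f n"]) (auto intro: tendsto_scaleR subspace_scale[OF assms])
qed

text \<open>Wanted because \<open>op_trace\<close> evaluates on a basis picked by choice. A maximal
  orthonormal set is total: the projection onto its closed span would otherwise leave a normal
  vector to adjoin.\<close>

lemma ex_orthonormal_basis: "\<exists>b::'a::{real_inner,complete_space} set. orthonormal_basis b"
proof -
  define \<A> where "\<A> = {b::'a set. pairwise orthogonal b \<and> (\<forall>e\<in>b. norm e = 1)}"
  have "\<exists>M\<in>\<A>. \<forall>X\<in>\<A>. M \<subseteq> X \<longrightarrow> X = M"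
  proof (rule subset_Zorn_nonempty)
    have "{} \<in> \<A>" by (simp add: \<A>_def)
    then show "\<A> \<noteq> {}" by blast
    fix C assume C: "C \<noteq> {}" "subset.chain \<A> C"
    then have CA: "C \<subseteq> \<A>" and tot: "\<And>X Y. X \<in> C \<Longrightarrow> Y \<in> C \<Longrightarrow> X \<subseteq> Y \<or> Y \<subseteq> X"
      unfolding subset_chain_def by blast+
    show "\<Union>C \<in> \<A>"
    proof -
      have "orthogonal x y" if xy: "x \<in> \<Union>C" "y \<in> \<Union>C" "x \<noteq> y" for x y
      proof -
        obtain X Y where "X \<in> C" "Y \<in> C" "x \<in> X" "y \<in> Y" using xy by auto
        then obtain Z where "Z \<in> C" "x \<in> Z" "y \<in> Z" using tot by blast
        then have "Z \<in> \<A>" using CA by blast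
        then show ?thesis using xy(3) \<open>x \<in> Z\<close> \<open>y \<in> Z\<close> by (simp add: \<A>_def pairwise_def)
      qed
      then have "pairwise orthogonal (\<Union>C)" unfolding pairwise_def by blast
      moreover have "norm x = 1" if "x \<in> \<Union>C" for x
        using that CA by (auto simp: \<A>_def)
      ultimately show ?thesis by (simp add: \<A>_def)
    qed
  qed
  then obtain b where b: "b \<in> \<A>" and mx: "\<And>X. X \<in> \<A> \<Longrightarrow> b \<subseteq> X \<Longrightarrow> X = b" by blast
  have "closure (span b) = UNIV"
  proof (rule ccontr)
    assume "closure (span b) \<noteq> UNIV"
    then obtain x where x: "x \<notin> closure (span b)" by auto
    obtain y where y: "y \<in> closure (span b)" "\<And>z. z \<in> closure (span b) \<Longrightarrow> (x - y) \<bullet> z = 0"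
      using closed_subspace_projection[OF closed_closure subspace_closure[OF subspace_span], of b x] by blast
    define w where "w = (1 / norm (x - y)) *\<^sub>R (x - y)"
    have n0: "norm (x - y) \<noteq> 0" using x y by auto
    have w1: "norm w = 1" using n0 by (simp add: w_def)
    have wo: "orthogonal w z" if "z \<in> b" for z
      using y(2)[of z] that closure_subset[of "span b"] span_base[OF that]
      by (auto simp: w_def orthogonal_def)
    have "orthogonal z w" if "z \<in> b" for z using wo[OF that] by (simp add: orthogonal_commute)
    then have "insert w b \<in> \<A>" using b w1 wo by (simp add: \<A>_def pairwise_insert)
    then have "w \<in> b" using mx by blast
    then show False using wo[of w] w1 by (simp add: orthogonal_def dot_square_norm)
  qed
  then show ?thesis using b unfolding orthonormal_basis_def \<A>_def by blast
qed

lemma orthonormal_sum_norm: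
  fixes F :: "'a::real_inner set"
  assumes "finite F" "pairwise orthogonal F" "\<And>e. e \<in> F \<Longrightarrow> norm e = 1"
  shows "e \<in> F \<Longrightarrow> e \<bullet> (\<Sum>f\<in>F. c f *\<^sub>R f) = c e"
    and "(norm (x - (\<Sum>f\<in>F. (f \<bullet> x) *\<^sub>R f)))\<^sup>2 = (norm x)\<^sup>2 - (\<Sum>f\<in>F. (f \<bullet> x)\<^sup>2)"
proof -
  have ee: "e \<bullet> f = (if e = f then 1 else 0)" if "e \<in> F" "f \<in> F" for e f
    using assms(2,3) that by (auto simp: pairwise_def orthogonal_def dot_square_norm)
  have A: "e \<bullet> (\<Sum>f\<in>F. c f *\<^sub>R f) = c e" if "e \<in> F" for e c
  proof -
    have "e \<bullet> (\<Sum>f\<in>F. c f *\<^sub>R f) = (\<Sum>f\<in>F. if e = f then c f else 0)"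
      unfolding inner_sum_right by (rule sum.cong) (use ee that in auto)
    then show ?thesis using that assms(1) by simp
  qed
  then show "e \<in> F \<Longrightarrow> e \<bullet> (\<Sum>f\<in>F. c f *\<^sub>R f) = c e" .
  define s where "s = (\<Sum>f\<in>F. (f \<bullet> x) *\<^sub>R f)"
  have "s \<bullet> s = (\<Sum>f\<in>F. (f \<bullet> x) * (f \<bullet> s))" by (subst s_def) (simp add: inner_sum_left)
  also have "\<dots> = (\<Sum>f\<in>F. (f \<bullet> x)\<^sup>2)" by (intro sum.cong) (auto simp: s_def A power2_eq_square)
  finally have 1: "s \<bullet> s = (\<Sum>f\<in>F. (f \<bullet> x)\<^sup>2)" .
  have 2: "x \<bullet> s = (\<Sum>f\<in>F. (f \<bullet> x)\<^sup>2)"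
    unfolding s_def by (simp add: inner_sum_right power2_eq_square inner_commute)
  have "(norm (x - s))\<^sup>2 = (norm x)\<^sup>2 - (\<Sum>f\<in>F. (f \<bullet> x)\<^sup>2)"
    unfolding power2_norm_eq_inner by (simp add: inner_diff 1 2 inner_commute[of s x])
  then show "(norm (x - (\<Sum>f\<in>F. (f \<bullet> x) *\<^sub>R f)))\<^sup>2 = (norm x)\<^sup>2 - (\<Sum>f\<in>F. (f \<bullet> x)\<^sup>2)"
    by (simp only: s_def)
qed

lemma norm_diff_pythagoras:
  fixes a :: "'a::real_inner"
  assumes "a \<bullet> b = 0"
  shows "(norm (a - b))\<^sup>2 = (norm a)\<^sup>2 + (norm b)\<^sup>2"
  using assms unfolding power2_norm_eq_inner by (simp add: inner_diff inner_commute)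

text \<open>For finite \<open>Y\<close> the defect in Bessel's inequality is the squared distance
  from \<open>x\<close> to the span of \<open>Y\<close>. It is small as soon as \<open>Y\<close>
  contains the finitely many vectors that occur in a good approximation \<open>y\<close>.\<close>

lemma parseval_has_sum:
  fixes b :: "'a::real_inner set"
  assumes b: "orthonormal_basis b"
  shows "((\<lambda>e. (e \<bullet> x)\<^sup>2) has_sum (norm x)\<^sup>2) b"
proof -
  have po: "pairwise orthogonal b" and n1: "\<And>e. e \<in> b \<Longrightarrow> norm e = 1" and cl: "closure (span b) = UNIV"
    using b by (auto simp: orthonormal_basis_def)
  have fin: "pairwise orthogonal F" "\<And>e. e \<in> F \<Longrightarrow> norm e = 1" if "F \<subseteq> b" for F
    using pairwise_subset[OF po that] n1 that by blast+
  have "((\<lambda>F. \<Sum>e\<in>F. (e \<bullet> x)\<^sup>2) \<longlongrightarrow> (norm x)\<^sup>2) (finite_subsets_at_top b)"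
  proof (rule tendstoI)
    fix \<epsilon> :: real assume \<epsilon>: "\<epsilon> > 0"
    obtain y where y: "y \<in> span b" "dist y x < sqrt \<epsilon>"
      using closure_approachable[of x "span b"] cl real_sqrt_gt_zero[OF \<epsilon>] by blast
    obtain F where F: "finite F" "F \<subseteq> b" "y \<in> span F"
    proof -
      obtain t r where t: "finite t" "t \<subseteq> b" "y = (\<Sum>a\<in>t. r a *\<^sub>R a)"
        using y(1) by (auto simp: span_explicit)
      have "y \<in> span t" unfolding t(3) by (rule span_sum, rule span_scale, rule span_base)
      then show ?thesis using that t by blast
    qed
    show "\<forall>\<^sub>F F in finite_subsets_at_top b. dist (\<Sum>e\<in>F. (e \<bullet> x)\<^sup>2) ((norm x)\<^sup>2) < \<epsilon>"
      unfolding eventually_finite_subsets_at_top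
    proof (intro exI[of _ F] conjI allI impI F(1,2))
      fix Y assume Y: "finite Y \<and> F \<subseteq> Y \<and> Y \<subseteq> b"
      define s where "s = (\<Sum>f\<in>Y. (f \<bullet> x) *\<^sub>R f)"
      note ons = orthonormal_sum_norm[of Y, OF _ fin(1)[of Y] fin(2)[of Y]]
      have e: "(norm (x - s))\<^sup>2 = (norm x)\<^sup>2 - (\<Sum>f\<in>Y. (f \<bullet> x)\<^sup>2)"
        unfolding s_def by (rule ons(2)) (use Y in auto)
      have "s \<in> span Y" unfolding s_def by (rule span_sum, rule span_scale, rule span_base)
      then have sp: "y - s \<in> span Y"
        using F(3) Y span_mono[of F Y] by (meson span_diff subsetD)
      have o1: "f \<bullet> (x - s) = 0" if "f \<in> Y" for f
      proof -
        have "f \<bullet> s = f \<bullet> x" unfolding s_def by (rule ons(1)) (use Y that in auto)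
        then show ?thesis by (simp add: inner_diff_right)
      qed
      have "orthogonal (x - s) (y - s)"
        by (rule orthogonal_to_span[OF sp]) (use o1 in \<open>simp add: orthogonal_def inner_commute\<close>)
      then have o: "(x - s) \<bullet> (y - s) = 0" by (simp add: orthogonal_def)
      have "(norm (x - y))\<^sup>2 = (norm ((x - s) - (y - s)))\<^sup>2" by simp
      also have "\<dots> = (norm (x - s))\<^sup>2 + (norm (y - s))\<^sup>2"
        by (rule norm_diff_pythagoras[OF o])
      finally have "(norm (x - s))\<^sup>2 \<le> (norm (x - y))\<^sup>2" by simp
      also have "\<dots> < \<epsilon>" using y(2) \<epsilon>
        using power_strict_mono[of "norm (x - y)" "sqrt \<epsilon>" 2] by (simp add: dist_norm norm_minus_commute)
      finally show "dist (\<Sum>e\<in>Y. (e \<bullet> x)\<^sup>2) ((norm x)\<^sup>2) < \<epsilon>" using e zero_le_power2[of "norm (x - s)"]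
        by (simp add: dist_real_def)
    qed
  qed
  then show ?thesis by (simp add: has_sum_def)
qed

section \<open>Orthonormal families and singular values\<close>

text \<open>Families indexed by numbers, not sets, so that singular vectors and singular values can
  be matched by their index.\<close>

definition onf :: "nat \<Rightarrow> (nat \<Rightarrow> 'a::real_inner) \<Rightarrow> bool" where
  "onf n e \<longleftrightarrow> (\<forall>i<n. \<forall>j<n. e i \<bullet> e j = (if i = j then 1 else 0))"

lemma onfD: "onf n e \<Longrightarrow> i < n \<Longrightarrow> j < n \<Longrightarrow> e i \<bullet> e j = (if i = j then 1 else 0)"
  by (simp add: onf_def)

lemma onf_norm: "onf n e \<Longrightarrow> i < n \<Longrightarrow> norm (e i) = 1"
  using onfD[of n e i i] by (simp add: norm_eq_sqrt_inner)

lemma onf_inner_sum: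
  assumes "onf n e" "i < n"
  shows "e i \<bullet> (\<Sum>j<n. c j *\<^sub>R e j) = c i"
proof -
  have "e i \<bullet> (\<Sum>j<n. c j *\<^sub>R e j) = (\<Sum>j<n. if i = j then c j else 0)"
    unfolding inner_sum_right by (rule sum.cong) (use onfD[OF assms(1)] assms(2) in auto)
  then show ?thesis using assms(2) by simp
qed

lemma onf_inner_sums:
  assumes "onf n e"
  shows "(\<Sum>j<n. c j *\<^sub>R e j) \<bullet> (\<Sum>j<n. d j *\<^sub>R e j) = (\<Sum>j<n. c j * d j)"
  by (simp add: inner_sum_left onf_inner_sum[OF assms])

lemma onf_inj: "onf n e \<Longrightarrow> inj_on e {..<n}"
  by (rule inj_onI) (metis lessThan_iff onfD zero_neq_one)

lemma onf_span_eq: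
  assumes "onf n e" "x \<in> span (e ` {..<n})"
  shows "x = (\<Sum>i<n. (e i \<bullet> x) *\<^sub>R e i)"
  using assms(2)
proof (induction rule: span_induct_alt)
  case base then show ?case by simp
next
  case (step c y z)
  then obtain k where k: "k < n" "y = e k" by auto
  have "(\<Sum>i<n. (e i \<bullet> y) *\<^sub>R e i) = (\<Sum>i<n. if i = k then e k else 0)"
    by (rule sum.cong) (use k onfD[OF assms(1)] in auto)
  then have "(\<Sum>i<n. (e i \<bullet> y) *\<^sub>R e i) = y" using k by simp
  then show ?case using step.IH
    by (simp add: inner_add_right scaleR_add_left sum.distrib flip: scaleR_scaleR scaleR_sum_right)
qed

lemma sum_in_span: "(\<Sum>i<n. c i *\<^sub>R e i) \<in> span (e ` {..<n::nat})"
  by (intro span_sum span_scale span_base) auto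

lemma onf_independent:
  assumes "onf n e" shows "independent (e ` {..<n})"
proof (rule independent_if_scalars_zero)
  show "finite (e ` {..<n})" by simp
  fix f x assume 0: "(\<Sum>x\<in>e ` {..<n}. f x *\<^sub>R x) = 0" and x: "x \<in> e ` {..<n}"
  obtain i where i: "i < n" "x = e i" using x by auto
  have "(\<Sum>x\<in>e ` {..<n}. f x *\<^sub>R x) = (\<Sum>j<n. f (e j) *\<^sub>R e j)"
    by (rule sum.reindex[OF onf_inj[OF assms], unfolded comp_def])
  then show "f x = 0" using 0 onf_inner_sum[OF assms i(1), of "\<lambda>j. f (e j)"] i by simp
qed

lemma onf_dim: "onf n e \<Longrightarrow> dim (span (e ` {..<n})) = n"
  by (simp add: dim_eq_card_independent[OF onf_independent] card_image[OF onf_inj])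

lemma onf_parseval:
  assumes "onf n e" "x \<in> span (e ` {..<n})"
  shows "(\<Sum>i<n. (e i \<bullet> x) * (e i \<bullet> y)) = x \<bullet> y"
proof -
  have "x \<bullet> y = (\<Sum>i<n. (e i \<bullet> x) *\<^sub>R e i) \<bullet> y" using onf_span_eq[OF assms] by simp
  then show ?thesis by (simp add: inner_sum_left)
qed

lemma ex_onf:
  fixes V :: "'a::real_inner set"
  assumes "finite B" "V \<subseteq> span B" "subspace V"
  shows "\<exists>e. onf (dim V) e \<and> span (e ` {..<dim V}) = V"
proof -
  obtain B' where B': "B' \<subseteq> V" "independent B'" "V \<subseteq> span B'" "card B' = dim V"
    using basis_exists by blast
  have finB: "finite B'" using independent_span_bound[OF assms(1) B'(2)] B'(1) assms(2) by blast
  obtain C where C: "finite C" "card C \<le> card B'" "span C = span B'" "pairwise orthogonal C"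
    using basis_orthogonal[OF finB] by blast
  have spV: "span B' = V" using B' assms(3) by (metis span_subspace)
  define C' where "C' = C - {0}"
  have spC': "span C' = V" using C(3) spV span_delete_0[of C] by (simp add: C'_def)
  have po: "pairwise orthogonal C'" using C(4) by (auto simp: C'_def pairwise_def)
  have ind: "independent C'" by (rule pairwise_orthogonal_independent[OF po]) (simp add: C'_def)
  have cC: "card C' = dim V" proof -
    have "span C' = span V" using spC' assms(3) by (simp add: span_eq_iff[THEN iffD2])
    then show ?thesis using dim_eq_card[of C' V] ind by simp
  qed
  obtain g where g: "bij_betw g {..<dim V} C'"
    using ex_bij_betw_nat_finite[of C'] C(1) cC by (auto simp: C'_def lessThan_atLeast0)
  define e where "e i = (1 / norm (g i)) *\<^sub>R g i" for i
  have gC: "g i \<in> C'" if "i < dim V" for i using g that by (auto simp: bij_betw_def)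
  have gn: "g i \<noteq> 0" if "i < dim V" for i using gC[OF that] by (simp add: C'_def)
  have "onf (dim V) e" unfolding onf_def
  proof (intro allI impI)
    fix i j assume ij: "i < dim V" "j < dim V"
    show "e i \<bullet> e j = (if i = j then 1 else 0)"
    proof (cases "i = j")
      case True then show ?thesis using gn[OF ij(1)] by (simp add: e_def dot_square_norm power2_eq_square)
    next
      case False
      then have "g i \<noteq> g j" using g ij by (auto simp: bij_betw_def inj_on_def)
      then have "g i \<bullet> g j = 0" using po gC ij by (auto simp: pairwise_def orthogonal_def)
      then show ?thesis using False by (simp add: e_def)
    qed
  qed
  moreover have "span (e ` {..<dim V}) = V"
  proof
    show "span (e ` {..<dim V}) \<subseteq> V"
    proof (rule span_minimal[OF _ assms(3)], rule image_subsetI)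
      fix i assume "i \<in> {..<dim V}"
      then have "g i \<in> span C'" using gC span_base by auto
      then show "e i \<in> V" using spC' assms(3) by (simp add: e_def subspace_scale)
    qed
    have "C' \<subseteq> span (e ` {..<dim V})"
    proof
      fix c assume "c \<in> C'"
      then obtain i where i: "i < dim V" "c = g i" using g by (auto simp: bij_betw_def)
      then have "c = norm (g i) *\<^sub>R e i" using gn by (simp add: e_def)
      then show "c \<in> span (e ` {..<dim V})" using i(1) by (metis imageI lessThan_iff span_base span_scale)
    qed
    then have "span C' \<subseteq> span (e ` {..<dim V})" by (rule span_minimal) (rule subspace_span)
    then show "V \<subseteq> span (e ` {..<dim V})" using spC' by simp
  qed
  ultimately show ?thesis by blast
qed

text \<open>The ambient space is not locally compact. The unit sphere of a finite-dimensional span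
  gets its compactness from this parametrised box, which is a continuous image of a product of
  intervals.\<close>

lemma compact_box_span:
  fixes e :: "nat \<Rightarrow> 'a::real_normed_vector"
  shows "compact {(\<Sum>i<n. c i *\<^sub>R e i) |c. \<forall>i<n. \<bar>c i\<bar> \<le> (1::real)}"
proof (induction n)
  case 0
  have "{(\<Sum>i<0. c i *\<^sub>R e i) |c. \<forall>i<0. \<bar>c i\<bar> \<le> (1::real)} = {0::'a}" by auto
  then show ?case by simp
next
  case (Suc n)
  let ?K = "{(\<Sum>i<n. c i *\<^sub>R e i) |c. \<forall>i<n. \<bar>c i\<bar> \<le> (1::real)}"
  have "compact ((\<lambda>(x, c). x + c *\<^sub>R e n) ` (?K \<times> {-1..1::real}))"
    by (rule compact_continuous_image)
      (auto intro!: continuous_intros compact_Times Suc.IH simp: case_prod_unfold)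
  also have "(\<lambda>(x, c). x + c *\<^sub>R e n) ` (?K \<times> {-1..1::real})
    = {(\<Sum>i<Suc n. c i *\<^sub>R e i) |c. \<forall>i<Suc n. \<bar>c i\<bar> \<le> (1::real)}" (is "?L = ?R")
  proof
    show "?L \<subseteq> ?R"
    proof
      fix y assume "y \<in> ?L"
      then obtain c d where cd: "\<forall>i<n. \<bar>c i\<bar> \<le> (1::real)" "d \<in> {-1..1}"
        "y = (\<Sum>i<n. c i *\<^sub>R e i) + d *\<^sub>R e n" by auto
      have "y = (\<Sum>i<Suc n. (c(n := d)) i *\<^sub>R e i)" using cd(3) by simp
      then show "y \<in> ?R" using cd(1,2) by (auto intro!: exI[of _ "c(n := d)"] simp: less_Suc_eq abs_le_iff)
    qed
    show "?R \<subseteq> ?L"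
    proof
      fix y assume "y \<in> ?R"
      then obtain c where c: "\<forall>i<Suc n. \<bar>c i\<bar> \<le> (1::real)" "y = (\<Sum>i<n. c i *\<^sub>R e i) + c n *\<^sub>R e n" by auto
      from c(1) have c1: "\<forall>i<n. \<bar>c i\<bar> \<le> 1" by simp
      have "c n \<in> {-1..1}" using c(1)[rule_format, of n] by (simp add: abs_le_iff)
      then show "y \<in> ?L" using c(2) c1 by (intro image_eqI[of _ _ "(\<Sum>i<n. c i *\<^sub>R e i, c n)"]) auto
    qed
  qed
  finally show ?case .
qed

lemma onf_coeff_le: "onf n e \<Longrightarrow> i < n \<Longrightarrow> \<bar>e i \<bullet> x\<bar> \<le> norm x"
  using Cauchy_Schwarz_ineq2[of "e i" x] by (simp add: onf_norm)

lemma onf_compact_sphere: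
  assumes "onf n e"
  shows "compact {x \<in> span (e ` {..<n}). norm x = 1}"
proof -
  let ?K = "{(\<Sum>i<n. c i *\<^sub>R e i) |c. \<forall>i<n. \<bar>c i\<bar> \<le> (1::real)}"
  have "{x \<in> span (e ` {..<n}). norm x = 1} = ?K \<inter> {x. norm x = 1}"
  proof (rule equalityI; rule subsetI)
    fix x assume x: "x \<in> {x \<in> span (e ` {..<n}). norm x = 1}"
    then have "x = (\<Sum>i<n. (e i \<bullet> x) *\<^sub>R e i)" using onf_span_eq[OF assms] by simp
    moreover have "\<forall>i<n. \<bar>e i \<bullet> x\<bar> \<le> 1" using onf_coeff_le[OF assms, of _ x] x by simp
    ultimately have "x \<in> ?K" by (auto intro!: exI[of _ "\<lambda>i. e i \<bullet> x"])
    then show "x \<in> ?K \<inter> {x. norm x = 1}" using x by simp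
  next
    fix x assume "x \<in> ?K \<inter> {x. norm x = 1}"
    then show "x \<in> {x \<in> span (e ` {..<n}). norm x = 1}" using sum_in_span[where e=e and n=n] by auto
  qed
  moreover have "closed {x::'a. norm x = 1}" by (intro closed_Collect_eq continuous_intros)
  ultimately show ?thesis using compact_Int_closed[OF compact_box_span] by simp
qed

text \<open>The first-order condition at a maximum, in a form without derivatives; it serves the
  maximisation in the singular value decomposition.\<close>

lemma linear_le_quadratic_imp_zero:
  fixes a c :: real
  assumes "\<And>t. 2 * t * a \<le> t * t * c"
  shows "a = 0"
proof (rule ccontr)
  assume a: "a \<noteq> 0"
  define t where "t = a / (\<bar>c\<bar> + 1)"
  have "2 * t * a \<le> t * t * c" by (rule assms)
  also have "\<dots> \<le> t * t * (\<bar>c\<bar> + 1)" by (intro mult_left_mono) auto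
  also have "\<dots> = t * a" by (simp add: t_def)
  finally have "t * a \<le> 0" by linarith
  moreover have "t * a = a\<^sup>2 / (\<bar>c\<bar> + 1)" by (simp add: t_def power2_eq_square)
  then have "t * a > 0" using a by (simp add: add_nonneg_pos)
  ultimately show False by linarith
qed

text \<open>The singular value decomposition is obtained by peeling off a vector of the unit
  sphere at which the norm of the image is maximal.\<close>

lemma onf_svd:
  fixes A :: "'a::real_inner \<Rightarrow>\<^sub>L 'b::real_inner"
  assumes "onf n f" "span (f ` {..<n}) = V"
  shows "\<exists>e. onf n e \<and> span (e ` {..<n}) = V \<and> (\<forall>i<n. \<forall>j<n. i \<noteq> j \<longrightarrow> A (e i) \<bullet> A (e j) = 0)"
  using assms
proof (induction n arbitrary: f V)
  case 0 then show ?case by auto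
next
  case (Suc n)
  let ?S = "{x \<in> V. norm x = 1}"
  have subV: "subspace V" using Suc.prems(2) by auto
  have cS: "compact ?S" using onf_compact_sphere[OF Suc.prems(1)] unfolding Suc.prems(2) .
  have "f 0 \<in> ?S" using Suc.prems onf_norm[OF Suc.prems(1), of 0] span_base[of "f 0" "f ` {..<Suc n}"] by auto
  then have neS: "?S \<noteq> {}" by blast
  have "\<exists>x\<in>?S. \<forall>y\<in>?S. norm (A y) \<le> norm (A x)"
    by (rule continuous_attains_sup[OF cS neS]) (intro continuous_intros)
  then obtain x where xS: "x \<in> V" "norm x = 1"
    and mx: "\<And>y. y \<in> V \<Longrightarrow> norm y = 1 \<Longrightarrow> norm (A y) \<le> norm (A x)" by blast
  have xx: "x \<bullet> x = 1" using xS(2) by (simp add: dot_square_norm)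
  have mx': "norm (A y) \<le> norm (A x) * norm y" if "y \<in> V" for y
  proof (cases "y = 0")
    case False
    have "(1 / norm y) *\<^sub>R y \<in> V" using that subV by (simp add: subspace_scale)
    from mx[OF this] False have "norm (A y) / norm y \<le> norm (A x)" by (simp add: blinfun.scaleR_right)
    then show ?thesis using False by (simp add: divide_simps)
  qed simp
  define V' where "V' = {y \<in> V. x \<bullet> y = 0}"
  have subV': "subspace V'"
    using subV unfolding V'_def subspace_def by (auto simp: inner_add_right)
  \<comment> \<open>First variation at the maximum \<open>x\<close> in the direction
    \<open>y\<close>: the norm of \<open>x + t *\<^sub>R y\<close> grows only quadratically in
    \<open>t\<close>, so the linear term of the image has to vanish.\<close>
  have orth: "A x \<bullet> A y = 0" if "y \<in> V'" for y
  proof (rule linear_le_quadratic_imp_zero[where c="(norm (A x))\<^sup>2 * (y \<bullet> y) - A y \<bullet> A y"])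
    fix t :: real
    have xy: "x \<bullet> y = 0" "y \<in> V" using that by (auto simp: V'_def)
    have "x + t *\<^sub>R y \<in> V" using xS(1) xy(2) subV by (simp add: subspace_add subspace_scale)
    then have "(norm (A (x + t *\<^sub>R y)))\<^sup>2 \<le> (norm (A x) * norm (x + t *\<^sub>R y))\<^sup>2"
      by (intro power_mono mx') auto
    also have "\<dots> = (norm (A x))\<^sup>2 * (1 + t * t * (y \<bullet> y))"
      unfolding power_mult_distrib power2_norm_eq_inner[of "x + _"]
      using xy(1) xx by (simp add: inner_add_left inner_add_right inner_commute)
    finally have "(norm (A (x + t *\<^sub>R y)))\<^sup>2 \<le> (norm (A x))\<^sup>2 * (1 + t * t * (y \<bullet> y))" .
    moreover have "(norm (A (x + t *\<^sub>R y)))\<^sup>2 = (norm (A x))\<^sup>2 + 2 * t * (A x \<bullet> A y) + t * t * (A y \<bullet> A y)"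
      unfolding power2_norm_eq_inner
      by (simp add: blinfun.add_right blinfun.scaleR_right inner_add_left inner_add_right inner_commute algebra_simps)
    ultimately show "2 * t * (A x \<bullet> A y) \<le> t * t * ((norm (A x))\<^sup>2 * (y \<bullet> y) - A y \<bullet> A y)"
      by (simp add: algebra_simps)
  qed
  have finV: "V \<subseteq> span (f ` {..<Suc n})" using Suc.prems(2) by simp
  have "V' \<subseteq> span (f ` {..<Suc n})" using finV by (auto simp: V'_def)
  from ex_onf[OF finite_imageI[OF finite_lessThan] this subV']
  obtain g where g': "onf (dim V') g \<and> span (g ` {..<dim V'}) = V'" by (rule exE)
  define m where "m = dim V'"
  have g1: "onf m g" using g' unfolding m_def by (rule conjunct1)
  have g2: "span (g ` {..<m}) = V'" using g' unfolding m_def by (rule conjunct2)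
  have ext: "onf (Suc k) (h(k := x)) \<and> span ((h(k := x)) ` {..<Suc k}) = V"
    if h: "onf k h" "span (h ` {..<k}) = V'" for h k
  proof
    have hV': "h i \<in> V'" if "i < k" for i using h(2) that span_base[of "h i" "h ` {..<k}"] by auto
    show "onf (Suc k) (h(k := x))" unfolding onf_def
      using onfD[OF h(1)] hV' xx by (auto simp: less_Suc_eq V'_def inner_commute)
    have im: "(h(k := x)) ` {..<Suc k} = insert x (h ` {..<k})" by (auto simp: lessThan_Suc)
    show "span ((h(k := x)) ` {..<Suc k}) = V"
    proof
      show "span ((h(k := x)) ` {..<Suc k}) \<subseteq> V"
        unfolding im by (rule span_minimal[OF _ subV]) (use hV' xS in \<open>auto simp: V'_def\<close>)
      show "V \<subseteq> span ((h(k := x)) ` {..<Suc k})"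
      proof
        fix v assume v: "v \<in> V"
        have "v - (x \<bullet> v) *\<^sub>R x \<in> V'"
          using v xS xx subV by (simp add: V'_def subspace_diff subspace_scale inner_diff_right)
        then have "v - (x \<bullet> v) *\<^sub>R x \<in> span (h ` {..<k})" using h(2) by simp
        then show "v \<in> span ((h(k := x)) ` {..<Suc k})" unfolding im
          unfolding span_breakdown_eq by blast
      qed
    qed
  qed
  \<comment> \<open>The induction hypothesis speaks about families of length \<open>n\<close>; both
    numbers are one less than the dimension of \<open>V\<close>.\<close>
  have "m = n"
  proof -
    have "dim V = Suc m" using ext[OF g1 g2] onf_dim[of "Suc m" "g(m := x)"] by simp
    moreover have "dim V = Suc n" using onf_dim[OF Suc.prems(1)] Suc.prems(2) by simp
    ultimately show ?thesis by simp
  qed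
  then have "onf n g" "span (g ` {..<n}) = V'" using g1 g2 by simp_all
  from Suc.IH[OF this] obtain h where h: "onf n h" "span (h ` {..<n}) = V'"
    "\<And>i j. i < n \<Longrightarrow> j < n \<Longrightarrow> i \<noteq> j \<Longrightarrow> A (h i) \<bullet> A (h j) = 0" by blast
  have hV': "h i \<in> V'" if "i < n" for i using h(2) that span_base[of "h i" "h ` {..<n}"] by auto
  let ?e = "h(n := x)"
  have "A (?e i) \<bullet> A (?e j) = 0" if ij: "i < Suc n" "j < Suc n" "i \<noteq> j" for i j
  proof (cases "i = n")
    case True
    then have "j < n" using ij by simp
    then show ?thesis using True ij orth[OF hV'] by simp
  next
    case False
    then have i: "i < n" using ij by simp
    show ?thesis
    proof (cases "j = n")
      case True
      then show ?thesis using i orth[OF hV'[OF i]] by (simp add: inner_commute[of _ "A x"])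
    next
      case False
      then have "j < n" using ij by simp
      then show ?thesis using i ij h(3) by simp
    qed
  qed
  then show ?case using ext[OF h(1,2)] by blast
qed

section \<open>Exponentials of diagonal operators\<close>

definition dyad :: "'a::real_inner \<Rightarrow> 'a \<Rightarrow> 'a \<Rightarrow>\<^sub>L 'a" where
  "dyad a b = Blinfun (\<lambda>x. (b \<bullet> x) *\<^sub>R a)"

lemma dyad_apply [simp]: "dyad a b x = (b \<bullet> x) *\<^sub>R a"
  unfolding dyad_def by (subst bounded_linear_Blinfun_apply) (auto intro!: bounded_linear_intros)

text \<open>Multiplication by \<open>f k\<close> on \<open>z k\<close> and the identity on the
  orthogonal complement of the family. Writing it as a perturbation of the identity keeps the sum
  finite in infinite dimension.\<close>

definition diag_op :: "nat \<Rightarrow> (nat \<Rightarrow> 'a::real_inner) \<Rightarrow> (nat \<Rightarrow> real) \<Rightarrow> 'a \<Rightarrow>\<^sub>L 'a" where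
  "diag_op m z f = id_blinfun + (\<Sum>k<m. (f k - 1) *\<^sub>R dyad (z k) (z k))"

lemma diag_op_apply: "diag_op m z f x = x + (\<Sum>k<m. ((f k - 1) * (z k \<bullet> x)) *\<^sub>R z k)"
  by (simp add: diag_op_def blinfun.add_left blinfun.sum_left blinfun.scaleR_left)

lemma diag_op_inner:
  assumes "onf m z" "k < m"
  shows "z k \<bullet> diag_op m z f x = f k * (z k \<bullet> x)"
  unfolding diag_op_apply inner_add_right onf_inner_sum[OF assms] by (simp add: algebra_simps)

lemma diag_op_compose:
  assumes "onf m z"
  shows "diag_op m z f o\<^sub>L diag_op m z g = diag_op m z (\<lambda>k. f k * g k)"
proof (rule blinfun_eqI)
  fix x
  have "diag_op m z f (diag_op m z g x) = diag_op m z g x + (\<Sum>k<m. ((f k - 1) * (g k * (z k \<bullet> x))) *\<^sub>R z k)"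
    unfolding diag_op_apply[of m z f]
    by (intro arg_cong2[where f="(+)"] sum.cong refl) (simp add: diag_op_inner[OF assms])
  also have "\<dots> = diag_op m z (\<lambda>k. f k * g k) x"
    unfolding diag_op_apply add.assoc sum.distrib[symmetric] scaleR_add_left[symmetric]
    by (intro arg_cong2[where f="(+)"] sum.cong refl arg_cong2[where f="(*\<^sub>R)"]) (simp add: algebra_simps)
  finally show "(diag_op m z f o\<^sub>L diag_op m z g) x = diag_op m z (\<lambda>k. f k * g k) x" by simp
qed

lemma diag_op_one [simp]: "diag_op m z (\<lambda>k. 1) = id_blinfun"
  by (simp add: diag_op_def)

lemma diag_op_sym: "diag_op m z f x \<bullet> y = x \<bullet> diag_op m z f y"
  by (simp add: diag_op_apply inner_add_left inner_add_right inner_sum_left inner_sum_right inner_commute mult_ac)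

text \<open>The zeroth power is the identity of the whole space and not the projection onto the span
  of the \<open>z k\<close>. With this term split off, the exponential series is summed separately
  on each \<open>z k\<close>.\<close>

lemma power_blinfun_diag:
  assumes "onf m z"
  shows "((\<lambda>T. (\<Sum>k<m. \<mu> k *\<^sub>R dyad (z k) (z k)) o\<^sub>L T) ^^ n) id_blinfun
    = (if n = 0 then id_blinfun else 0) + (\<Sum>k<m. (\<mu> k ^ n - (if n = 0 then 1 else 0)) *\<^sub>R dyad (z k) (z k))"
proof (induction n)
  case 0 then show ?case by simp
next
  case (Suc n)
  let ?A = "\<Sum>k<m. \<mu> k *\<^sub>R dyad (z k) (z k)"
  have Az: "?A (z k) = \<mu> k *\<^sub>R z k" if "k < m" for k
  proof -
    have "?A (z k) = (\<Sum>j<m. if j = k then \<mu> k *\<^sub>R z k else 0)"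
      unfolding blinfun.sum_left by (rule sum.cong) (use onfD[OF assms] that in \<open>auto simp: blinfun.scaleR_left\<close>)
    then show ?thesis using that by simp
  qed
  show ?case
  proof (rule blinfun_eqI)
    fix x
    let ?c = "\<lambda>k. \<mu> k ^ n - (if n = 0 then 1 else 0)"
    have "(((\<lambda>T. ?A o\<^sub>L T) ^^ Suc n) id_blinfun) x
      = ?A ((if n = 0 then x else 0) + (\<Sum>k<m. (?c k * (z k \<bullet> x)) *\<^sub>R z k))"
      by (simp add: Suc.IH blinfun.add_left blinfun.sum_left blinfun.scaleR_left blinfun.zero_left
          if_distrib[of "\<lambda>f. blinfun_apply f x"])
    also have "\<dots> = ?A (if n = 0 then x else 0) + (\<Sum>k<m. (\<mu> k * ?c k * (z k \<bullet> x)) *\<^sub>R z k)"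
      unfolding blinfun.add_right blinfun.sum_right blinfun.scaleR_right
      by (intro arg_cong2[where f="(+)"] sum.cong refl) (simp add: Az mult_ac)
    also have "\<dots> = (\<Sum>k<m. (\<mu> k ^ Suc n * (z k \<bullet> x)) *\<^sub>R z k)"
      by (cases "n = 0") (simp_all add: blinfun.sum_left blinfun.scaleR_left)
    finally show "(((\<lambda>T. ?A o\<^sub>L T) ^^ Suc n) id_blinfun) x =
      ((if Suc n = 0 then id_blinfun else 0) + (\<Sum>k<m. (\<mu> k ^ Suc n - (if Suc n = 0 then 1 else 0)) *\<^sub>R dyad (z k) (z k))) x"
      by (simp add: blinfun.add_left blinfun.sum_left blinfun.scaleR_left)
  qed
qed

lemma op_exp_sums_diag:
  assumes "onf m z"
  shows "(\<lambda>n. (1 / fact n) *\<^sub>R (((\<lambda>T. (\<Sum>k<m. \<mu> k *\<^sub>R dyad (z k) (z k)) o\<^sub>L T) ^^ n) id_blinfun))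
     sums diag_op m z (\<lambda>k. exp (\<mu> k))"
proof -
  have 1: "(\<lambda>n. if n = 0 then (id_blinfun :: 'a \<Rightarrow>\<^sub>L 'a) else 0) sums id_blinfun"
    using sums_single[of 0 "\<lambda>_. id_blinfun :: 'a \<Rightarrow>\<^sub>L 'a"] by simp
  have 2: "(\<lambda>n. (\<mu> k ^ n / fact n - (if n = 0 then 1 else 0)) *\<^sub>R dyad (z k) (z k)) sums ((exp (\<mu> k) - 1) *\<^sub>R dyad (z k) (z k))" for k
  proof (rule bounded_linear.sums[OF bounded_linear_scaleR_left], rule sums_diff)
    show "(\<lambda>n. \<mu> k ^ n / fact n) sums exp (\<mu> k)"
      using exp_converges[of "\<mu> k"] by (simp add: divide_inverse mult.commute)
    show "(\<lambda>n. if n = 0 then 1 else 0 :: real) sums 1"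
      using sums_single[of 0 "\<lambda>_. 1::real"] by simp
  qed
  have "(\<lambda>n. (if n = 0 then id_blinfun else 0) + (\<Sum>k<m. (\<mu> k ^ n / fact n - (if n = 0 then 1 else 0)) *\<^sub>R dyad (z k) (z k)))
      sums diag_op m z (\<lambda>k. exp (\<mu> k))"
    unfolding diag_op_def by (intro sums_add 1 sums_sum 2)
  then show ?thesis
    unfolding power_blinfun_diag[OF assms]
    by (rule sums_cong[THEN iffD1, rotated])
      (auto simp: scaleR_add_right scaleR_sum_right diff_divide_distrib intro!: sum.cong)
qed

lemma op_exp_diag:
  assumes "onf m z"
  shows "op_exp (\<Sum>k<m. \<mu> k *\<^sub>R dyad (z k) (z k)) = diag_op m z (\<lambda>k. exp (\<mu> k))"
  unfolding op_exp_def using sums_unique[OF op_exp_sums_diag[OF assms]] by simp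

lemma sum_lessThan_add: "(\<Sum>k<p + q. f k) = (\<Sum>k<p. f k) + (\<Sum>k<q. f (p + k :: nat))" for f :: "nat \<Rightarrow> 'b::comm_monoid_add"
  by (induction q) (simp_all add: add.assoc)

section \<open>The splitting of the Hilbert space\<close>

locale hilbert_splitting =
  fixes E0 :: "'a::{real_inner, complete_space} set"
    and \<Phi> :: "'a \<Rightarrow>\<^sub>L 'a"
    and p :: nat
  assumes inf: "infinite_dimensional TYPE('a)"
    and p0: "p > 0"
    and subE: "subspace E0" and dimE: "dim E0 = p"
    and PhiE: "\<And>x. x \<in> E0 \<Longrightarrow> \<Phi> x = x"
    and PhiW: "\<And>x. x \<in> orthogonal_comp E0 \<Longrightarrow> \<Phi> x = - x"
begin

lemma ex_basis_E0: "\<exists>e. onf p e \<and> span (e ` {..<p}) = E0"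
proof -
  obtain B where B: "B \<subseteq> E0" "independent B" "E0 \<subseteq> span B" "card B = dim E0"
    using basis_exists by blast
  \<comment> \<open>Here \<open>p > 0\<close> excludes the default value 0 of \<open>dim\<close> on
    subspaces without a finite basis.\<close>
  have "finite B" using B(4) dimE p0 card_ge_0_finite[of B] by simp
  then show ?thesis using ex_onf[OF _ B(3) subE] dimE by simp
qed

definition basis_E0 :: "nat \<Rightarrow> 'a" where "basis_E0 = (SOME e. onf p e \<and> span (e ` {..<p}) = E0)"

lemma onf_basis_E0: "onf p basis_E0" and span_basis_E0: "span (basis_E0 ` {..<p}) = E0"
  using someI_ex[OF ex_basis_E0] by (auto simp: basis_E0_def)

text \<open>The orthogonal complement of \<open>E0\<close> (see \<open>W_iff\<close>), as an
  eigenspace so that membership is an equation.\<close>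

definition W :: "'a set" where "W = {x. \<Phi> x = - x}"

definition onE :: "(nat \<Rightarrow> 'a) \<Rightarrow> bool" where "onE e \<longleftrightarrow> onf p e \<and> (\<forall>i<p. e i \<in> E0)"

lemma onE_basis_E0: "onE basis_E0"
  unfolding onE_def using onf_basis_E0 span_basis_E0 span_base[of _ "basis_E0 ` {..<p}"] by auto

lemma onE_span:
  assumes "onE e" shows "span (e ` {..<p}) = E0"
proof
  have e: "onf p e" "e ` {..<p} \<subseteq> E0" using assms by (auto simp: onE_def)
  show "span (e ` {..<p}) \<subseteq> E0" by (rule span_minimal[OF e(2) subE])
  show "E0 \<subseteq> span (e ` {..<p})"
  proof (rule ccontr)
    assume "\<not> ?thesis"
    then obtain v where v: "v \<in> E0" "v \<notin> span (e ` {..<p})" by blast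
    have "independent (insert v (e ` {..<p}))"
      by (rule independent_insertI[OF v(2) onf_independent[OF e(1)]])
    moreover have "insert v (e ` {..<p}) \<subseteq> span (basis_E0 ` {..<p})" using e(2) v(1) span_basis_E0 by simp
    ultimately have "card (insert v (e ` {..<p})) \<le> card (basis_E0 ` {..<p})"
      using independent_span_bound[of "basis_E0 ` {..<p}"] by blast
    moreover have "v \<notin> e ` {..<p}"
    proof
      assume "v \<in> e ` {..<p}"
      from span_base[OF this] v(2) show False by contradiction
    qed
    then have "card (insert v (e ` {..<p})) = Suc (card (e ` {..<p}))"
      by (intro card_insert_disjoint) auto
    moreover have "card (e ` {..<p}) = p" by (subst card_image[OF onf_inj[OF e(1)]]) simp
    moreover have "card (basis_E0 ` {..<p}) = p" by (subst card_image[OF onf_inj[OF onf_basis_E0]]) simp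
    ultimately show False by linarith
  qed
qed

lemma orthogonal_compI:
  assumes "onE e" "\<And>i. i < p \<Longrightarrow> e i \<bullet> x = 0"
  shows "x \<in> orthogonal_comp E0"
  unfolding orthogonal_comp_def
proof (intro CollectI ballI)
  fix y assume "y \<in> E0"
  then have "y \<in> span (e ` {..<p})" using onE_span[OF assms(1)] by simp
  then have "orthogonal x y"
    by (rule orthogonal_to_span) (use assms(2) in \<open>auto simp: orthogonal_def inner_commute\<close>)
  then show "orthogonal y x" by (simp add: orthogonal_commute)
qed

lemma E_eq:
  assumes "onE e" "x \<in> E0" shows "x = (\<Sum>i<p. (e i \<bullet> x) *\<^sub>R e i)"
  using onf_span_eq[of p e x] assms onE_span[OF assms(1)] by (simp add: onE_def)

lemma sum_in_E: "onE e \<Longrightarrow> (\<Sum>i<p. c i *\<^sub>R e i) \<in> E0"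
  using sum_in_span[of c e p] onE_span[of e] by simp

text \<open>A vector minus its projection to \<open>E0\<close> lies in the complement, so the two
  eigenvalue conditions determine the operator. Its symmetry and involutivity are read off from the
  formula.\<close>

lemma Phi_apply:
  assumes "onE e" shows "\<Phi> x = 2 *\<^sub>R (\<Sum>i<p. (e i \<bullet> x) *\<^sub>R e i) - x"
proof -
  define q where "q = (\<Sum>i<p. (e i \<bullet> x) *\<^sub>R e i)"
  have q: "q \<in> E0" unfolding q_def by (rule sum_in_E[OF assms])
  have "e i \<bullet> (x - q) = 0" if "i < p" for i
    using onf_inner_sum[of p e i "\<lambda>i. e i \<bullet> x"] assms that by (simp add: q_def onE_def inner_diff_right)
  then have "x - q \<in> orthogonal_comp E0" by (rule orthogonal_compI[OF assms])
  then have "\<Phi> (x - q) = - (x - q)" by (rule PhiW)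
  then have "\<Phi> x = q - (x - q)" using PhiE[OF q] by (simp add: blinfun.diff_right algebra_simps)
  then show ?thesis by (simp add: q_def scaleR_2)
qed

lemma Phi_sym: "\<Phi> x \<bullet> y = x \<bullet> \<Phi> y"
  unfolding Phi_apply[OF onE_basis_E0]
  by (simp add: inner_diff_left inner_diff_right inner_sum_left inner_sum_right inner_commute mult_ac)

lemma E_iff: "x \<in> E0 \<longleftrightarrow> \<Phi> x = x"
proof
  assume "\<Phi> x = x"
  define q where "q = (\<Sum>i<p. (basis_E0 i \<bullet> x) *\<^sub>R basis_E0 i)"
  have q: "q \<in> E0" unfolding q_def by (rule sum_in_E[OF onE_basis_E0])
  have "\<Phi> x = 2 *\<^sub>R q - x" unfolding q_def by (rule Phi_apply[OF onE_basis_E0])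
  then have "2 *\<^sub>R x = 2 *\<^sub>R q" using \<open>\<Phi> x = x\<close> by (metis add.commute diff_add_cancel scaleR_2)
  then show "x \<in> E0" using q by simp
qed (rule PhiE)

lemma Phi_Phi [simp]: "\<Phi> (\<Phi> x) = x"
proof -
  define q where "q = (\<Sum>i<p. (basis_E0 i \<bullet> x) *\<^sub>R basis_E0 i)"
  have "q \<in> E0" unfolding q_def by (rule sum_in_E[OF onE_basis_E0])
  then have "\<Phi> q = q" by (rule PhiE)
  moreover have "\<Phi> x = 2 *\<^sub>R q - x" unfolding q_def by (rule Phi_apply[OF onE_basis_E0])
  ultimately show ?thesis by (simp add: blinfun.diff_right blinfun.scaleR_right)
qed

lemma W_iff: "x \<in> W \<longleftrightarrow> (\<forall>y\<in>E0. y \<bullet> x = 0)"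
proof
  assume "x \<in> W"
  then have x: "\<Phi> x = - x" by (simp add: W_def)
  show "\<forall>y\<in>E0. y \<bullet> x = 0"
  proof
    fix y assume "y \<in> E0"
    then have "y \<bullet> x = \<Phi> y \<bullet> x" by (simp add: PhiE)
    also have "\<dots> = - (y \<bullet> x)" by (simp add: Phi_sym x)
    finally show "y \<bullet> x = 0" by simp
  qed
next
  assume "\<forall>y\<in>E0. y \<bullet> x = 0"
  then have "x \<in> orthogonal_comp E0" by (simp add: orthogonal_comp_def orthogonal_def)
  then show "x \<in> W" by (simp add: W_def PhiW)
qed

lemma EW: "x \<in> E0 \<Longrightarrow> y \<in> W \<Longrightarrow> x \<bullet> y = 0" "y \<in> W \<Longrightarrow> x \<in> E0 \<Longrightarrow> y \<bullet> x = 0"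
  using W_iff by (auto simp: inner_commute)

lemma subW: "subspace W"
  unfolding subspace_def W_def by (auto simp: blinfun.add_right blinfun.scaleR_right blinfun.zero_right)

lemma WI: "onE e \<Longrightarrow> (\<And>i. i < p \<Longrightarrow> e i \<bullet> x = 0) \<Longrightarrow> x \<in> W"
  using orthogonal_compI PhiW by (simp add: W_def)

lemma W_diff:
  assumes "onE e" shows "x - (\<Sum>i<p. (e i \<bullet> x) *\<^sub>R e i) \<in> W"
proof (rule WI[OF assms])
  fix i assume "i < p"
  then show "e i \<bullet> (x - (\<Sum>i<p. (e i \<bullet> x) *\<^sub>R e i)) = 0"
    using onf_inner_sum[of p e i "\<lambda>i. e i \<bullet> x"] assms by (simp add: inner_diff_right onE_def)
qed

text \<open>Infinite dimension enters through this lemma: finitely many linear conditions never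
  exhaust \<open>W\<close>. Adding the basis of \<open>E0\<close> to the conditions puts the vector
  into \<open>W\<close>.\<close>

lemma ex_unit_orthogonal:
  assumes "finite F" shows "\<exists>x\<in>W. norm x = 1 \<and> (\<forall>f\<in>F. f \<bullet> x = 0)"
proof -
  let ?G = "F \<union> basis_E0 ` {..<p}"
  have fG: "finite ?G" using assms by simp
  obtain e where e: "onf (dim (span ?G)) e" "span (e ` {..<dim (span ?G)}) = span ?G"
    using ex_onf[OF fG order_refl subspace_span] by blast
  define m where "m = dim (span ?G)"
  have e1: "onf m e" and e2: "span (e ` {..<m}) = span ?G" using e unfolding m_def by blast+
  have "span ?G \<noteq> UNIV" using inf fG unfolding infinite_dimensional_def by blast
  then obtain x where x: "x \<notin> span ?G" by blast
  define w where "w = x - (\<Sum>i<m. (e i \<bullet> x) *\<^sub>R e i)"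
  have w0: "w \<noteq> 0"
  proof
    assume "w = 0"
    then have "x = (\<Sum>i<m. (e i \<bullet> x) *\<^sub>R e i)" by (simp add: w_def)
    then have "x \<in> span (e ` {..<m})" using sum_in_span by metis
    then show False using x e2 by simp
  qed
  have ew: "e i \<bullet> w = 0" if "i < m" for i
    using onf_inner_sum[OF e1 that, of "\<lambda>i. e i \<bullet> x"] by (simp add: w_def inner_diff_right)
  have gw: "g \<bullet> w = 0" if "g \<in> ?G" for g
  proof -
    have "g \<in> span (e ` {..<m})" using span_base[OF that] e2 by simp
    then have "orthogonal w g"
      by (rule orthogonal_to_span) (use ew in \<open>auto simp: orthogonal_def inner_commute\<close>)
    then show ?thesis by (simp add: orthogonal_def inner_commute)
  qed
  have "w \<in> W" by (rule WI[OF onE_basis_E0]) (use gw in auto)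
  then have "(1 / norm w) *\<^sub>R w \<in> W" using subW by (simp add: subspace_scale)
  then show ?thesis using gw w0 by (intro bexI[of _ "(1 / norm w) *\<^sub>R w"]) auto
qed

text \<open>The tangent space \<open>p_space\<close> with the Hilbert-Schmidt condition left out;
  that condition follows from finite rank, see \<open>p_space_eq\<close>.\<close>

definition pp :: "('a \<Rightarrow>\<^sub>L 'a) set" where
  "pp = {A :: 'a \<Rightarrow>\<^sub>L 'a. (\<forall>x y. A x \<bullet> y = x \<bullet> A y) \<and> (\<forall>x. A (\<Phi> x) = - \<Phi> (A x))}"

lemma pp_sym: "A \<in> pp \<Longrightarrow> A x \<bullet> y = x \<bullet> A y" by (simp add: pp_def)
lemma pp_anti: "A \<in> pp \<Longrightarrow> A (\<Phi> x) = - \<Phi> (A x)" by (simp add: pp_def)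
lemma pp_EW: "A \<in> pp \<Longrightarrow> x \<in> E0 \<Longrightarrow> A x \<in> W"
  using pp_anti[of A x] PhiE[of x] by (metis (mono_tags) W_def mem_Collect_eq minus_minus)
lemma pp_WE: "A \<in> pp \<Longrightarrow> x \<in> W \<Longrightarrow> A x \<in> E0"
  using pp_anti[of A x] by (simp add: W_def E_iff blinfun.minus_right)
lemma pp_scale: "A \<in> pp \<Longrightarrow> c *\<^sub>R A \<in> pp"
  by (simp add: pp_def blinfun.scaleR_left blinfun.scaleR_right)
lemma pp_add: "A \<in> pp \<Longrightarrow> B \<in> pp \<Longrightarrow> A + B \<in> pp"
  by (simp add: pp_def blinfun.add_left blinfun.add_right inner_add_left inner_add_right)
lemma pp_minus: "A \<in> pp \<Longrightarrow> - A \<in> pp" using pp_scale[of A "-1"] by simp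
lemma pp_diff: "A \<in> pp \<Longrightarrow> B \<in> pp \<Longrightarrow> A - B \<in> pp" using pp_add[of A "- B"] pp_minus by simp
lemma pp_zero: "0 \<in> pp" by (simp add: pp_def blinfun.zero_left blinfun.zero_right)

text \<open>An element exchanges \<open>E0\<close> and \<open>W\<close>, and by symmetry its part on
  \<open>W\<close> is the adjoint of its part on \<open>E0\<close>.\<close>

lemma pp_eqI:
  assumes A: "A \<in> pp" and B: "B \<in> pp" and e: "onE e" and eq: "\<And>i. i < p \<Longrightarrow> A (e i) = B (e i)"
  shows "A = B"
proof (rule blinfun_eqI)
  fix x
  define q where "q = (\<Sum>i<p. (e i \<bullet> x) *\<^sub>R e i)"
  define w where "w = x - q"
  have w: "w \<in> W" unfolding w_def q_def by (rule W_diff[OF e])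
  have q: "A q = B q" unfolding q_def by (simp add: blinfun.sum_right blinfun.scaleR_right eq)
  have "A w = B w"
  proof -
    have "e i \<bullet> A w = e i \<bullet> B w" if "i < p" for i
      using pp_sym[OF A, of "e i" w] pp_sym[OF B, of "e i" w] eq[OF that] by simp
    then show ?thesis using E_eq[OF e pp_WE[OF A w]] E_eq[OF e pp_WE[OF B w]] by simp
  qed
  then have "A (q + w) = B (q + w)" using q by (simp add: blinfun.add_right)
  then show "A x = B x" by (simp add: w_def)
qed

definition frame :: "(nat \<Rightarrow> 'a) \<Rightarrow> (nat \<Rightarrow> 'a) \<Rightarrow> bool" where
  "frame e n \<longleftrightarrow> onE e \<and> onf p n \<and> (\<forall>i<p. n i \<in> W)"

text \<open>Normal form with singular values \<open>l i\<close>: it exchanges \<open>e i\<close> and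
  \<open>n i\<close> up to the factor \<open>l i\<close> and vanishes on the orthogonal complement
  of all of them. For a fixed frame these operators form a maximal abelian subspace of
  \<open>pp\<close>, that is, a maximal flat.\<close>

definition frame_op :: "(nat \<Rightarrow> 'a) \<Rightarrow> (nat \<Rightarrow> 'a) \<Rightarrow> (nat \<Rightarrow> real) \<Rightarrow> 'a \<Rightarrow>\<^sub>L 'a" where
  "frame_op e n l = (\<Sum>i<p. l i *\<^sub>R (dyad (n i) (e i) + dyad (e i) (n i)))"

lemma frame_op_apply: "frame_op e n l x = (\<Sum>i<p. (l i * (e i \<bullet> x)) *\<^sub>R n i) + (\<Sum>i<p. (l i * (n i \<bullet> x)) *\<^sub>R e i)"
  by (simp add: frame_op_def blinfun.sum_left blinfun.scaleR_left blinfun.add_left scaleR_add_right sum.distrib)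

lemma frame_inner:
  assumes "frame e n" "i < p" "j < p"
  shows "e i \<bullet> e j = (if i = j then 1 else 0)" "n i \<bullet> n j = (if i = j then 1 else 0)"
    "e i \<bullet> n j = 0" "n i \<bullet> e j = 0" "e i \<in> E0" "n i \<in> W" "\<Phi> (e i) = e i" "\<Phi> (n i) = - n i"
  using assms EW PhiE unfolding frame_def onE_def onf_def W_def by auto

lemma frame_op_frame:
  assumes f: "frame e n" and j: "j < p"
  shows "frame_op e n l (e j) = l j *\<^sub>R n j" "frame_op e n l (n j) = l j *\<^sub>R e j"
proof -
  have *: "(\<Sum>i<p. (if i = j then g i else 0)) = g j" for g :: "nat \<Rightarrow> 'a" using j by simp
  have "frame_op e n l (e j) = (\<Sum>i<p. if i = j then l i *\<^sub>R n i else 0) + (\<Sum>i<p. 0)"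
    unfolding frame_op_apply by (intro arg_cong2[where f="(+)"] sum.cong) (use frame_inner[OF f _ j] in auto)
  then show "frame_op e n l (e j) = l j *\<^sub>R n j" using * by simp
  have "frame_op e n l (n j) = (\<Sum>i<p. 0) + (\<Sum>i<p. if i = j then l i *\<^sub>R e i else 0)"
    unfolding frame_op_apply by (intro arg_cong2[where f="(+)"] sum.cong) (use frame_inner[OF f _ j] in auto)
  then show "frame_op e n l (n j) = l j *\<^sub>R e j" using * by simp
qed

lemma frame_op_pp:
  assumes f: "frame e n" shows "frame_op e n l \<in> pp"
  unfolding pp_def
proof (intro CollectI conjI allI)
  fix x y
  show "frame_op e n l x \<bullet> y = x \<bullet> frame_op e n l y"
    by (simp add: frame_op_apply inner_add_left inner_add_right inner_sum_left inner_sum_right inner_commute mult_ac)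
next
  fix x
  have 1: "e i \<bullet> \<Phi> x = e i \<bullet> x" "n i \<bullet> \<Phi> x = - (n i \<bullet> x)" if "i < p" for i
    using Phi_sym[of "e i" x] Phi_sym[of "n i" x] frame_inner[OF f that that] by simp_all
  have 2: "(\<Sum>i<p. (l i * (e i \<bullet> \<Phi> x)) *\<^sub>R n i) = - \<Phi> (\<Sum>i<p. (l i * (e i \<bullet> x)) *\<^sub>R n i)"
    using frame_inner[OF f] by (simp add: 1 blinfun.sum_right blinfun.scaleR_right flip: sum_negf)
  have 3: "(\<Sum>i<p. (l i * (n i \<bullet> \<Phi> x)) *\<^sub>R e i) = - \<Phi> (\<Sum>i<p. (l i * (n i \<bullet> x)) *\<^sub>R e i)"
    using frame_inner[OF f] by (simp add: 1 blinfun.sum_right blinfun.scaleR_right flip: sum_negf)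
  show "frame_op e n l (\<Phi> x) = - \<Phi> (frame_op e n l x)"
    unfolding frame_op_apply 2 3 by (simp add: blinfun.add_right)
qed

text \<open>Normalising works only for nonzero \<open>a i\<close>. For the others a direction in
  \<open>W\<close> is chosen orthogonal to all previous vectors and to all \<open>a j\<close>; the
  induction therefore also records orthogonality to the \<open>a j\<close> that are still to
  come.\<close>

lemma frame_completion:
  assumes on: "\<And>i j. i < p \<Longrightarrow> j < p \<Longrightarrow> i \<noteq> j \<Longrightarrow> a i \<bullet> a j = 0"
    and aW: "\<And>i. i < p \<Longrightarrow> a i \<in> W"
  shows "\<exists>n. onf p n \<and> (\<forall>i<p. n i \<in> W \<and> norm (a i) *\<^sub>R n i = a i)"
proof -
  have "\<exists>n. onf k n \<and> (\<forall>i<k. n i \<in> W \<and> norm (a i) *\<^sub>R n i = a i \<and> (\<forall>j<p. j \<noteq> i \<longrightarrow> n i \<bullet> a j = 0))" if "k \<le> p" for k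
    using that
  proof (induction k)
    case 0 then show ?case by (simp add: onf_def)
  next
    case (Suc k)
    then obtain n where n: "onf k n" "\<And>i. i < k \<Longrightarrow> n i \<in> W" "\<And>i. i < k \<Longrightarrow> norm (a i) *\<^sub>R n i = a i"
      "\<And>i j. i < k \<Longrightarrow> j < p \<Longrightarrow> j \<noteq> i \<Longrightarrow> n i \<bullet> a j = 0" by auto
    have kp: "k < p" using Suc.prems by simp
    have "\<exists>v. v \<in> W \<and> norm v = 1 \<and> norm (a k) *\<^sub>R v = a k \<and> (\<forall>i<k. n i \<bullet> v = 0) \<and> (\<forall>j<p. j \<noteq> k \<longrightarrow> v \<bullet> a j = 0)"
    proof (cases "a k = 0")
      case True
      obtain v where "v \<in> W" "norm v = 1" "\<And>f. f \<in> n ` {..<k} \<union> a ` {..<p} \<Longrightarrow> f \<bullet> v = 0"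
        using ex_unit_orthogonal[of "n ` {..<k} \<union> a ` {..<p}"] by auto
      then have "v \<bullet> f = 0" if "f \<in> n ` {..<k} \<union> a ` {..<p}" for f
        using that by (simp add: inner_commute)
      with \<open>v \<in> W\<close> \<open>norm v = 1\<close> True show ?thesis by (intro exI[of _ v]) (auto simp: inner_commute[of _ v])
    next
      case False
      define w where "w = (1 / norm (a k)) *\<^sub>R a k"
      have w1: "w \<in> W" using aW[OF kp] subW by (simp add: w_def subspace_scale)
      have w2: "norm w = 1" "norm (a k) *\<^sub>R w = a k" using False by (simp_all add: w_def)
      have w3: "\<forall>i<k. n i \<bullet> w = 0" using n(4)[OF _ kp] by (auto simp: w_def)
      have w4: "\<forall>j<p. j \<noteq> k \<longrightarrow> w \<bullet> a j = 0" using on[OF kp] by (auto simp: w_def)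
      show ?thesis by (intro exI[of _ w] conjI w1 w2 w3 w4)
    qed
    then obtain v where v: "v \<in> W \<and> norm v = 1 \<and> norm (a k) *\<^sub>R v = a k \<and> (\<forall>i<k. n i \<bullet> v = 0) \<and> (\<forall>j<p. j \<noteq> k \<longrightarrow> v \<bullet> a j = 0)"
      by (rule exE)
    note v1 = v[THEN conjunct1] and v2 = v[THEN conjunct2, THEN conjunct1]
      and v3 = v[THEN conjunct2, THEN conjunct2, THEN conjunct1]
      and v4 = v[THEN conjunct2, THEN conjunct2, THEN conjunct2, THEN conjunct1]
      and v5 = v[THEN conjunct2, THEN conjunct2, THEN conjunct2, THEN conjunct2]
    have vv: "v \<bullet> v = 1" using v2 by (simp add: dot_square_norm)
    let ?n = "n(k := v)"
    have "onf (Suc k) ?n" unfolding onf_def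
      using onfD[OF n(1)] v4 vv by (auto simp: less_Suc_eq inner_commute)
    moreover have "?n i \<in> W \<and> norm (a i) *\<^sub>R ?n i = a i \<and> (\<forall>j<p. j \<noteq> i \<longrightarrow> ?n i \<bullet> a j = 0)"
      if "i < Suc k" for i
    proof (cases "i = k")
      case True
      then show ?thesis using v1 v3 v5 by (simp only: fun_upd_same simp_thms)
    next
      case False
      then have "i < k" using that by simp
      then show ?thesis using n(2,3)[of i] n(4)[of i] False by (simp add: fun_upd_other)
    qed
    ultimately show ?case by blast
  qed
  from this[of p] show ?thesis by blast
qed

text \<open>By \<open>pp_eqI\<close> it suffices to decompose the restriction to \<open>E0\<close>.
  Where a singular value vanishes, the left singular vector comes from
  \<open>frame_completion\<close>.\<close>

lemma pp_svd:
  assumes A: "A \<in> pp"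
  shows "\<exists>e n l. frame e n \<and> (\<forall>i<p. l i \<ge> 0) \<and> A = frame_op e n l"
proof -
  obtain e where e: "onf p e" "span (e ` {..<p}) = E0" "\<And>i j. i < p \<Longrightarrow> j < p \<Longrightarrow> i \<noteq> j \<Longrightarrow> A (e i) \<bullet> A (e j) = 0"
    using onf_svd[OF onf_basis_E0 span_basis_E0, of A] by blast
  have eE: "e i \<in> E0" if "i < p" for i using e(2) span_base[of "e i" "e ` {..<p}"] that by auto
  have oe: "onE e" using e(1) eE by (simp add: onE_def)
  obtain n where n: "onf p n" "\<And>i. i < p \<Longrightarrow> n i \<in> W" "\<And>i. i < p \<Longrightarrow> norm (A (e i)) *\<^sub>R n i = A (e i)"
    using frame_completion[of "\<lambda>i. A (e i)"] e(3) pp_EW[OF A eE] by blast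
  have f: "frame e n" using oe n by (simp add: frame_def)
  have "A = frame_op e n (\<lambda>i. norm (A (e i)))"
    by (rule pp_eqI[OF A frame_op_pp[OF f] oe]) (use frame_op_frame(1)[OF f] n(3) in simp)
  then show ?thesis using f by (intro exI[of _ e] exI[of _ n] exI[of _ "\<lambda>i. norm (A (e i))"]) simp
qed

text \<open>Orthonormal eigenvectors of \<open>frame_op e n l\<close>; \<open>diag_val\<close> lists
  their eigenvalues \<open>l k\<close> and \<open>- l k\<close> in the same order.\<close>

definition diag_vec :: "(nat \<Rightarrow> 'a) \<Rightarrow> (nat \<Rightarrow> 'a) \<Rightarrow> nat \<Rightarrow> 'a" where
  "diag_vec e n k = (if k < p then (1 / sqrt 2) *\<^sub>R (e k + n k) else (1 / sqrt 2) *\<^sub>R (e (k - p) - n (k - p)))"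

definition diag_val :: "(nat \<Rightarrow> real) \<Rightarrow> nat \<Rightarrow> real" where
  "diag_val l k = (if k < p then l k else - l (k - p))"

lemma diag_vec_onf:
  assumes f: "frame e n" shows "onf (p + p) (diag_vec e n)"
proof -
  note fi = frame_inner[OF f]
  have "diag_vec e n i \<bullet> diag_vec e n j = (if i = j then 1 else 0)" if ij: "i < p + p" "j < p + p" for i j
  proof -
    have i': "i - p < p" if "\<not> i < p" using ij that by simp
    have j': "j - p < p" if "\<not> j < p" using ij that by simp
    have h: "(1 / sqrt 2) * ((1 / sqrt 2) * c) = c / 2" for c :: real by simp
    have z1: "diag_vec e n k = (1 / sqrt 2) *\<^sub>R (e k + n k)" if "k < p" for k using that by (simp add: diag_vec_def)
    have z2: "diag_vec e n k = (1 / sqrt 2) *\<^sub>R (e (k - p) - n (k - p))" if "\<not> k < p" for k using that by (simp add: diag_vec_def)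
    show ?thesis
    proof (cases "i < p"; cases "j < p")
      assume *: "i < p" "j < p"
      then show ?thesis using fi[OF *] unfolding z1[OF *(1)] z1[OF *(2)] inner_scaleR_left inner_scaleR_right h
        by (simp add: inner_add_left inner_add_right)
    next
      assume *: "i < p" "\<not> j < p"
      then show ?thesis using fi[OF *(1) j'[OF *(2)]] unfolding z1[OF *(1)] z2[OF *(2)] inner_scaleR_left inner_scaleR_right h
        by (simp add: inner_add_left inner_diff_right)
    next
      assume *: "\<not> i < p" "j < p"
      then show ?thesis using fi[OF i'[OF *(1)] *(2)] unfolding z2[OF *(1)] z1[OF *(2)] inner_scaleR_left inner_scaleR_right h
        by (simp add: inner_diff_left inner_add_right)
    next
      assume *: "\<not> i < p" "\<not> j < p"
      then have "i - p = j - p \<longleftrightarrow> i = j" by linarith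
      then show ?thesis using fi[OF i'[OF *(1)] j'[OF *(2)]] unfolding z2[OF *(1)] z2[OF *(2)] inner_scaleR_left inner_scaleR_right h
        by (simp add: inner_diff_left inner_diff_right)
    qed
  qed
  then show ?thesis by (simp add: onf_def)
qed

lemma frame_op_diag: "frame_op e n l = (\<Sum>k<p+p. diag_val l k *\<^sub>R dyad (diag_vec e n k) (diag_vec e n k))"
proof -
  have "(\<Sum>k<p+p. diag_val l k *\<^sub>R dyad (diag_vec e n k) (diag_vec e n k))
     = (\<Sum>k<p. l k *\<^sub>R dyad ((1 / sqrt 2) *\<^sub>R (e k + n k)) ((1 / sqrt 2) *\<^sub>R (e k + n k)))
     + (\<Sum>k<p. - l k *\<^sub>R dyad ((1 / sqrt 2) *\<^sub>R (e k - n k)) ((1 / sqrt 2) *\<^sub>R (e k - n k)))"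
    unfolding sum_lessThan_add by (simp add: diag_val_def diag_vec_def)
  also have "\<dots> = (\<Sum>k<p. l k *\<^sub>R dyad ((1 / sqrt 2) *\<^sub>R (e k + n k)) ((1 / sqrt 2) *\<^sub>R (e k + n k))
        + - l k *\<^sub>R dyad ((1 / sqrt 2) *\<^sub>R (e k - n k)) ((1 / sqrt 2) *\<^sub>R (e k - n k)))"
    by (rule sum.distrib[symmetric])
  also have "\<dots> = frame_op e n l"
    unfolding frame_op_def
  proof (rule sum.cong[OF refl], rule blinfun_eqI)
    fix k x
    have R: "dyad ((1 / sqrt 2) *\<^sub>R v) ((1 / sqrt 2) *\<^sub>R v) = (1 / 2) *\<^sub>R dyad v v" for v :: 'a
      by (rule blinfun_eqI) (simp add: blinfun.scaleR_left)
    have S: "(c + d) *\<^sub>R (e k + n k) - (c - d) *\<^sub>R (e k - n k) = 2 *\<^sub>R (c *\<^sub>R n k + d *\<^sub>R e k)" for c d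
      unfolding scaleR_2 by (simp add: algebra_simps)
    have "(l k *\<^sub>R (1 / 2) *\<^sub>R dyad (e k + n k) (e k + n k) + - l k *\<^sub>R (1 / 2) *\<^sub>R dyad (e k - n k) (e k - n k)) x
      = (l k / 2) *\<^sub>R ((e k \<bullet> x + n k \<bullet> x) *\<^sub>R (e k + n k) - (e k \<bullet> x - n k \<bullet> x) *\<^sub>R (e k - n k))"
      by (simp add: blinfun.diff_left blinfun.scaleR_left inner_add_left inner_diff_left scaleR_diff_right)
    also have "\<dots> = l k *\<^sub>R ((e k \<bullet> x) *\<^sub>R n k + (n k \<bullet> x) *\<^sub>R e k)"
      unfolding S by simp
    finally show "(l k *\<^sub>R dyad ((1 / sqrt 2) *\<^sub>R (e k + n k)) ((1 / sqrt 2) *\<^sub>R (e k + n k))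
        + - l k *\<^sub>R dyad ((1 / sqrt 2) *\<^sub>R (e k - n k)) ((1 / sqrt 2) *\<^sub>R (e k - n k))) x
       = (l k *\<^sub>R (dyad (n k) (e k) + dyad (e k) (n k))) x"
      unfolding R by (simp add: blinfun.scaleR_left blinfun.add_left)
  qed
  finally show ?thesis by simp
qed

text \<open>One family of eigenvectors serves all multiples of \<open>A\<close>, so statements about
  the one-parameter group become statements about the functions
  \<open>exp (t * \<mu> k)\<close>.\<close>

lemma pp_diag:
  assumes A: "A \<in> pp"
  obtains z \<mu> where "onf (p + p) z" "A = (\<Sum>k<p+p. \<mu> k *\<^sub>R dyad (z k) (z k))"
    "\<And>t. op_exp (t *\<^sub>R A) = diag_op (p+p) z (\<lambda>k. exp (t * \<mu> k))"
proof -
  obtain e n l where s: "frame e n" "A = frame_op e n l" using pp_svd[OF A] by blast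
  have o: "onf (p + p) (diag_vec e n)" by (rule diag_vec_onf[OF s(1)])
  have A': "A = (\<Sum>k<p+p. diag_val l k *\<^sub>R dyad (diag_vec e n k) (diag_vec e n k))" using s(2) frame_op_diag by simp
  have "op_exp (t *\<^sub>R A) = diag_op (p+p) (diag_vec e n) (\<lambda>k. exp (t * diag_val l k))" for t
  proof -
    have "t *\<^sub>R A = (\<Sum>k<p+p. (t * diag_val l k) *\<^sub>R dyad (diag_vec e n k) (diag_vec e n k))"
      unfolding A' by (simp add: scaleR_sum_right)
    then show ?thesis using op_exp_diag[OF o, of "\<lambda>k. t * diag_val l k"] by (simp only:)
  qed
  then show ?thesis by (rule that[of "diag_vec e n" "diag_val l", OF o A'])
qed

end

section \<open>The orthogonal group of the form\<close>

lemma span_eq_of_card: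
  fixes I :: "'a::real_vector set"
  assumes "independent I" "I \<subseteq> span F" "finite F" "card F \<le> card I" "finite I"
  shows "span I = span F"
proof
  show "span I \<subseteq> span F" by (rule span_minimal[OF assms(2) subspace_span])
  have "F \<subseteq> span I"
  proof (rule ccontr)
    assume "\<not> F \<subseteq> span I"
    then obtain v where v: "v \<in> F" "v \<notin> span I" by blast
    have "independent (insert v I)" by (rule independent_insertI[OF v(2) assms(1)])
    moreover have "insert v I \<subseteq> span F" using assms(2) span_base[OF v(1)] by simp
    ultimately have "card (insert v I) \<le> card F"
      using independent_span_bound[OF assms(3)] by blast
    moreover have "v \<notin> I"
    proof
      assume "v \<in> I"
      from span_base[OF this] v(2) show False by contradiction
    qed
    then have "card (insert v I) = Suc (card I)" using assms(5) by simp
    ultimately show False using assms(4) by linarith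
  qed
  then show "span F \<subseteq> span I" by (rule span_minimal[OF _ subspace_span])
qed

lemma sums_blinfun_compose_right:
  assumes "f sums s" shows "(\<lambda>n. T o\<^sub>L f n) sums (T o\<^sub>L s)"
  using bounded_linear.sums[OF bounded_bilinear.bounded_linear_right[OF bounded_bilinear_blinfun_compose] assms] .

lemma sums_blinfun_compose_left:
  assumes "f sums s" shows "(\<lambda>n. f n o\<^sub>L T) sums (s o\<^sub>L T)"
  using bounded_linear.sums[OF bounded_bilinear.bounded_linear_left[OF bounded_bilinear_blinfun_compose] assms] .

definition ex :: "real \<Rightarrow> ('a::real_normed_vector \<Rightarrow>\<^sub>L 'a) \<Rightarrow> 'a \<Rightarrow>\<^sub>L 'a" where
  "ex t A = op_exp (t *\<^sub>R A)"

context hilbert_splitting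
begin

section \<open>One-parameter groups generated by elements of \<open>pp\<close>\<close>

lemma ex_add:
  assumes "A \<in> pp" shows "ex (s + t) A = ex s A o\<^sub>L ex t A"
proof -
  obtain z \<mu> where z: "onf (p + p) z" "\<And>t. op_exp (t *\<^sub>R A) = diag_op (p+p) z (\<lambda>k. exp (t * \<mu> k))"
    using pp_diag[OF assms] by metis
  show ?thesis unfolding ex_def z(2) diag_op_compose[OF z(1)] by (simp add: distrib_right exp_add)
qed

lemma ex_0: assumes "A \<in> pp" shows "ex 0 A = id_blinfun"
proof -
  obtain z \<mu> where z: "onf (p + p) z" "\<And>t. op_exp (t *\<^sub>R A) = diag_op (p+p) z (\<lambda>k. exp (t * \<mu> k))"
    using pp_diag[OF assms] by metis
  show ?thesis unfolding ex_def z(2) by simp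
qed

lemma ex_inv: assumes "A \<in> pp" shows "ex t A (ex (- t) A x) = x" "ex (- t) A (ex t A x) = x"
proof -
  have 1: "ex t A (ex (- t) A x) = x" for t
    using ex_add[OF assms, of t "- t"] ex_0[OF assms] by (metis add.right_inverse blinfun_apply_blinfun_compose blinfun_apply_id_blinfun id_apply)
  show "ex t A (ex (- t) A x) = x" "ex (- t) A (ex t A x) = x" using 1[of t] 1[of "- t"] by simp_all
qed

lemma ex_sym: assumes "A \<in> pp" shows "ex t A x \<bullet> y = x \<bullet> ex t A y"
proof -
  obtain z \<mu> where z: "onf (p + p) z" "\<And>t. op_exp (t *\<^sub>R A) = diag_op (p+p) z (\<lambda>k. exp (t * \<mu> k))"
    using pp_diag[OF assms] by metis
  show ?thesis unfolding ex_def z(2) by (rule diag_op_sym)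
qed

lemma ex_deriv0: assumes "A \<in> pp" shows "((\<lambda>t. ex t A) has_vector_derivative A) (at 0)"
proof -
  obtain z \<mu> where z: "onf (p + p) z" "A = (\<Sum>k<p+p. \<mu> k *\<^sub>R dyad (z k) (z k))"
    "\<And>t. op_exp (t *\<^sub>R A) = diag_op (p+p) z (\<lambda>k. exp (t * \<mu> k))"
    using pp_diag[OF assms] by metis
  have "((\<lambda>t. id_blinfun + (\<Sum>k<p+p. (exp (t * \<mu> k) - 1) *\<^sub>R dyad (z k) (z k))) has_vector_derivative
      (0 + (\<Sum>k<p+p. \<mu> k *\<^sub>R dyad (z k) (z k)))) (at 0)"
  proof (intro has_vector_derivative_add has_vector_derivative_const has_vector_derivative_sum)
    fix k
    have "((\<lambda>t. exp (t * \<mu> k) - 1) has_real_derivative \<mu> k) (at 0)"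
      by (auto intro!: derivative_eq_intros)
    then have "((\<lambda>t. (exp (t * \<mu> k) - 1) *\<^sub>R dyad (z k) (z k)) has_vector_derivative
        ((exp (0 * \<mu> k) - 1) *\<^sub>R 0 + \<mu> k *\<^sub>R dyad (z k) (z k))) (at 0)"
      by (intro has_vector_derivative_scaleR has_vector_derivative_const)
    then show "((\<lambda>t. (exp (t * \<mu> k) - 1) *\<^sub>R dyad (z k) (z k)) has_vector_derivative
        \<mu> k *\<^sub>R dyad (z k) (z k)) (at 0)" by simp
  qed
  then show ?thesis unfolding ex_def z(3) diag_op_def using z(2) by (simp only: add_0)
qed

lemma ex_deriv: assumes A: "A \<in> pp" shows "((\<lambda>t. ex t A) has_vector_derivative (A o\<^sub>L ex t A)) (at t)"
proof -
  have "((\<lambda>s. s - t) has_vector_derivative 1) (at t)" by (auto intro!: derivative_eq_intros)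
  moreover have "((\<lambda>s. ex s A) has_vector_derivative A) (at (t - t))" using ex_deriv0[OF A] by simp
  ultimately have "((\<lambda>s. ex s A) \<circ> (\<lambda>s. s - t) has_vector_derivative 1 *\<^sub>R A) (at t)"
    by (rule vector_diff_chain_at)
  then have "((\<lambda>s. ex (s - t) A) has_vector_derivative A) (at t)" by (simp add: comp_def)
  then have "((\<lambda>s. ex (s - t) A o\<^sub>L ex t A) has_vector_derivative (A o\<^sub>L ex t A)) (at t)"
    by (rule bounded_linear.has_vector_derivative[OF bounded_bilinear.bounded_linear_left[OF bounded_bilinear_blinfun_compose]])
  moreover have "ex (s - t) A o\<^sub>L ex t A = ex s A" for s
    unfolding ex_add[OF A, of "s - t" t, symmetric] by simp
  ultimately show ?thesis by simp
qed

lemma op_exp_sums: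
  assumes "A \<in> pp"
  shows "(\<lambda>n. (1 / fact n) *\<^sub>R (((\<lambda>T. A o\<^sub>L T) ^^ n) id_blinfun)) sums op_exp A"
proof -
  obtain z \<mu> where z: "onf (p + p) z" "A = (\<Sum>k<p+p. \<mu> k *\<^sub>R dyad (z k) (z k))"
    using pp_diag[OF assms] by metis
  show ?thesis using op_exp_sums_diag[OF z(1), of \<mu>] op_exp_diag[OF z(1), of \<mu>] z(2) by (simp only:)
qed

lemma op_exp_intertwine:
  fixes T :: "'a \<Rightarrow>\<^sub>L 'a"
  assumes A: "A \<in> pp" and B: "B \<in> pp" and TA: "\<And>x. T (A x) = B (T x)"
  shows "T (op_exp A x) = op_exp B (T x)"
proof -
  have 1: "T ((((\<lambda>S. A o\<^sub>L S) ^^ n) id_blinfun) x) = (((\<lambda>S. B o\<^sub>L S) ^^ n) id_blinfun) (T x)" for n x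
    by (induction n) (simp_all add: TA)
  have "T o\<^sub>L ((1 / fact n) *\<^sub>R (((\<lambda>S. A o\<^sub>L S) ^^ n) id_blinfun)) = ((1 / fact n) *\<^sub>R (((\<lambda>S. B o\<^sub>L S) ^^ n) id_blinfun)) o\<^sub>L T" for n
    by (rule blinfun_eqI) (simp add: blinfun.scaleR_left blinfun.scaleR_right 1)
  then have "T o\<^sub>L op_exp A = op_exp B o\<^sub>L T"
    using sums_blinfun_compose_right[OF op_exp_sums[OF A], of T] sums_blinfun_compose_left[OF op_exp_sums[OF B], of T]
    by (simp add: sums_unique2)
  then have "(T o\<^sub>L op_exp A) x = (op_exp B o\<^sub>L T) x" by simp
  then show ?thesis by simp
qed

text \<open>The factor \<open>c\<close> covers commutation (\<open>c = 1\<close>) as well as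
  \<open>\<Phi>\<close>, which conjugates \<open>A\<close> to its negative (\<open>c = -1\<close>)
  and hence inverts the group, see \<open>ex_Phi\<close>.\<close>

lemma ex_intertwine:
  fixes T :: "'a \<Rightarrow>\<^sub>L 'a"
  assumes A: "A \<in> pp" and B: "B \<in> pp" and TA: "\<And>x. T (A x) = c *\<^sub>R B (T x)"
  shows "T (ex t A x) = ex (c * t) B (T x)"
  unfolding ex_def
  by (rule op_exp_intertwine[OF pp_scale[OF A] pp_scale[OF B]])
    (simp add: blinfun.scaleR_left blinfun.scaleR_right TA mult.commute)

lemma ex_Phi: assumes "A \<in> pp" shows "\<Phi> (ex t A x) = ex (- t) A (\<Phi> x)"
  using ex_intertwine[OF assms assms, of \<Phi> "-1" t x] pp_anti[OF assms] by simp

lemma ex_commute: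
  fixes T :: "'a \<Rightarrow>\<^sub>L 'a"
  assumes "A \<in> pp" "\<And>x. T (A x) = A (T x)" shows "T (ex t A x) = ex t A (T x)"
  using ex_intertwine[OF assms(1,1), of T 1 t x] assms(2) by simp

lemma ex_eigen:
  assumes A: "A \<in> pp" and v: "A v = c *\<^sub>R v" shows "ex t A v = exp (t * c) *\<^sub>R v"
proof -
  obtain z \<mu> where z: "onf (p + p) z" "A = (\<Sum>k<p+p. \<mu> k *\<^sub>R dyad (z k) (z k))"
    "\<And>t. op_exp (t *\<^sub>R A) = diag_op (p+p) z (\<lambda>k. exp (t * \<mu> k))"
    using pp_diag[OF A] by metis
  have Av: "A v = (\<Sum>k<p+p. (\<mu> k * (z k \<bullet> v)) *\<^sub>R z k)"
    unfolding z(2) by (simp add: blinfun.sum_left blinfun.scaleR_left)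
  have ck: "\<mu> k * (z k \<bullet> v) = c * (z k \<bullet> v)" if "k < p + p" for k
  proof -
    have "z k \<bullet> A v = \<mu> k * (z k \<bullet> v)" unfolding Av by (rule onf_inner_sum[OF z(1) that])
    then show ?thesis unfolding v inner_scaleR_right by (rule sym)
  qed
  have e: "(exp (t * \<mu> k) - 1) * (z k \<bullet> v) = (exp (t * c) - 1) * (z k \<bullet> v)" if "k < p + p" for k
    using ck[OF that] by (cases "z k \<bullet> v = 0") auto
  have cv: "c *\<^sub>R v = c *\<^sub>R (\<Sum>k<p+p. (z k \<bullet> v) *\<^sub>R z k)"
    unfolding v[symmetric] Av by (simp add: ck scaleR_sum_right)
  have "ex t A v = v + (\<Sum>k<p+p. ((exp (t * c) - 1) * (z k \<bullet> v)) *\<^sub>R z k)"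
    unfolding ex_def z(3) diag_op_apply by (intro arg_cong2[where f="(+)"] refl sum.cong) (use e in simp_all)
  also have "\<dots> = v + (exp (t * c) - 1) *\<^sub>R (\<Sum>k<p+p. (z k \<bullet> v) *\<^sub>R z k)"
    by (simp add: scaleR_sum_right)
  \<comment> \<open>For nonzero \<open>c\<close> the eigenvector lies in the span of the
    \<open>z k\<close>. For \<open>c = 0\<close> it need not, but then the factor in front
    vanishes.\<close>
  also have "(exp (t * c) - 1) *\<^sub>R (\<Sum>k<p+p. (z k \<bullet> v) *\<^sub>R z k) = (exp (t * c) - 1) *\<^sub>R v"
    using cv by (cases "c = 0") simp_all
  finally show ?thesis by (simp add: algebra_simps)
qed

text \<open>A hyperbolic rotation in the plane of \<open>e i\<close> and \<open>n i\<close>: the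
  isotropic vectors \<open>e i + n i\<close> and \<open>e i - n i\<close> are eigenvectors with
  reciprocal eigenvalues.\<close>

lemma ex_frame:
  assumes f: "frame e n" and i: "i < p"
  shows "ex t (frame_op e n l) (e i) = cosh (t * l i) *\<^sub>R e i + sinh (t * l i) *\<^sub>R n i"
proof -
  note s = frame_op_frame[OF f i, of l]
  have 1: "ex t (frame_op e n l) (e i + n i) = exp (t * l i) *\<^sub>R (e i + n i)"
    by (rule ex_eigen[OF frame_op_pp[OF f]]) (simp add: blinfun.add_right s algebra_simps)
  have 2: "ex t (frame_op e n l) (e i - n i) = exp (t * - l i) *\<^sub>R (e i - n i)"
    by (rule ex_eigen[OF frame_op_pp[OF f]]) (simp add: blinfun.diff_right s algebra_simps)
  have "2 *\<^sub>R ex t (frame_op e n l) (e i) = ex t (frame_op e n l) (e i + n i) + ex t (frame_op e n l) (e i - n i)"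
    by (simp add: blinfun.add_right blinfun.diff_right scaleR_2)
  also have "\<dots> = 2 *\<^sub>R (cosh (t * l i) *\<^sub>R e i + sinh (t * l i) *\<^sub>R n i)"
    unfolding 1 2 by (simp add: cosh_def sinh_def algebra_simps)
  finally show ?thesis by simp
qed

text \<open>Membership in the orthogonal group with the inverse as an explicit second argument, so
  that transport of structure can be written without choosing or computing inverses.\<close>

definition form_iso :: "('a \<Rightarrow>\<^sub>L 'a) \<Rightarrow> ('a \<Rightarrow>\<^sub>L 'a) \<Rightarrow> bool" where
  "form_iso h g \<longleftrightarrow> (\<forall>x. g (h x) = x) \<and> (\<forall>x. h (g x) = x) \<and> (\<forall>x y. h x \<bullet> \<Phi> (h y) = x \<bullet> \<Phi> y)"

lemma O_group_iff: "h \<in> carrier (O_group \<Phi>) \<longleftrightarrow> (\<exists>g. form_iso h g)"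
proof -
  have 1: "adjoint (blinfun_apply h) \<circ> blinfun_apply \<Phi> \<circ> blinfun_apply h = blinfun_apply \<Phi>
    \<longleftrightarrow> (\<forall>x y. h x \<bullet> \<Phi> (h y) = x \<bullet> \<Phi> y)" for h :: "'a \<Rightarrow>\<^sub>L 'a"
  proof
    assume "adjoint (blinfun_apply h) \<circ> blinfun_apply \<Phi> \<circ> blinfun_apply h = blinfun_apply \<Phi>"
    then have "adjoint (blinfun_apply h) (\<Phi> (h y)) = \<Phi> y" for y by (metis comp_apply)
    then show "\<forall>x y. h x \<bullet> \<Phi> (h y) = x \<bullet> \<Phi> y" by (simp add: inner_adjoint_blinfun)
  next
    assume "\<forall>x y. h x \<bullet> \<Phi> (h y) = x \<bullet> \<Phi> y"
    then have *: "x \<bullet> adjoint (blinfun_apply h) (\<Phi> (h y)) = x \<bullet> \<Phi> y" for x y by (simp flip: inner_adjoint_blinfun)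
    have "adjoint (blinfun_apply h) (\<Phi> (h y)) = \<Phi> y" for y by (rule vector_eq_ldot[THEN iffD1], rule allI, rule *)
    then show "adjoint (blinfun_apply h) \<circ> blinfun_apply \<Phi> \<circ> blinfun_apply h = blinfun_apply \<Phi>"
      by (simp add: fun_eq_iff)
  qed
  have 2: "g o\<^sub>L h = id_blinfun \<longleftrightarrow> (\<forall>x. g (h x) = x)" for g h :: "'a \<Rightarrow>\<^sub>L 'a"
    by (metis blinfun_apply_blinfun_compose blinfun_apply_id_blinfun blinfun_eqI id_apply)
  show ?thesis by (simp add: O_group_def 1 2 form_iso_def) blast
qed

lemma form_isoD: assumes "form_iso h g" shows "g (h x) = x" "h (g x) = x" "h x \<bullet> \<Phi> (h y) = x \<bullet> \<Phi> y"
  using assms by (auto simp: form_iso_def)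

lemma form_iso_adj: assumes "form_iso h g" shows "h x \<bullet> \<Phi> y = x \<bullet> \<Phi> (g y)" "\<Phi> y \<bullet> h x = \<Phi> (g y) \<bullet> x"
  using form_isoD(3)[OF assms, of x "g y"] form_isoD(2)[OF assms] by (simp_all add: inner_commute)

lemma form_iso_inv: assumes "form_iso h g" shows "form_iso g h"
  unfolding form_iso_def using form_isoD(1,2)[OF assms] form_isoD(3)[OF assms, of "g x" "g y" for x y] by metis

lemma form_iso_id: "form_iso id_blinfun id_blinfun" by (simp add: form_iso_def)
lemma form_iso_comp: "form_iso h g \<Longrightarrow> form_iso h' g' \<Longrightarrow> form_iso (h o\<^sub>L h') (g' o\<^sub>L g)" by (simp add: form_iso_def)
lemma form_iso_ex: "A \<in> pp \<Longrightarrow> form_iso (ex t A) (ex (- t) A)"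
  by (simp add: form_iso_def ex_inv ex_Phi ex_sym)

text \<open>Subspaces in \<open>X\<close> are encoded by the reflections in them that are orthogonal for the form.\<close>

definition is_reflector :: "'a set \<Rightarrow> ('a \<Rightarrow>\<^sub>L 'a) \<Rightarrow> bool" where
  "is_reflector E J \<longleftrightarrow> (\<forall>x. J (J x) = x) \<and> (\<forall>x y. J x \<bullet> \<Phi> y = x \<bullet> \<Phi> (J y)) \<and> E = {x. J x = x}"

lemma Phi_inner_eqI: assumes "\<And>y. x \<bullet> \<Phi> y = z \<bullet> \<Phi> y" shows "x = z"
proof -
  have *: "x \<bullet> y = z \<bullet> y" for y using assms[of "\<Phi> y"] by simp
  show ?thesis by (rule vector_eq_rdot[THEN iffD1], rule allI, rule *)
qed

text \<open>With \<open>Q = (1 + J) / 2\<close> and \<open>R = (1 + K) / 2\<close>, equality of the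
  ranges gives \<open>Q R = R\<close> and \<open>R Q = Q\<close>. The adjoint of the first identity
  for the form is \<open>R Q = R\<close>, so \<open>Q = R\<close>.\<close>

lemma is_reflector_unique:
  assumes J: "is_reflector E J" and K: "is_reflector E K" shows "J = K"
proof -
  have reflector: "J (J x) = x" "K (K x) = x" for x using assms by (auto simp: is_reflector_def)
  have adj: "J x \<bullet> \<Phi> y = x \<bullet> \<Phi> (J y)" "K x \<bullet> \<Phi> y = x \<bullet> \<Phi> (K y)" for x y using assms by (auto simp: is_reflector_def)
  have EE: "J x = x \<longleftrightarrow> K x = x" for x using assms unfolding is_reflector_def by blast
  have 1: "J (K x) + J x = K x + x" for x
  proof -
    have "K (K x + x) = K x + x" by (simp add: blinfun.add_right reflector add.commute)
    then have "J (K x + x) = K x + x" using EE by blast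
    then show ?thesis by (simp add: blinfun.add_right)
  qed
  have 2: "K (J x) + K x = J x + x" for x
  proof -
    have "J (J x + x) = J x + x" by (simp add: blinfun.add_right reflector add.commute)
    then have "K (J x + x) = J x + x" using EE by blast
    then show ?thesis by (simp add: blinfun.add_right)
  qed
  have 3: "K (J x) + J x = K x + x" for x
  proof (rule Phi_inner_eqI)
    fix y
    have "(K (J x) + J x) \<bullet> \<Phi> y = x \<bullet> \<Phi> (J (K y) + J y)" by (simp add: inner_add_left inner_add_right blinfun.add_right adj)
    also have "\<dots> = (K x + x) \<bullet> \<Phi> y" unfolding 1 by (simp add: inner_add_left inner_add_right blinfun.add_right adj)
    finally show "(K (J x) + J x) \<bullet> \<Phi> y = (K x + x) \<bullet> \<Phi> y" .
  qed
  show ?thesis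
  proof (rule blinfun_eqI)
    fix x
    have "(K (J x) + K x) + (K x + x) = (J x + x) + (K (J x) + J x)" using 2[of x] 3[of x] by simp
    then have "2 *\<^sub>R K x = 2 *\<^sub>R J x" by (simp add: scaleR_2 algebra_simps)
    then show "J x = K x" by simp
  qed
qed

lemma is_reflector_E0: "is_reflector E0 \<Phi>"
  unfolding is_reflector_def using E_iff Phi_sym by auto

lemma is_reflector_image:
  assumes J: "is_reflector E J" and h: "form_iso h g" shows "is_reflector (h ` E) (h o\<^sub>L J o\<^sub>L g)"
proof -
  have reflector: "J (J x) = x" for x using J by (simp add: is_reflector_def)
  have adj: "J x \<bullet> \<Phi> y = x \<bullet> \<Phi> (J y)" for x y using J by (simp add: is_reflector_def)
  have EE: "E = {x. J x = x}" using J by (simp add: is_reflector_def)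
  have "h ` E = {x. h (J (g x)) = x}"
  proof (intro equalityI subsetI)
    fix x assume "x \<in> h ` E" then show "x \<in> {x. h (J (g x)) = x}" using EE form_isoD[OF h] by auto
  next
    fix x assume "x \<in> {x. h (J (g x)) = x}"
    then have x: "h (J (g x)) = x" by simp
    then have "J (g x) = g x" using form_isoD(1)[OF h, of "J (g x)"] by simp
    then have "g x \<in> E" using EE by simp
    then show "x \<in> h ` E" using form_isoD(2)[OF h, of x] by (metis imageI)
  qed
  then show ?thesis unfolding is_reflector_def
    by (simp add: form_isoD[OF h] reflector form_iso_adj(1)[OF h] adj form_iso_adj(1)[OF form_iso_inv[OF h]])
qed

definition reflector :: "'a set \<Rightarrow> 'a \<Rightarrow>\<^sub>L 'a" where "reflector E = (THE J. is_reflector E J)"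

lemma reflector_eq: "is_reflector E J \<Longrightarrow> reflector E = J"
  unfolding reflector_def using is_reflector_unique by blast

abbreviation "X \<equiv> X_space p \<Phi>"

lemma image_X:
  assumes h: "form_iso h g" and E: "E \<in> X" shows "h ` E \<in> X"
proof -
  have lin: "linear (blinfun_apply h)" by (rule bounded_linear.linear[OF blinfun.bounded_linear_right])
  have s: "subspace E" "dim E = p" "\<And>x. x \<in> E \<Longrightarrow> x \<noteq> 0 \<Longrightarrow> x \<bullet> \<Phi> x > 0"
    using E by (auto simp: X_space_def hform_def)
  have inj: "inj (blinfun_apply h)" by (rule injI) (metis form_isoD(1)[OF h])
  obtain B where B: "B \<subseteq> E" "independent B" "E \<subseteq> span B" "card B = dim E" using basis_exists by blast
  have spB: "span B = E" using B s(1) by (metis span_subspace)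
  have "independent (h ` B)"
    by (rule linear_independent_injective_image[OF lin B(2)]) (use inj in \<open>auto intro: inj_on_subset\<close>)
  moreover have "span (h ` B) = h ` E" using linear_span_image[OF lin, of B] spB by simp
  ultimately have "dim (h ` E) = card (h ` B)" using dim_span_eq_card_independent by metis
  also have "\<dots> = p" using card_image[of h B] inj B(4) s(2) by (simp add: inj_on_subset[OF inj])
  finally have "dim (h ` E) = p" .
  moreover have "subspace (h ` E)" by (rule linear_subspace_image[OF lin s(1)])
  moreover have "y \<bullet> \<Phi> y > 0" if y: "y \<in> h ` E" "y \<noteq> 0" for y
  proof -
    obtain x where x: "x \<in> E" "y = h x" using y(1) by auto
    then have "x \<noteq> 0" using y(2) by (auto simp: blinfun.zero_right)
    then show ?thesis using s(3)[OF x(1)] x(2) form_isoD(3)[OF h] by simp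
  qed
  ultimately show ?thesis by (simp add: X_space_def hform_def)
qed

lemma E0_X: "E0 \<in> X"
  using subE dimE PhiE by (simp add: X_space_def hform_def)

text \<open>A positive definite \<open>E\<close> is the graph of a map from \<open>E0\<close> to
  \<open>W\<close> whose singular values \<open>m i\<close> are below 1. The hyperbolic rotation by
  the inverse hyperbolic tangents of the \<open>m i\<close> carries \<open>E0\<close> to this
  graph.\<close>

lemma X_ex_frame:
  assumes E: "E \<in> X"
  shows "\<exists>A\<in>pp. E = ex 1 A ` E0"
proof -
  have s: "subspace E" "dim E = p" and pos: "\<And>x. x \<in> E \<Longrightarrow> x \<noteq> 0 \<Longrightarrow> x \<bullet> \<Phi> x > 0"
    using E by (auto simp: X_space_def hform_def)
  obtain B where B: "B \<subseteq> E" "independent B" "E \<subseteq> span B" "card B = dim E" using basis_exists by blast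
  have finB: "finite B" using B(4) s(2) p0 card_ge_0_finite[of B] by simp
  have spB: "span B = E" using B s(1) by (metis span_subspace)
  \<comment> \<open>The orthogonal projection to \<open>E0\<close>. It is injective on
    \<open>E\<close> because the form is negative on its kernel \<open>W\<close>; as the dimensions
    agree, \<open>E\<close> is a graph over \<open>E0\<close>.\<close>
  define q where "q = (1/2) *\<^sub>R (id_blinfun + \<Phi>)"
  have q: "q x = (1/2) *\<^sub>R (x + \<Phi> x)" for x by (simp add: q_def blinfun.scaleR_left blinfun.add_left)
  have lin: "linear (blinfun_apply q)" by (rule bounded_linear.linear[OF blinfun.bounded_linear_right])
  have qE: "q x \<in> E0" for x unfolding E_iff q by (simp add: blinfun.scaleR_right blinfun.add_right add.commute)
  have q0: "x = 0" if "x \<in> E" "q x = 0" for x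
  proof (rule ccontr)
    assume "x \<noteq> 0"
    have "x + \<Phi> x = 0" using that(2) by (simp add: q)
    then have "\<Phi> x = - x" by (simp add: eq_neg_iff_add_eq_0 add.commute)
    then show False using pos[OF that(1) \<open>x \<noteq> 0\<close>] inner_ge_zero[of x] by simp
  qed
  have inj: "inj_on (blinfun_apply q) (span B)"
  proof (rule inj_onI)
    fix x y assume "x \<in> span B" "y \<in> span B" "q x = q y"
    then have "q (x - y) = 0" "x - y \<in> E" using spB s(1) by (auto simp: blinfun.diff_right subspace_diff)
    then show "x = y" using q0 by fastforce
  qed
  have iq: "independent (q ` B)" by (rule linear_independent_injective_image[OF lin B(2) inj])
  have cq: "card (q ` B) = p"
    using card_image[OF inj_on_subset[OF inj span_superset]] B(4) s(2) by simp
  have "span (q ` B) = span (basis_E0 ` {..<p})"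
    by (rule span_eq_of_card[OF iq]) (use qE span_basis_E0 finB cq card_image[OF onf_inj[OF onf_basis_E0]] in auto)
  then have "q ` E = E0" using linear_span_image[OF lin, of B] spB span_basis_E0 by simp
  then have ex: "\<exists>x. x \<in> E \<and> q x = basis_E0 i" if "i < p" for i
    using that onE_basis_E0 unfolding onE_def by (metis imageE)
  define x where "x i = (SOME x. x \<in> E \<and> q x = basis_E0 i)" for i
  have x: "x i \<in> E" "q (x i) = basis_E0 i" if "i < p" for i
    using someI_ex[OF ex[OF that]] unfolding x_def by blast+
  define w where "w i = x i - basis_E0 i" for i
  have wW: "w i \<in> W" if "i < p" for i
  proof -
    have "\<Phi> (basis_E0 i) = basis_E0 i" using that onE_basis_E0 PhiE by (simp add: onE_def)
    moreover have "2 *\<^sub>R q (x i) = x i + \<Phi> (x i)" by (simp add: q)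
    then have "\<Phi> (x i) = basis_E0 i + basis_E0 i - x i" using x(2)[OF that] by (simp add: scaleR_2 eq_diff_eq add.commute)
    ultimately show ?thesis by (simp add: W_def w_def blinfun.diff_right)
  qed
  \<comment> \<open>The graph map together with its adjoint; the singular value decomposition of
    this element of \<open>pp\<close> provides the frame.\<close>
  define A1 where "A1 = (\<Sum>i<p. dyad (w i) (basis_E0 i) + dyad (basis_E0 i) (w i))"
  have A1: "A1 y = (\<Sum>i<p. (basis_E0 i \<bullet> y) *\<^sub>R w i) + (\<Sum>i<p. (w i \<bullet> y) *\<^sub>R basis_E0 i)" for y
    by (simp add: A1_def blinfun.sum_left blinfun.add_left sum.distrib)
  have "A1 \<in> pp" unfolding pp_def
  proof (intro CollectI conjI allI)
    fix y z
    show "A1 y \<bullet> z = y \<bullet> A1 z"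
      by (simp add: A1 inner_add_left inner_add_right inner_sum_left inner_sum_right inner_commute mult_ac)
  next
    fix y
    have b: "\<Phi> (basis_E0 i) = basis_E0 i" "\<Phi> (w i) = - w i" if "i < p" for i
      using that onE_basis_E0 PhiE wW by (auto simp: onE_def W_def)
    then have "basis_E0 i \<bullet> \<Phi> y = basis_E0 i \<bullet> y" "w i \<bullet> \<Phi> y = - (w i \<bullet> y)" if "i < p" for i
      using Phi_sym[of "basis_E0 i" y] Phi_sym[of "w i" y] that by simp_all
    then show "A1 (\<Phi> y) = - \<Phi> (A1 y)"
      using b by (simp add: A1 blinfun.add_right blinfun.sum_right blinfun.scaleR_right sum_negf)
  qed
  then obtain e n m where f: "frame e n" and m0: "\<And>i. i < p \<Longrightarrow> m i \<ge> 0" and A1s: "A1 = frame_op e n m"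
    using pp_svd by blast
  have oe: "onE e" using f by (simp add: frame_def)
  have emE: "e j + m j *\<^sub>R n j \<in> E" if j: "j < p" for j
  proof -
    have ej: "e j = (\<Sum>i<p. (basis_E0 i \<bullet> e j) *\<^sub>R basis_E0 i)" by (rule E_eq[OF onE_basis_E0]) (use frame_inner[OF f j j] in simp)
    have "w i \<bullet> e j = 0" if "i < p" for i using EW(2)[OF wW[OF that]] frame_inner[OF f j j] by simp
    then have "A1 (e j) = (\<Sum>i<p. (basis_E0 i \<bullet> e j) *\<^sub>R w i)" by (simp add: A1)
    then have "m j *\<^sub>R n j = (\<Sum>i<p. (basis_E0 i \<bullet> e j) *\<^sub>R w i)" using frame_op_frame(1)[OF f j] A1s by simp
    then have "e j + m j *\<^sub>R n j = (\<Sum>i<p. (basis_E0 i \<bullet> e j) *\<^sub>R basis_E0 i) + (\<Sum>i<p. (basis_E0 i \<bullet> e j) *\<^sub>R w i)"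
      by (rule arg_cong2[where f="(+)", OF ej])
    also have "\<dots> = (\<Sum>i<p. (basis_E0 i \<bullet> e j) *\<^sub>R x i)"
      by (simp add: w_def flip: sum.distrib scaleR_add_right)
    also have "\<dots> \<in> E" using x(1) s(1) by (intro subspace_sum subspace_scale) auto
    finally show ?thesis .
  qed
  have m1: "m j < 1" if j: "j < p" for j
  proof -
    note fi = frame_inner[OF f j j]
    have "e j \<bullet> (e j + m j *\<^sub>R n j) = 1" using fi by (simp add: inner_add_right)
    then have "e j + m j *\<^sub>R n j \<noteq> 0" by (metis inner_zero_right zero_neq_one)
    from pos[OF emE[OF j] this] have "1 - m j * m j > 0" using fi
      by (simp add: blinfun.add_right blinfun.scaleR_right inner_add_left inner_diff_right)
    then show ?thesis using mult_mono[of 1 "m j" 1 "m j"] by (cases "m j < 1") auto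
  qed
  \<comment> \<open>The inverse hyperbolic tangent: \<open>ex_frame\<close> sends \<open>e i\<close>
    to a multiple of \<open>e i + tanh (l i) *\<^sub>R n i\<close>, and this has to be the graph
    vector with slope \<open>m i\<close>.\<close>
  define l where "l i = ln ((1 + m i) / (1 - m i)) / 2" for i
  have th: "tanh (l i) = m i" if "i < p" for i
  proof -
    have m: "1 + m i > 0" "1 - m i > 0" using m0[OF that] m1[OF that] by simp_all
    then have e: "exp (- 2 * l i) = (1 - m i) / (1 + m i)"
      by (simp add: l_def exp_minus)
    have "1 - (1 - m i) / (1 + m i) = 2 * m i / (1 + m i)" "1 + (1 - m i) / (1 + m i) = 2 / (1 + m i)"
      using m by (simp_all add: field_simps)
    then show ?thesis unfolding tanh_real_altdef e using m by simp
  qed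
  let ?A = "frame_op e n l"
  have AE: "ex 1 ?A (e i) \<in> E" if i: "i < p" for i
  proof -
    have "ex 1 ?A (e i) = cosh (l i) *\<^sub>R (e i + m i *\<^sub>R n i)"
      unfolding ex_frame[OF f i] using th[OF i] by (simp add: tanh_def scaleR_add_right field_simps cosh_real_nonzero)
    then show ?thesis using emE[OF i] s(1) by (simp add: subspace_scale)
  qed
  have form_iso: "form_iso (ex 1 ?A) (ex (- 1) ?A)" by (rule form_iso_ex[OF frame_op_pp[OF f]])
  have linA: "linear (blinfun_apply (ex 1 ?A))" by (rule bounded_linear.linear[OF blinfun.bounded_linear_right])
  have injA: "inj (blinfun_apply (ex 1 ?A))" by (rule injI) (metis form_isoD(1)[OF form_iso])
  have e1: "onf p e" using oe by (simp add: onE_def)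
  have "span (ex 1 ?A ` e ` {..<p}) = span B"
  proof (rule span_eq_of_card)
    show "independent (ex 1 ?A ` e ` {..<p})"
      by (rule linear_independent_injective_image[OF linA onf_independent[OF e1]]) (rule inj_on_subset[OF injA subset_UNIV])
    show "ex 1 ?A ` e ` {..<p} \<subseteq> span B" using AE spB by auto
    have "card (ex 1 ?A ` e ` {..<p}) = card (e ` {..<p})" by (rule card_image) (rule inj_on_subset[OF injA subset_UNIV])
    also have "\<dots> = p" by (subst card_image[OF onf_inj[OF e1]]) simp
    finally show "card B \<le> card (ex 1 ?A ` e ` {..<p})" using B(4) s(2) by simp
  qed (use finB in auto)
  then have "ex 1 ?A ` E0 = E" using linear_span_image[OF linA, of "e ` {..<p}"] onE_span[OF oe] spB by simp
  then show ?thesis using frame_op_pp[OF f] by blast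
qed

end

section \<open>The Riemannian norm\<close>

lemma has_vector_derivative_iff_quotient:
  fixes f :: "real \<Rightarrow> 'b::real_normed_vector"
  shows "(f has_vector_derivative D) (at t) \<longleftrightarrow> ((\<lambda>s. (1 / (s - t)) *\<^sub>R (f s - f t)) \<longlongrightarrow> D) (at t)"
proof -
  have bl: "bounded_linear (\<lambda>x. x *\<^sub>R D)" by (rule bounded_linear_scaleR_left)
  have e: "norm (f s - f t - (s - t) *\<^sub>R D) / norm (s - t) = norm ((1 / (s - t)) *\<^sub>R (f s - f t) - D)" if "s \<noteq> t" for s
  proof -
    have "(1 / (s - t)) *\<^sub>R (f s - f t) - D = (1 / (s - t)) *\<^sub>R (f s - f t - (s - t) *\<^sub>R D)"
      using that by (simp add: scaleR_diff_right)
    then show ?thesis by (simp add: divide_inverse mult.commute)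
  qed
  have "(f has_vector_derivative D) (at t) \<longleftrightarrow> ((\<lambda>s. norm (f s - f t - (s - t) *\<^sub>R D) / norm (s - t)) \<longlongrightarrow> 0) (at t)"
    unfolding has_vector_derivative_def has_derivative_iff_norm using bl by simp
  also have "\<dots> \<longleftrightarrow> ((\<lambda>s. norm ((1 / (s - t)) *\<^sub>R (f s - f t) - D)) \<longlongrightarrow> 0) (at t)"
    by (rule tendsto_cong, unfold eventually_at_filter, intro always_eventually allI impI, rule e)
  also have "\<dots> \<longleftrightarrow> ((\<lambda>s. (1 / (s - t)) *\<^sub>R (f s - f t)) \<longlongrightarrow> D) (at t)"
    unfolding tendsto_norm_zero_iff by (rule LIM_zero_iff)
  finally show ?thesis .
qed

lemma tendsto_compose_blinfun:
  "(f \<longlongrightarrow> a) F \<Longrightarrow> (g \<longlongrightarrow> b) F \<Longrightarrow> ((\<lambda>x. f x o\<^sub>L g x) \<longlongrightarrow> a o\<^sub>L b) F"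
  by (rule bounded_bilinear.tendsto[OF bounded_bilinear_blinfun_compose])

lemma vd_compose_blinfun:
  "(f has_vector_derivative f') (at t) \<Longrightarrow> (g has_vector_derivative g') (at t)
   \<Longrightarrow> ((\<lambda>s. f s o\<^sub>L g s) has_vector_derivative ((f t o\<^sub>L g') + (f' o\<^sub>L g t))) (at t)"
  by (rule bounded_bilinear.has_vector_derivative[OF bounded_bilinear_blinfun_compose])

lemma vd_compose_right:
  assumes "(f has_vector_derivative f') F"
  shows "((\<lambda>s. f s o\<^sub>L T) has_vector_derivative (f' o\<^sub>L T)) F"
  by (rule bounded_linear.has_vector_derivative[OF bounded_bilinear.bounded_linear_left[OF bounded_bilinear_blinfun_compose] assms])

lemma vd_compose_const:
  assumes "(f has_vector_derivative f') (at t)"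
  shows "((\<lambda>s. S o\<^sub>L f s o\<^sub>L T) has_vector_derivative (S o\<^sub>L f' o\<^sub>L T)) (at t)"
  using vd_compose_blinfun[OF vd_compose_blinfun[OF has_vector_derivative_const assms] has_vector_derivative_const, of S T]
  by simp

text \<open>The resolvent identity; continuity and differentiability of inversion both rest on
  it.\<close>

lemma inverse_difference:
  fixes M N :: "real \<Rightarrow> 'b::real_normed_vector \<Rightarrow>\<^sub>L 'b"
  assumes "\<And>x. N s (M s x) = x" "\<And>x. M t (N t x) = x"
  shows "N s - N t = - (N s o\<^sub>L (M s - M t) o\<^sub>L N t)"
  by (rule blinfun_eqI) (simp add: blinfun.diff_left blinfun.diff_right blinfun.minus_left assms)

lemma inverse_tendsto:
  fixes M N :: "real \<Rightarrow> 'b::real_normed_vector \<Rightarrow>\<^sub>L 'b"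
  assumes T: "t \<in> T" and inv: "\<And>s x. s \<in> T \<Longrightarrow> N s (M s x) = x" "\<And>s x. s \<in> T \<Longrightarrow> M s (N s x) = x"
    and M: "(M \<longlongrightarrow> M t) (at t within T)"
  shows "(N \<longlongrightarrow> N t) (at t within T)"
proof -
  define c where "c = norm (N t)"
  have c0: "c \<ge> 0" by (simp add: c_def)
  have lim0: "((\<lambda>s. norm (M s - M t)) \<longlongrightarrow> 0) (at t within T)"
    by (rule tendsto_norm_zero[OF LIM_zero[OF M]])
  have evT: "\<forall>\<^sub>F s in at t within T. s \<in> T"
    by (simp add: eventually_at_filter)
  \<comment> \<open>With this radius \<open>norm (M s - M t) * c\<close> is at most 1/2, so the term
    with \<open>N s\<close> in the resolvent estimate can be absorbed and \<open>norm (N s)\<close>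
    is at most \<open>2 * c\<close>. Taking \<open>c + 1\<close> avoids a zero denominator.\<close>
  have ev: "\<forall>\<^sub>F s in at t within T. norm (M s - M t) < 1 / (2 * (c + 1))"
    by (rule order_tendstoD(2)[OF lim0]) (use c0 in simp)
  have bd: "norm (N s - N t) \<le> norm (M s - M t) * (2 * c * c)" if s: "s \<in> T" and sm: "norm (M s - M t) < 1 / (2 * (c + 1))" for s
  proof -
    have 1: "norm (N s - N t) \<le> norm (N s) * norm (M s - M t) * c"
    proof -
      have "norm (N s - N t) = norm (N s o\<^sub>L (M s - M t) o\<^sub>L N t)"
        using inverse_difference[OF inv(1)[OF s] inv(2)[OF T]] by (metis norm_minus_cancel)
      also have "\<dots> \<le> norm (N s o\<^sub>L (M s - M t)) * norm (N t)" by (rule norm_blinfun_compose)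
      also have "\<dots> \<le> norm (N s) * norm (M s - M t) * norm (N t)"
        by (rule mult_right_mono[OF norm_blinfun_compose]) simp
      finally show ?thesis by (simp add: c_def)
    qed
    have "norm (M s - M t) * c \<le> 1 / (2 * (c + 1)) * (c + 1)" using sm c0 by (intro mult_mono) auto
    also have "\<dots> = 1 / 2" using c0 by simp
    finally have "norm (N s) * (norm (M s - M t) * c) \<le> norm (N s) * (1 / 2)" by (rule mult_left_mono) simp
    moreover have "norm (N s) \<le> norm (N t) + norm (N s - N t)" by (rule norm_triangle_sub)
    ultimately have "norm (N s) \<le> 2 * c" using 1 by (simp add: c_def mult.assoc)
    then have "norm (N s) * (norm (M s - M t) * c) \<le> (2 * c) * (norm (M s - M t) * c)"
      by (rule mult_right_mono) (simp add: c0)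
    then show ?thesis using 1 by (simp add: mult_ac)
  qed
  have "((\<lambda>s. norm (M s - M t) * (2 * c * c)) \<longlongrightarrow> 0 * (2 * c * c)) (at t within T)" by (intro tendsto_intros lim0)
  then have g: "((\<lambda>s. norm (M s - M t) * (2 * c * c)) \<longlongrightarrow> 0) (at t within T)" by simp
  have "\<forall>\<^sub>F s in at t within T. norm (N s - N t) \<le> norm (M s - M t) * (2 * c * c)"
    using eventually_conj[OF evT ev] by (rule eventually_mono) (use bd in blast)
  then have "((\<lambda>s. N s - N t) \<longlongrightarrow> 0) (at t within T)" by (rule Lim_null_comparison[OF _ g])
  then show ?thesis by (rule LIM_zero_cancel)
qed

lemma inverse_vd:
  fixes M N :: "real \<Rightarrow> 'b::real_normed_vector \<Rightarrow>\<^sub>L 'b"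
  assumes T: "open T" "t \<in> T" and inv: "\<And>s x. s \<in> T \<Longrightarrow> N s (M s x) = x" "\<And>s x. s \<in> T \<Longrightarrow> M s (N s x) = x"
    and M: "(M has_vector_derivative M') (at t)"
  shows "(N has_vector_derivative - (N t o\<^sub>L M' o\<^sub>L N t)) (at t)"
proof -
  have Mt: "(M \<longlongrightarrow> M t) (at t)" using has_vector_derivative_continuous[OF M] by (simp add: continuous_at)
  have Mt': "(M \<longlongrightarrow> M t) (at t within T)" using Mt by (rule tendsto_within_subset) simp
  have "(N \<longlongrightarrow> N t) (at t within T)" by (rule inverse_tendsto[OF T(2) inv Mt'])
  then have Nt: "(N \<longlongrightarrow> N t) (at t)" using at_within_open[OF T(2,1)] by simp
  have "((\<lambda>s. - (N s o\<^sub>L ((1 / (s - t)) *\<^sub>R (M s - M t)) o\<^sub>L N t)) \<longlongrightarrow> - (N t o\<^sub>L M' o\<^sub>L N t)) (at t)"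
    by (intro tendsto_minus tendsto_compose_blinfun tendsto_const Nt M[unfolded has_vector_derivative_iff_quotient])
  moreover have "\<forall>\<^sub>F s in at t. - (N s o\<^sub>L ((1 / (s - t)) *\<^sub>R (M s - M t)) o\<^sub>L N t) = (1 / (s - t)) *\<^sub>R (N s - N t)"
  proof (rule eventually_mono[OF eventually_at_in_open'[OF T]])
    fix s assume "s \<in> T"
    then have e: "N s - N t = - (N s o\<^sub>L (M s - M t) o\<^sub>L N t)" by (intro inverse_difference inv T)
    show "- (N s o\<^sub>L ((1 / (s - t)) *\<^sub>R (M s - M t)) o\<^sub>L N t) = (1 / (s - t)) *\<^sub>R (N s - N t)"
      unfolding e by (rule blinfun_eqI) (simp add: blinfun.scaleR_left blinfun.scaleR_right blinfun.minus_left)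
  qed
  ultimately show ?thesis unfolding has_vector_derivative_iff_quotient
    by (rule Lim_transform_eventually)
qed

section \<open>The Hilbert-Schmidt norm on the tangent space\<close>

lemma has_sum_lessThan_sum:
  fixes f :: "nat \<Rightarrow> 'b \<Rightarrow> real"
  assumes "\<And>k. (f k has_sum s k) A"
  shows "((\<lambda>x. \<Sum>k<n. f k x) has_sum (\<Sum>k<n. s k)) A"
  by (induction n) (simp_all add: has_sum_add assms)

context hilbert_splitting
begin

text \<open>The Hilbert-Schmidt norm computed on \<open>E0\<close> alone (see
  \<open>hs_norm_eq\<close>): the restriction to \<open>W\<close> is the adjoint of the restriction
  to \<open>E0\<close> and contributes the same amount, whence the factor 2.\<close>

definition N :: "('a \<Rightarrow>\<^sub>L 'a) \<Rightarrow> real" where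
  "N A = sqrt (2 * (\<Sum>i<p. (norm (A (basis_E0 i)))\<^sup>2))"

lemma N_nonneg: "N A \<ge> 0" by (simp add: N_def sum_nonneg)

text \<open>Parseval in \<open>E0\<close> for each \<open>e j\<close>. The right-hand side does not
  mention \<open>b\<close>, which makes \<open>N\<close> independent of the orthonormal basis, see
  \<open>N_onE\<close>.\<close>

lemma sum_norm_frame_op:
  assumes f: "frame e n" and b: "onE b"
  shows "(\<Sum>i<p. (norm (frame_op e n l (b i)))\<^sup>2) = (\<Sum>j<p. (l j)\<^sup>2)"
proof -
  have on: "onf p n" "onE e" "onf p b" using f b by (auto simp: frame_def onE_def)
  have 1: "(norm (frame_op e n l (b i)))\<^sup>2 = (\<Sum>j<p. (l j)\<^sup>2 * ((b i \<bullet> e j) * (b i \<bullet> e j)))" if i: "i < p" for i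
  proof -
    have "n j \<bullet> b i = 0" if "j < p" for j
      using EW(2)[of "n j" "b i"] frame_inner(6)[OF f that that] b i by (simp add: onE_def)
    then have "frame_op e n l (b i) = (\<Sum>j<p. (l j * (e j \<bullet> b i)) *\<^sub>R n j)" by (simp add: frame_op_apply)
    then have "(norm (frame_op e n l (b i)))\<^sup>2 = (\<Sum>j<p. (l j * (e j \<bullet> b i)) * (l j * (e j \<bullet> b i)))"
      unfolding power2_norm_eq_inner using onf_inner_sums[OF on(1)] by simp
    then show ?thesis by (simp add: power2_eq_square inner_commute mult_ac)
  qed
  have "(\<Sum>i<p. (norm (frame_op e n l (b i)))\<^sup>2) = (\<Sum>i<p. \<Sum>j<p. (l j)\<^sup>2 * ((b i \<bullet> e j) * (b i \<bullet> e j)))"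
    using 1 by simp
  also have "\<dots> = (\<Sum>j<p. (l j)\<^sup>2 * (\<Sum>i<p. (b i \<bullet> e j) * (b i \<bullet> e j)))"
    by (subst sum.swap) (simp add: sum_distrib_left)
  also have "\<dots> = (\<Sum>j<p. (l j)\<^sup>2)"
  proof (rule sum.cong[OF refl])
    fix j assume "j \<in> {..<p}"
    then have j: "j < p" by simp
    have "e j \<in> span (b ` {..<p})" using onE_span[OF b] frame_inner(5)[OF f j j] by simp
    then have "(\<Sum>i<p. (b i \<bullet> e j) * (b i \<bullet> e j)) = 1"
      using onf_parseval[OF on(3), of "e j" "e j"] frame_inner(1)[OF f j j] by simp
    then show "(l j)\<^sup>2 * (\<Sum>i<p. (b i \<bullet> e j) * (b i \<bullet> e j)) = (l j)\<^sup>2" by simp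
  qed
  finally show ?thesis .
qed

lemma N_frame_op: "frame e n \<Longrightarrow> N (frame_op e n l) = sqrt (2 * (\<Sum>j<p. (l j)\<^sup>2))"
  by (simp add: N_def sum_norm_frame_op[OF _ onE_basis_E0])

lemma N_onE: assumes "A \<in> pp" "onE b" shows "N A = sqrt (2 * (\<Sum>i<p. (norm (A (b i)))\<^sup>2))"
proof -
  obtain e n l where "frame e n" "A = frame_op e n l" using pp_svd[OF assms(1)] by blast
  then show ?thesis using N_frame_op sum_norm_frame_op[OF _ assms(2)] by simp
qed

text \<open>Expanding in the finitely many eigenvectors makes this a finite combination of Parseval
  sums, one for each eigenvector; the eigenvalues come in pairs of opposite sign.\<close>

lemma hs_has_sum:
  assumes f: "frame e n" and b: "orthonormal_basis b"
  shows "((\<lambda>x. (norm (frame_op e n l x))\<^sup>2) has_sum (2 * (\<Sum>j<p. (l j)\<^sup>2))) b"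
proof -
  note o = diag_vec_onf[OF f]
  have 1: "(norm (frame_op e n l x))\<^sup>2 = (\<Sum>k<p+p. (diag_val l k)\<^sup>2 * (x \<bullet> diag_vec e n k)\<^sup>2)" for x
  proof -
    have "frame_op e n l x = (\<Sum>k<p+p. (diag_val l k * (diag_vec e n k \<bullet> x)) *\<^sub>R diag_vec e n k)"
      unfolding frame_op_diag by (simp add: blinfun.sum_left blinfun.scaleR_left)
    then show ?thesis unfolding power2_norm_eq_inner using onf_inner_sums[OF o]
      by (simp add: power2_eq_square inner_commute mult_ac)
  qed
  have "((\<lambda>x. \<Sum>k<p+p. (diag_val l k)\<^sup>2 * (x \<bullet> diag_vec e n k)\<^sup>2) has_sum (\<Sum>k<p+p. (diag_val l k)\<^sup>2 * (norm (diag_vec e n k))\<^sup>2)) b"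
    by (intro has_sum_lessThan_sum has_sum_cmult_right parseval_has_sum[OF b])
  moreover have "(\<Sum>k<p+p. (diag_val l k)\<^sup>2 * (norm (diag_vec e n k))\<^sup>2) = (\<Sum>k<p+p. (diag_val l k)\<^sup>2)"
    using onf_norm[OF o] by simp
  moreover have "(\<Sum>k<p+p. (diag_val l k)\<^sup>2) = 2 * (\<Sum>j<p. (l j)\<^sup>2)"
    unfolding sum_lessThan_add by (simp add: diag_val_def)
  ultimately show ?thesis unfolding 1 by simp
qed

lemma pp_has_sum:
  assumes "A \<in> pp" "orthonormal_basis b"
  shows "((\<lambda>x. (norm (A x))\<^sup>2) has_sum (N A)\<^sup>2) b"
proof -
  obtain e n l where "frame e n" "A = frame_op e n l" using pp_svd[OF assms(1)] by blast
  then show ?thesis using hs_has_sum[OF _ assms(2)] N_frame_op by (simp add: sum_nonneg)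
qed

lemma hs_norm_eq: assumes "A \<in> pp" shows "hs_norm A = N A"
proof -
  define b where "b = (SOME b::'a set. orthonormal_basis b)"
  have b: "orthonormal_basis b" unfolding b_def by (rule someI_ex[OF ex_orthonormal_basis])
  have "x \<bullet> adjoint (blinfun_apply A) (A x) = (norm (A x))\<^sup>2" for x
    by (simp add: power2_norm_eq_inner flip: inner_adjoint_blinfun)
  then have "op_trace (adjoint (blinfun_apply A) \<circ> blinfun_apply A) = (N A)\<^sup>2"
    unfolding op_trace_def b_def[symmetric] using infsumI[OF pp_has_sum[OF assms b]] by simp
  then show ?thesis by (simp add: hs_norm_def N_nonneg)
qed

lemma p_space_eq: "p_space \<Phi> = pp"
proof
  have adj: "adjoint (blinfun_apply A) = blinfun_apply A \<longleftrightarrow> (\<forall>x y. A x \<bullet> y = x \<bullet> A y)" for A :: "'a \<Rightarrow>\<^sub>L 'a"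
  proof
    assume "adjoint (blinfun_apply A) = blinfun_apply A"
    then show "\<forall>x y. A x \<bullet> y = x \<bullet> A y" using inner_adjoint_blinfun[of A] by simp
  qed (simp add: adjoint_unique)
  have anti: "(A o\<^sub>L \<Phi>) + (\<Phi> o\<^sub>L A) = 0 \<longleftrightarrow> (\<forall>x. A (\<Phi> x) = - \<Phi> (A x))" for A :: "'a \<Rightarrow>\<^sub>L 'a"
  proof
    assume h: "(A o\<^sub>L \<Phi>) + (\<Phi> o\<^sub>L A) = 0"
    show "\<forall>x. A (\<Phi> x) = - \<Phi> (A x)"
    proof
      fix x
      have "((A o\<^sub>L \<Phi>) + (\<Phi> o\<^sub>L A)) x = 0" using h by simp
      then show "A (\<Phi> x) = - \<Phi> (A x)" by (simp add: blinfun.add_left eq_neg_iff_add_eq_0)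
    qed
  next
    assume "\<forall>x. A (\<Phi> x) = - \<Phi> (A x)"
    then show "(A o\<^sub>L \<Phi>) + (\<Phi> o\<^sub>L A) = 0" by (intro blinfun_eqI) (simp add: blinfun.add_left)
  qed
  show "p_space \<Phi> \<subseteq> pp" unfolding p_space_def pp_def adj anti by blast
  show "pp \<subseteq> p_space \<Phi>"
  proof
    fix A assume A: "A \<in> pp"
    then have "hilbert_schmidt A" unfolding hilbert_schmidt_def
      using pp_has_sum[OF A] has_sum_imp_summable by blast
    then show "A \<in> p_space \<Phi>" using A unfolding p_space_def pp_def adj anti by blast
  qed
qed

text \<open>The orthogonal and the oblique projection onto an element of \<open>X\<close> are obtained from each other by
  the formula in \<open>dual\<close>, so that a curve of one kind inherits its derivatives from the other kind.\<close>

definition D0 :: "('a \<Rightarrow>\<^sub>L 'a) \<Rightarrow> 'a \<Rightarrow>\<^sub>L 'a" where "D0 M = M + (\<Phi> o\<^sub>L M o\<^sub>L \<Phi>)"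
definition DD :: "('a \<Rightarrow>\<^sub>L 'a) \<Rightarrow> 'a \<Rightarrow>\<^sub>L 'a" where "DD M = D0 M - id_blinfun"
text \<open>The product rule for \<open>H o\<^sub>L DD K\<close> when \<open>H\<close> has
  derivative \<open>m\<close> and \<open>DD K\<close> is the inverse of \<open>DD H\<close>.\<close>

definition dtr :: "('a \<Rightarrow>\<^sub>L 'a) \<Rightarrow> ('a \<Rightarrow>\<^sub>L 'a) \<Rightarrow> ('a \<Rightarrow>\<^sub>L 'a) \<Rightarrow> 'a \<Rightarrow>\<^sub>L 'a" where
  "dtr H K m = (m o\<^sub>L DD K) - (H o\<^sub>L (DD K o\<^sub>L D0 m o\<^sub>L DD K))"

definition dual :: "('a \<Rightarrow>\<^sub>L 'a) \<Rightarrow> ('a \<Rightarrow>\<^sub>L 'a) \<Rightarrow> bool" where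
  "dual H K \<longleftrightarrow> K = H o\<^sub>L DD K \<and> (\<forall>x. DD K (DD H x) = x) \<and> (\<forall>x. DD H (DD K x) = x)"

lemma D0_vd: "(f has_vector_derivative f') (at t) \<Longrightarrow> ((\<lambda>s. D0 (f s)) has_vector_derivative D0 f') (at t)"
  unfolding D0_def by (intro has_vector_derivative_add vd_compose_const)

lemma DD_vd: "(f has_vector_derivative f') (at t) \<Longrightarrow> ((\<lambda>s. DD (f s)) has_vector_derivative D0 f') (at t)"
  unfolding DD_def using has_vector_derivative_diff[OF D0_vd has_vector_derivative_const] by simp

lemma D0_tendsto: "(f \<longlongrightarrow> l) F \<Longrightarrow> ((\<lambda>s. D0 (f s)) \<longlongrightarrow> D0 l) F"
  unfolding D0_def by (intro tendsto_intros tendsto_compose_blinfun)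

lemma DD_tendsto: "(f \<longlongrightarrow> l) F \<Longrightarrow> ((\<lambda>s. DD (f s)) \<longlongrightarrow> DD l) F"
  unfolding DD_def by (intro tendsto_intros D0_tendsto)

lemma dual_tendsto:
  fixes t :: real
  assumes T: "t \<in> T" and d: "\<And>s. s \<in> T \<Longrightarrow> dual (H s) (K s)"
    and H: "(H \<longlongrightarrow> H t) (at t within T)"
  shows "((\<lambda>s. DD (K s)) \<longlongrightarrow> DD (K t)) (at t within T)" "(K \<longlongrightarrow> K t) (at t within T)"
proof -
  have i: "DD (K s) (DD (H s) x) = x" "DD (H s) (DD (K s) x) = x" if "s \<in> T" for s x
    using d[OF that] by (auto simp: dual_def)
  show 1: "((\<lambda>s. DD (K s)) \<longlongrightarrow> DD (K t)) (at t within T)"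
    by (rule inverse_tendsto[where M="\<lambda>s. DD (H s)", OF T i DD_tendsto[OF H]])
  have "((\<lambda>s. H s o\<^sub>L DD (K s)) \<longlongrightarrow> H t o\<^sub>L DD (K t)) (at t within T)" by (intro tendsto_compose_blinfun H 1)
  moreover have "\<forall>\<^sub>F s in at t within T. H s o\<^sub>L DD (K s) = K s"
    unfolding eventually_at_filter by (rule always_eventually) (use d in \<open>auto simp: dual_def\<close>)
  ultimately have "(K \<longlongrightarrow> H t o\<^sub>L DD (K t)) (at t within T)" by (rule Lim_transform_eventually)
  moreover have "H t o\<^sub>L DD (K t) = K t" using d[OF T] by (simp add: dual_def)
  ultimately show "(K \<longlongrightarrow> K t) (at t within T)" by simp
qed

lemma dual_vd:
  assumes T: "open T" "t \<in> T" and d: "\<And>s. s \<in> T \<Longrightarrow> dual (H s) (K s)"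
    and H: "(H has_vector_derivative m) (at t)"
  shows "(K has_vector_derivative dtr (H t) (K t) m) (at t)"
proof -
  have i: "DD (K s) (DD (H s) x) = x" "DD (H s) (DD (K s) x) = x" if "s \<in> T" for s x
    using d[OF that] by (auto simp: dual_def)
  have 1: "((\<lambda>s. DD (K s)) has_vector_derivative - (DD (K t) o\<^sub>L D0 m o\<^sub>L DD (K t))) (at t)"
    by (rule inverse_vd[where M="\<lambda>s. DD (H s)", OF T i DD_vd[OF H]])
  have "((\<lambda>s. H s o\<^sub>L DD (K s)) has_vector_derivative
     ((H t o\<^sub>L (- (DD (K t) o\<^sub>L D0 m o\<^sub>L DD (K t)))) + (m o\<^sub>L DD (K t)))) (at t)"
    by (rule vd_compose_blinfun[OF H 1])
  then have 2: "((\<lambda>s. H s o\<^sub>L DD (K s)) has_vector_derivative dtr (H t) (K t) m) (at t)"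
    by (simp add: dtr_def bounded_bilinear.minus_right[OF bounded_bilinear_blinfun_compose])
  show ?thesis
    by (rule has_vector_derivative_transform_within_open[OF 2 T]) (use d in \<open>simp add: dual_def\<close>)
qed

lemma dual_C1:
  assumes T: "open T" and d: "\<And>s. s \<in> T \<Longrightarrow> dual (H s) (K s)"
    and H: "\<And>t. t \<in> T \<Longrightarrow> (H has_vector_derivative m t) (at t)" and m: "continuous_on T m"
  shows "continuous_on T (\<lambda>t. dtr (H t) (K t) (m t))"
  unfolding continuous_on_eq_continuous_at[OF T] continuous_at
proof
  fix t assume t: "t \<in> T"
  have Ht: "(H \<longlongrightarrow> H t) (at t)" using has_vector_derivative_continuous[OF H[OF t]] by (simp add: continuous_at)
  have "((\<lambda>s. DD (K s)) \<longlongrightarrow> DD (K t)) (at t within T)"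
    by (rule dual_tendsto(1)[OF t d tendsto_within_subset[OF Ht subset_UNIV]])
  then have k: "((\<lambda>s. DD (K s)) \<longlongrightarrow> DD (K t)) (at t)" using at_within_open[OF t T] by simp
  have mt: "(m \<longlongrightarrow> m t) (at t)" using m t continuous_on_eq_continuous_at[OF T] continuous_at by blast
  show "((\<lambda>t. dtr (H t) (K t) (m t)) \<longlongrightarrow> dtr (H t) (K t) (m t)) (at t)"
    unfolding dtr_def by (intro tendsto_diff tendsto_compose_blinfun mt k Ht D0_tendsto)
qed

text \<open>The projection onto \<open>E\<close> along the complement for the form, where
  \<open>orth_proj\<close> projects along the complement for the inner product.\<close>

definition oblique_proj :: "'a set \<Rightarrow> 'a \<Rightarrow>\<^sub>L 'a" where "oblique_proj E = (1/2) *\<^sub>R (id_blinfun + reflector E)"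

lemma oblique_proj_apply: "oblique_proj E x = (1/2) *\<^sub>R (x + reflector E x)"
  by (simp add: oblique_proj_def blinfun.scaleR_left blinfun.add_left)

lemma X_form_iso: assumes "E \<in> X" obtains h g where "form_iso h g" "E = h ` E0"
  using X_ex_frame[OF assms] form_iso_ex by metis

lemma reflector_image: assumes "form_iso h g" "E \<in> X" shows "reflector (h ` E) = h o\<^sub>L reflector E o\<^sub>L g"
proof -
  obtain h' g' where h': "form_iso h' g'" "E = h' ` E0" using X_form_iso[OF assms(2)] .
  have "is_reflector E (h' o\<^sub>L \<Phi> o\<^sub>L g')" using is_reflector_image[OF is_reflector_E0 h'(1)] h'(2) by simp
  then show ?thesis using reflector_eq is_reflector_image[OF _ assms(1)] by metis
qed

lemma reflector_E0: "reflector E0 = \<Phi>" by (rule reflector_eq[OF is_reflector_E0])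

lemma X_is_reflector: assumes "E \<in> X" shows "is_reflector E (reflector E)"
proof -
  obtain h g where h: "form_iso h g" "E = h ` E0" using X_form_iso[OF assms] .
  have "is_reflector E (h o\<^sub>L \<Phi> o\<^sub>L g)" using is_reflector_image[OF is_reflector_E0 h(1)] h(2) by simp
  then show ?thesis using reflector_eq by metis
qed

lemma reflector_props:
  assumes "E \<in> X"
  shows "reflector E (reflector E x) = x" "reflector E x \<bullet> \<Phi> y = x \<bullet> \<Phi> (reflector E y)" "x \<in> E \<longleftrightarrow> reflector E x = x"
  using X_is_reflector[OF assms] unfolding is_reflector_def by blast+

lemma orth_proj_props:
  assumes E: "E \<in> X"
  shows "orth_proj E x \<in> E" "z \<in> E \<Longrightarrow> z \<bullet> (x - orth_proj E x) = 0"
proof -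
  have s: "subspace E" "dim E = p" using E by (auto simp: X_space_def)
  obtain B where B: "B \<subseteq> E" "independent B" "E \<subseteq> span B" "card B = dim E" using basis_exists by blast
  have finB: "finite B" using B(4) s(2) p0 card_ge_0_finite[of B] by simp
  obtain f where f: "onf p f" "span (f ` {..<p}) = E" using ex_onf[OF finB B(3) s(1)] s(2) by metis
  define P where "P = (\<Sum>i<p. dyad (f i) (f i))"
  have P: "P x = (\<Sum>i<p. (f i \<bullet> x) *\<^sub>R f i)" for x by (simp add: P_def blinfun.sum_left)
  have PE: "P x \<in> E" for x unfolding P f(2)[symmetric] by (rule sum_in_span)
  have Po: "z \<bullet> (x - P x) = 0" if "z \<in> E" for x z
  proof -
    have fi: "f i \<bullet> (x - P x) = 0" if "i < p" for i
      unfolding P inner_diff_right onf_inner_sum[OF f(1) that] by simp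
    have zs: "z \<in> span (f ` {..<p})" using that f(2) by simp
    have "orthogonal (x - P x) z"
    proof (rule orthogonal_to_span[OF zs])
      fix y assume "y \<in> f ` {..<p}"
      then obtain i where "i < p" "y = f i" by auto
      then have "y \<bullet> (x - P x) = 0" using fi by simp
      then show "orthogonal (x - P x) y" unfolding orthogonal_def by (subst inner_commute)
    qed
    then show ?thesis unfolding orthogonal_def by (subst inner_commute)
  qed
  have "(THE y. y \<in> E \<and> (\<forall>z\<in>E. orthogonal (x - y) z)) = P x" for x
  proof (rule the_equality)
    show "P x \<in> E \<and> (\<forall>z\<in>E. orthogonal (x - P x) z)"
      unfolding orthogonal_def using PE Po[of _ x] by (simp add: inner_commute[of "x - P x"])
  next
    fix y assume y: "y \<in> E \<and> (\<forall>z\<in>E. orthogonal (x - y) z)"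
    then have d: "P x - y \<in> E" using PE s(1) by (simp add: subspace_diff)
    have "(x - y) \<bullet> (P x - y) = 0" using y d by (simp add: orthogonal_def)
    then have "(P x - y) \<bullet> (x - y) = 0" by (subst inner_commute)
    moreover have "(P x - y) \<bullet> (x - P x) = 0" by (rule Po[OF d])
    ultimately have "(P x - y) \<bullet> (P x - y) = 0" by (simp add: inner_diff_right)
    then show "y = P x" by simp
  qed
  then have "orth_proj E = P" unfolding orth_proj_def by (simp add: blinfun_apply_inverse)
  then show "orth_proj E x \<in> E" "z \<in> E \<Longrightarrow> z \<bullet> (x - orth_proj E x) = 0" using PE Po by simp_all
qed

lemma DD_apply: "DD M x = M x + \<Phi> (M (\<Phi> x)) - x"
  by (simp add: DD_def D0_def blinfun.add_left blinfun.diff_left)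

text \<open>Equal ranges give \<open>P Q = Q\<close> and \<open>Q P = P\<close>. As
  \<open>\<Phi> Q \<Phi>\<close> is the adjoint of \<open>Q\<close> for the inner product,
  \<open>P \<Phi> Q \<Phi> = P\<close>, hence \<open>P (Q + \<Phi> Q \<Phi> - 1) = Q\<close>. The
  roles can be exchanged because \<open>\<Phi> P \<Phi>\<close> is the adjoint of \<open>P\<close>
  for the form.\<close>

lemma dual_PQ:
  assumes E: "E \<in> X"
  shows "dual (orth_proj E) (oblique_proj E)" "dual (oblique_proj E) (orth_proj E)"
proof -
  let ?P = "blinfun_apply (orth_proj E)" and ?Q = "blinfun_apply (oblique_proj E)"
  note J = reflector_props[OF E] and P = orth_proj_props[OF E]
  have sub: "subspace E" using E by (simp add: X_space_def)
  have QE: "?Q x \<in> E" for x unfolding J(3) oblique_proj_apply by (simp add: blinfun.scaleR_right blinfun.add_right J(1) add.commute)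
  have Qid: "?Q x = x" if "x \<in> E" for x
  proof -
    have "reflector E x = x" using that J(3) by blast
    then show ?thesis by (simp add: oblique_proj_apply flip: scaleR_2)
  qed
  have Pid: "?P x = x" if "x \<in> E" for x
  proof -
    have "x - ?P x \<in> E" using that P(1) sub by (simp add: subspace_diff)
    then have "(x - ?P x) \<bullet> (x - ?P x) = 0" by (rule P(2))
    then show ?thesis by simp
  qed
  have Psym: "?P x \<bullet> y = x \<bullet> ?P y" for x y
  proof -
    have "?P x \<bullet> (y - ?P y) = 0" "?P y \<bullet> (x - ?P x) = 0" using P by blast+
    then show ?thesis by (simp add: inner_diff_right inner_commute)
  qed
  have Qsym: "?Q x \<bullet> \<Phi> y = x \<bullet> \<Phi> (?Q y)" for x y
    by (simp add: oblique_proj_apply blinfun.scaleR_right blinfun.add_right inner_add_left inner_add_right J(2))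
  have PQ: "?P (?Q x) = ?Q x" and QP: "?Q (?P x) = ?P x" for x using Pid[OF QE] Qid[OF P(1)] .
  have 1: "?P (\<Phi> (?Q (\<Phi> x))) = ?P x" for x
  proof (rule vector_eq_rdot[THEN iffD1], rule allI)
    fix y
    have "?P (\<Phi> (?Q (\<Phi> x))) \<bullet> y = ?Q (\<Phi> x) \<bullet> \<Phi> (?P y)" by (simp add: Psym Phi_sym)
    also have "\<dots> = \<Phi> x \<bullet> \<Phi> (?P y)" by (simp add: Qsym QP)
    also have "\<dots> = ?P x \<bullet> y" by (simp add: Phi_sym Psym)
    finally show "?P (\<Phi> (?Q (\<Phi> x))) \<bullet> y = ?P x \<bullet> y" .
  qed
  have 2: "?Q (\<Phi> (?P (\<Phi> x))) = ?Q x" for x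
  proof (rule Phi_inner_eqI)
    fix y
    have "?Q (\<Phi> (?P (\<Phi> x))) \<bullet> \<Phi> y = \<Phi> (?P (\<Phi> x)) \<bullet> \<Phi> (?Q y)" by (rule Qsym)
    also have "\<dots> = \<Phi> x \<bullet> ?Q y" by (simp add: Phi_sym Psym PQ)
    also have "\<dots> = ?Q x \<bullet> \<Phi> y" by (simp add: Phi_sym Qsym)
    finally show "?Q (\<Phi> (?P (\<Phi> x))) \<bullet> \<Phi> y = ?Q x \<bullet> \<Phi> y" .
  qed
  have 3: "?P (DD (oblique_proj E) x) = ?Q x" for x
    unfolding DD_apply by (simp add: blinfun.add_right blinfun.diff_right PQ 1)
  have 4: "?Q (DD (orth_proj E) x) = ?P x" for x
    unfolding DD_apply by (simp add: blinfun.add_right blinfun.diff_right QP 2)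
  have commuting: "DD M (\<Phi> x) = \<Phi> (DD M x)" for M x
    by (simp add: DD_apply blinfun.add_right blinfun.diff_right)
  have 5: "DD (oblique_proj E) (DD (orth_proj E) x) = x" for x
    unfolding DD_apply[of "oblique_proj E"] commuting[symmetric] 4 by (simp add: DD_apply)
  have 6: "DD (orth_proj E) (DD (oblique_proj E) x) = x" for x
    unfolding DD_apply[of "orth_proj E"] commuting[symmetric] 3 by (simp add: DD_apply)
  have 7: "oblique_proj E = orth_proj E o\<^sub>L DD (oblique_proj E)" "orth_proj E = oblique_proj E o\<^sub>L DD (orth_proj E)"
    by (rule blinfun_eqI, simp add: 3 4)+
  show "dual (orth_proj E) (oblique_proj E)" "dual (oblique_proj E) (orth_proj E)"
    unfolding dual_def using 5 6 7 by blast+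
qed

lemma oblique_proj_image: "form_iso h g \<Longrightarrow> E \<in> X \<Longrightarrow> oblique_proj (h ` E) = h o\<^sub>L oblique_proj E o\<^sub>L g"
  by (rule blinfun_eqI) (simp add: oblique_proj_apply reflector_image blinfun.scaleR_right blinfun.add_right form_isoD)

section \<open>Geodesics and tangent vectors\<close>

lemma ex_X: "form_iso h g \<Longrightarrow> A \<in> pp \<Longrightarrow> h ` ex t A ` E0 \<in> X"
  by (intro image_X[of h g] image_X[OF form_iso_ex] E0_X)

text \<open>The parameter doubles because \<open>\<Phi>\<close> inverts the one-parameter group:
  conjugating \<open>\<Phi>\<close> by \<open>ex t A\<close> multiplies it by
  \<open>ex (2 * t) A\<close>.\<close>

lemma reflector_line:
  assumes h: "form_iso h g" and A: "A \<in> pp"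
  shows "reflector (h ` ex t A ` E0) = h o\<^sub>L (ex (2 * t) A o\<^sub>L \<Phi>) o\<^sub>L g"
proof (rule blinfun_eqI)
  fix x
  have "reflector (h ` ex t A ` E0) x = h (ex t A (\<Phi> (ex (- t) A (g x))))"
    using reflector_image[OF h image_X[OF form_iso_ex[OF A] E0_X]] reflector_image[OF form_iso_ex[OF A] E0_X] reflector_E0 by simp
  also have "\<dots> = h (ex (2 * t) A (\<Phi> (g x)))"
    using ex_add[OF A, of t t] by (simp add: ex_Phi[OF A])
  finally show "reflector (h ` ex t A ` E0) x = (h o\<^sub>L (ex (2 * t) A o\<^sub>L \<Phi>) o\<^sub>L g) x" by simp
qed

lemma ex2_deriv:
  assumes A: "A \<in> pp"
  shows "((\<lambda>s. ex (2 * s) A) has_vector_derivative 2 *\<^sub>R (A o\<^sub>L ex (2 * t) A)) (at t)"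
proof -
  have "((\<lambda>s. 2 * s) has_vector_derivative 2) (at t)" by (auto intro!: derivative_eq_intros)
  then have "((\<lambda>s. ex s A) \<circ> (\<lambda>s. 2 * s) has_vector_derivative 2 *\<^sub>R (A o\<^sub>L ex (2 * t) A)) (at t)"
    by (rule vector_diff_chain_at) (rule ex_deriv[OF A])
  then show ?thesis by (simp add: comp_def)
qed

lemma oblique_proj_line_vd:
  assumes h: "form_iso h g" and A: "A \<in> pp"
  shows "((\<lambda>s. oblique_proj (h ` ex s A ` E0)) has_vector_derivative (h o\<^sub>L (A o\<^sub>L ex (2 * t) A o\<^sub>L \<Phi>) o\<^sub>L g)) (at t)"
proof -
  have "((\<lambda>s. h o\<^sub>L (ex (2 * s) A o\<^sub>L \<Phi>) o\<^sub>L g) has_vector_derivative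
      (h o\<^sub>L (2 *\<^sub>R (A o\<^sub>L ex (2 * t) A) o\<^sub>L \<Phi>) o\<^sub>L g)) (at t)"
    by (rule vd_compose_const[OF vd_compose_right[OF ex2_deriv[OF A]]])
  then have "((\<lambda>s. (1/2) *\<^sub>R (id_blinfun + (h o\<^sub>L (ex (2 * s) A o\<^sub>L \<Phi>) o\<^sub>L g))) has_vector_derivative
      (1/2) *\<^sub>R (0 + (h o\<^sub>L (2 *\<^sub>R (A o\<^sub>L ex (2 * t) A) o\<^sub>L \<Phi>) o\<^sub>L g))) (at t)"
    by (intro bounded_linear.has_vector_derivative[OF bounded_linear_scaleR_right]
        has_vector_derivative_add has_vector_derivative_const)
  moreover have "(1/2) *\<^sub>R (0 + (h o\<^sub>L (2 *\<^sub>R (A o\<^sub>L ex (2 * t) A) o\<^sub>L \<Phi>) o\<^sub>L g)) = h o\<^sub>L (A o\<^sub>L ex (2 * t) A o\<^sub>L \<Phi>) o\<^sub>L g"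
    by (rule blinfun_eqI) (simp add: blinfun.scaleR_left blinfun.scaleR_right)
  ultimately show ?thesis unfolding oblique_proj_def reflector_line[OF h A] by simp
qed

lemma stabilizer_Phi:
  assumes k: "form_iso k l" and E: "k ` E0 = E0"
  shows "k (\<Phi> x) = \<Phi> (k x)"
proof -
  have "is_reflector E0 (k o\<^sub>L \<Phi> o\<^sub>L l)" using is_reflector_image[OF is_reflector_E0 k] E by simp
  then have "k o\<^sub>L \<Phi> o\<^sub>L l = \<Phi>" using is_reflector_unique is_reflector_E0 by blast
  then have "(k o\<^sub>L \<Phi> o\<^sub>L l) (k x) = \<Phi> (k x)" by simp
  then show ?thesis by (simp add: form_isoD[OF k])
qed

lemma commute_Phi_isometry:
  assumes k: "form_iso k l" and c: "\<And>x. k (\<Phi> x) = \<Phi> (k x)"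
  shows "k x \<bullet> k y = x \<bullet> y" "norm (k x) = norm x" "l (\<Phi> x) = \<Phi> (l x)" "x \<in> E0 \<Longrightarrow> k x \<in> E0" "k ` E0 = E0"
proof -
  show 1: "k x \<bullet> k y = x \<bullet> y" for x y
    using form_isoD(3)[OF k, of x "\<Phi> y"] c[of y] by (metis Phi_Phi)
  show "norm (k x) = norm x" by (simp add: norm_eq_sqrt_inner 1)
  have lc: "l (\<Phi> x) = \<Phi> (l x)" for x
  proof -
    have "k (l (\<Phi> x)) = k (\<Phi> (l x))" by (simp add: form_isoD[OF k] c)
    then have "l (k (l (\<Phi> x))) = l (k (\<Phi> (l x)))" by (rule arg_cong)
    then show ?thesis by (simp only: form_isoD[OF k])
  qed
  show "l (\<Phi> x) = \<Phi> (l x)" by (rule lc)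
  show kE: "x \<in> E0 \<Longrightarrow> k x \<in> E0" for x by (simp add: E_iff flip: c)
  show "k ` E0 = E0"
  proof (intro equalityI subsetI)
    fix y assume "y \<in> E0"
    then have "l y \<in> E0" by (simp add: E_iff flip: lc)
    then have "k (l y) \<in> k ` E0" by (rule imageI)
    then show "y \<in> k ` E0" by (simp add: form_isoD[OF k])
  qed (use kE in auto)
qed

lemma onE_image:
  assumes k: "form_iso k l" and c: "\<And>x. k (\<Phi> x) = \<Phi> (k x)" and e: "onE e"
  shows "onE (\<lambda>i. k (e i))"
  using e commute_Phi_isometry[OF k c] unfolding onE_def onf_def by simp

lemma N_conj:
  fixes B :: "'a \<Rightarrow>\<^sub>L 'a"
  assumes k: "form_iso k l" and c: "\<And>x. k (\<Phi> x) = \<Phi> (k x)" and A: "A \<in> pp" and eq: "\<And>x. B x = k (A (l x))"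
  shows "N B = N A"
proof -
  have lc: "l (\<Phi> x) = \<Phi> (l x)" for x by (rule commute_Phi_isometry(3)[OF k c])
  have "onE (\<lambda>i. l (basis_E0 i))" by (rule onE_image[OF form_iso_inv[OF k] lc onE_basis_E0])
  then have "N A = sqrt (2 * (\<Sum>i<p. (norm (A (l (basis_E0 i))))\<^sup>2))" by (rule N_onE[OF A])
  then show ?thesis unfolding N_def eq by (simp add: commute_Phi_isometry(2)[OF k c])
qed

text \<open>Two group elements with the same image of \<open>E0\<close> differ by one that commutes
  with \<open>\<Phi>\<close> and is therefore orthogonal; conjugation by it does not change
  \<open>N\<close>. This makes the Riemannian norm well defined.\<close>

lemma N_eq_of_tangent_eq:
  assumes h: "form_iso h g" and h': "form_iso h' g'" and E: "h ` E0 = h' ` E0" and A: "A \<in> pp"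
    and eq: "h o\<^sub>L (A o\<^sub>L \<Phi>) o\<^sub>L g = h' o\<^sub>L (A' o\<^sub>L \<Phi>) o\<^sub>L g'"
  shows "N A' = N A"
proof -
  have k: "form_iso (g' o\<^sub>L h) (g o\<^sub>L h')" by (rule form_iso_comp[OF form_iso_inv[OF h'] h])
  have "(g' o\<^sub>L h) ` E0 = g' ` h' ` E0" unfolding E[symmetric] by (simp add: image_image)
  also have "\<dots> = E0" by (simp add: image_image form_isoD[OF h'])
  finally have kE: "(g' o\<^sub>L h) ` E0 = E0" .
  note kc = stabilizer_Phi[OF k kE]
  have lc: "(g o\<^sub>L h') (\<Phi> x) = \<Phi> ((g o\<^sub>L h') x)" for x by (rule commute_Phi_isometry(3)[OF k kc])
  show ?thesis
  proof (rule N_conj[OF k kc A])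
    fix x
    have "h' (A' x) = (h' o\<^sub>L (A' o\<^sub>L \<Phi>) o\<^sub>L g') (h' (\<Phi> x))" by (simp add: form_isoD[OF h'])
    also have "\<dots> = h (A (\<Phi> (g (h' (\<Phi> x)))))" unfolding eq[symmetric] by simp
    also have "\<Phi> (g (h' (\<Phi> x))) = g (h' x)" using lc[of "\<Phi> x"] by simp
    finally have "g' (h' (A' x)) = g' (h (A (g (h' x))))" by simp
    then show "A' x = (g' o\<^sub>L h) (A ((g o\<^sub>L h') x))" by (simp add: form_isoD[OF h'])
  qed
qed

text \<open>Resolves the definite description in \<open>riem_norm\<close>. By \<open>dual_vd\<close>
  the derivatives of the two kinds of projections determine each other, so the oblique one can be
  used to exhibit a witness and to compare any two.\<close>

lemma riem_norm_eq:
  assumes T: "open T" "t \<in> T" and \<gamma>: "\<And>s. s \<in> T \<Longrightarrow> \<gamma> s \<in> X"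
    and h: "form_iso h g" and A: "A \<in> pp" and E: "\<gamma> t = h ` E0"
    and q: "((\<lambda>s. oblique_proj (\<gamma> s)) has_vector_derivative (h o\<^sub>L (A o\<^sub>L \<Phi>) o\<^sub>L g)) (at t)"
    and v: "((\<lambda>s. orth_proj (\<gamma> s)) has_vector_derivative v) (at t)"
  shows "riem_norm E0 \<Phi> (\<gamma> t) v = N A"
proof -
  define P where "P = orth_proj (\<gamma> t)"
  define Q where "Q = oblique_proj (\<gamma> t)"
  have line: "((\<lambda>s. oblique_proj (k ` ex s B ` E0)) has_vector_derivative (k o\<^sub>L (B o\<^sub>L \<Phi>) o\<^sub>L l)) (at 0)"
    if "form_iso k l" "B \<in> pp" for k l B
  proof -
    have "B o\<^sub>L ex (2 * 0) B = B" by (rule blinfun_eqI) (simp add: ex_0[OF that(2)])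
    then show ?thesis using oblique_proj_line_vd[OF that, of 0] by simp
  qed
  have v_eq: "v = dtr Q P (h o\<^sub>L (A o\<^sub>L \<Phi>) o\<^sub>L g)"
    using dual_vd[where H="\<lambda>s. oblique_proj (\<gamma> s)" and K="\<lambda>s. orth_proj (\<gamma> s)", OF T dual_PQ(2)[OF \<gamma>] q]
      vector_derivative_unique_at[OF v] unfolding P_def Q_def by blast
  have start: "k ` ex 0 B ` E0 = k ` E0" if "B \<in> pp" for k B
    using ex_0[OF that] by simp
  \<comment> \<open>The geodesic in direction \<open>A\<close> has the same starting point and the
    same oblique derivative as the curve, hence also the same orthogonal derivative.\<close>
  have wit: "((\<lambda>s. orth_proj (h ` ex s A ` E0)) has_vector_derivative v) (at 0)"
    using dual_vd[where H="\<lambda>s. oblique_proj (h ` ex s A ` E0)" and K="\<lambda>s. orth_proj (h ` ex s A ` E0)",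
        OF open_UNIV UNIV_I dual_PQ(2)[OF ex_X[OF h A]] line[OF h A]]
    unfolding start[OF A] E[symmetric] v_eq P_def Q_def .
  have uniq: "N A' = N A"
    if h': "form_iso h' g'" and A': "A' \<in> pp" and E': "h' ` E0 = \<gamma> t"
      and v': "((\<lambda>s. orth_proj (h' ` ex s A' ` E0)) has_vector_derivative v) (at 0)" for h' g' A'
  proof -
    have dq: "k o\<^sub>L (B o\<^sub>L \<Phi>) o\<^sub>L l = dtr P Q v"
      if k: "form_iso k l" and B: "B \<in> pp" and EE: "k ` E0 = \<gamma> t"
        and vv: "((\<lambda>s. orth_proj (k ` ex s B ` E0)) has_vector_derivative v) (at 0)" for k l B
    proof -
      have "((\<lambda>s. oblique_proj (k ` ex s B ` E0)) has_vector_derivative dtr P Q v) (at 0)"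
        using dual_vd[where H="\<lambda>s. orth_proj (k ` ex s B ` E0)" and K="\<lambda>s. oblique_proj (k ` ex s B ` E0)",
          OF open_UNIV UNIV_I dual_PQ(1)[OF ex_X[OF k B]] vv]
        unfolding start[OF B] EE P_def Q_def .
      then show ?thesis using vector_derivative_unique_at[OF line[OF k B]] by blast
    qed
    have "h o\<^sub>L (A o\<^sub>L \<Phi>) o\<^sub>L g = h' o\<^sub>L (A' o\<^sub>L \<Phi>) o\<^sub>L g'"
      using dq[OF h A E[symmetric] wit] dq[OF h' A' E' v'] by simp
    then show ?thesis using N_eq_of_tangent_eq[OF h h' _ A] E E' by simp
  qed
  show ?thesis unfolding riem_norm_def p_space_eq
  proof (rule the_equality)
    show "\<exists>h\<in>carrier (O_group \<Phi>). \<exists>A'\<in>pp. blinfun_apply h ` E0 = \<gamma> t \<and>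
        ((\<lambda>t. orth_proj (blinfun_apply h ` blinfun_apply (op_exp (t *\<^sub>R A')) ` E0)) has_vector_derivative v) (at 0) \<and>
        N A = hs_norm A'"
      using h A E wit hs_norm_eq[OF A] unfolding ex_def O_group_iff by (intro bexI[of _ h] bexI[of _ A]) (auto simp: O_group_iff)
  next
    fix r assume "\<exists>h\<in>carrier (O_group \<Phi>). \<exists>A'\<in>pp. blinfun_apply h ` E0 = \<gamma> t \<and>
        ((\<lambda>t. orth_proj (blinfun_apply h ` blinfun_apply (op_exp (t *\<^sub>R A')) ` E0)) has_vector_derivative v) (at 0) \<and>
        r = hs_norm A'"
    then obtain h' A' where h': "h' \<in> carrier (O_group \<Phi>)" and A': "A' \<in> pp" "h' ` E0 = \<gamma> t"
      "((\<lambda>s. orth_proj (h' ` ex s A' ` E0)) has_vector_derivative v) (at 0)" "r = hs_norm A'"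
      unfolding ex_def by blast
    from h' obtain g' where "form_iso h' g'" unfolding O_group_iff by blast
    from uniq[OF this A'(1-3)] show "r = N A" using A'(4) hs_norm_eq[OF A'(1)] by simp
  qed
qed

text \<open>Differentiating \<open>J J = 1\<close> for the reflectors \<open>J\<close> along the
  curve shows that the derivative anticommutes with the reflector, and symmetry for the form is
  inherited by the derivative. Transported to \<open>E0\<close> these are the two conditions
  defining \<open>pp\<close>.\<close>

lemma tangent_form:
  assumes T: "open T" "t \<in> T" and \<gamma>: "\<And>s. s \<in> T \<Longrightarrow> \<gamma> s \<in> X"
    and h: "form_iso h g" and E: "\<gamma> t = h ` E0"
    and q: "((\<lambda>s. oblique_proj (\<gamma> s)) has_vector_derivative q) (at t)"
  shows "g o\<^sub>L (q o\<^sub>L (h o\<^sub>L \<Phi>)) \<in> pp" "q = h o\<^sub>L ((g o\<^sub>L (q o\<^sub>L (h o\<^sub>L \<Phi>))) o\<^sub>L \<Phi>) o\<^sub>L g"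
proof -
  have JQ: "reflector F = 2 *\<^sub>R oblique_proj F - id_blinfun" for F by (rule blinfun_eqI) (simp add: oblique_proj_apply blinfun.diff_left blinfun.scaleR_left)
  have J: "((\<lambda>s. reflector (\<gamma> s)) has_vector_derivative (2 *\<^sub>R q)) (at t)"
    unfolding JQ using has_vector_derivative_diff[OF bounded_linear.has_vector_derivative[OF bounded_linear_scaleR_right q] has_vector_derivative_const]
    by simp
  have sq: "((\<lambda>s. reflector (\<gamma> s) o\<^sub>L reflector (\<gamma> s)) has_vector_derivative ((reflector (\<gamma> t) o\<^sub>L 2 *\<^sub>R q) + (2 *\<^sub>R q o\<^sub>L reflector (\<gamma> t)))) (at t)"
    by (rule vd_compose_blinfun[OF J J])
  have "((\<lambda>s. id_blinfun) has_vector_derivative ((reflector (\<gamma> t) o\<^sub>L 2 *\<^sub>R q) + (2 *\<^sub>R q o\<^sub>L reflector (\<gamma> t)))) (at t)"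
    by (rule has_vector_derivative_transform_within_open[OF sq T])
      (rule blinfun_eqI, simp add: reflector_props(1)[OF \<gamma>])
  then have z: "(reflector (\<gamma> t) o\<^sub>L 2 *\<^sub>R q) + (2 *\<^sub>R q o\<^sub>L reflector (\<gamma> t)) = 0"
    by (rule vector_derivative_unique_at) simp
  have anti: "q (reflector (\<gamma> t) x) = - reflector (\<gamma> t) (q x)" for x
  proof -
    have "((reflector (\<gamma> t) o\<^sub>L 2 *\<^sub>R q) + (2 *\<^sub>R q o\<^sub>L reflector (\<gamma> t))) x = 0" using z by simp
    then have "2 *\<^sub>R (q (reflector (\<gamma> t) x) + reflector (\<gamma> t) (q x)) = 0"
      by (simp add: blinfun.add_left blinfun.scaleR_left blinfun.scaleR_right add.commute flip: scaleR_add_right)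
    then show ?thesis by (simp add: eq_neg_iff_add_eq_0)
  qed
  have sym: "q x \<bullet> \<Phi> y = x \<bullet> \<Phi> (q y)" for x y
  proof -
    have "bounded_linear (\<lambda>M. blinfun_apply M x \<bullet> \<Phi> y - x \<bullet> \<Phi> (blinfun_apply M y))"
      by (intro bounded_linear_sub bounded_linear_intros bounded_linear_compose[OF bounded_linear_inner_left]
          bounded_linear_compose[OF bounded_linear_inner_right])
    from bounded_linear.has_vector_derivative[OF this q]
    have d: "((\<lambda>s. oblique_proj (\<gamma> s) x \<bullet> \<Phi> y - x \<bullet> \<Phi> (oblique_proj (\<gamma> s) y)) has_vector_derivative (q x \<bullet> \<Phi> y - x \<bullet> \<Phi> (q y))) (at t)" .
    have "((\<lambda>s. 0) has_vector_derivative (q x \<bullet> \<Phi> y - x \<bullet> \<Phi> (q y))) (at t)"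
      by (rule has_vector_derivative_transform_within_open[OF d T])
        (simp add: oblique_proj_apply blinfun.scaleR_right blinfun.add_right inner_add_left inner_add_right reflector_props(2)[OF \<gamma>])
    then have "q x \<bullet> \<Phi> y - x \<bullet> \<Phi> (q y) = 0" by (rule vector_derivative_unique_at) simp
    then show ?thesis by simp
  qed
  have JE: "reflector (\<gamma> t) = h o\<^sub>L \<Phi> o\<^sub>L g" unfolding E using reflector_image[OF h E0_X] reflector_E0 by simp
  let ?A = "g o\<^sub>L (q o\<^sub>L (h o\<^sub>L \<Phi>))"
  show "?A \<in> pp" unfolding pp_def
  proof (intro CollectI conjI allI)
    fix x y
    have "?A x \<bullet> y = g (q (h (\<Phi> x))) \<bullet> \<Phi> (\<Phi> y)" by simp
    also have "\<dots> = \<Phi> x \<bullet> \<Phi> (g (q (h (\<Phi> y))))" by (simp only: form_iso_adj(1)[OF form_iso_inv[OF h]] sym form_iso_adj(1)[OF h])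
    also have "\<dots> = x \<bullet> ?A y" by (simp add: Phi_sym)
    finally show "?A x \<bullet> y = x \<bullet> ?A y" .
  next
    fix x
    have "?A (\<Phi> x) = g (q (h x))" by simp
    also have "h x = reflector (\<gamma> t) (h (\<Phi> x))" unfolding JE by (simp add: form_isoD[OF h])
    also have "g (q (reflector (\<gamma> t) (h (\<Phi> x)))) = - \<Phi> (?A x)"
      unfolding anti unfolding JE by (simp add: form_isoD[OF h] blinfun.minus_right)
    finally show "?A (\<Phi> x) = - \<Phi> (?A x)" .
  qed
  show "q = h o\<^sub>L (?A o\<^sub>L \<Phi>) o\<^sub>L g" by (rule blinfun_eqI) (simp add: form_isoD[OF h])
qed

text \<open>The description of curves by the oblique projections instead of the orthogonal ones: it is
  equivariant and linear, because the projection attached to the image of a subspace under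
  a group element is a conjugate.\<close>

definition qcurve :: "(real \<Rightarrow> 'a set) \<Rightarrow> real set \<Rightarrow> (real \<Rightarrow> 'a \<Rightarrow>\<^sub>L 'a) \<Rightarrow> (real \<Rightarrow> 'a \<Rightarrow>\<^sub>L 'a)
    \<Rightarrow> (real \<Rightarrow> 'a \<Rightarrow>\<^sub>L 'a) \<Rightarrow> (real \<Rightarrow> 'a \<Rightarrow>\<^sub>L 'a) \<Rightarrow> bool" where
  "qcurve \<gamma> S q h g A \<longleftrightarrow> (\<forall>t\<in>{0..1}. \<gamma> t \<in> X) \<and> finite S \<and> continuous_on {0..1} (\<lambda>t. oblique_proj (\<gamma> t)) \<and>
     continuous_on ({0<..<1} - S) q \<and>
     (\<forall>t\<in>{0<..<1} - S. ((\<lambda>s. oblique_proj (\<gamma> s)) has_vector_derivative q t) (at t) \<and> form_iso (h t) (g t) \<and> \<gamma> t = h t ` E0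
        \<and> A t \<in> pp \<and> q t = h t o\<^sub>L (A t o\<^sub>L \<Phi>) o\<^sub>L g t)"

lemma open_T: "finite S \<Longrightarrow> open ({0<..<1::real} - S)"
  by (intro open_Diff finite_imp_closed) auto

lemma dual_continuous:
  assumes "\<And>s. s \<in> T \<Longrightarrow> dual (H s) (K s)" "continuous_on T H" shows "continuous_on (T :: real set) K"
  unfolding continuous_on_def using dual_tendsto(2)[of _ T H K] assms unfolding continuous_on_def by blast

lemma curve_imp_qcurve:
  assumes c: "curve_of_length p E0 \<Phi> \<gamma> L"
  shows "\<exists>S q h g A. qcurve \<gamma> S q h g A \<and> ((\<lambda>t. N (A t)) has_integral L) {0..1}"
proof -
  have X: "\<And>t. t \<in> {0..1} \<Longrightarrow> \<gamma> t \<in> X"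
    and pc: "(\<lambda>t. orth_proj (\<gamma> t)) piecewise_C1_differentiable_on {0..1}"
    and int: "((\<lambda>t. riem_norm E0 \<Phi> (\<gamma> t) (vector_derivative (\<lambda>s. orth_proj (\<gamma> s)) (at t))) has_integral L) {0..1}"
    using c unfolding curve_of_length_def by blast+
  obtain S D where S: "finite S" and cP: "continuous_on {0..1} (\<lambda>t. orth_proj (\<gamma> t))"
    and D: "\<And>t. t \<in> {0..1} - S \<Longrightarrow> ((\<lambda>t. orth_proj (\<gamma> t)) has_vector_derivative D t) (at t)"
    and cD: "continuous_on ({0..1} - S) D"
    using pc unfolding piecewise_C1_differentiable_on_def C1_differentiable_on_def by blast
  \<comment> \<open>Break points and endpoints are removed together: what remains is open, as the
    rules for two-sided derivatives require, and the finitely many points do not affect the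
    integral.\<close>
  let ?T = "{0<..<1::real} - S"
  note T = open_T[OF S]
  have XT: "\<gamma> t \<in> X" if "t \<in> ?T" for t using X that by simp
  have DT: "((\<lambda>t. orth_proj (\<gamma> t)) has_vector_derivative D t) (at t)" if "t \<in> ?T" for t using D that by simp
  have cDT: "continuous_on ?T D" by (rule continuous_on_subset[OF cD]) auto
  define q where "q t = dtr (orth_proj (\<gamma> t)) (oblique_proj (\<gamma> t)) (D t)" for t
  have q: "((\<lambda>s. oblique_proj (\<gamma> s)) has_vector_derivative q t) (at t)" if "t \<in> ?T" for t
    unfolding q_def by (rule dual_vd[where H="\<lambda>s. orth_proj (\<gamma> s)", OF T that dual_PQ(1)[OF XT] DT[OF that]])
  have cq: "continuous_on ?T q"
    unfolding q_def by (rule dual_C1[OF T dual_PQ(1)[OF XT] DT cDT])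
  have cQ: "continuous_on {0..1} (\<lambda>t. oblique_proj (\<gamma> t))" by (rule dual_continuous[OF dual_PQ(1)[OF X] cP])
  have "\<forall>t. \<exists>hg. t \<in> ?T \<longrightarrow> form_iso (fst hg) (snd hg) \<and> \<gamma> t = fst hg ` E0"
    using X_form_iso[OF XT] by (metis fst_conv snd_conv)
  then obtain hg where hg: "\<And>t. t \<in> ?T \<Longrightarrow> form_iso (fst (hg t)) (snd (hg t)) \<and> \<gamma> t = fst (hg t) ` E0" by metis
  define h where "h t = fst (hg t)" for t
  define g where "g t = snd (hg t)" for t
  have h: "form_iso (h t) (g t)" "\<gamma> t = h t ` E0" if "t \<in> ?T" for t using hg[OF that] by (simp_all add: h_def g_def)
  define A where "A t = g t o\<^sub>L (q t o\<^sub>L (h t o\<^sub>L \<Phi>))" for t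
  have A: "A t \<in> pp" "q t = h t o\<^sub>L (A t o\<^sub>L \<Phi>) o\<^sub>L g t" if "t \<in> ?T" for t
    unfolding A_def using tangent_form[OF T that XT h[OF that] q[OF that]] by blast+
  have qc: "qcurve \<gamma> S q h g A"
    unfolding qcurve_def using X S cQ cq q h A by blast
  have "((\<lambda>t. N (A t)) has_integral L) {0..1}"
  proof (rule has_integral_spike_finite[OF _ _ int])
    show "finite (S \<union> {0, 1})" using S by simp
    fix t assume "t \<in> {0..1} - (S \<union> {0, 1})"
    then have t: "t \<in> ?T" by auto
    have "((\<lambda>s. oblique_proj (\<gamma> s)) has_vector_derivative (h t o\<^sub>L (A t o\<^sub>L \<Phi>) o\<^sub>L g t)) (at t)"
      using q[OF t] A(2)[OF t] by (simp only:)
    from riem_norm_eq[OF T t XT h(1)[OF t] A(1)[OF t] h(2)[OF t] this DT[OF t]]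
    show "N (A t) = riem_norm E0 \<Phi> (\<gamma> t) (vector_derivative (\<lambda>s. orth_proj (\<gamma> s)) (at t))"
      using vector_derivative_at[OF DT[OF t]] by simp
  qed
  then show ?thesis using qc by blast
qed

lemma qcurve_imp_curve:
  assumes c: "qcurve \<gamma> S q h g A" and int: "((\<lambda>t. N (A t)) has_integral L) {0..1}"
  shows "curve_of_length p E0 \<Phi> \<gamma> L"
proof -
  let ?T = "{0<..<1::real} - S"
  have X: "\<And>t. t \<in> {0..1} \<Longrightarrow> \<gamma> t \<in> X" and S: "finite S" and cQ: "continuous_on {0..1} (\<lambda>t. oblique_proj (\<gamma> t))"
    and cq: "continuous_on ?T q"
    and q: "\<And>t. t \<in> ?T \<Longrightarrow> ((\<lambda>s. oblique_proj (\<gamma> s)) has_vector_derivative q t) (at t)"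
    and h: "\<And>t. t \<in> ?T \<Longrightarrow> form_iso (h t) (g t)" "\<And>t. t \<in> ?T \<Longrightarrow> \<gamma> t = h t ` E0"
    and A: "\<And>t. t \<in> ?T \<Longrightarrow> A t \<in> pp" "\<And>t. t \<in> ?T \<Longrightarrow> q t = h t o\<^sub>L (A t o\<^sub>L \<Phi>) o\<^sub>L g t"
    using c unfolding qcurve_def by blast+
  note T = open_T[OF S]
  have XT: "\<gamma> t \<in> X" if "t \<in> ?T" for t using X that by simp
  define D where "D t = dtr (oblique_proj (\<gamma> t)) (orth_proj (\<gamma> t)) (q t)" for t
  have D: "((\<lambda>s. orth_proj (\<gamma> s)) has_vector_derivative D t) (at t)" if "t \<in> ?T" for t
    unfolding D_def by (rule dual_vd[where H="\<lambda>s. oblique_proj (\<gamma> s)", OF T that dual_PQ(2)[OF XT] q[OF that]])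
  have cD: "continuous_on ?T D"
    unfolding D_def by (rule dual_C1[OF T dual_PQ(2)[OF XT] q cq])
  have cP: "continuous_on {0..1} (\<lambda>t. orth_proj (\<gamma> t))" by (rule dual_continuous[OF dual_PQ(2)[OF X] cQ])
  \<comment> \<open>The endpoints become break points, since the oblique derivatives are only
    available in the interior.\<close>
  have S': "{0..1} - (S \<union> {0, 1}) = ?T" by auto
  have pc: "(\<lambda>t. orth_proj (\<gamma> t)) piecewise_C1_differentiable_on {0..1}"
    unfolding piecewise_C1_differentiable_on_def C1_differentiable_on_def
  proof (intro conjI cP exI[of _ "S \<union> {0, 1}"] exI[of _ D])
    show "finite (S \<union> {0, 1})" using S by simp
    show "\<forall>x\<in>{0..1} - (S \<union> {0, 1}). ((\<lambda>t. orth_proj (\<gamma> t)) has_vector_derivative D x) (at x)" unfolding S' using D by blast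
    show "continuous_on ({0..1} - (S \<union> {0, 1})) D" unfolding S' by (rule cD)
  qed
  have "((\<lambda>t. riem_norm E0 \<Phi> (\<gamma> t) (vector_derivative (\<lambda>s. orth_proj (\<gamma> s)) (at t))) has_integral L) {0..1}"
  proof (rule has_integral_spike_finite[OF _ _ int])
    show "finite (S \<union> {0, 1})" using S by simp
    fix t assume "t \<in> {0..1} - (S \<union> {0, 1})"
    then have t: "t \<in> ?T" by auto
    have "((\<lambda>s. oblique_proj (\<gamma> s)) has_vector_derivative (h t o\<^sub>L (A t o\<^sub>L \<Phi>) o\<^sub>L g t)) (at t)"
      using q[OF t] A(2)[OF t] by (simp only:)
    from riem_norm_eq[OF T t XT h(1)[OF t] A(1)[OF t] h(2)[OF t] this D[OF t]]
    show "riem_norm E0 \<Phi> (\<gamma> t) (vector_derivative (\<lambda>s. orth_proj (\<gamma> s)) (at t)) = N (A t)"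
      using vector_derivative_at[OF D[OF t]] by simp
  qed
  then show ?thesis unfolding curve_of_length_def using X pc by blast
qed

section \<open>Transport of curves by the group and the length of geodesics\<close>

lemma qcurve_image:
  assumes k: "form_iso k l" and c: "qcurve \<gamma> S q h g A"
  shows "qcurve (\<lambda>t. k ` \<gamma> t) S (\<lambda>t. k o\<^sub>L q t o\<^sub>L l) (\<lambda>t. k o\<^sub>L h t) (\<lambda>t. g t o\<^sub>L l) A"
proof -
  let ?T = "{0<..<1::real} - S"
  have X: "\<And>t. t \<in> {0..1} \<Longrightarrow> \<gamma> t \<in> X" and S: "finite S" and cQ: "continuous_on {0..1} (\<lambda>t. oblique_proj (\<gamma> t))"
    and cq: "continuous_on ?T q"
    and q: "\<And>t. t \<in> ?T \<Longrightarrow> ((\<lambda>s. oblique_proj (\<gamma> s)) has_vector_derivative q t) (at t)"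
    and h: "\<And>t. t \<in> ?T \<Longrightarrow> form_iso (h t) (g t)" "\<And>t. t \<in> ?T \<Longrightarrow> \<gamma> t = h t ` E0"
    and A: "\<And>t. t \<in> ?T \<Longrightarrow> A t \<in> pp" "\<And>t. t \<in> ?T \<Longrightarrow> q t = h t o\<^sub>L (A t o\<^sub>L \<Phi>) o\<^sub>L g t"
    using c unfolding qcurve_def by blast+
  have cc: "continuous_on U (\<lambda>t. k o\<^sub>L f t o\<^sub>L l)" if "continuous_on U f" for f :: "real \<Rightarrow> 'a \<Rightarrow>\<^sub>L 'a" and U
    using that by (intro bounded_bilinear.continuous_on[OF bounded_bilinear_blinfun_compose] continuous_on_const)
  have 1: "continuous_on {0..1} (\<lambda>t. oblique_proj (k ` \<gamma> t))"
    by (rule continuous_on_eq[OF cc[OF cQ]]) (use oblique_proj_image[OF k X] in simp)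
  have 2: "((\<lambda>s. oblique_proj (k ` \<gamma> s)) has_vector_derivative (k o\<^sub>L q t o\<^sub>L l)) (at t)" if t: "t \<in> ?T" for t
  proof (rule has_vector_derivative_transform_within_open[OF vd_compose_const[OF q[OF t]] open_T[OF S] t])
    fix s assume "s \<in> ?T"
    then have "\<gamma> s \<in> X" using X by simp
    then show "k o\<^sub>L oblique_proj (\<gamma> s) o\<^sub>L l = oblique_proj (k ` \<gamma> s)" using oblique_proj_image[OF k] by simp
  qed
  have 3: "k ` \<gamma> t = (k o\<^sub>L h t) ` E0" if "t \<in> ?T" for t using h(2)[OF that] by (simp add: image_image)
  have 4: "k o\<^sub>L q t o\<^sub>L l = (k o\<^sub>L h t) o\<^sub>L (A t o\<^sub>L \<Phi>) o\<^sub>L (g t o\<^sub>L l)" if "t \<in> ?T" for t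
    by (rule blinfun_eqI) (simp add: A(2)[OF that])
  show ?thesis unfolding qcurve_def
    using image_X[OF k X] S 1 2 3 4 cc[OF cq] form_iso_comp[OF k h(1)] A(1) by blast
qed

lemma curve_image:
  assumes "form_iso k l" "curve_of_length p E0 \<Phi> \<gamma> L"
  shows "curve_of_length p E0 \<Phi> (\<lambda>t. k ` \<gamma> t) L"
  using curve_imp_qcurve[OF assms(2)] qcurve_image[OF assms(1)] qcurve_imp_curve by blast

lemma continuous_ex2: "A \<in> pp \<Longrightarrow> continuous_on U (\<lambda>t. ex (2 * t) A)"
  by (intro continuous_at_imp_continuous_on ballI has_vector_derivative_continuous[OF ex2_deriv])

text \<open>Constant speed: moved back to \<open>E0\<close> by \<open>h o\<^sub>L ex t A\<close>,
  the tangent vector is \<open>A\<close> at every time, because \<open>A\<close> commutes with its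
  exponentials.\<close>

lemma curve_geodesic:
  assumes h: "form_iso h g" and A: "A \<in> pp"
  shows "curve_of_length p E0 \<Phi> (\<lambda>t. h ` ex t A ` E0) (N A)"
proof (rule qcurve_imp_curve)
  have "continuous_on U (\<lambda>t. h o\<^sub>L (A o\<^sub>L ex (2 * t) A o\<^sub>L \<Phi>) o\<^sub>L g)" for U
    by (intro bounded_bilinear.continuous_on[OF bounded_bilinear_blinfun_compose] continuous_on_const continuous_ex2[OF A])
  moreover have "continuous_on {0..1} (\<lambda>t. oblique_proj (h ` ex t A ` E0))"
    by (intro continuous_at_imp_continuous_on ballI has_vector_derivative_continuous[OF oblique_proj_line_vd[OF h A]])
  moreover have "h o\<^sub>L (A o\<^sub>L ex (2 * t) A o\<^sub>L \<Phi>) o\<^sub>L g = (h o\<^sub>L ex t A) o\<^sub>L (A o\<^sub>L \<Phi>) o\<^sub>L (ex (- t) A o\<^sub>L g)" for t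
  proof (rule blinfun_eqI)
    fix x
    have c: "A (ex s A y) = ex s A (A y)" for s y by (rule ex_commute[OF A]) simp
    have "ex t A (A (\<Phi> (ex (- t) A (g x)))) = A (ex t A (ex t A (\<Phi> (g x))))"
      using ex_Phi[OF A, of "- t" "g x"] by (simp add: c)
    also have "\<dots> = A (ex (2 * t) A (\<Phi> (g x)))" using ex_add[OF A, of t t] by simp
    finally show "(h o\<^sub>L (A o\<^sub>L ex (2 * t) A o\<^sub>L \<Phi>) o\<^sub>L g) x = ((h o\<^sub>L ex t A) o\<^sub>L (A o\<^sub>L \<Phi>) o\<^sub>L (ex (- t) A o\<^sub>L g)) x"
      by simp
  qed
  moreover have "h ` ex t A ` E0 = (h o\<^sub>L ex t A) ` E0" for t by (simp add: image_image)
  ultimately show "qcurve (\<lambda>t. h ` ex t A ` E0) {} (\<lambda>t. h o\<^sub>L (A o\<^sub>L ex (2 * t) A o\<^sub>L \<Phi>) o\<^sub>L g) (\<lambda>t. h o\<^sub>L ex t A)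
      (\<lambda>t. ex (- t) A o\<^sub>L g) (\<lambda>t. A)"
    unfolding qcurve_def using ex_X[OF h A] oblique_proj_line_vd[OF h A] form_iso_comp[OF h form_iso_ex[OF A]] A
    by (intro conjI ballI) simp_all
  show "((\<lambda>t. N A) has_integral N A) {0..1::real}" using has_integral_const_real[of "N A" 0 1] by simp
qed

end

section \<open>Gram-Schmidt orthogonalisation\<close>

text \<open>Without normalisation, so that each vector differs from \<open>v i\<close> only by a
  combination of its predecessors. Its squared length for \<open>K\<close> is the quotient of two
  successive Gram determinants.\<close>

function gram_schmidt :: "('a::real_inner \<Rightarrow>\<^sub>L 'a) \<Rightarrow> (nat \<Rightarrow> 'a) \<Rightarrow> nat \<Rightarrow> 'a" where
  "gram_schmidt K v i = v i - (\<Sum>j<i. ((v i \<bullet> K (gram_schmidt K v j)) / (gram_schmidt K v j \<bullet> K (gram_schmidt K v j))) *\<^sub>R gram_schmidt K v j)"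
  by auto
termination by (relation "Wellfounded.measure (\<lambda>(K, v, i). i)") auto

declare gram_schmidt.simps [simp del]

context
  fixes K :: "'a::real_inner \<Rightarrow>\<^sub>L 'a" and v :: "nat \<Rightarrow> 'a" and m :: nat
  assumes sym: "\<And>x y. x \<bullet> K y = K x \<bullet> y" and pos: "\<And>x. x \<noteq> 0 \<Longrightarrow> x \<bullet> K x > 0"
begin

lemma swap: assumes "x \<bullet> K y = 0" shows "y \<bullet> K x = 0"
  using assms sym[of y x] inner_commute[of "K y" x] by linarith

lemma gram_schmidt_span: "gram_schmidt K v i - v i \<in> span (v ` {..<i})"
proof (induction i rule: less_induct)
  case (less i)
  have "gram_schmidt K v j \<in> span (v ` {..<i})" if "j < i" for j
  proof -
    have "gram_schmidt K v j - v j \<in> span (v ` {..<i})"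
      using less.IH[OF that] span_mono[of "v ` {..<j}" "v ` {..<i}"] that by (meson image_mono lessThan_subset_iff less_imp_le subsetD)
    moreover have "v j \<in> span (v ` {..<i})" using that by (intro span_base) auto
    ultimately have "gram_schmidt K v j - v j + v j \<in> span (v ` {..<i})" by (rule span_add)
    then show ?thesis by simp
  qed
  then have "- (\<Sum>j<i. ((v i \<bullet> K (gram_schmidt K v j)) / (gram_schmidt K v j \<bullet> K (gram_schmidt K v j))) *\<^sub>R gram_schmidt K v j) \<in> span (v ` {..<i})"
    by (intro span_neg span_sum span_scale) auto
  then show ?case by (simp add: gram_schmidt.simps[of K v i])
qed

lemma gram_schmidt_nonzero:
  assumes "\<And>i. i < m \<Longrightarrow> v i \<notin> span (v ` {..<i})" "i < m"
  shows "gram_schmidt K v i \<noteq> 0"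
proof
  assume "gram_schmidt K v i = 0"
  then have "- v i \<in> span (v ` {..<i})" using gram_schmidt_span[of i] by simp
  then have "v i \<in> span (v ` {..<i})" using span_neg[of "- v i"] by simp
  with assms(1)[OF assms(2)] show False by contradiction
qed

lemma gram_schmidt_orth:
  assumes "\<And>i. i < m \<Longrightarrow> v i \<notin> span (v ` {..<i})"
  shows "i < m \<Longrightarrow> j < i \<Longrightarrow> gram_schmidt K v i \<bullet> K (gram_schmidt K v j) = 0"
proof (induction i arbitrary: j rule: less_induct)
  case (less i)
  have off: "gram_schmidt K v k \<bullet> K (gram_schmidt K v j) = 0" if "k < i" "k \<noteq> j" for k
  proof (cases "k < j")
    case True
    have "j < m" using less.prems by linarith
    from less.IH[OF less.prems(2) this True] have "gram_schmidt K v j \<bullet> K (gram_schmidt K v k) = 0" .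
    then show ?thesis by (rule swap)
  next
    case False
    then have jk: "j < k" using that by linarith
    have "k < m" using that less.prems by linarith
    from less.IH[OF that(1) this jk] show ?thesis .
  qed
  have nz: "gram_schmidt K v j \<bullet> K (gram_schmidt K v j) \<noteq> 0" using pos[OF gram_schmidt_nonzero[OF assms, of j]] less.prems by simp
  have "(\<Sum>k<i. ((v i \<bullet> K (gram_schmidt K v k)) / (gram_schmidt K v k \<bullet> K (gram_schmidt K v k))) * (gram_schmidt K v k \<bullet> K (gram_schmidt K v j)))
     = (\<Sum>k<i. if k = j then v i \<bullet> K (gram_schmidt K v j) else 0)"
    by (rule sum.cong) (use off nz in auto)
  then have "(\<Sum>k<i. ((v i \<bullet> K (gram_schmidt K v k)) / (gram_schmidt K v k \<bullet> K (gram_schmidt K v k))) * (gram_schmidt K v k \<bullet> K (gram_schmidt K v j))) = v i \<bullet> K (gram_schmidt K v j)"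
    using less.prems by simp
  then show ?case by (simp add: gram_schmidt.simps[of K v i] inner_diff_left inner_sum_left)
qed

lemma gram_schmidt_span_eq: "v j \<in> span (gram_schmidt K v ` {..j})"
proof (induction j rule: less_induct)
  case (less j)
  have "(\<Sum>k<j. ((v j \<bullet> K (gram_schmidt K v k)) / (gram_schmidt K v k \<bullet> K (gram_schmidt K v k))) *\<^sub>R gram_schmidt K v k) \<in> span (gram_schmidt K v ` {..j})"
    by (intro span_sum span_scale span_base) auto
  moreover have "gram_schmidt K v j \<in> span (gram_schmidt K v ` {..j})" by (intro span_base) auto
  ultimately have "gram_schmidt K v j + (\<Sum>k<j. ((v j \<bullet> K (gram_schmidt K v k)) / (gram_schmidt K v k \<bullet> K (gram_schmidt K v k))) *\<^sub>R gram_schmidt K v k) \<in> span (gram_schmidt K v ` {..j})"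
    by (intro span_add)
  then show ?case by (simp add: gram_schmidt.simps[of K v j])
qed

lemma gram_schmidt_orth_span:
  assumes "\<And>i. i < m \<Longrightarrow> v i \<notin> span (v ` {..<i})" "i < m" "w \<in> span (v ` {..<i})"
  shows "w \<bullet> K (gram_schmidt K v i) = 0"
  using assms(3)
proof (induction rule: span_induct_alt)
  case base then show ?case by simp
next
  case (step c x y)
  then obtain j where j: "j < i" "x = v j" by auto
  have "x \<bullet> K (gram_schmidt K v i) = 0"
    using gram_schmidt_span_eq[of j] unfolding j(2)[symmetric]
  proof (induction rule: span_induct_alt)
    case base then show ?case by simp
  next
    case (step d a b)
    then obtain k where k: "k \<le> j" "a = gram_schmidt K v k" by auto
    have "k < i" using k(1) j(1) by linarith
    then have "gram_schmidt K v i \<bullet> K (gram_schmidt K v k) = 0" using gram_schmidt_orth[OF _ assms(2)] assms(1) by blast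
    then have "a \<bullet> K (gram_schmidt K v i) = 0" unfolding k(2) by (rule swap)
    then show ?case using step.IH by (simp add: inner_add_left)
  qed
  then show ?case using step.IH by (simp add: inner_add_left)
qed

lemma gram_schmidt_orthogonal_family:
  assumes "\<And>i j. i < j \<Longrightarrow> j < m \<Longrightarrow> v j \<bullet> K (v i) = 0"
  shows "i < m \<Longrightarrow> gram_schmidt K v i = v i"
proof (induction i rule: less_induct)
  case (less i)
  then have "(\<Sum>j<i. ((v i \<bullet> K (gram_schmidt K v j)) / (gram_schmidt K v j \<bullet> K (gram_schmidt K v j))) *\<^sub>R gram_schmidt K v j) = 0"
    by (intro sum.neutral) (auto simp: assms)
  then show ?case by (simp add: gram_schmidt.simps[of K v i])
qed

end

text \<open>The coefficients vary with the form while the flag of spans stays fixed; hence the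
  derivative of the \<open>i\<close>-th vector involves only the earlier \<open>v j\<close>.\<close>

lemma gram_schmidt_vd:
  fixes K :: "real \<Rightarrow> 'a::real_inner \<Rightarrow>\<^sub>L 'a"
  assumes K: "(K has_vector_derivative K') (at t)"
    and sym: "\<And>x y. x \<bullet> K t y = K t x \<bullet> y" and pos: "\<And>x. x \<noteq> 0 \<Longrightarrow> x \<bullet> K t x > 0"
    and ind: "\<And>i. i < m \<Longrightarrow> v i \<notin> span (v ` {..<i})"
  shows "i < m \<Longrightarrow> \<exists>u'\<in>span (v ` {..<i}). ((\<lambda>s. gram_schmidt (K s) v i) has_vector_derivative u') (at t)"
proof (induction i rule: less_induct)
  case (less i)
  have ex: "\<exists>w'\<in>span (v ` {..<i}). ((\<lambda>s. ((v i \<bullet> K s (gram_schmidt (K s) v j)) / (gram_schmidt (K s) v j \<bullet> K s (gram_schmidt (K s) v j))) *\<^sub>R gram_schmidt (K s) v j) has_vector_derivative w') (at t)"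
    if j: "j < i" for j
  proof -
    obtain u' where u': "u' \<in> span (v ` {..<j})" "((\<lambda>s. gram_schmidt (K s) v j) has_vector_derivative u') (at t)"
      using less.IH[OF j] j less.prems by auto
    have Ku: "((\<lambda>s. K s (gram_schmidt (K s) v j)) has_vector_derivative (K t u' + K' (gram_schmidt (K t) v j))) (at t)"
      by (rule bounded_bilinear.has_vector_derivative[OF bounded_bilinear_blinfun_apply K u'(2)])
    have nz: "gram_schmidt (K t) v j \<bullet> K t (gram_schmidt (K t) v j) \<noteq> 0"
      using pos[OF gram_schmidt_nonzero[OF sym pos ind, of m j]] j less.prems by simp
    obtain n' where n': "((\<lambda>s. v i \<bullet> K s (gram_schmidt (K s) v j)) has_real_derivative n') (at t)"
      using bounded_linear.has_vector_derivative[OF bounded_linear_inner_right Ku]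
      unfolding has_real_derivative_iff_has_vector_derivative by blast
    obtain d' where d': "((\<lambda>s. gram_schmidt (K s) v j \<bullet> K s (gram_schmidt (K s) v j)) has_real_derivative d') (at t)"
      using bounded_bilinear.has_vector_derivative[OF bounded_bilinear_inner u'(2) Ku]
      unfolding has_real_derivative_iff_has_vector_derivative by blast
    from DERIV_divide[OF n' d' nz] obtain c' where
      c': "((\<lambda>s. (v i \<bullet> K s (gram_schmidt (K s) v j)) / (gram_schmidt (K s) v j \<bullet> K s (gram_schmidt (K s) v j))) has_real_derivative c') (at t)"
      by blast
    let ?c = "(v i \<bullet> K t (gram_schmidt (K t) v j)) / (gram_schmidt (K t) v j \<bullet> K t (gram_schmidt (K t) v j))"
    have 1: "((\<lambda>s. ((v i \<bullet> K s (gram_schmidt (K s) v j)) / (gram_schmidt (K s) v j \<bullet> K s (gram_schmidt (K s) v j))) *\<^sub>R gram_schmidt (K s) v j) has_vector_derivative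
       (?c *\<^sub>R u' + c' *\<^sub>R gram_schmidt (K t) v j)) (at t)"
      by (rule has_vector_derivative_scaleR[OF c' u'(2)])
    have sub: "span (v ` {..<j}) \<subseteq> span (v ` {..<i})" using j by (intro span_mono image_mono) auto
    have vj: "v j \<in> span (v ` {..<i})" using j by (intro span_base) auto
    have "gram_schmidt (K t) v j - v j \<in> span (v ` {..<i})" by (rule subsetD[OF sub gram_schmidt_span[OF sym pos]])
    from span_add[OF this vj] have gi: "gram_schmidt (K t) v j \<in> span (v ` {..<i})" by simp
    have 2: "?c *\<^sub>R u' + c' *\<^sub>R gram_schmidt (K t) v j \<in> span (v ` {..<i})"
      by (rule span_add[OF span_scale[OF subsetD[OF sub u'(1)]] span_scale[OF gi]])
    show ?thesis by (rule bexI, rule 1, rule 2)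
  qed
  define w' where "w' j = (SOME w. w \<in> span (v ` {..<i}) \<and>
    ((\<lambda>s. ((v i \<bullet> K s (gram_schmidt (K s) v j)) / (gram_schmidt (K s) v j \<bullet> K s (gram_schmidt (K s) v j))) *\<^sub>R gram_schmidt (K s) v j) has_vector_derivative w) (at t))" for j
  have w'': "w' j \<in> span (v ` {..<i}) \<and>
    ((\<lambda>s. ((v i \<bullet> K s (gram_schmidt (K s) v j)) / (gram_schmidt (K s) v j \<bullet> K s (gram_schmidt (K s) v j))) *\<^sub>R gram_schmidt (K s) v j) has_vector_derivative w' j) (at t)"
    if "j < i" for j
    using someI_ex[OF ex[OF that, unfolded Bex_def]] unfolding w'_def .
  note w' = conjunct1[OF w''] conjunct2[OF w'']
  have "((\<lambda>s. v i - (\<Sum>j<i. ((v i \<bullet> K s (gram_schmidt (K s) v j)) / (gram_schmidt (K s) v j \<bullet> K s (gram_schmidt (K s) v j))) *\<^sub>R gram_schmidt (K s) v j)) has_vector_derivative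
      (0 - (\<Sum>j<i. w' j))) (at t)"
    by (intro has_vector_derivative_diff has_vector_derivative_const has_vector_derivative_sum) (simp add: w'(2))
  then have "((\<lambda>s. gram_schmidt (K s) v i) has_vector_derivative (0 - (\<Sum>j<i. w' j))) (at t)"
    unfolding gram_schmidt.simps[of _ v i] .
  moreover have "0 - (\<Sum>j<i. w' j) \<in> span (v ` {..<i})"
    by (intro span_diff span_0 span_sum w'(1)) simp
  ultimately show ?case by (rule bexI)
qed

text \<open>The variation of the vector itself lies in the span of its predecessors, to which the
  vector is orthogonal for the form. Only the variation of the form contributes.\<close>

lemma ln_gram_schmidt_vd:
  fixes K :: "real \<Rightarrow> 'a::real_inner \<Rightarrow>\<^sub>L 'a"
  assumes K: "(K has_vector_derivative K') (at t)"
    and sym: "\<And>x y. x \<bullet> K t y = K t x \<bullet> y" and pos: "\<And>x. x \<noteq> 0 \<Longrightarrow> x \<bullet> K t x > 0"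
    and ind: "\<And>i. i < m \<Longrightarrow> v i \<notin> span (v ` {..<i})" and i: "i < m"
  shows "((\<lambda>s. ln (gram_schmidt (K s) v i \<bullet> K s (gram_schmidt (K s) v i))) has_real_derivative
     (gram_schmidt (K t) v i \<bullet> K' (gram_schmidt (K t) v i)) / (gram_schmidt (K t) v i \<bullet> K t (gram_schmidt (K t) v i))) (at t)"
proof -
  obtain u' where u': "u' \<in> span (v ` {..<i})" "((\<lambda>s. gram_schmidt (K s) v i) has_vector_derivative u') (at t)"
    using gram_schmidt_vd[OF K sym pos ind i] by blast
  let ?u = "gram_schmidt (K t) v i"
  have Ku: "((\<lambda>s. K s (gram_schmidt (K s) v i)) has_vector_derivative (K t u' + K' ?u)) (at t)"
    by (rule bounded_bilinear.has_vector_derivative[OF bounded_bilinear_blinfun_apply K u'(2)])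
  have d: "((\<lambda>s. gram_schmidt (K s) v i \<bullet> K s (gram_schmidt (K s) v i)) has_real_derivative (?u \<bullet> (K t u' + K' ?u) + u' \<bullet> K t ?u)) (at t)"
    unfolding has_real_derivative_iff_has_vector_derivative
    by (rule bounded_bilinear.has_vector_derivative[OF bounded_bilinear_inner u'(2) Ku])
  have o: "u' \<bullet> K t ?u = 0" by (rule gram_schmidt_orth_span[OF sym pos ind i u'(1)])
  have o': "?u \<bullet> K t u' = 0" by (rule swap[OF sym pos o])
  have p: "?u \<bullet> K t ?u > 0" by (rule pos[OF gram_schmidt_nonzero[OF sym pos ind i]])
  have "((\<lambda>s. ln (gram_schmidt (K s) v i \<bullet> K s (gram_schmidt (K s) v i))) has_real_derivative
     (1 / (?u \<bullet> K t ?u)) * (?u \<bullet> (K t u' + K' ?u) + u' \<bullet> K t ?u)) (at t)"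
    by (rule DERIV_chain2[OF DERIV_ln_divide[OF p] d])
  then show ?thesis by (simp add: o o' inner_add_right)
qed

lemma gram_schmidt_tendsto:
  assumes K: "(K \<longlongrightarrow> K0) F"
    and sym: "\<And>x y. x \<bullet> blinfun_apply K0 y = K0 x \<bullet> y" and pos: "\<And>x. x \<noteq> 0 \<Longrightarrow> x \<bullet> blinfun_apply K0 x > 0"
    and ind: "\<And>i. i < m \<Longrightarrow> v i \<notin> span (v ` {..<i})"
  shows "i < m \<Longrightarrow> ((\<lambda>s. gram_schmidt (K s) v i) \<longlongrightarrow> gram_schmidt K0 v i) F"
proof (induction i rule: less_induct)
  case (less i)
  have nz: "gram_schmidt K0 v j \<bullet> K0 (gram_schmidt K0 v j) \<noteq> 0" if "j < i" for j
    using pos[OF gram_schmidt_nonzero[OF sym pos ind, of m j]] that less.prems by simp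
  have "((\<lambda>s. v i - (\<Sum>j<i. ((v i \<bullet> K s (gram_schmidt (K s) v j)) / (gram_schmidt (K s) v j \<bullet> K s (gram_schmidt (K s) v j))) *\<^sub>R gram_schmidt (K s) v j)) \<longlongrightarrow>
      v i - (\<Sum>j<i. ((v i \<bullet> K0 (gram_schmidt K0 v j)) / (gram_schmidt K0 v j \<bullet> K0 (gram_schmidt K0 v j))) *\<^sub>R gram_schmidt K0 v j)) F"
    by (intro tendsto_diff tendsto_sum tendsto_scaleR tendsto_divide tendsto_inner tendsto_const
        bounded_bilinear.tendsto[OF bounded_bilinear_blinfun_apply K] less.IH nz) (use less.prems in auto)
  then show ?case unfolding gram_schmidt.simps[of _ v i] .
qed

section \<open>Busemann functions\<close>

context hilbert_splitting
begin

definition pos_form :: "'a set \<Rightarrow> 'a \<Rightarrow>\<^sub>L 'a" where "pos_form E = \<Phi> o\<^sub>L reflector E"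

lemma pos_form_apply: "pos_form E x = \<Phi> (reflector E x)" by (simp add: pos_form_def)

lemma pos_form_inner: assumes "form_iso h g" shows "x \<bullet> pos_form (h ` E0) y = g x \<bullet> g y"
proof -
  have "x \<bullet> pos_form (h ` E0) y = x \<bullet> \<Phi> (h (\<Phi> (g y)))"
    using reflector_image[OF assms E0_X] reflector_E0 by (simp add: pos_form_apply)
  also have "\<dots> = g x \<bullet> \<Phi> (\<Phi> (g y))" using form_iso_adj(1)[OF form_iso_inv[OF assms], of x "\<Phi> (g y)"] by simp
  finally show ?thesis by simp
qed

lemma pos_form_props:
  assumes "E \<in> X"
  shows "x \<bullet> pos_form E y = pos_form E x \<bullet> y" "x \<noteq> 0 \<Longrightarrow> x \<bullet> pos_form E x > 0"
proof -
  obtain h g where h: "form_iso h g" "E = h ` E0" using X_form_iso[OF assms] .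
  show "x \<bullet> pos_form E y = pos_form E x \<bullet> y"
    unfolding h(2) inner_commute[of "pos_form (h ` E0) x"] pos_form_inner[OF h(1)] by (rule inner_commute)
  assume "x \<noteq> 0"
  then have "g x \<noteq> 0" using form_isoD(2)[OF h(1), of x] by (metis blinfun.zero_right)
  then show "x \<bullet> pos_form E x > 0" unfolding h(2) pos_form_inner[OF h(1)] by simp
qed

text \<open>The gradient bound behind the lower estimate for the distance: orthonormal vectors spanning
  an isotropic subspace have components in \<^term>\<open>E0\<close> and \<^term>\<open>W\<close> that are, up to the factor
  \<open>sqrt 2\<close>, orthonormal as well.\<close>

lemma isotropic_bound:
  assumes w: "onf p w" and iso: "\<And>i j. i < p \<Longrightarrow> j < p \<Longrightarrow> w i \<bullet> \<Phi> (w j) = 0" and A: "A \<in> pp"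
  shows "(\<Sum>i<p. (w i \<bullet> A (w i))\<^sup>2) \<le> (N A)\<^sup>2 / 2"
proof -
  define x where "x i = (1/2) *\<^sub>R (w i + \<Phi> (w i))" for i
  define y where "y i = (1/2) *\<^sub>R (w i - \<Phi> (w i))" for i
  have wxy: "w i = x i + y i" for i
    unfolding x_def y_def by (simp flip: scaleR_add_right add: scaleR_2[symmetric])
  have xE: "x i \<in> E0" for i unfolding E_iff x_def by (simp add: blinfun.scaleR_right blinfun.add_right add.commute)
  have yW: "y i \<in> W" for i unfolding W_def y_def by (simp add: blinfun.scaleR_right blinfun.diff_right flip: scaleR_minus_right)
  have PP: "\<Phi> a \<bullet> \<Phi> b = a \<bullet> b" for a b by (simp add: Phi_sym)
  have iso': "\<Phi> (w i) \<bullet> w j = 0" if "i < p" "j < p" for i j using iso[OF that] by (simp add: Phi_sym)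
  have xx: "x i \<bullet> x j = (if i = j then 1 else 0) / 2" if "i < p" "j < p" for i j
    using onfD[OF w that] iso[OF that] iso'[OF that]
    by (simp add: x_def inner_add_left inner_add_right PP)
  have yy: "y i \<bullet> y i = 1 / 2" if "i < p" for i
    using onfD[OF w that that] iso[OF that that] iso'[OF that that]
    by (simp add: y_def inner_diff_left inner_diff_right PP)
  have oE: "onE (\<lambda>i. sqrt 2 *\<^sub>R x i)"
    unfolding onE_def onf_def
  proof (intro conjI allI impI)
    fix i j assume ij: "i < p" "j < p"
    have "(sqrt 2 *\<^sub>R x i) \<bullet> (sqrt 2 *\<^sub>R x j) = 2 * (x i \<bullet> x j)" by (simp flip: mult.assoc)
    then show "(sqrt 2 *\<^sub>R x i) \<bullet> (sqrt 2 *\<^sub>R x j) = (if i = j then 1 else 0)" unfolding xx[OF ij] by simp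
  qed (use xE subE in \<open>simp add: subspace_scale\<close>)
  have bnd: "(w i \<bullet> A (w i))\<^sup>2 \<le> (norm (A (sqrt 2 *\<^sub>R x i)))\<^sup>2" if i: "i < p" for i
  proof -
    \<comment> \<open>\<open>A\<close> exchanges \<open>E0\<close> and \<open>W\<close>, so only the
      mixed terms survive.\<close>
    have "x i \<bullet> A (x i) = 0" "y i \<bullet> A (y i) = 0"
      using EW(1)[OF xE pp_EW[OF A xE]] EW(2)[OF yW pp_WE[OF A yW]] by blast+
    moreover have "x i \<bullet> A (y i) = y i \<bullet> A (x i)" by (metis pp_sym[OF A] inner_commute)
    ultimately have "w i \<bullet> A (w i) = 2 * (y i \<bullet> A (x i))"
      unfolding wxy by (simp add: blinfun.add_right inner_add_left inner_add_right)
    then have "(w i \<bullet> A (w i))\<^sup>2 = 4 * (y i \<bullet> A (x i))\<^sup>2" by (simp add: power_mult_distrib)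
    also have "\<dots> \<le> 4 * ((y i \<bullet> y i) * (A (x i) \<bullet> A (x i)))"
      using Cauchy_Schwarz_ineq[of "y i" "A (x i)"] by simp
    also have "\<dots> = 2 * (A (x i) \<bullet> A (x i))" using yy[OF i] by simp
    also have "\<dots> = (norm (A (sqrt 2 *\<^sub>R x i)))\<^sup>2"
      by (simp add: dot_square_norm blinfun.scaleR_right power_mult_distrib)
    finally show ?thesis .
  qed
  have "(\<Sum>i<p. (w i \<bullet> A (w i))\<^sup>2) \<le> (\<Sum>i<p. (norm (A (sqrt 2 *\<^sub>R x i)))\<^sup>2)"
    by (rule sum_mono) (use bnd in simp)
  also have "\<dots> = (N A)\<^sup>2 / 2" unfolding N_onE[OF A oE] by (simp add: sum_nonneg)
  finally show ?thesis .
qed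

text \<open>The Busemann function of a point at infinity given by the flag spanned by \<open>v\<close> and the weights \<open>l\<close>;
  the Gram-Schmidt process is the one of the positive definite form attached to \<open>E\<close>.\<close>

definition busemann :: "(nat \<Rightarrow> real) \<Rightarrow> (nat \<Rightarrow> 'a) \<Rightarrow> 'a set \<Rightarrow> real" where
  "busemann l v E = (\<Sum>i<p. l i * ln (gram_schmidt (pos_form E) v i \<bullet> pos_form E (gram_schmidt (pos_form E) v i)))"

definition isotropic_family :: "(nat \<Rightarrow> 'a) \<Rightarrow> bool" where
  "isotropic_family v \<longleftrightarrow> (\<forall>i<p. v i \<notin> span (v ` {..<i})) \<and> (\<forall>i<p. \<forall>j<p. v i \<bullet> \<Phi> (v j) = 0)"

lemma isotropic_family_span:
  assumes v: "isotropic_family v" and x: "x \<in> span (v ` {..<p})" and y: "y \<in> span (v ` {..<p})"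
  shows "x \<bullet> \<Phi> y = 0"
proof -
  have 1: "v i \<bullet> \<Phi> y = 0" if i: "i < p" for i
    using y
  proof (induction rule: span_induct_alt)
    case (step c a b)
    then obtain j where "j < p" "a = v j" by auto
    then have "v i \<bullet> \<Phi> a = 0" using v i by (simp add: isotropic_family_def)
    then show ?case using step.IH by (simp add: blinfun.add_right blinfun.scaleR_right inner_add_right)
  qed (simp add: blinfun.zero_right)
  show ?thesis using x
  proof (induction rule: span_induct_alt)
    case (step c a b)
    then obtain j where "j < p" "a = v j" by auto
    then have "a \<bullet> \<Phi> y = 0" using 1 by simp
    then show ?case using step.IH by (simp add: inner_add_left)
  qed simp
qed

text \<open>The derivative along the curve is \<open>-2\<close> times the sum of the
  \<open>l i * (w i \<bullet> A t (w i))\<close>, to be bounded by Cauchy-Schwarz and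
  \<open>isotropic_bound\<close>. The constant is \<open>N\<close> of an element of
  \<open>pp\<close> with singular values \<open>l\<close>, which is what makes the estimate sharp in
  the matching direction.\<close>

lemma busemann_lipschitz:
  assumes v: "isotropic_family v" and c: "curve_of_length p E0 \<Phi> \<gamma> L"
  shows "\<bar>busemann l v (\<gamma> 1) - busemann l v (\<gamma> 0)\<bar> \<le> sqrt (2 * (\<Sum>i<p. (l i)\<^sup>2)) * L"
proof -
  obtain S q h g A where qc: "qcurve \<gamma> S q h g A" and int: "((\<lambda>t. N (A t)) has_integral L) {0..1}"
    using curve_imp_qcurve[OF c] by blast
  let ?T = "{0<..<1::real} - S"
  have X: "\<And>t. t \<in> {0..1} \<Longrightarrow> \<gamma> t \<in> X" and S: "finite S" and cQ: "continuous_on {0..1} (\<lambda>t. oblique_proj (\<gamma> t))"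
    and q: "\<And>t. t \<in> ?T \<Longrightarrow> ((\<lambda>s. oblique_proj (\<gamma> s)) has_vector_derivative q t) (at t)"
    and h: "\<And>t. t \<in> ?T \<Longrightarrow> form_iso (h t) (g t)" "\<And>t. t \<in> ?T \<Longrightarrow> \<gamma> t = h t ` E0"
    and A: "\<And>t. t \<in> ?T \<Longrightarrow> A t \<in> pp" "\<And>t. t \<in> ?T \<Longrightarrow> q t = h t o\<^sub>L (A t o\<^sub>L \<Phi>) o\<^sub>L g t"
    using qc unfolding qcurve_def by blast+
  have ind: "\<And>i. i < p \<Longrightarrow> v i \<notin> span (v ` {..<i})" using v by (simp add: isotropic_family_def)
  have KQ: "pos_form F = 2 *\<^sub>R (\<Phi> o\<^sub>L oblique_proj F) - \<Phi>" for F
    by (rule blinfun_eqI) (simp add: oblique_proj_apply pos_form_apply blinfun.diff_left blinfun.scaleR_left blinfun.scaleR_right blinfun.add_right)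
  have cK: "continuous_on {0..1} (\<lambda>t. pos_form (\<gamma> t))"
    unfolding KQ by (intro continuous_intros bounded_bilinear.continuous_on[OF bounded_bilinear_blinfun_compose] cQ)
  define \<phi> where "\<phi> t = busemann l v (\<gamma> t)" for t
  define G where "G i t = gram_schmidt (pos_form (\<gamma> t)) v i" for i t
  define \<phi>' where "\<phi>' t = (\<Sum>i<p. l i * ((G i t \<bullet> (2 *\<^sub>R (\<Phi> o\<^sub>L q t)) (G i t)) / (G i t \<bullet> pos_form (\<gamma> t) (G i t))))" for t
  have Gpos: "G i t \<bullet> pos_form (\<gamma> t) (G i t) > 0" if "i < p" "t \<in> {0..1}" for i t
    unfolding G_def using pos_form_props[OF X[OF that(2)]] gram_schmidt_nonzero[OF pos_form_props[OF X[OF that(2)]] ind that(1)] by blast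
  have c\<phi>: "continuous_on {0..1} \<phi>"
    unfolding continuous_on_def
  proof
    fix t :: real assume t: "t \<in> {0..1}"
    have Kt: "((\<lambda>t. pos_form (\<gamma> t)) \<longlongrightarrow> pos_form (\<gamma> t)) (at t within {0..1})" using cK t by (simp add: continuous_on_def)
    have Gt: "((\<lambda>s. gram_schmidt (pos_form (\<gamma> s)) v i) \<longlongrightarrow> gram_schmidt (pos_form (\<gamma> t)) v i) (at t within {0..1})" if "i < p" for i
      by (rule gram_schmidt_tendsto[OF Kt pos_form_props[OF X[OF t]] ind that])
    show "(\<phi> \<longlongrightarrow> \<phi> t) (at t within {0..1})"
      unfolding \<phi>_def busemann_def
    proof (intro tendsto_sum tendsto_mult tendsto_const tendsto_ln tendsto_inner
        bounded_bilinear.tendsto[OF bounded_bilinear_blinfun_apply Kt] Gt)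
      fix i assume "i \<in> {..<p}"
      then show "gram_schmidt (pos_form (\<gamma> t)) v i \<bullet> pos_form (\<gamma> t) (gram_schmidt (pos_form (\<gamma> t)) v i) \<noteq> 0"
        using Gpos[of i t] t by (simp add: G_def)
    qed auto
  qed
  have d\<phi>: "(\<phi> has_vector_derivative \<phi>' t) (at t)" if t: "t \<in> ?T" for t
  proof -
    have t01: "t \<in> {0..1}" using t by simp
    have "((\<lambda>s. pos_form (\<gamma> s)) has_vector_derivative (2 *\<^sub>R (\<Phi> o\<^sub>L q t) - 0)) (at t)"
      unfolding KQ
      by (intro has_vector_derivative_diff has_vector_derivative_const bounded_linear.has_vector_derivative[OF bounded_linear_scaleR_right]
          bounded_linear.has_vector_derivative[OF bounded_bilinear.bounded_linear_right[OF bounded_bilinear_blinfun_compose]] q[OF t])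
    then have K': "((\<lambda>s. pos_form (\<gamma> s)) has_vector_derivative 2 *\<^sub>R (\<Phi> o\<^sub>L q t)) (at t)" by simp
    have "(\<phi> has_real_derivative \<phi>' t) (at t)"
      unfolding \<phi>_def busemann_def \<phi>'_def G_def
      by (intro DERIV_sum DERIV_cmult ln_gram_schmidt_vd[OF K' pos_form_props[OF X[OF t01]] ind]) auto
    then show ?thesis unfolding has_real_derivative_iff_has_vector_derivative .
  qed
  have bd: "\<bar>\<phi>' t\<bar> \<le> sqrt (2 * (\<Sum>i<p. (l i)\<^sup>2)) * N (A t)" if t: "t \<in> ?T" for t
  proof -
    have t01: "t \<in> {0..1}" using t by simp
    note hg = h(1)[OF t]
    define n where "n i = G i t \<bullet> pos_form (\<gamma> t) (G i t)" for i
    \<comment> \<open>The Gram-Schmidt vectors moved back to \<open>E0\<close> and normalised: there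
      \<open>pos_form\<close> becomes the inner product, so they are orthonormal, and they still
      span an isotropic subspace.\<close>
    define w where "w i = (1 / sqrt (n i)) *\<^sub>R g t (G i t)" for i
    have npos: "n i > 0" if "i < p" for i using Gpos[OF that t01] by (simp add: n_def)
    have Kin: "x \<bullet> pos_form (\<gamma> t) y = g t x \<bullet> g t y" for x y using pos_form_inner[OF hg] h(2)[OF t] by simp
    have orth: "G i t \<bullet> pos_form (\<gamma> t) (G j t) = 0" if "i < p" "j < i" for i j
      unfolding G_def by (rule gram_schmidt_orth[OF pos_form_props[OF X[OF t01]] ind that])
    have gg: "g t (G i t) \<bullet> g t (G j t) = (if i = j then n i else 0)" if "i < p" "j < p" for i j
    proof (cases i j rule: linorder_cases)
      case less
      then have "g t (G j t) \<bullet> g t (G i t) = 0" using orth[OF that(2) less] by (simp add: Kin)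
      then show ?thesis using less by (simp add: inner_commute)
    next
      case equal then show ?thesis by (simp add: n_def Kin)
    next
      case greater then show ?thesis using orth[OF that(1) greater] by (simp add: Kin)
    qed
    have w: "onf p w" unfolding onf_def
    proof (intro allI impI)
      fix i j assume ij: "i < p" "j < p"
      have "sqrt (n i) * sqrt (n i) = n i" using npos[OF ij(1)] by simp
      then show "w i \<bullet> w j = (if i = j then 1 else 0)" using gg[OF ij] npos[OF ij(1)]
        by (cases "i = j") (auto simp: w_def)
    qed
    have Gs: "G i t \<in> span (v ` {..<p})" if "i < p" for i
    proof -
      have "G i t - v i \<in> span (v ` {..<i})" unfolding G_def by (rule gram_schmidt_span[OF pos_form_props[OF X[OF t01]]])
      then have "G i t - v i \<in> span (v ` {..<p})" using that span_mono[of "v ` {..<i}" "v ` {..<p}"] by (meson image_mono lessThan_subset_iff less_imp_le subsetD)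
      moreover have "v i \<in> span (v ` {..<p})" using that by (intro span_base) auto
      ultimately have "G i t - v i + v i \<in> span (v ` {..<p})" by (rule span_add)
      then show ?thesis by simp
    qed
    have iso: "w i \<bullet> \<Phi> (w j) = 0" if "i < p" "j < p" for i j
      using isotropic_family_span[OF v Gs[OF that(1)] Gs[OF that(2)]] form_isoD(3)[OF form_iso_inv[OF hg]]
      by (simp add: w_def blinfun.scaleR_right)
    have bnd: "(G i t \<bullet> (2 *\<^sub>R (\<Phi> o\<^sub>L q t)) (G i t)) / n i = - 2 * (w i \<bullet> A t (w i))" if i: "i < p" for i
    proof -
      have "G i t \<bullet> \<Phi> (q t (G i t)) = g t (G i t) \<bullet> \<Phi> (A t (\<Phi> (g t (G i t))))"
        using form_iso_adj(1)[OF form_iso_inv[OF hg]] by (subst A(2)[OF t]) (simp add: form_isoD[OF hg])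
      also have "\<dots> = - (g t (G i t) \<bullet> A t (g t (G i t)))"
        by (simp add: pp_anti[OF A(1)[OF t]] blinfun.minus_right)
      finally have "G i t \<bullet> \<Phi> (q t (G i t)) = - (g t (G i t) \<bullet> A t (g t (G i t)))" .
      moreover have "w i \<bullet> A t (w i) = (g t (G i t) \<bullet> A t (g t (G i t))) / n i"
        using npos[OF i] by (simp add: w_def blinfun.scaleR_right)
      ultimately show ?thesis by (simp add: blinfun.scaleR_left)
    qed
    have "\<phi>' t = (\<Sum>i<p. l i * (- 2 * (w i \<bullet> A t (w i))))"
      unfolding \<phi>'_def n_def[symmetric] by (rule sum.cong) (use bnd in auto)
    also have "\<dots> = - 2 * (\<Sum>i<p. l i * (w i \<bullet> A t (w i)))" by (simp add: sum_distrib_left mult_ac)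
    finally have "(\<phi>' t)\<^sup>2 = 4 * (\<Sum>i<p. l i * (w i \<bullet> A t (w i)))\<^sup>2" by (simp add: power_mult_distrib)
    also have "\<dots> \<le> 4 * ((\<Sum>i<p. (l i)\<^sup>2) * (\<Sum>i<p. (w i \<bullet> A t (w i))\<^sup>2))"
      using Cauchy_Schwarz_ineq_sum[of l "\<lambda>i. w i \<bullet> A t (w i)" "{..<p}"] by simp
    also have "\<dots> \<le> 4 * ((\<Sum>i<p. (l i)\<^sup>2) * ((N (A t))\<^sup>2 / 2))"
      by (intro mult_left_mono isotropic_bound[OF w iso A(1)[OF t]] sum_nonneg) auto
    also have "\<dots> = (sqrt (2 * (\<Sum>i<p. (l i)\<^sup>2)) * N (A t))\<^sup>2"
      by (simp add: power_mult_distrib sum_nonneg)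
    finally have "(\<phi>' t)\<^sup>2 \<le> (sqrt (2 * (\<Sum>i<p. (l i)\<^sup>2)) * N (A t))\<^sup>2" .
    then show ?thesis using abs_le_square_iff[of "\<phi>' t" "sqrt (2 * (\<Sum>i<p. (l i)\<^sup>2)) * N (A t)"]
      by (simp add: N_nonneg sum_nonneg)
  qed
  define c where "c = sqrt (2 * (\<Sum>i<p. (l i)\<^sup>2))"
  have c0: "c \<ge> 0" by (simp add: c_def sum_nonneg)
  \<comment> \<open>Set to zero at the exceptional points, so that the comparison of the integrands
    holds at every point.\<close>
  define \<psi> where "\<psi> t = (if t \<in> ?T then \<phi>' t else 0)" for t
  have "(\<phi>' has_integral (\<phi> 1 - \<phi> 0)) {0..1}"
    by (rule fundamental_theorem_of_calculus_interior_strong[OF S _ _ c\<phi>]) (use d\<phi> in auto)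
  then have i\<psi>: "(\<psi> has_integral (\<phi> 1 - \<phi> 0)) {0..1}"
    by (rule has_integral_spike_finite[of "S \<union> {0, 1}", rotated 2]) (use S in \<open>auto simp: \<psi>_def\<close>)
  define B where "B t = (if t \<in> ?T then c * N (A t) else 0)" for t
  have "((\<lambda>t. c * N (A t)) has_integral (c * L)) {0..1}" by (rule has_integral_mult_right[OF int])
  then have iB: "(B has_integral (c * L)) {0..1}"
    by (rule has_integral_spike_finite[of "S \<union> {0, 1}", rotated 2]) (use S in \<open>auto simp: B_def\<close>)
  have "\<psi> t \<le> B t" "- \<psi> t \<le> B t" for t using bd[of t] by (auto simp: \<psi>_def B_def c_def abs_le_iff)
  then have "\<phi> 1 - \<phi> 0 \<le> c * L" "- (\<phi> 1 - \<phi> 0) \<le> c * L"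
    using has_integral_le[OF i\<psi> iB] has_integral_le[OF has_integral_neg[OF i\<psi>] iB] by blast+
  then show ?thesis by (simp add: \<phi>_def c_def abs_le_iff)
qed

end

section \<open>Isometries and reflections\<close>

text \<open>Vaisala's proof of the Mazur-Ulam theorem: if an isometry \<open>g\<close> fixes two points that the
  reflection in \<open>M\<close> exchanges, then the commutator of \<open>g\<close> and the reflection also does, and it moves
  \<open>M\<close> twice as far; but such isometries move \<open>M\<close> by a bounded amount.\<close>

locale reflection_space =
  fixes X :: "'b set" and d :: "'b \<Rightarrow> 'b \<Rightarrow> real" and s :: "'b \<Rightarrow> 'b \<Rightarrow> 'b"
  assumes d_sym: "x \<in> X \<Longrightarrow> y \<in> X \<Longrightarrow> d x y = d y x"
    and d_nonneg: "x \<in> X \<Longrightarrow> y \<in> X \<Longrightarrow> d x y \<ge> 0"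
    and d_zero: "x \<in> X \<Longrightarrow> y \<in> X \<Longrightarrow> d x y = 0 \<longleftrightarrow> x = y"
    and d_tri: "x \<in> X \<Longrightarrow> y \<in> X \<Longrightarrow> z \<in> X \<Longrightarrow> d x z \<le> d x y + d y z"
    and s_in: "m \<in> X \<Longrightarrow> x \<in> X \<Longrightarrow> s m x \<in> X"
    and s_invol: "m \<in> X \<Longrightarrow> x \<in> X \<Longrightarrow> s m (s m x) = x"
    and s_iso: "m \<in> X \<Longrightarrow> x \<in> X \<Longrightarrow> y \<in> X \<Longrightarrow> d (s m x) (s m y) = d x y"
    and s_double: "m \<in> X \<Longrightarrow> x \<in> X \<Longrightarrow> d (s m x) x = 2 * d m x"
begin

definition isometry :: "('b \<Rightarrow> 'b) \<Rightarrow> bool" where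
  "isometry g \<longleftrightarrow> bij_betw g X X \<and> (\<forall>x\<in>X. \<forall>y\<in>X. d (g x) (g y) = d x y)"

lemma isometry_in: "isometry g \<Longrightarrow> x \<in> X \<Longrightarrow> g x \<in> X"
  unfolding isometry_def by (meson bij_betwE)

lemma isometry_inv: assumes "isometry g" shows "isometry (inv_into X g)"
    "x \<in> X \<Longrightarrow> inv_into X g (g x) = x" "x \<in> X \<Longrightarrow> g (inv_into X g x) = x"
proof -
  have b: "bij_betw g X X" and e: "\<And>x y. x \<in> X \<Longrightarrow> y \<in> X \<Longrightarrow> d (g x) (g y) = d x y"
    using assms by (auto simp: isometry_def)
  show 1: "x \<in> X \<Longrightarrow> g (inv_into X g x) = x" for x by (rule bij_betw_inv_into_right[OF b])
  show "x \<in> X \<Longrightarrow> inv_into X g (g x) = x" by (rule bij_betw_inv_into_left[OF b])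
  have b': "bij_betw (inv_into X g) X X" by (rule bij_betw_inv_into[OF b])
  have "d (inv_into X g x) (inv_into X g y) = d x y" if "x \<in> X" "y \<in> X" for x y
    using e[of "inv_into X g x" "inv_into X g y"] 1[OF that(1)] 1[OF that(2)] bij_betwE[OF b'] that by simp
  then show "isometry (inv_into X g)" using b' by (simp add: isometry_def)
qed

lemma isometry_comp: "isometry g \<Longrightarrow> isometry h \<Longrightarrow> isometry (g \<circ> h)"
  using isometry_in[of h] unfolding isometry_def by (auto intro: bij_betw_trans)

lemma isometry_s: assumes "m \<in> X" shows "isometry (s m)"
  unfolding isometry_def
proof (intro conjI ballI)
  show "bij_betw (s m) X X"
    by (rule bij_betw_byWitness[where f'="s m"]) (use s_invol[OF assms] s_in[OF assms] in auto)
qed (rule s_iso[OF assms])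

lemma s_fixed_iff: "m \<in> X \<Longrightarrow> x \<in> X \<Longrightarrow> s m x = x \<longleftrightarrow> x = m"
  using s_double[of m x] d_zero[of m x] d_zero[of "s m x" x] s_in[of m x] by auto

lemma fixes_midpoint:
  assumes m: "m \<in> X" and x: "x \<in> X" and y: "s m x = y"
    and g: "isometry g" "g x = x" "g y = y"
  shows "g m = m"
proof -
  have yX: "y \<in> X" using s_in[OF m x] y by simp
  have geo_sym: "s m y = x" using s_invol[OF m x] y by simp
  have smm: "s m m = m" using s_fixed_iff[OF m m] by simp
  have bound: "2 ^ n * d m (g m) \<le> 2 * d m x" if "isometry g" "g x = x" "g y = y" for n g
    using that
  proof (induction n arbitrary: g)
    case 0
    have gm: "g m \<in> X" by (rule isometry_in[OF 0(1) m])
    have "d m (g m) \<le> d m x + d x (g m)" by (rule d_tri[OF m x gm])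
    also have "d x (g m) = d (g x) (g m)" using 0(2) by simp
    also have "\<dots> = d m x" using 0(1) m x d_sym[OF m x] by (simp add: isometry_def)
    finally show ?case by simp
  next
    case (Suc n)
    let ?h = "inv_into X g"
    note inv = isometry_inv[OF Suc.prems(1)]
    define g' where "g' = s m \<circ> ?h \<circ> s m \<circ> g"
    have gm: "g m \<in> X" by (rule isometry_in[OF Suc.prems(1) m])
    have sgm: "s m (g m) \<in> X" by (rule s_in[OF m gm])
    have i: "isometry g'" unfolding g'_def
      by (intro isometry_comp isometry_s m inv(1) Suc.prems(1))
    have hx: "?h x = x" "?h y = y" using inv(2)[OF x] inv(2)[OF yX] Suc.prems by simp_all
    have gx: "g' x = x" "g' y = y" unfolding g'_def using Suc.prems(2,3) hx y geo_sym by simp_all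
    have "2 ^ n * d m (g' m) \<le> 2 * d m x" by (rule Suc.IH[OF i gx])
    moreover have "d m (g' m) = 2 * d m (g m)"
    proof -
      have h: "?h (s m (g m)) \<in> X" by (rule isometry_in[OF inv(1) sgm])
      have "d m (g' m) = d (s m m) (s m (?h (s m (g m))))" by (simp add: g'_def smm)
      also have "\<dots> = d m (?h (s m (g m)))" by (rule s_iso[OF m m h])
      also have "\<dots> = d (g m) (g (?h (s m (g m))))" using Suc.prems(1) m h by (simp add: isometry_def)
      also have "\<dots> = d (g m) (s m (g m))" by (simp add: inv(3)[OF sgm])
      also have "\<dots> = 2 * d m (g m)" using s_double[OF m gm] d_sym[OF gm sgm] by simp
      finally show ?thesis .
    qed
    ultimately show ?case by simp
  qed
  have gm: "g m \<in> X" by (rule isometry_in[OF g(1) m])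
  have "d m (g m) = 0"
  proof (rule ccontr)
    assume "d m (g m) \<noteq> 0"
    then have pos: "d m (g m) > 0" using d_nonneg[OF m gm] by simp
    obtain n where "2 * d m x / d m (g m) < 2 ^ n"
      using real_arch_pow[of 2 "2 * d m x / d m (g m)"] by auto
    then have "2 * d m x < 2 ^ n * d m (g m)" using pos by (simp add: divide_less_eq)
    then show False using bound[OF g, of n] by simp
  qed
  then show ?thesis using d_zero[OF m gm] by simp
qed

text \<open>The isometry \<open>s m \<circ> inv_into X f \<circ> s m' \<circ> f\<close> fixes
  \<open>x\<close> and its mirror image, hence \<open>m\<close> by \<open>fixes_midpoint\<close>.
  Unwinding this, \<open>s m'\<close> fixes \<open>f m\<close>, and \<open>m'\<close> is its only
  fixed point.\<close>

lemma isometry_midpoint: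
  assumes f: "isometry f" and m: "m \<in> X" and x: "x \<in> X" and m': "m' \<in> X" and eq: "s m' (f x) = f (s m x)"
  shows "f m = m'"
proof -
  let ?h = "inv_into X f"
  note inv = isometry_inv[OF f]
  define y where "y = s m x"
  have y: "y \<in> X" unfolding y_def by (rule s_in[OF m x])
  define g where "g = s m \<circ> ?h \<circ> s m' \<circ> f"
  have fy: "s m' (f y) = f x" unfolding y_def eq[symmetric] by (rule s_invol[OF m' isometry_in[OF f x]])
  have geo_sym: "s m y = x" unfolding y_def by (rule s_invol[OF m x])
  have "g m = m"
  proof (rule fixes_midpoint[OF m x y_def[symmetric]])
    show "isometry g" unfolding g_def by (intro isometry_comp isometry_s m m' inv(1) f)
    have "g x = s m (?h (f y))" unfolding g_def comp_apply eq y_def ..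
    then show "g x = x" using inv(2)[OF y] geo_sym by simp
    have "g y = s m (?h (f x))" unfolding g_def comp_apply fy ..
    then show "g y = y" using inv(2)[OF x] y_def by simp
  qed
  then have 1: "s m (?h (s m' (f m))) = m" by (simp add: g_def)
  have fm: "f m \<in> X" by (rule isometry_in[OF f m])
  have h: "?h (s m' (f m)) \<in> X" by (rule isometry_in[OF inv(1) s_in[OF m' fm]])
  have "s m m = m" using s_fixed_iff[OF m m] by simp
  then have "?h (s m' (f m)) = m" using s_invol[OF m h] 1 by simp
  then have "s m' (f m) = f m" using inv(3)[OF s_in[OF m' fm]] by simp
  then show ?thesis using s_fixed_iff[OF m' fm] by simp
qed

end

section \<open>The distance\<close>

context hilbert_splitting
begin

abbreviation "dX \<equiv> X_dist p E0 \<Phi>"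

lemma curve_length_nonneg: assumes "curve_of_length p E0 \<Phi> \<gamma> L" shows "L \<ge> 0"
proof -
  obtain S q h g A where "qcurve \<gamma> S q h g A" and i: "((\<lambda>t. N (A t)) has_integral L) {0..1}"
    using curve_imp_qcurve[OF assms] by blast
  from i show ?thesis by (rule has_integral_nonneg) (rule N_nonneg)
qed

lemma lengths_bdd: "bdd_below {L. \<exists>\<gamma>. curve_of_length p E0 \<Phi> \<gamma> L \<and> \<gamma> 0 = E \<and> \<gamma> 1 = F}"
  by (rule bdd_belowI[of _ 0]) (use curve_length_nonneg in blast)

lemma X_pair:
  assumes "E \<in> X" "F \<in> X"
  obtains h g A where "form_iso h g" "A \<in> pp" "E = h ` E0" "F = h ` ex 1 A ` E0"
proof -
  obtain h g where h: "form_iso h g" "E = h ` E0" using X_form_iso[OF assms(1)] .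
  obtain A where A: "A \<in> pp" "g ` F = ex 1 A ` E0" using X_ex_frame[OF image_X[OF form_iso_inv[OF h(1)] assms(2)]] by blast
  have "F = h ` g ` F" by (simp add: image_image form_isoD[OF h(1)])
  then have "F = h ` ex 1 A ` E0" using A(2) by simp
  then show ?thesis by (rule that[OF h(1) A(1) h(2)])
qed

lemma line_0: "A \<in> pp \<Longrightarrow> h ` ex 0 A ` E0 = h ` E0"
  by (simp add: ex_0)

lemma geodesic_length:
  assumes "form_iso h g" "A \<in> pp"
  shows "N A \<in> {L. \<exists>\<gamma>. curve_of_length p E0 \<Phi> \<gamma> L \<and> \<gamma> 0 = h ` E0 \<and> \<gamma> 1 = h ` ex 1 A ` E0}"
proof (intro CollectI exI conjI)
  show "curve_of_length p E0 \<Phi> (\<lambda>t. h ` ex t A ` E0) (N A)" by (rule curve_geodesic[OF assms])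
  show "h ` ex 0 A ` E0 = h ` E0" by (rule line_0[OF assms(2)])
qed (rule refl)

lemma dX_le: assumes "form_iso h g" "A \<in> pp" shows "dX (h ` E0) (h ` ex 1 A ` E0) \<le> N A"
  unfolding X_dist_def by (rule cInf_lower[OF geodesic_length[OF assms] lengths_bdd])

lemma lengths_nonempty:
  assumes "E \<in> X" "F \<in> X"
  shows "{L. \<exists>\<gamma>. curve_of_length p E0 \<Phi> \<gamma> L \<and> \<gamma> 0 = E \<and> \<gamma> 1 = F} \<noteq> {}"
proof -
  obtain h g A where h: "form_iso h g" "A \<in> pp" "E = h ` E0" "F = h ` ex 1 A ` E0" using X_pair[OF assms] .
  show ?thesis unfolding h(3,4) using geodesic_length[OF h(1,2)] by (rule ex_in_conv[THEN iffD1, OF exI])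
qed

lemma busemann_dX:
  assumes v: "isotropic_family v" and EF: "E \<in> X" "F \<in> X"
  shows "\<bar>busemann l v F - busemann l v E\<bar> \<le> sqrt (2 * (\<Sum>i<p. (l i)\<^sup>2)) * dX E F"
proof -
  define c where "c = sqrt (2 * (\<Sum>i<p. (l i)\<^sup>2))"
  have c0: "c \<ge> 0" by (simp add: c_def sum_nonneg)
  define S where "S = {L. \<exists>\<gamma>. curve_of_length p E0 \<Phi> \<gamma> L \<and> \<gamma> 0 = E \<and> \<gamma> 1 = F}"
  have ne: "S \<noteq> {}" unfolding S_def by (rule lengths_nonempty[OF EF])
  have dS: "dX E F = Inf S" by (simp add: X_dist_def S_def)
  have b: "\<bar>busemann l v F - busemann l v E\<bar> \<le> c * L" if "L \<in> S" for L
    using that busemann_lipschitz[OF v, of _ L l] unfolding c_def S_def by auto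
  show ?thesis
  proof (cases "c = 0")
    case True
    obtain L where "L \<in> S" using ne by blast
    from b[OF this] show ?thesis using True unfolding c_def by simp
  next
    case False
    then have cp: "c > 0" using c0 by simp
    have "\<bar>busemann l v F - busemann l v E\<bar> / c \<le> Inf S"
      by (rule cInf_greatest[OF ne]) (use b cp in \<open>simp add: divide_le_eq mult.commute\<close>)
    then show ?thesis using cp unfolding dS c_def[symmetric] by (simp add: divide_le_eq mult.commute)
  qed
qed

lemma curve_set_image:
  assumes h: "form_iso h g"
  shows "{L. \<exists>\<gamma>. curve_of_length p E0 \<Phi> \<gamma> L \<and> \<gamma> 0 = E \<and> \<gamma> 1 = F}
     \<subseteq> {L. \<exists>\<gamma>. curve_of_length p E0 \<Phi> \<gamma> L \<and> \<gamma> 0 = h ` E \<and> \<gamma> 1 = h ` F}"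
proof
  fix L assume "L \<in> {L. \<exists>\<gamma>. curve_of_length p E0 \<Phi> \<gamma> L \<and> \<gamma> 0 = E \<and> \<gamma> 1 = F}"
  then obtain \<gamma> where "curve_of_length p E0 \<Phi> \<gamma> L" "\<gamma> 0 = E" "\<gamma> 1 = F" by blast
  then show "L \<in> {L. \<exists>\<gamma>. curve_of_length p E0 \<Phi> \<gamma> L \<and> \<gamma> 0 = h ` E \<and> \<gamma> 1 = h ` F}"
    using curve_image[OF h] by (intro CollectI exI[of _ "\<lambda>t. h ` \<gamma> t"]) simp
qed

lemma dX_image:
  assumes h: "form_iso h g"
  shows "dX (h ` E) (h ` F) = dX E F"
proof -
  have g: "g ` h ` E = E" "g ` h ` F = F" by (simp_all add: image_image form_isoD[OF h])
  have "{L. \<exists>\<gamma>. curve_of_length p E0 \<Phi> \<gamma> L \<and> \<gamma> 0 = h ` E \<and> \<gamma> 1 = h ` F}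
     \<subseteq> {L. \<exists>\<gamma>. curve_of_length p E0 \<Phi> \<gamma> L \<and> \<gamma> 0 = E \<and> \<gamma> 1 = F}"
    using curve_set_image[OF form_iso_inv[OF h], of "h ` E" "h ` F"] unfolding g .
  then have "{L. \<exists>\<gamma>. curve_of_length p E0 \<Phi> \<gamma> L \<and> \<gamma> 0 = h ` E \<and> \<gamma> 1 = h ` F}
     = {L. \<exists>\<gamma>. curve_of_length p E0 \<Phi> \<gamma> L \<and> \<gamma> 0 = E \<and> \<gamma> 1 = F}"
    using curve_set_image[OF h] by (rule subset_antisym)
  then show ?thesis unfolding X_dist_def by (rule arg_cong)
qed

text \<open>The flag consists of the isotropic vectors \<open>e i + n i\<close>, weighted by the
  singular values. They stay orthogonal eigenvectors of \<open>pos_form\<close> along the whole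
  geodesic, so Gram-Schmidt leaves them unchanged and the function decreases linearly with the
  largest slope that \<open>busemann_lipschitz\<close> permits.\<close>

lemma busemann_function:
  assumes A: "A \<in> pp"
  shows "\<exists>l v. isotropic_family v \<and> sqrt (2 * (\<Sum>i<p. (l i)\<^sup>2)) = N A \<and> busemann l v E0 - busemann l v (ex 1 A ` E0) = (N A)\<^sup>2"
proof -
  obtain e n l where f: "frame e n" and As: "A = frame_op e n l" using pp_svd[OF A] by blast
  define v where "v i = e i + n i" for i
  note fi = frame_inner[OF f]
  have vv: "v i \<bullet> v j = (if i = j then 2 else 0)" if "i < p" "j < p" for i j
    using fi[OF that] by (simp add: v_def inner_add_left inner_add_right)
  have iso: "v i \<bullet> \<Phi> (v j) = 0" if "i < p" "j < p" for i j
    using fi[OF that] fi(7,8)[OF that(2,2)] by (simp add: v_def blinfun.add_right inner_add_left inner_diff_right)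
  have "v i \<notin> span (v ` {..<i})" if i: "i < p" for i
  proof
    assume s: "v i \<in> span (v ` {..<i})"
    have "orthogonal (v i) (v i)"
    proof (rule orthogonal_to_span[OF s])
      fix y assume "y \<in> v ` {..<i}"
      then obtain j where "j < i" "y = v j" by auto
      then show "orthogonal (v i) y" using vv[OF i, of j] i by (simp add: orthogonal_def)
    qed
    then show False using vv[OF i i] by (simp add: orthogonal_def)
  qed
  then have v: "isotropic_family v" using iso by (simp add: isotropic_family_def)
  have Nl: "N A = sqrt (2 * (\<Sum>i<p. (l i)\<^sup>2))" unfolding As by (rule N_frame_op[OF f])
  have eig: "pos_form (ex t A ` E0) (v i) = exp (- 2 * t * l i) *\<^sub>R v i" if i: "i < p" for t i
  proof -
    have "reflector (id_blinfun ` ex t A ` E0) = id_blinfun o\<^sub>L (ex (2 * t) A o\<^sub>L \<Phi>) o\<^sub>L id_blinfun" by (rule reflector_line[OF form_iso_id A])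
    then have "reflector (ex t A ` E0) (v i) = ex (2 * t) A (\<Phi> (v i))" by simp
    then have "pos_form (ex t A ` E0) (v i) = ex (- (2 * t)) A (v i)" by (simp add: pos_form_apply ex_Phi[OF A])
    also have "\<dots> = exp (- (2 * t) * l i) *\<^sub>R v i"
      by (rule ex_eigen[OF A]) (simp add: As v_def blinfun.add_right frame_op_frame[OF f i] scaleR_add_right add.commute)
    finally show ?thesis by simp
  qed
  have X: "ex t A ` E0 \<in> X" for t by (rule image_X[OF form_iso_ex[OF A] E0_X])
  have b: "busemann l v (ex t A ` E0) = (\<Sum>i<p. l i * (ln 2 - 2 * t * l i))" for t
  proof -
    have gram_schmidt: "gram_schmidt (pos_form (ex t A ` E0)) v i = v i" if "i < p" for i
    proof (rule gram_schmidt_orthogonal_family[where m=p, OF pos_form_props[OF X] _ that])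
      fix i j assume "i < j" "j < p"
      then show "v j \<bullet> pos_form (ex t A ` E0) (v i) = 0" using eig[of i t] vv[of j i] by simp
    qed
    have "l i * ln (gram_schmidt (pos_form (ex t A ` E0)) v i \<bullet> pos_form (ex t A ` E0) (gram_schmidt (pos_form (ex t A ` E0)) v i)) = l i * (ln 2 - 2 * t * l i)"
      if i: "i < p" for i
      unfolding gram_schmidt[OF i] eig[OF i] inner_scaleR_right vv[OF i i] by (simp add: ln_mult)
    then show ?thesis unfolding busemann_def by (intro sum.cong) auto
  qed
  have "busemann l v E0 = (\<Sum>i<p. l i * ln 2)" using b[of 0] ex_0[OF A] by simp
  then have "busemann l v E0 - busemann l v (ex 1 A ` E0) = (\<Sum>i<p. l i * ln 2 - l i * (ln 2 - 2 * l i))"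
    using b[of 1] by (simp add: sum_subtractf)
  also have "\<dots> = 2 * (\<Sum>i<p. (l i)\<^sup>2)" by (simp add: sum_distrib_left algebra_simps power2_eq_square)
  also have "\<dots> = (N A)\<^sup>2" unfolding Nl by (simp add: sum_nonneg)
  finally show ?thesis using v Nl by (intro exI[of _ l] exI[of _ v]) simp
qed

lemma dX_E0: assumes A: "A \<in> pp" shows "dX E0 (ex 1 A ` E0) = N A"
proof (rule antisym)
  show "dX E0 (ex 1 A ` E0) \<le> N A" using dX_le[OF form_iso_id A] by simp
  obtain l v where v: "isotropic_family v" "sqrt (2 * (\<Sum>i<p. (l i)\<^sup>2)) = N A" "busemann l v E0 - busemann l v (ex 1 A ` E0) = (N A)\<^sup>2"
    using busemann_function[OF A] by blast
  have XA: "ex 1 A ` E0 \<in> X" by (rule image_X[OF form_iso_ex[OF A] E0_X])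
  have "\<bar>busemann l v (ex 1 A ` E0) - busemann l v E0\<bar> \<le> N A * dX E0 (ex 1 A ` E0)"
    using busemann_dX[OF v(1) E0_X XA, of l] unfolding v(2) .
  then have le: "(N A)\<^sup>2 \<le> N A * dX E0 (ex 1 A ` E0)"
    unfolding v(3)[symmetric] by linarith
  have nn: "0 \<le> dX E0 (ex 1 A ` E0)"
    unfolding X_dist_def by (rule cInf_greatest[OF lengths_nonempty[OF E0_X XA]])
      (use curve_length_nonneg in blast)
  show "N A \<le> dX E0 (ex 1 A ` E0)"
  proof (cases "N A = 0")
    case False
    then have "N A > 0" using N_nonneg[of A] by simp
    then show ?thesis using le by (simp add: power2_eq_square)
  qed (use nn in simp)
qed

lemma dX_line:
  assumes h: "form_iso h g" and A: "A \<in> pp" shows "dX (h ` E0) (h ` ex 1 A ` E0) = N A"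
  unfolding dX_image[OF h] by (rule dX_E0[OF A])

lemma N_scale: "N (c *\<^sub>R A) = \<bar>c\<bar> * N A"
proof -
  have "(\<Sum>i<p. (norm ((c *\<^sub>R A) (basis_E0 i)))\<^sup>2) = c\<^sup>2 * (\<Sum>i<p. (norm (A (basis_E0 i)))\<^sup>2)"
    by (simp add: blinfun.scaleR_left power_mult_distrib sum_distrib_left)
  then have "N (c *\<^sub>R A) = sqrt (c\<^sup>2 * (2 * (\<Sum>i<p. (norm (A (basis_E0 i)))\<^sup>2)))" unfolding N_def by (simp add: mult.left_commute)
  then show ?thesis unfolding real_sqrt_mult N_def by simp
qed

lemma ex_scale: "ex t (c *\<^sub>R A) = ex (t * c) A" by (simp add: ex_def)

lemma line_shift:
  assumes A: "A \<in> pp" shows "ex t A ` E0 = ex s A ` ex 1 ((t - s) *\<^sub>R A) ` E0"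
proof -
  have "ex t A = ex s A o\<^sub>L ex (t - s) A" using ex_add[OF A, of s "t - s"] by simp
  then have "ex t A x = ex s A (ex 1 ((t - s) *\<^sub>R A) x)" for x by (simp add: ex_scale)
  then show ?thesis unfolding image_image by (intro image_cong refl)
qed

lemma dX_line2:
  assumes h: "form_iso h g" and A: "A \<in> pp" shows "dX (h ` ex s A ` E0) (h ` ex t A ` E0) = \<bar>t - s\<bar> * N A"
  unfolding dX_image[OF h] line_shift[OF A, of t s] dX_image[OF form_iso_ex[OF A]] dX_E0[OF pp_scale[OF A]] N_scale ..

lemma N_zero_iff: assumes A: "A \<in> pp" shows "N A = 0 \<longleftrightarrow> A = 0"
proof
  assume "N A = 0"
  then have "(\<Sum>i<p. (norm (A (basis_E0 i)))\<^sup>2) = 0" by (simp add: N_def)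
  then have "A (basis_E0 i) = 0" if "i < p" for i using that by (simp add: sum_nonneg_eq_0_iff)
  then show "A = 0" by (intro pp_eqI[OF A pp_zero onE_basis_E0]) simp
qed (simp add: N_def)

lemma dX_nonneg: assumes "E \<in> X" "F \<in> X" shows "dX E F \<ge> 0"
proof -
  obtain h g A where h: "form_iso h g" "A \<in> pp" "E = h ` E0" "F = h ` ex 1 A ` E0" using X_pair[OF assms] .
  show ?thesis unfolding h(3,4) dX_line[OF h(1,2)] by (rule N_nonneg)
qed

lemma dX_zero: assumes "E \<in> X" "F \<in> X" shows "dX E F = 0 \<longleftrightarrow> E = F"
proof -
  obtain h g A where h: "form_iso h g" "A \<in> pp" "E = h ` E0" "F = h ` ex 1 A ` E0" using X_pair[OF assms] .
  have d: "dX E F = N A" unfolding h(3,4) by (rule dX_line[OF h(1,2)])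
  have E00: "ex 1 0 ` E0 = E0" using line_0[OF pp_zero, of id_blinfun] ex_scale[of 1 0 "0::'a \<Rightarrow>\<^sub>L 'a"] by simp
  have "dX E E = N 0" using dX_line[OF h(1) pp_zero] unfolding E00 h(3)[symmetric] .
  then have "dX E E = 0" using N_zero_iff[OF pp_zero] by simp
  moreover have "E = F" if "N A = 0"
  proof -
    have "A = 0" using that N_zero_iff[OF h(2)] by simp
    then show ?thesis using h(3,4) E00 by simp
  qed
  ultimately show ?thesis using d by auto
qed

lemma dX_sym: assumes "E \<in> X" "F \<in> X" shows "dX E F = dX F E"
proof -
  obtain h g A where h: "form_iso h g" "A \<in> pp" "E = h ` E0" "F = h ` ex 1 A ` E0" using X_pair[OF assms] .
  have E: "E = h ` ex 0 A ` E0" unfolding h(3) by (rule line_0[OF h(2), symmetric])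
  show ?thesis unfolding E h(4) dX_line2[OF h(1,2)] by simp
qed

text \<open>Curves are not concatenated: the Busemann function of the geodesic from \<open>E\<close>
  to \<open>F\<close> drops by \<open>(N A)\<^sup>2\<close> in total, and on each of the two legs by
  at most \<open>N A\<close> times the distance.\<close>

lemma dX_tri: assumes E: "E \<in> X" and G: "G \<in> X" and F: "F \<in> X" shows "dX E F \<le> dX E G + dX G F"
proof -
  obtain h g A where h: "form_iso h g" and A: "A \<in> pp" and EF: "E = h ` E0" "F = h ` ex 1 A ` E0" using X_pair[OF E F] .
  obtain l v where v: "isotropic_family v" "sqrt (2 * (\<Sum>i<p. (l i)\<^sup>2)) = N A" "busemann l v E0 - busemann l v (ex 1 A ` E0) = (N A)\<^sup>2"
    using busemann_function[OF A] by blast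
  have gG: "g ` G \<in> X" by (rule image_X[OF form_iso_inv[OF h] G])
  have XA: "ex 1 A ` E0 \<in> X" by (rule image_X[OF form_iso_ex[OF A] E0_X])
  have G': "h ` g ` G = G" by (simp add: image_image form_isoD[OF h])
  have d1: "dX E0 (g ` G) = dX E G" using dX_image[OF h, of E0 "g ` G"] unfolding G' EF(1) by simp
  have d2: "dX (g ` G) (ex 1 A ` E0) = dX G F" using dX_image[OF h, of "g ` G" "ex 1 A ` E0"] unfolding G' EF(2) by simp
  have b1: "\<bar>busemann l v (g ` G) - busemann l v E0\<bar> \<le> N A * dX E G"
    using busemann_dX[OF v(1) E0_X gG, of l] unfolding v(2) d1 .
  have b2: "\<bar>busemann l v (ex 1 A ` E0) - busemann l v (g ` G)\<bar> \<le> N A * dX G F"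
    using busemann_dX[OF v(1) gG XA, of l] unfolding v(2) d2 .
  have le: "N A * N A \<le> N A * (dX E G + dX G F)"
    using b1 b2 v(3) by (simp add: power2_eq_square distrib_left)
  have d: "dX E F = N A" unfolding EF by (rule dX_line[OF h A])
  show ?thesis
  proof (cases "N A = 0")
    case True
    then show ?thesis using d dX_nonneg[OF E G] dX_nonneg[OF G F] by simp
  next
    case False
    then have "N A > 0" using N_nonneg[of A] by simp
    then show ?thesis using le d by simp
  qed
qed

section \<open>Geodesic symmetries\<close>

definition geo_sym :: "'a set \<Rightarrow> 'a set \<Rightarrow> 'a set" where "geo_sym M E = reflector M ` E"

lemma form_iso_reflector: assumes "M \<in> X" shows "form_iso (reflector M) (reflector M)"
  unfolding form_iso_def using reflector_props[OF assms] by simp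

lemma geo_sym_line:
  assumes h: "form_iso h g" and A: "A \<in> pp"
  shows "geo_sym (h ` ex s A ` E0) (h ` ex t A ` E0) = h ` ex (2 * s - t) A ` E0"
proof -
  have "reflector (h ` ex s A ` E0) (h (ex t A x)) = h (ex (2 * s - t) A x)" if "x \<in> E0" for x
  proof -
    have "reflector (h ` ex s A ` E0) (h (ex t A x)) = h (ex (2 * s) A (\<Phi> (ex t A x)))"
      using reflector_line[OF h A] by (simp add: form_isoD[OF h])
    also have "\<dots> = h (ex (2 * s) A (ex (- t) A x))" using ex_Phi[OF A] PhiE[OF that] by simp
    also have "\<dots> = h (ex (2 * s - t) A x)" using ex_add[OF A, of "2 * s" "- t"] by simp
    finally show ?thesis .
  qed
  then show ?thesis unfolding geo_sym_def image_image by (intro image_cong refl)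
qed

sublocale refl: reflection_space X dX geo_sym
proof
  fix m x y assume m: "m \<in> X" and x: "x \<in> X"
  show "geo_sym m x \<in> X" unfolding geo_sym_def by (rule image_X[OF form_iso_reflector[OF m] x])
  show "geo_sym m (geo_sym m x) = x" unfolding geo_sym_def by (simp add: image_image reflector_props(1)[OF m])
  show "dX (geo_sym m x) (geo_sym m y) = dX x y" unfolding geo_sym_def by (rule dX_image[OF form_iso_reflector[OF m]])
  \<comment> \<open>Any two points lie on a common geodesic. The symmetry at parameter 0 sends
    parameter 1 to parameter \<open>-1\<close>, which is where the factor 2 comes from.\<close>
  obtain h g A where h: "form_iso h g" "A \<in> pp" "m = h ` E0" "x = h ` ex 1 A ` E0" using X_pair[OF m x] .
  have m': "m = h ` ex 0 A ` E0" unfolding h(3) by (rule line_0[OF h(2), symmetric])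
  show "dX (geo_sym m x) x = 2 * dX m x"
    unfolding m' h(4) geo_sym_line[OF h(1,2)] dX_line2[OF h(1,2)] by simp
next
  fix x y z assume x: "x \<in> X" and y: "y \<in> X"
  show "dX x y = dX y x" by (rule dX_sym[OF x y])
  show "0 \<le> dX x y" by (rule dX_nonneg[OF x y])
  show "(dX x y = 0) = (x = y)" by (rule dX_zero[OF x y])
  show "z \<in> X \<Longrightarrow> dX x z \<le> dX x y + dX y z" by (rule dX_tri[OF x y])
qed

lemma midpoint_exists:
  assumes "E \<in> X" "F \<in> X" shows "\<exists>M\<in>X. geo_sym M E = F"
proof -
  obtain h g A where h: "form_iso h g" "A \<in> pp" "E = h ` E0" "F = h ` ex 1 A ` E0" using X_pair[OF assms] .
  have E: "E = h ` ex 0 A ` E0" unfolding h(3) by (rule line_0[OF h(2), symmetric])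
  have "geo_sym (h ` ex (1/2) A ` E0) E = F" unfolding E h(4) geo_sym_line[OF h(1,2)] by simp
  then show ?thesis using ex_X[OF h(1,2)] by (rule bexI)
qed

text \<open>Some symmetry exchanges \<open>f F\<close> with \<open>f (geo_sym E F)\<close>; by
  \<open>isometry_midpoint\<close> its centre can only be \<open>f E\<close>.\<close>

lemma isometry_geo_sym:
  assumes f: "refl.isometry f" and E: "E \<in> X" and F: "F \<in> X"
  shows "f (geo_sym E F) = geo_sym (f E) (f F)"
proof -
  have fF: "f F \<in> X" by (rule refl.isometry_in[OF f F])
  have fs: "f (geo_sym E F) \<in> X" by (rule refl.isometry_in[OF f refl.s_in[OF E F]])
  obtain M where M: "M \<in> X" "geo_sym M (f F) = f (geo_sym E F)" using midpoint_exists[OF fF fs] by (rule bexE)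
  have "f E = M" by (rule refl.isometry_midpoint[OF f E F M])
  then show ?thesis using M(2) by simp
qed

lemma ge_X: "A \<in> pp \<Longrightarrow> ex t A ` E0 \<in> X" by (rule image_X[OF form_iso_ex E0_X])

text \<open>\<open>B\<close> is read off at parameter 1. The set of parameters where the two sides
  agree contains 0 and 1 and is stable under \<open>2 * s - t\<close> and halving, so it contains
  all dyadic rationals; as both sides are Lipschitz, it is everything.\<close>

lemma isometry_geodesic:
  assumes f: "refl.isometry f" and f0: "f E0 = E0" and A: "A \<in> pp"
  shows "\<exists>B\<in>pp. \<forall>t. f (ex t A ` E0) = ex t B ` E0"
proof -
  obtain B where B: "B \<in> pp" "f (ex 1 A ` E0) = ex 1 B ` E0"
    using X_ex_frame[OF refl.isometry_in[OF f ge_X[OF A, of 1]]] by (rule bexE)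
  have l0: "ex 0 C ` E0 = E0" if "C \<in> pp" for C using ex_0[OF that] by simp
  have syl: "geo_sym (ex s C ` E0) (ex t C ` E0) = ex (2 * s - t) C ` E0" if "C \<in> pp" for s t C
    using geo_sym_line[OF form_iso_id that, of s t] by simp
  have dl: "dX (ex s C ` E0) (ex t C ` E0) = \<bar>t - s\<bar> * N C" if "C \<in> pp" for s t C
    using dX_line2[OF form_iso_id that, of s t] by simp
  define P where "P t \<longleftrightarrow> f (ex t A ` E0) = ex t B ` E0" for t
  have P0: "P 0" using f0 l0[OF A] l0[OF B(1)] by (simp add: P_def)
  have P1: "P 1" using B(2) by (simp add: P_def)
  have Pref: "P (2 * s - t)" if "P s" "P t" for s t
  proof -
    have "f (ex (2 * s - t) A ` E0) = f (geo_sym (ex s A ` E0) (ex t A ` E0))" unfolding syl[OF A] ..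
    also have "\<dots> = geo_sym (f (ex s A ` E0)) (f (ex t A ` E0))" by (rule isometry_geo_sym[OF f ge_X[OF A] ge_X[OF A]])
    also have "\<dots> = ex (2 * s - t) B ` E0" using that unfolding P_def by (simp add: syl[OF B(1)])
    finally show ?thesis by (simp add: P_def)
  qed
  have Phalf: "P (t / 2)" if "P t" for t
    unfolding P_def
  proof (rule refl.isometry_midpoint[OF f ge_X[OF A] ge_X[OF A, of 0] ge_X[OF B(1)]])
    have "geo_sym (ex (t / 2) B ` E0) (f (ex 0 A ` E0)) = ex t B ` E0"
      using P0 unfolding P_def by (simp add: syl[OF B(1)])
    also have "\<dots> = f (geo_sym (ex (t / 2) A ` E0) (ex 0 A ` E0))" using that unfolding P_def by (simp add: syl[OF A])
    finally show "geo_sym (ex (t / 2) B ` E0) (f (ex 0 A ` E0)) = f (geo_sym (ex (t / 2) A ` E0) (ex 0 A ` E0))" .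
  qed
  have Pnat: "P (real n) \<and> P (real (Suc n))" for n
  proof (induction n)
    case 0 then show ?case using P0 P1 by simp
  next
    case (Suc n)
    have "P (2 * real (Suc n) - real n)" by (rule Pref) (use Suc in auto)
    moreover have "2 * real (Suc n) - real n = real (Suc (Suc n))" by simp
    ultimately have "P (real (Suc (Suc n)))" by (simp only:)
    then show ?case using Suc by blast
  qed
  have Pint: "P (real_of_int k)" for k
  proof (cases "k \<ge> 0")
    case True
    then show ?thesis using Pnat[of "nat k"] by simp
  next
    case False
    have "P (2 * 0 - real (nat (- k)))" by (rule Pref[OF P0]) (use Pnat in blast)
    then show ?thesis using False by simp
  qed
  have Pdy: "P (real_of_int k / 2 ^ m)" for k m
  proof (induction m)
    case 0 then show ?case using Pint by simp
  next
    case (Suc m)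
    have "real_of_int k / 2 ^ Suc m = (real_of_int k / 2 ^ m) / 2" by simp
    then show ?case using Phalf[OF Suc.IH] by (simp only:)
  qed
  have "f (ex t A ` E0) = ex t B ` E0" for t
  proof -
    define c where "c = N A + N B"
    have fX: "f (ex u A ` E0) \<in> X" for u by (rule refl.isometry_in[OF f ge_X[OF A]])
    have bd: "dX (f (ex t A ` E0)) (ex t B ` E0) \<le> c / 2 ^ m" for m
    proof -
      define u where "u = real_of_int \<lfloor>t * 2 ^ m\<rfloor> / 2 ^ m"
      have "\<bar>t * 2 ^ m - real_of_int \<lfloor>t * 2 ^ m\<rfloor>\<bar> \<le> 1" by linarith
      moreover have "t - u = (t * 2 ^ m - real_of_int \<lfloor>t * 2 ^ m\<rfloor>) / 2 ^ m" by (simp add: u_def diff_divide_distrib)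
      ultimately have tu: "\<bar>t - u\<bar> \<le> 1 / 2 ^ m" by (simp add: abs_divide divide_right_mono)
      have Pu: "f (ex u A ` E0) = ex u B ` E0" using Pdy unfolding P_def u_def .
      have "dX (f (ex t A ` E0)) (ex t B ` E0) \<le> dX (f (ex t A ` E0)) (f (ex u A ` E0)) + dX (f (ex u A ` E0)) (ex t B ` E0)"
        by (rule dX_tri[OF fX fX ge_X[OF B(1)]])
      also have "dX (f (ex t A ` E0)) (f (ex u A ` E0)) = dX (ex t A ` E0) (ex u A ` E0)"
        using f ge_X[OF A] unfolding refl.isometry_def by simp
      also have "\<dots> = \<bar>u - t\<bar> * N A" by (rule dl[OF A])
      also have "dX (f (ex u A ` E0)) (ex t B ` E0) = \<bar>t - u\<bar> * N B" unfolding Pu by (rule dl[OF B(1)])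
      also have "\<bar>u - t\<bar> * N A + \<bar>t - u\<bar> * N B = \<bar>t - u\<bar> * c" by (simp add: c_def abs_minus_commute distrib_left)
      also have "\<dots> \<le> (1 / 2 ^ m) * c" by (rule mult_right_mono[OF tu]) (simp add: c_def N_nonneg)
      finally show ?thesis by simp
    qed
    have "(\<lambda>m. c * (1 / 2) ^ m) \<longlonglongrightarrow> c * 0" by (intro tendsto_mult tendsto_const LIMSEQ_realpow_zero) auto
    then have "(\<lambda>m. c / 2 ^ m) \<longlonglongrightarrow> 0" by (simp add: power_divide)
    then have "dX (f (ex t A ` E0)) (ex t B ` E0) \<le> 0" by (rule LIMSEQ_le_const) (use bd in blast)
    then have "dX (f (ex t A ` E0)) (ex t B ` E0) = 0" using dX_nonneg[OF fX ge_X[OF B(1)]] by (rule antisym)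
    then show ?thesis using dX_zero[OF fX ge_X[OF B(1)]] by blast
  qed
  then show ?thesis by (intro bexI[OF _ B(1)] allI)
qed

end

section \<open>The differential of an isometry\<close>

lemma sinh_bounds:
  fixes x :: real
  assumes "x \<ge> 0"
  shows "x \<le> sinh x" "sinh x \<le> x * cosh x"
proof -
  have "x \<le> sinh x \<and> sinh x \<le> x * cosh x"
  proof (cases "x = 0")
    case False
    then have x: "0 < x" using assms by simp
    have "\<exists>z. 0 < z \<and> z < x \<and> sinh x - sinh 0 = (x - 0) * cosh z"
      by (rule MVT2[OF x]) (auto intro!: derivative_eq_intros)
    then obtain z where z: "0 < z" "z < x" "sinh x = x * cosh z" by auto
    have "1 \<le> cosh z" by (rule cosh_real_ge_1)
    moreover have "cosh z \<le> cosh x" using z cosh_real_nonneg_le_iff[of z x] by simp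
    ultimately show ?thesis using x z(3) by simp
  qed simp
  then show "x \<le> sinh x" "sinh x \<le> x * cosh x" by blast+
qed

context hilbert_splitting
begin

text \<open>Half of the Hilbert-Schmidt inner product on \<open>pp\<close>; see
  \<open>N_inner_pp\<close>.\<close>

definition inner_pp :: "('a \<Rightarrow>\<^sub>L 'a) \<Rightarrow> ('a \<Rightarrow>\<^sub>L 'a) \<Rightarrow> real" where
  "inner_pp A B = (\<Sum>i<p. A (basis_E0 i) \<bullet> B (basis_E0 i))"

lemma N_inner_pp: "(N A)\<^sup>2 = 2 * inner_pp A A"
  by (simp add: N_def inner_pp_def sum_nonneg power2_norm_eq_inner)

lemma inner_pp_simps:
  "inner_pp (A + B) C = inner_pp A C + inner_pp B C" "inner_pp C (A + B) = inner_pp C A + inner_pp C B"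
  "inner_pp (A - B) C = inner_pp A C - inner_pp B C" "inner_pp C (A - B) = inner_pp C A - inner_pp C B"
  "inner_pp (c *\<^sub>R A) C = c * inner_pp A C" "inner_pp C (c *\<^sub>R A) = c * inner_pp C A"
  by (simp_all add: inner_pp_def blinfun.add_left blinfun.diff_left blinfun.scaleR_left inner_add_left inner_add_right
      inner_diff_left inner_diff_right sum.distrib sum_subtractf sum_distrib_left)

lemma inner_pp_commute: "inner_pp A B = inner_pp B A"
  by (simp add: inner_pp_def inner_commute)

lemma inner_pp_polar: "inner_pp A B = ((N A)\<^sup>2 + (N B)\<^sup>2 - (N (A - B))\<^sup>2) / 4"
  unfolding N_inner_pp by (simp add: inner_pp_simps inner_pp_commute[of B A])

lemma inner_pp_zero: assumes "A \<in> pp" "inner_pp A A = 0" shows "A = 0"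
  using N_zero_iff[OF assms(1)] N_inner_pp[of A] assms(2) by simp

lemma N_tendsto: "(f \<longlongrightarrow> l) F \<Longrightarrow> ((\<lambda>x. N (f x)) \<longlongrightarrow> N l) F"
  unfolding N_def by (intro tendsto_intros bounded_bilinear.tendsto[OF bounded_bilinear_blinfun_apply])

text \<open>The left-hand side is the hyperbolic sine of twice the operator, an element of
  \<open>pp\<close> that can be computed from products of exponentials when the operator itself is
  only known implicitly.\<close>

lemma sinh_frame:
  assumes f: "frame e n"
  shows "(1/2) *\<^sub>R (ex 2 (frame_op e n l) - ex (- 2) (frame_op e n l)) = frame_op e n (\<lambda>i. sinh (2 * l i))"
proof (rule pp_eqI[OF _ frame_op_pp[OF f]])
  note A = frame_op_pp[OF f, of l]
  show "(1/2) *\<^sub>R (ex 2 (frame_op e n l) - ex (- 2) (frame_op e n l)) \<in> pp"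
    unfolding pp_def
  proof (intro CollectI conjI allI)
    fix x y
    show "((1/2) *\<^sub>R (ex 2 (frame_op e n l) - ex (- 2) (frame_op e n l))) x \<bullet> y = x \<bullet> ((1/2) *\<^sub>R (ex 2 (frame_op e n l) - ex (- 2) (frame_op e n l))) y"
      by (simp add: blinfun.scaleR_left blinfun.diff_left inner_diff_left inner_diff_right ex_sym[OF A])
  next
    fix x
    have 1: "ex t (frame_op e n l) (\<Phi> x) = \<Phi> (ex (- t) (frame_op e n l) x)" for t using ex_Phi[OF A, of "- t" x] by simp
    show "((1/2) *\<^sub>R (ex 2 (frame_op e n l) - ex (- 2) (frame_op e n l))) (\<Phi> x) = - \<Phi> (((1/2) *\<^sub>R (ex 2 (frame_op e n l) - ex (- 2) (frame_op e n l))) x)"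
      by (simp add: blinfun.scaleR_left blinfun.diff_left blinfun.scaleR_right blinfun.diff_right 1 flip: scaleR_minus_right)
  qed
  show "onE e" using f by (simp add: frame_def)
  fix i assume i: "i < p"
  have "ex 2 (frame_op e n l) (e i) - ex (- 2) (frame_op e n l) (e i) = 2 *\<^sub>R (sinh (2 * l i) *\<^sub>R n i)"
    unfolding ex_frame[OF f i] scaleR_2 by simp
  then show "((1/2) *\<^sub>R (ex 2 (frame_op e n l) - ex (- 2) (frame_op e n l))) (e i) = frame_op e n (\<lambda>i. sinh (2 * l i)) (e i)"
    unfolding frame_op_frame(1)[OF f i] by (simp add: blinfun.scaleR_left blinfun.diff_left)
qed

text \<open>Apply \<open>sinh_bounds\<close> to each singular value. The individual factors
  \<open>cosh (2 * l i)\<close> may be replaced by \<open>cosh (N S)\<close>, since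
  \<open>2 * l i \<le> sinh (2 * l i) \<le> N S\<close>; the resulting bound involves only
  \<open>S\<close>, which tends to 0 in the application.\<close>

lemma N_sinh_bounds:
  assumes A: "A \<in> pp"
  defines "S \<equiv> (1/2) *\<^sub>R (ex 2 A - ex (- 2) A)"
  shows "2 * N A \<le> N S" "N S \<le> 2 * N A * cosh (N S)"
proof -
  obtain e n l where f: "frame e n" and l: "\<And>i. i < p \<Longrightarrow> l i \<ge> 0" and As: "A = frame_op e n l" using pp_svd[OF A] by blast
  have S: "S = frame_op e n (\<lambda>i. sinh (2 * l i))" unfolding S_def As by (rule sinh_frame[OF f])
  have NS: "N S = sqrt (2 * (\<Sum>i<p. (sinh (2 * l i))\<^sup>2))" unfolding S by (rule N_frame_op[OF f])
  have NA: "2 * N A = sqrt (2 * (\<Sum>i<p. (2 * l i)\<^sup>2))"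
  proof -
    have "2 * N A = N (2 *\<^sub>R A)" by (simp add: N_scale)
    also have "2 *\<^sub>R A = frame_op e n (\<lambda>i. 2 * l i)" unfolding As frame_op_def by (simp add: scaleR_sum_right)
    also have "N (frame_op e n (\<lambda>i. 2 * l i)) = sqrt (2 * (\<Sum>i<p. (2 * l i)\<^sup>2))" by (rule N_frame_op[OF f])
    finally show ?thesis .
  qed
  have le: "2 * l i \<le> sinh (2 * l i)" "sinh (2 * l i) \<le> 2 * l i * cosh (2 * l i)" if "i < p" for i
    using sinh_bounds[of "2 * l i"] l[OF that] by simp_all
  have "(\<Sum>i<p. (2 * l i)\<^sup>2) \<le> (\<Sum>i<p. (sinh (2 * l i))\<^sup>2)"
    by (rule sum_mono, rule power_mono) (use le l in auto)
  then show "2 * N A \<le> N S" unfolding NS NA by simp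
  have c: "cosh (2 * l i) \<le> cosh (N S)" if i: "i < p" for i
  proof -
    have "(sinh (2 * l i))\<^sup>2 \<le> (\<Sum>i<p. (sinh (2 * l i))\<^sup>2)" by (rule member_le_sum) (use i in auto)
    also have "\<dots> \<le> 2 * (\<Sum>i<p. (sinh (2 * l i))\<^sup>2)" by (simp add: sum_nonneg)
    also have "\<dots> = (N S)\<^sup>2" unfolding NS by (simp add: sum_nonneg)
    finally have "sinh (2 * l i) \<le> N S" by (rule power2_le_imp_le) (rule N_nonneg)
    then have "2 * l i \<le> N S" using le(1)[OF i] by simp
    then show ?thesis using l[OF i] cosh_real_nonneg_le_iff[of "2 * l i" "N S"] N_nonneg by simp
  qed
  have "(sinh (2 * l i))\<^sup>2 \<le> (cosh (N S))\<^sup>2 * (2 * l i)\<^sup>2" if i: "i < p" for i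
  proof -
    have "sinh (2 * l i) \<le> 2 * l i * cosh (N S)"
      using le(2)[OF i] mult_left_mono[OF c[OF i], of "2 * l i"] l[OF i] by simp
    then have "(sinh (2 * l i))\<^sup>2 \<le> (2 * l i * cosh (N S))\<^sup>2" by (rule power_mono) (use l[OF i] in simp)
    then show ?thesis by (simp add: power_mult_distrib mult_ac)
  qed
  then have "(\<Sum>i<p. (sinh (2 * l i))\<^sup>2) \<le> (\<Sum>i<p. (cosh (N S))\<^sup>2 * (2 * l i)\<^sup>2)" by (intro sum_mono) simp
  then have le2: "2 * (\<Sum>i<p. (sinh (2 * l i))\<^sup>2) \<le> (cosh (N S))\<^sup>2 * (2 * (\<Sum>i<p. (2 * l i)\<^sup>2))"
    unfolding sum_distrib_left[symmetric] by simp
  have "N S = sqrt (2 * (\<Sum>i<p. (sinh (2 * l i))\<^sup>2))" by (rule NS)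
  also have "\<dots> \<le> sqrt ((cosh (N S))\<^sup>2 * (2 * (\<Sum>i<p. (2 * l i)\<^sup>2)))" by (rule real_sqrt_le_mono[OF le2])
  also have "\<dots> = cosh (N S) * (2 * N A)" unfolding real_sqrt_mult[of "(cosh (N S))\<^sup>2"] NA by simp
  finally show "N S \<le> 2 * N A * cosh (N S)" by (simp add: mult_ac)
qed

text \<open>The distance is \<open>N C\<close>, where \<open>ex 1 C\<close> carries
  \<open>E0\<close> to \<open>ex (- t) A\<close> ex t B \<open>E0\<close>. This \<open>C\<close> is
  not an explicit function of \<open>t\<close>, but comparing reflectors shows
  \<open>ex 2 C = Z t\<close>, with inverse \<open>Z' t\<close>. So its hyperbolic sine
  \<open>S t\<close> is differentiable at 0, and \<open>N_sinh_bounds\<close> squeezes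
  \<open>N C\<close> between multiples of \<open>N (S t)\<close> whose ratio tends to 1.\<close>

lemma dX_infinitesimal:
  assumes A: "A \<in> pp" and B: "B \<in> pp"
  shows "((\<lambda>t. dX (ex t A ` E0) (ex t B ` E0) / t) \<longlongrightarrow> N (B - A)) (at_right 0)"
proof -
  define Z where "Z t = ex (- t) A o\<^sub>L (ex (2 * t) B) o\<^sub>L ex (- t) A" for t
  define Z' where "Z' t = ex t A o\<^sub>L (ex (- (2 * t)) B) o\<^sub>L ex t A" for t
  define S where "S t = (1/2) *\<^sub>R (Z t - Z' t)" for t
  have exl: "((\<lambda>t. ex (c * t) C) has_vector_derivative c *\<^sub>R C) (at 0)" if C: "C \<in> pp" for c C
    using ex_deriv0[OF pp_scale[OF C, of c]] by (simp add: ex_scale mult.commute)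
  have e0: "ex 0 C = id_blinfun" if "C \<in> pp" for C by (rule ex_0[OF that])
  have vZ: "(Z has_vector_derivative (2 *\<^sub>R B - 2 *\<^sub>R A)) (at 0)"
  proof -
    have "((\<lambda>t. ex ((- 1) * t) A o\<^sub>L ex (2 * t) B o\<^sub>L ex ((- 1) * t) A) has_vector_derivative
      ((ex ((- 1) * 0) A o\<^sub>L ex (2 * 0) B) o\<^sub>L ((- 1) *\<^sub>R A))
      + (((ex ((- 1) * 0) A o\<^sub>L (2 *\<^sub>R B)) + (((- 1) *\<^sub>R A) o\<^sub>L ex (2 * 0) B)) o\<^sub>L ex ((- 1) * 0) A)) (at 0)"
      by (intro vd_compose_blinfun exl[OF A] exl[OF B])
    moreover have "((ex ((- 1) * 0) A o\<^sub>L ex (2 * 0) B) o\<^sub>L ((- 1) *\<^sub>R A))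
      + (((ex ((- 1) * 0) A o\<^sub>L (2 *\<^sub>R B)) + (((- 1) *\<^sub>R A) o\<^sub>L ex (2 * 0) B)) o\<^sub>L ex ((- 1) * 0) A) = 2 *\<^sub>R B - 2 *\<^sub>R A"
      by (rule blinfun_eqI) (simp add: e0[OF A] e0[OF B] blinfun.add_left blinfun.scaleR_left blinfun.diff_left blinfun.minus_left scaleR_2)
    ultimately show ?thesis by (simp add: Z_def[abs_def])
  qed
  have vZ': "(Z' has_vector_derivative (2 *\<^sub>R A - 2 *\<^sub>R B)) (at 0)"
  proof -
    have "((\<lambda>t. ex (1 * t) A o\<^sub>L ex ((- 2) * t) B o\<^sub>L ex (1 * t) A) has_vector_derivative
      ((ex (1 * 0) A o\<^sub>L ex ((- 2) * 0) B) o\<^sub>L (1 *\<^sub>R A))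
      + (((ex (1 * 0) A o\<^sub>L ((- 2) *\<^sub>R B)) + ((1 *\<^sub>R A) o\<^sub>L ex ((- 2) * 0) B)) o\<^sub>L ex (1 * 0) A)) (at 0)"
      by (intro vd_compose_blinfun exl[OF A] exl[OF B])
    moreover have "((ex (1 * 0) A o\<^sub>L ex ((- 2) * 0) B) o\<^sub>L (1 *\<^sub>R A))
      + (((ex (1 * 0) A o\<^sub>L ((- 2) *\<^sub>R B)) + ((1 *\<^sub>R A) o\<^sub>L ex ((- 2) * 0) B)) o\<^sub>L ex (1 * 0) A) = 2 *\<^sub>R A - 2 *\<^sub>R B"
      by (rule blinfun_eqI) (simp add: e0[OF A] e0[OF B] blinfun.add_left blinfun.scaleR_left blinfun.diff_left blinfun.minus_left scaleR_2)
    ultimately show ?thesis by (simp add: Z'_def[abs_def])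
  qed
  have "(S has_vector_derivative (1/2) *\<^sub>R ((2 *\<^sub>R B - 2 *\<^sub>R A) - (2 *\<^sub>R A - 2 *\<^sub>R B))) (at 0)"
    unfolding S_def[abs_def]
    by (intro bounded_linear.has_vector_derivative[OF bounded_linear_scaleR_right] has_vector_derivative_diff vZ vZ')
  moreover have "(1/2) *\<^sub>R ((2 *\<^sub>R B - 2 *\<^sub>R A) - (2 *\<^sub>R A - 2 *\<^sub>R B)) = 2 *\<^sub>R (B - A)"
  proof -
    have e: "2 *\<^sub>R B - 2 *\<^sub>R A = 2 *\<^sub>R (B - A)" "2 *\<^sub>R A - 2 *\<^sub>R B = - (2 *\<^sub>R (B - A))"
      by (simp_all add: scaleR_diff_right)
    have "(1/2) *\<^sub>R (C - - C) = C" for C :: "'a \<Rightarrow>\<^sub>L 'a" by (simp flip: scaleR_2)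
    then show ?thesis unfolding e .
  qed
  ultimately have vS: "(S has_vector_derivative 2 *\<^sub>R (B - A)) (at 0)" by simp
  have S0: "S 0 = 0" by (simp add: S_def Z_def Z'_def e0[OF A] e0[OF B])
  have "((\<lambda>t. (1 / t) *\<^sub>R S t) \<longlongrightarrow> 2 *\<^sub>R (B - A)) (at 0)"
    using vS unfolding has_vector_derivative_iff_quotient S0 by simp
  then have lS: "((\<lambda>t. (1 / t) *\<^sub>R S t) \<longlongrightarrow> 2 *\<^sub>R (B - A)) (at_right 0)"
    by (rule tendsto_within_subset) simp
  have "((\<lambda>t. N ((1 / t) *\<^sub>R S t)) \<longlongrightarrow> N (2 *\<^sub>R (B - A))) (at_right 0)" by (rule N_tendsto[OF lS])
  moreover have "\<forall>\<^sub>F t in at_right 0. N ((1 / t) *\<^sub>R S t) = N (S t) / t"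
    unfolding eventually_at_filter by (rule always_eventually) (simp add: N_scale)
  ultimately have lNS: "((\<lambda>t. N (S t) / t) \<longlongrightarrow> 2 * N (B - A)) (at_right 0)"
    using Lim_transform_eventually[where f="\<lambda>t. N ((1 / t) *\<^sub>R S t)" and g="\<lambda>t. N (S t) / t"] by (simp add: N_scale)
  have "(S \<longlongrightarrow> S 0) (at 0)" using has_vector_derivative_continuous[OF vS] by (simp add: continuous_at)
  then have "(S \<longlongrightarrow> 0) (at_right 0)" unfolding S0 by (rule tendsto_within_subset) simp
  from N_tendsto[OF this] have "((\<lambda>t. N (S t)) \<longlongrightarrow> 0) (at_right 0)" using N_zero_iff[OF pp_zero] by simp
  then have "((\<lambda>t. cosh (N (S t))) \<longlongrightarrow> cosh 0) (at_right 0)" by (rule tendsto_cosh)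
  then have lc: "((\<lambda>t. cosh (N (S t))) \<longlongrightarrow> 1) (at_right 0)" by simp
  have lo: "((\<lambda>t. (N (S t) / t) / cosh (N (S t)) / 2) \<longlongrightarrow> 2 * N (B - A) / 1 / 2) (at_right 0)"
    by (intro tendsto_divide lNS lc tendsto_const) auto
  have up: "((\<lambda>t. (N (S t) / t) / 2) \<longlongrightarrow> 2 * N (B - A) / 2) (at_right 0)"
    by (intro tendsto_divide lNS tendsto_const) auto
  have key: "N (S t) / cosh (N (S t)) \<le> 2 * dX (ex t A ` E0) (ex t B ` E0)" "2 * dX (ex t A ` E0) (ex t B ` E0) \<le> N (S t)" for t
  proof -
    have XE: "ex (- t) A ` ex t B ` E0 \<in> X" by (rule image_X[OF form_iso_ex[OF A] ge_X[OF B]])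
    obtain C where C: "C \<in> pp" "ex (- t) A ` ex t B ` E0 = ex 1 C ` E0" using X_ex_frame[OF XE] by (rule bexE)
    have ret: "ex t A ` ex 1 C ` E0 = ex t B ` E0" unfolding C(2)[symmetric] by (simp add: image_image ex_inv[OF A])
    have d: "dX (ex t A ` E0) (ex t B ` E0) = N C" unfolding ret[symmetric] dX_image[OF form_iso_ex[OF A]] by (rule dX_E0[OF C(1)])
    have J: "reflector (ex 1 C ` E0) = ex (- t) A o\<^sub>L (ex (2 * t) B o\<^sub>L \<Phi>) o\<^sub>L ex t A"
      unfolding C(2)[symmetric] using reflector_line[OF form_iso_ex[OF A, of "- t"] B, of t] by simp
    have J2: "reflector (ex 1 C ` E0) = ex 2 C o\<^sub>L \<Phi>"
    proof -
      have "reflector (id_blinfun ` ex 1 C ` E0) = id_blinfun o\<^sub>L (ex (2 * 1) C o\<^sub>L \<Phi>) o\<^sub>L id_blinfun" by (rule reflector_line[OF form_iso_id C(1)])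
      then show ?thesis by (intro blinfun_eqI) simp
    qed
    have Z: "ex 2 C x = Z t x" for x
    proof -
      have "ex 2 C x = reflector (ex 1 C ` E0) (\<Phi> x)" unfolding J2 by simp
      also have "\<dots> = Z t x" unfolding J Z_def using ex_Phi[OF A, of t "\<Phi> x"] by simp
      finally show ?thesis .
    qed
    have Z': "ex (- 2) C x = Z' t x" for x
    proof -
      have "ex (- 2) C x = \<Phi> (ex 2 C (\<Phi> x))" using ex_Phi[OF C(1), of 2 "\<Phi> x"] by simp
      also have "\<dots> = Z' t x" unfolding Z Z_def Z'_def by (simp add: ex_Phi[OF A] ex_Phi[OF B])
      finally show ?thesis .
    qed
    have "(1/2) *\<^sub>R (ex 2 C - ex (- 2) C) = S t"
      unfolding S_def by (rule blinfun_eqI) (simp add: blinfun.scaleR_left blinfun.diff_left Z Z')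
    then have b: "2 * N C \<le> N (S t)" "N (S t) \<le> 2 * N C * cosh (N (S t))" using N_sinh_bounds[OF C(1)] by simp_all
    show "2 * dX (ex t A ` E0) (ex t B ` E0) \<le> N (S t)" unfolding d by (rule b(1))
    show "N (S t) / cosh (N (S t)) \<le> 2 * dX (ex t A ` E0) (ex t B ` E0)" unfolding d
      using b(2) cosh_real_pos[of "N (S t)"] by (simp add: divide_le_eq)
  qed
  show ?thesis
  proof (rule tendsto_sandwich[OF _ _ _ _])
    show "((\<lambda>t. (N (S t) / t) / cosh (N (S t)) / 2) \<longlongrightarrow> N (B - A)) (at_right 0)" using lo by simp
    show "((\<lambda>t. (N (S t) / t) / 2) \<longlongrightarrow> N (B - A)) (at_right 0)" using up by simp
    show "\<forall>\<^sub>F t in at_right 0. (N (S t) / t) / cosh (N (S t)) / 2 \<le> dX (ex t A ` E0) (ex t B ` E0) / t"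
      unfolding eventually_at_filter
    proof (rule always_eventually, intro allI impI)
      fix t :: real assume "t \<in> {0<..}"
      then have t: "t > 0" by simp
      have "(N (S t) / cosh (N (S t)) / 2) / t \<le> dX (ex t A ` E0) (ex t B ` E0) / t"
        using key(1)[of t] t by (intro divide_right_mono) auto
      then show "(N (S t) / t) / cosh (N (S t)) / 2 \<le> dX (ex t A ` E0) (ex t B ` E0) / t" by (simp add: mult_ac)
    qed
    show "\<forall>\<^sub>F t in at_right 0. dX (ex t A ` E0) (ex t B ` E0) / t \<le> (N (S t) / t) / 2"
      unfolding eventually_at_filter
    proof (rule always_eventually, intro allI impI)
      fix t :: real assume "t \<in> {0<..}"
      then have t: "t > 0" by simp
      have "dX (ex t A ` E0) (ex t B ` E0) / t \<le> (N (S t) / 2) / t"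
        using key(2)[of t] t by (intro divide_right_mono) auto
      then show "dX (ex t A ` E0) (ex t B ` E0) / t \<le> (N (S t) / t) / 2" by (simp add: mult_ac)
    qed
  qed
qed

lemma line_eq_imp_eq:
  assumes A: "A \<in> pp" and B: "B \<in> pp" and eq: "\<And>t. ex t A ` E0 = ex t B ` E0" shows "A = B"
proof (rule blinfun_eqI)
  fix x
  have l: "((\<lambda>s. oblique_proj (ex s C ` E0)) has_vector_derivative (id_blinfun o\<^sub>L (C o\<^sub>L ex (2 * 0) C o\<^sub>L \<Phi>) o\<^sub>L id_blinfun)) (at 0)"
    if "C \<in> pp" for C using oblique_proj_line_vd[OF form_iso_id that, of 0] by simp
  have "id_blinfun o\<^sub>L (A o\<^sub>L ex (2 * 0) A o\<^sub>L \<Phi>) o\<^sub>L id_blinfun = id_blinfun o\<^sub>L (B o\<^sub>L ex (2 * 0) B o\<^sub>L \<Phi>) o\<^sub>L id_blinfun"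
    using l[OF A] l[OF B] unfolding eq by (rule vector_derivative_unique_at)
  then have "(id_blinfun o\<^sub>L (A o\<^sub>L ex (2 * 0) A o\<^sub>L \<Phi>) o\<^sub>L id_blinfun) (\<Phi> x) = (id_blinfun o\<^sub>L (B o\<^sub>L ex (2 * 0) B o\<^sub>L \<Phi>) o\<^sub>L id_blinfun) (\<Phi> x)"
    by (rule arg_cong)
  then show "A x = B x" by (simp add: ex_0[OF A] ex_0[OF B])
qed

text \<open>For \<open>n\<close> in \<open>W\<close> and \<open>e\<close> in \<open>E0\<close> this
  is an element of \<open>pp\<close> whose restriction to \<open>E0\<close> has rank at most
  one.\<close>

definition sym_dyad :: "'a \<Rightarrow> 'a \<Rightarrow> 'a \<Rightarrow>\<^sub>L 'a" where "sym_dyad n e = dyad n e + dyad e n"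

lemma sym_dyad_apply: "sym_dyad n e x = (e \<bullet> x) *\<^sub>R n + (n \<bullet> x) *\<^sub>R e"
  by (simp add: sym_dyad_def blinfun.add_left)

lemma sym_dyad_pp: assumes "n \<in> W" "e \<in> E0" shows "sym_dyad n e \<in> pp"
  unfolding pp_def
proof (intro CollectI conjI allI)
  fix x y
  show "sym_dyad n e x \<bullet> y = x \<bullet> sym_dyad n e y" by (simp add: sym_dyad_apply inner_add_left inner_add_right inner_commute mult_ac)
next
  fix x
  have 1: "\<Phi> n = - n" "\<Phi> e = e" using assms PhiE by (auto simp: W_def)
  then have 2: "e \<bullet> \<Phi> x = e \<bullet> x" "n \<bullet> \<Phi> x = - (n \<bullet> x)" using Phi_sym[of e x] Phi_sym[of n x] by simp_all
  show "sym_dyad n e (\<Phi> x) = - \<Phi> (sym_dyad n e x)" by (simp add: sym_dyad_apply 1 2 blinfun.add_right blinfun.scaleR_right)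
qed

lemma commute_deriv:
  fixes S :: "'a \<Rightarrow>\<^sub>L 'a"
  assumes A: "A \<in> pp" and c: "\<And>t x. S (ex (a * t) A x) = ex (a * t) A (S x)" and a: "a \<noteq> 0"
  shows "S (A x) = A (S x)"
proof -
  have d: "((\<lambda>t. ex (a * t) A) has_vector_derivative a *\<^sub>R A) (at 0)"
    using ex_deriv0[OF pp_scale[OF A, of a]] by (simp add: ex_scale mult.commute)
  have "((\<lambda>t. S o\<^sub>L ex (a * t) A) has_vector_derivative ((S o\<^sub>L a *\<^sub>R A) + (0 o\<^sub>L ex (a * 0) A))) (at 0)"
    by (intro vd_compose_blinfun has_vector_derivative_const d)
  then have 1: "((\<lambda>t. S o\<^sub>L ex (a * t) A) has_vector_derivative ((S o\<^sub>L a *\<^sub>R A) + (0 o\<^sub>L ex (a * 0) A))) (at 0)" .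
  have 2: "((\<lambda>t. ex (a * t) A o\<^sub>L S) has_vector_derivative (a *\<^sub>R A o\<^sub>L S)) (at 0)"
    by (rule vd_compose_right[OF d])
  have "S o\<^sub>L ex (a * t) A = ex (a * t) A o\<^sub>L S" for t
    by (intro blinfun_eqI) (simp add: c)
  then have "(S o\<^sub>L a *\<^sub>R A) + (0 o\<^sub>L ex (a * 0) A) = a *\<^sub>R A o\<^sub>L S"
    using vector_derivative_unique_at[OF 1] 2 by simp
  then have "((S o\<^sub>L a *\<^sub>R A) + (0 o\<^sub>L ex (a * 0) A)) x = (a *\<^sub>R A o\<^sub>L S) x" by simp
  then show ?thesis using a by (simp add: blinfun.add_left blinfun.scaleR_left blinfun.scaleR_right)
qed

text \<open>Fixing every subspace means commuting with every reflector, hence, after differentiation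
  along geodesics, with all of \<open>pp\<close>. Commutation with the elements
  \<open>sym_dyad n e\<close> makes \<open>h\<close> a scalar, as in Schur's lemma, and the form
  allows only the scalars 1 and \<open>-1\<close>.\<close>

lemma trivial_action:
  assumes h: "form_iso h g" and tr: "\<And>E. E \<in> X \<Longrightarrow> h ` E = E"
  shows "h = id_blinfun \<or> h = - id_blinfun"
proof -
  have J: "h (reflector E x) = reflector E (h x)" if "E \<in> X" for E x
  proof -
    have "reflector E = h o\<^sub>L reflector E o\<^sub>L g" using reflector_image[OF h that] tr[OF that] by simp
    then have "reflector E (h x) = (h o\<^sub>L reflector E o\<^sub>L g) (h x)" by (rule arg_cong[where f="\<lambda>M. blinfun_apply M (h x)"])
    then show ?thesis by (simp add: form_isoD[OF h])
  qed
  have hP: "h (\<Phi> x) = \<Phi> (h x)" for x using J[OF E0_X] reflector_E0 by simp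
  have comm: "h (A x) = A (h x)" if A: "A \<in> pp" for A x
  proof (rule commute_deriv[OF A, of h 2])
    fix t x
    have "reflector (id_blinfun ` ex t A ` E0) = id_blinfun o\<^sub>L (ex (2 * t) A o\<^sub>L \<Phi>) o\<^sub>L id_blinfun" by (rule reflector_line[OF form_iso_id A])
    then have "reflector (ex t A ` E0) y = ex (2 * t) A (\<Phi> y)" for y by simp
    then show "h (ex (2 * t) A x) = ex (2 * t) A (h x)" using J[OF ge_X[OF A, of t], of "\<Phi> x"] hP by simp
  qed simp
  define e where "e = basis_E0 0"
  have e: "e \<in> E0" "e \<bullet> e = 1" using onE_basis_E0 p0 onfD[of p basis_E0 0 0] by (auto simp: onE_def e_def)
  define c where "c = e \<bullet> h e"
  have heE: "h e \<in> E0" unfolding E_iff using hP[of e] PhiE[OF e(1)] by simp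
  have hW: "h n = c *\<^sub>R n" if n: "n \<in> W" for n
  proof -
    have "sym_dyad n e e = n" using e EW(2)[OF n e(1)] by (simp add: sym_dyad_apply)
    then have "h n = sym_dyad n e (h e)" using comm[OF sym_dyad_pp[OF n e(1)], of e] by simp
    then show ?thesis using EW(2)[OF n heE] by (simp add: sym_dyad_apply c_def)
  qed
  obtain n where n: "n \<in> W" "norm n = 1" using ex_unit_orthogonal[of "{}"] by auto
  have nn: "n \<bullet> n = 1" using n(2) by (simp add: dot_square_norm)
  have hE: "h x = c *\<^sub>R x" if x: "x \<in> E0" for x
  proof -
    have "sym_dyad n x n = x" using nn EW(1)[OF x n(1)] by (simp add: sym_dyad_apply)
    then have "h x = sym_dyad n x (c *\<^sub>R n)" using comm[OF sym_dyad_pp[OF n(1) x], of n] hW[OF n(1)] by simp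
    then show ?thesis using \<open>sym_dyad n x n = x\<close> by (simp add: blinfun.scaleR_right)
  qed
  have hc: "h x = c *\<^sub>R x" for x
  proof -
    define q where "q = (\<Sum>i<p. (basis_E0 i \<bullet> x) *\<^sub>R basis_E0 i)"
    have "q \<in> E0" unfolding q_def by (rule sum_in_E[OF onE_basis_E0])
    moreover have "x - q \<in> W" unfolding q_def by (rule W_diff[OF onE_basis_E0])
    ultimately have "h q = c *\<^sub>R q" "h (x - q) = c *\<^sub>R (x - q)" using hE hW by blast+
    then show ?thesis by (simp add: blinfun.diff_right scaleR_diff_right)
  qed
  have "h e \<bullet> \<Phi> (h e) = e \<bullet> \<Phi> e" by (rule form_isoD(3)[OF h])
  then have "c * c = 1" using e PhiE[OF e(1)] by (simp add: hc blinfun.scaleR_right)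
  then have "c = 1 \<or> c = -1" by (rule square_eq_1_iff[THEN iffD1])
  then show ?thesis
  proof
    assume "c = 1"
    then have "h = id_blinfun" by (intro blinfun_eqI) (simp add: hc)
    then show ?thesis ..
  next
    assume "c = -1"
    then have "h = - id_blinfun" by (intro blinfun_eqI) (simp add: hc blinfun.minus_left)
    then show ?thesis ..
  qed
qed

definition commuting :: "('a \<Rightarrow>\<^sub>L 'a) \<Rightarrow> ('a \<Rightarrow>\<^sub>L 'a) \<Rightarrow> bool" where
  "commuting A B \<longleftrightarrow> (\<forall>x. A (B x) = B (A x))"

text \<open>Together with \<open>ex_unit_orthogonal\<close> this yields a vector of \<open>W\<close>
  annihilated by finitely many given elements.\<close>

lemma pp_kernel:
  assumes A: "A \<in> pp" and y: "y \<in> W" and o: "\<And>i. i < p \<Longrightarrow> A (basis_E0 i) \<bullet> y = 0"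
  shows "A y = 0"
proof -
  have "basis_E0 i \<bullet> A y = 0" if "i < p" for i using o[OF that] pp_sym[OF A, of "basis_E0 i" y] by simp
  then show ?thesis using E_eq[OF onE_basis_E0 pp_WE[OF A y]] by simp
qed

end

section \<open>An isometry fixing the base point and its differential\<close>

locale iso_fix = hilbert_splitting +
  fixes f
  assumes f: "refl.isometry f" and f0: "f E0 = E0"
begin

text \<open>The differential of \<open>f\<close> at \<open>E0\<close>, defined through the geodesics
  it permutes. A one-parameter family of subspaces determines its generator, so the choice is
  unique, see \<open>T_eqI\<close>.\<close>

definition T :: "('a \<Rightarrow>\<^sub>L 'a) \<Rightarrow> 'a \<Rightarrow>\<^sub>L 'a" where
  "T A = (SOME B. B \<in> pp \<and> (\<forall>t. f (ex t A ` E0) = ex t B ` E0))"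

lemma T: assumes "A \<in> pp" shows "T A \<in> pp" "f (ex t A ` E0) = ex t (T A) ` E0"
proof -
  have "\<exists>B. B \<in> pp \<and> (\<forall>t. f (ex t A ` E0) = ex t B ` E0)" using isometry_geodesic[OF f f0 assms] by (simp only: Bex_def)
  then have *: "T A \<in> pp \<and> (\<forall>t. f (ex t A ` E0) = ex t (T A) ` E0)" unfolding T_def by (rule someI_ex)
  show "T A \<in> pp" by (rule conjunct1[OF *])
  show "f (ex t A ` E0) = ex t (T A) ` E0" by (rule spec[OF conjunct2[OF *]])
qed

lemma T_eqI: assumes "A \<in> pp" "B \<in> pp" "\<And>t. f (ex t A ` E0) = ex t B ` E0" shows "T A = B"
  by (rule line_eq_imp_eq[OF T(1)[OF assms(1)] assms(2)]) (use T(2)[OF assms(1)] assms(3) in simp)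

lemma T_scale: assumes A: "A \<in> pp" shows "T (c *\<^sub>R A) = c *\<^sub>R T A"
  by (rule T_eqI[OF pp_scale[OF A] pp_scale[OF T(1)[OF A]]]) (simp add: ex_scale T(2)[OF A])

lemma f_dist: "E \<in> X \<Longrightarrow> F \<in> X \<Longrightarrow> dX (f E) (f F) = dX E F"
  using f by (simp add: refl.isometry_def)

text \<open>The isometry property in the infinitesimal limit. At this stage \<open>T\<close> is only
  homogeneous, so preserving differences is more than preserving norms.\<close>

lemma N_T_diff: assumes A: "A \<in> pp" and B: "B \<in> pp" shows "N (T B - T A) = N (B - A)"
proof -
  have "dX (ex t (T A) ` E0) (ex t (T B) ` E0) = dX (ex t A ` E0) (ex t B ` E0)" for t
    unfolding T(2)[OF A, symmetric] T(2)[OF B, symmetric] by (rule f_dist[OF ge_X[OF A] ge_X[OF B]])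
  then have "((\<lambda>t. dX (ex t A ` E0) (ex t B ` E0) / t) \<longlongrightarrow> N (T B - T A)) (at_right 0)"
    using dX_infinitesimal[OF T(1)[OF A] T(1)[OF B]] by simp
  then show ?thesis using dX_infinitesimal[OF A B] by (rule tendsto_unique[OF trivial_limit_at_right_real])
qed

lemma T_0: "T 0 = 0" using T_scale[OF pp_zero, of 0] by simp

lemma N_T: assumes "A \<in> pp" shows "N (T A) = N A"
  using N_T_diff[OF pp_zero assms] T_0 by simp

lemma inner_pp_T: assumes "A \<in> pp" "B \<in> pp" shows "inner_pp (T A) (T B) = inner_pp A B"
  unfolding inner_pp_polar[of "T A"] inner_pp_polar[of A] N_T[OF assms(1)] N_T[OF assms(2)] N_T_diff[OF assms(2,1)] ..

text \<open>Additivity is forced by preservation of inner products: expanded, the squared norm of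
  the defect is that of \<open>(A + B) - A - B\<close>.\<close>

lemma T_add: assumes A: "A \<in> pp" and B: "B \<in> pp" shows "T (A + B) = T A + T B"
proof -
  note C = pp_add[OF A B]
  let ?D = "T (A + B) - (T A + T B)"
  have D: "?D \<in> pp" by (intro pp_diff pp_add T(1) A B C)
  have "inner_pp ?D ?D = inner_pp (A + B) (A + B) - 2 * inner_pp (A + B) A - 2 * inner_pp (A + B) B + inner_pp A A + 2 * inner_pp A B + inner_pp B B"
    by (simp only: inner_pp_simps inner_pp_T[OF C C] inner_pp_T[OF C A] inner_pp_T[OF C B] inner_pp_T[OF A C] inner_pp_T[OF B C] inner_pp_T[OF A A] inner_pp_T[OF A B] inner_pp_T[OF B A] inner_pp_T[OF B B])
      (simp add: inner_pp_simps inner_pp_commute[of B A])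
  also have "\<dots> = 0" by (simp add: inner_pp_simps inner_pp_commute[of B A])
  finally have "?D = 0" by (rule inner_pp_zero[OF D])
  then show ?thesis by simp
qed

lemma T_sum: assumes "\<And>i. i < (n::nat) \<Longrightarrow> A i \<in> pp" shows "T (\<Sum>i<n. A i) = (\<Sum>i<n. T (A i)) \<and> (\<Sum>i<n. A i) \<in> pp"
  using assms
proof (induction n)
  case 0 then show ?case by (simp add: T_0 pp_zero)
next
  case (Suc n)
  then show ?case using T_add[of "\<Sum>i<n. A i" "A n"] pp_add by simp
qed

lemma iso_fix_inv: "iso_fix E0 \<Phi> p (inv_into X f)"
proof
  show "refl.isometry (inv_into X f)" by (rule refl.isometry_inv(1)[OF f])
  show "inv_into X f E0 = E0" using refl.isometry_inv(2)[OF f E0_X] f0 by simp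
qed

lemma T_surj: assumes B: "B \<in> pp" shows "\<exists>A\<in>pp. T A = B"
proof -
  interpret i: iso_fix E0 \<Phi> p "inv_into X f" by (rule iso_fix_inv)
  have "f (ex t (i.T B) ` E0) = ex t B ` E0" for t
    unfolding i.T(2)[OF B, symmetric] by (rule refl.isometry_inv(3)[OF f ge_X[OF B]])
  then have "T (i.T B) = B" by (rule T_eqI[OF i.T(1)[OF B] B])
  then show ?thesis using i.T(1)[OF B] by (rule bexI)
qed

text \<open>A transvection is a product of two geodesic symmetries, at \<open>E0\<close> and at
  parameter \<open>t / 2\<close>, and \<open>f\<close> respects symmetries.\<close>

lemma f_ex: assumes A: "A \<in> pp" and E: "E \<in> X" shows "f (ex t A ` E) = ex t (T A) ` f E"
proof -
  have 1: "ex t C ` F = geo_sym (ex (t / 2) C ` E0) (geo_sym E0 F)" if C: "C \<in> pp" for C F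
  proof -
    have "reflector (id_blinfun ` ex (t / 2) C ` E0) = id_blinfun o\<^sub>L (ex (2 * (t / 2)) C o\<^sub>L \<Phi>) o\<^sub>L id_blinfun" by (rule reflector_line[OF form_iso_id C])
    then have "reflector (ex (t / 2) C ` E0) y = ex t C (\<Phi> y)" for y by simp
    then show ?thesis by (simp add: geo_sym_def reflector_E0 image_image)
  qed
  have "f (ex t A ` E) = f (geo_sym (ex (t / 2) A ` E0) (geo_sym E0 E))" unfolding 1[OF A] ..
  also have "\<dots> = geo_sym (f (ex (t / 2) A ` E0)) (f (geo_sym E0 E))" by (rule isometry_geo_sym[OF f ge_X[OF A] refl.s_in[OF E0_X E]])
  also have "\<dots> = geo_sym (ex (t / 2) (T A) ` E0) (geo_sym E0 (f E))" unfolding isometry_geo_sym[OF f E0_X E] f0 T(2)[OF A] ..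
  finally show ?thesis unfolding 1[OF T(1)[OF A]] .
qed

text \<open>By \<open>f_ex\<close> the transvections of the images commute as maps of the space of
  subspaces, so their commutator \<open>h\<close> in the group acts trivially and is the identity up
  to sign. Differentiating in both parameters then gives commutation of the generators.\<close>

lemma commuting_T: assumes A: "A \<in> pp" and B: "B \<in> pp" and c: "commuting A B" shows "commuting (T A) (T B)"
proof -
  let ?A = "T A" and ?B = "T B"
  note A' = T(1)[OF A] and B' = T(1)[OF B]
  have AB: "ex t A (ex u B x) = ex u B (ex t A x)" for t u x
  proof -
    have "B (ex t A y) = ex t A (B y)" for t y by (rule ex_commute[OF A]) (use c in \<open>simp add: commuting_def\<close>)
    then show ?thesis by (intro ex_commute[OF B]) simp
  qed
  have eq: "ex t ?A (ex u ?B x) = ex u ?B (ex t ?A x)" for t u x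
  proof -
    define h where "h = (ex (- t) ?A o\<^sub>L ex (- u) ?B) o\<^sub>L (ex t ?A o\<^sub>L ex u ?B)"
    define g where "g = (ex (- u) ?B o\<^sub>L ex (- t) ?A) o\<^sub>L (ex u ?B o\<^sub>L ex t ?A)"
    have "form_iso (ex (- t) ?A) (ex t ?A)" "form_iso (ex (- u) ?B) (ex u ?B)" using form_iso_ex[OF A', of "- t"] form_iso_ex[OF B', of "- u"] by simp_all
    then have h: "form_iso h g" unfolding h_def g_def by (intro form_iso_comp form_iso_ex A' B')
    have "h ` F = F" if F: "F \<in> X" for F
    proof -
      define E where "E = inv_into X f F"
      have E: "E \<in> X" "f E = F" unfolding E_def
        using refl.isometry_in[OF refl.isometry_inv(1)[OF f] F] refl.isometry_inv(3)[OF f F] by simp_all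
      have "ex t ?A ` ex u ?B ` F = f (ex t A ` ex u B ` E)"
        unfolding f_ex[OF A image_X[OF form_iso_ex[OF B] E(1)]] f_ex[OF B E(1)] E(2) ..
      also have "ex t A ` ex u B ` E = ex u B ` ex t A ` E" by (simp add: image_image AB)
      also have "f (ex u B ` ex t A ` E) = ex u ?B ` ex t ?A ` F"
        unfolding f_ex[OF B image_X[OF form_iso_ex[OF A] E(1)]] f_ex[OF A E(1)] E(2) ..
      finally have *: "ex t ?A ` ex u ?B ` F = ex u ?B ` ex t ?A ` F" .
      have "h ` F = ex (- t) ?A ` ex (- u) ?B ` ex t ?A ` ex u ?B ` F" by (simp add: h_def image_image)
      also have "\<dots> = F" unfolding * by (simp add: image_image ex_inv[OF A'] ex_inv[OF B'])
      finally show ?thesis .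
    qed
    then have "h = id_blinfun \<or> h = - id_blinfun" by (rule trivial_action[OF h])
    moreover have "h \<noteq> - id_blinfun"
    proof
      assume hm: "h = - id_blinfun"
      \<comment> \<open>A unit vector annihilated by both generators is fixed by all four
        exponentials, so \<open>h\<close> cannot be minus the identity.\<close>
      obtain y where y: "y \<in> W" "norm y = 1" "\<And>z. z \<in> (\<lambda>i. ?A (basis_E0 i)) ` {..<p} \<union> (\<lambda>i. ?B (basis_E0 i)) ` {..<p} \<Longrightarrow> z \<bullet> y = 0"
        using ex_unit_orthogonal[of "(\<lambda>i. ?A (basis_E0 i)) ` {..<p} \<union> (\<lambda>i. ?B (basis_E0 i)) ` {..<p}"] by auto
      have "?A y = 0 *\<^sub>R y" using pp_kernel[OF A' y(1)] y(3) by simp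
      then have ya: "ex s ?A y = y" for s using ex_eigen[OF A', of y 0 s] by simp
      have "?B y = 0 *\<^sub>R y" using pp_kernel[OF B' y(1)] y(3) by simp
      then have yb: "ex s ?B y = y" for s using ex_eigen[OF B', of y 0 s] by simp
      have "h y = y" by (simp add: h_def ya yb)
      moreover have "h y = - y" using hm by (simp add: blinfun.minus_left)
      ultimately have "y = - y" by simp
      then have "2 *\<^sub>R y = 0" by (simp add: scaleR_2 eq_neg_iff_add_eq_0)
      then show False using y(2) by simp
    qed
    ultimately have "h x = x" by simp
    then have "ex (- t) ?A (ex (- u) ?B (ex t ?A (ex u ?B x))) = x" by (simp add: h_def)
    then have "ex u ?B (ex t ?A (ex (- t) ?A (ex (- u) ?B (ex t ?A (ex u ?B x))))) = ex u ?B (ex t ?A x)" by simp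
    then show ?thesis by (simp only: ex_inv[OF A'] ex_inv[OF B'])
  qed
  have 1: "ex u ?B (?A x) = ?A (ex u ?B x)" for u x
    by (rule commute_deriv[OF A', of _ 1]) (simp_all add: eq)
  have "?A (?B x) = ?B (?A x)" for x
    by (rule commute_deriv[OF B', of _ 1]) (simp_all add: 1)
  then show ?thesis by (simp add: commuting_def)
qed

lemma commuting_T_iff: assumes A: "A \<in> pp" and B: "B \<in> pp" shows "commuting (T A) (T B) \<longleftrightarrow> commuting A B"
proof
  assume c: "commuting (T A) (T B)"
  interpret i: iso_fix E0 \<Phi> p "inv_into X f" by (rule iso_fix_inv)
  have it: "i.T (T C) = C" if C: "C \<in> pp" for C
    by (rule i.T_eqI[OF T(1)[OF C] C]) (simp add: T(2)[OF C, symmetric] refl.isometry_inv(2)[OF f ge_X[OF C]])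
  show "commuting A B" using i.commuting_T[OF T(1)[OF A] T(1)[OF B] c] unfolding it[OF A] it[OF B] .
qed (rule commuting_T[OF A B])

end

section \<open>Rank one elements\<close>

context hilbert_splitting
begin

text \<open>The spanning set is taken inside \<open>pp\<close> because \<open>T\<close> is linear
  only there, and finite dimension has to be transported by \<open>T\<close>.\<close>

definition fin_dim :: "('a \<Rightarrow>\<^sub>L 'a) set \<Rightarrow> bool" where
  "fin_dim S \<longleftrightarrow> (\<exists>F. finite F \<and> F \<subseteq> pp \<and> S \<subseteq> span F)"

definition centraliser :: "('a \<Rightarrow>\<^sub>L 'a) \<Rightarrow> ('a \<Rightarrow>\<^sub>L 'a) set" where
  "centraliser A = {B \<in> pp. commuting A B}"

lemma sym_dyad_add1: "sym_dyad (m + n) e = sym_dyad m e + sym_dyad n e"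
  by (rule blinfun_eqI) (simp add: sym_dyad_apply blinfun.add_left inner_add_left algebra_simps)

lemma sym_dyad_add2: "sym_dyad m (e + e') = sym_dyad m e + sym_dyad m e'"
  by (rule blinfun_eqI) (simp add: sym_dyad_apply blinfun.add_left inner_add_left algebra_simps)

lemma sym_dyad_scale1: "sym_dyad (c *\<^sub>R m) e = c *\<^sub>R sym_dyad m e"
  by (rule blinfun_eqI) (simp add: sym_dyad_apply blinfun.scaleR_left algebra_simps)

lemma sym_dyad_scale2: "sym_dyad m (c *\<^sub>R e) = c *\<^sub>R sym_dyad m e"
  by (rule blinfun_eqI) (simp add: sym_dyad_apply blinfun.scaleR_left algebra_simps)

lemma sym_dyad_zero: "sym_dyad 0 e = 0" "sym_dyad m 0 = 0"
  by (rule blinfun_eqI, simp add: sym_dyad_apply)+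

lemma sym_dyad_sum1: "sym_dyad (\<Sum>k<(q::nat). c k *\<^sub>R m k) e = (\<Sum>k<q. c k *\<^sub>R sym_dyad (m k) e)"
  by (induction q) (simp_all add: sym_dyad_zero sym_dyad_add1 sym_dyad_scale1)

lemma pp_sum: "(\<And>i. i < (q::nat) \<Longrightarrow> A i \<in> pp) \<Longrightarrow> (\<Sum>i<q. A i) \<in> pp"
  by (induction q) (simp_all add: pp_zero pp_add)

lemma onE_delta:
  assumes "onE b" "i < p" shows "(\<Sum>j<p. (b j \<bullet> b i) *\<^sub>R (v j :: 'b::real_vector)) = v i"
proof -
  have "(\<Sum>j<p. (b j \<bullet> b i) *\<^sub>R v j) = (\<Sum>j<p. if j = i then v i else 0)"
    by (rule sum.cong) (use onfD[of p b] assms in \<open>auto simp: onE_def\<close>)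
  then show ?thesis using assms(2) by simp
qed

lemma pp_expand:
  assumes A: "A \<in> pp" and b: "onE b"
  shows "A = (\<Sum>j<p. sym_dyad (A (b j)) (b j))"
proof (rule pp_eqI[OF A _ b])
  have bE: "b j \<in> E0" if "j < p" for j using b that by (simp add: onE_def)
  show "(\<Sum>j<p. sym_dyad (A (b j)) (b j)) \<in> pp" by (intro pp_sum sym_dyad_pp pp_EW[OF A] bE)
  fix i assume i: "i < p"
  have "(\<Sum>j<p. sym_dyad (A (b j)) (b j)) (b i) = (\<Sum>j<p. (b j \<bullet> b i) *\<^sub>R A (b j) + (A (b j) \<bullet> b i) *\<^sub>R b j)"
    by (simp add: blinfun.sum_left sym_dyad_apply)
  also have "\<dots> = (\<Sum>j<p. (b j \<bullet> b i) *\<^sub>R A (b j))"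
    by (rule sum.cong) (use EW(2)[OF pp_EW[OF A bE] bE[OF i]] in auto)
  also have "\<dots> = A (b i)" by (rule onE_delta[OF b i])
  finally show "A (b i) = (\<Sum>j<p. sym_dyad (A (b j)) (b j)) (b i)" by simp
qed

lemma inner_pp_sym_dyad: assumes m: "m \<in> W" and e: "e \<in> E0" shows "inner_pp (sym_dyad m e) S = m \<bullet> S e"
proof -
  have bE: "basis_E0 j \<in> E0" if "j < p" for j using onE_basis_E0 that by (simp add: onE_def)
  have "inner_pp (sym_dyad m e) S = (\<Sum>i<p. (basis_E0 i \<bullet> e) * (m \<bullet> S (basis_E0 i)))"
    unfolding inner_pp_def by (rule sum.cong) (use EW(2)[OF m bE] in \<open>auto simp: sym_dyad_apply inner_commute[of e]\<close>)
  also have "\<dots> = m \<bullet> S (\<Sum>i<p. (basis_E0 i \<bullet> e) *\<^sub>R basis_E0 i)"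
    by (simp add: blinfun.sum_right blinfun.scaleR_right inner_sum_right)
  also have "(\<Sum>i<p. (basis_E0 i \<bullet> e) *\<^sub>R basis_E0 i) = e" by (rule E_eq[OF onE_basis_E0 e, symmetric])
  finally show ?thesis .
qed

lemma inner_pp_sym_dyad_sym_dyad:
  assumes "m \<in> W" "e \<in> E0" "m' \<in> W" "e' \<in> E0" shows "inner_pp (sym_dyad m e) (sym_dyad m' e') = (m \<bullet> m') * (e \<bullet> e')"
  unfolding inner_pp_sym_dyad[OF assms(1,2)] using EW(2)[OF assms(3,2)]
  by (simp add: sym_dyad_apply inner_add_right inner_commute mult_ac)

lemma frame_op_inner:
  assumes f: "frame e n" and i: "i < p"
  shows "e i \<bullet> frame_op e n l x = l i * (n i \<bullet> x)" "n i \<bullet> frame_op e n l x = l i * (e i \<bullet> x)"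
  using pp_sym[OF frame_op_pp[OF f], of l "e i" x] pp_sym[OF frame_op_pp[OF f], of l "n i" x] frame_op_frame[OF f i, of l] by simp_all

lemma commuting_frame_op: assumes f: "frame e n" shows "commuting (frame_op e n l) (frame_op e n m)"
  unfolding commuting_def
proof
  fix x
  have "frame_op e n a (frame_op e n b x) = (\<Sum>i<p. (a i * b i * (n i \<bullet> x)) *\<^sub>R n i) + (\<Sum>i<p. (a i * b i * (e i \<bullet> x)) *\<^sub>R e i)" for a b
    unfolding frame_op_apply[of e n a] using frame_op_inner[OF f, of _ b x]
    by (intro arg_cong2[where f="(+)"] sum.cong) (simp_all add: mult_ac)
  then show "frame_op e n l (frame_op e n m x) = frame_op e n m (frame_op e n l x)" by (simp add: mult.commute)
qed

lemma frame_op_diff: "frame_op e n a - frame_op e n b = frame_op e n (\<lambda>i. a i - b i)"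
  unfolding frame_op_def by (simp add: scaleR_diff_left sum_subtractf)

lemma N2_frame_op: "frame e n \<Longrightarrow> (N (frame_op e n l))\<^sup>2 = 2 * (\<Sum>j<p. (l j)\<^sup>2)"
  by (simp add: N_frame_op sum_nonneg)

lemma inner_pp_frame_op: assumes f: "frame e n" shows "inner_pp (frame_op e n a) (frame_op e n b) = (\<Sum>i<p. a i * b i)"
proof -
  have "(\<Sum>j<p. (a j - b j)\<^sup>2) = (\<Sum>j<p. (a j)\<^sup>2) + (\<Sum>j<p. (b j)\<^sup>2) - 2 * (\<Sum>j<p. a j * b j)"
    by (simp add: power2_diff sum.distrib sum_subtractf sum_distrib_left mult.assoc)
  then show ?thesis unfolding inner_pp_polar[of "frame_op e n a"] frame_op_diff N2_frame_op[OF f] by simp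
qed

text \<open>In the frame, let \<open>b = n k \<bullet> B (e j)\<close> and
  \<open>c = n j \<bullet> B (e k)\<close>. Commutation gives \<open>l j * b = l k * c\<close> and
  \<open>l k * b = l j * c\<close>; eliminating \<open>b\<close> gives the second claim. The first
  says that \<open>B (e j)\<close> has no component outside the frame unless \<open>l j\<close>
  vanishes.\<close>

lemma centraliser_relations:
  assumes f: "frame e n" and B: "B \<in> pp" and c: "commuting (frame_op e n l) B" and j: "j < p"
  shows "w \<in> W \<Longrightarrow> (\<And>i. i < p \<Longrightarrow> n i \<bullet> w = 0) \<Longrightarrow> l j * (w \<bullet> B (e j)) = 0"
    "k < p \<Longrightarrow> ((l j)\<^sup>2 - (l k)\<^sup>2) * (n j \<bullet> B (e k)) = 0"
proof -
  let ?A = "frame_op e n l"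
  have A: "?A \<in> pp" by (rule frame_op_pp[OF f])
  have cc: "?A (B x) = B (?A x)" for x using c by (simp add: commuting_def)
  have R1: "l j * (w \<bullet> B (e j)) = ?A w \<bullet> B (n j)" for w
    using pp_sym[OF A, of w "B (n j)"] cc[of "n j"] frame_op_frame(2)[OF f j, of l] by (simp add: blinfun.scaleR_right)
  show "l j * (w \<bullet> B (e j)) = 0" if w: "w \<in> W" "\<And>i. i < p \<Longrightarrow> n i \<bullet> w = 0"
  proof -
    have "e i \<bullet> w = 0" if "i < p" for i using EW(1)[OF frame_inner(5)[OF f that that] w(1)] .
    then have "?A w = 0" using w(2) by (simp add: frame_op_apply)
    then show ?thesis using R1[of w] by simp
  qed
  assume k: "k < p"
  have sw: "e k \<bullet> B (n j) = n j \<bullet> B (e k)" using pp_sym[OF B, of "e k" "n j"] by (simp add: inner_commute)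
  have 1: "l j * (n k \<bullet> B (e j)) = l k * (n j \<bullet> B (e k))"
    using R1[of "n k"] frame_op_frame(2)[OF f k, of l] sw by simp
  have "?A (e k) \<bullet> B (e j) = e k \<bullet> B (?A (e j))" using pp_sym[OF A, of "e k" "B (e j)"] cc[of "e j"] by simp
  then have 2: "l k * (n k \<bullet> B (e j)) = l j * (n j \<bullet> B (e k))"
    using frame_op_frame(1)[OF f k, of l] frame_op_frame(1)[OF f j, of l] sw by (simp add: blinfun.scaleR_right)
  have "(l j)\<^sup>2 * (n j \<bullet> B (e k)) = l j * (l k * (n k \<bullet> B (e j)))" unfolding 2 by (simp add: power2_eq_square)
  also have "\<dots> = l k * (l j * (n k \<bullet> B (e j)))" by simp
  also have "\<dots> = (l k)\<^sup>2 * (n j \<bullet> B (e k))" unfolding 1 by (simp add: power2_eq_square)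
  finally show "((l j)\<^sup>2 - (l k)\<^sup>2) * (n j \<bullet> B (e k)) = 0" by (simp add: left_diff_distrib)
qed

lemma centraliser_expand:
  assumes f: "frame e n" and B: "B \<in> pp" and c: "commuting (frame_op e n l) B" and j: "j < p" and l: "l j \<noteq> 0"
  shows "B (e j) = (\<Sum>k<p. (n k \<bullet> B (e j)) *\<^sub>R n k)"
proof -
  define w where "w = B (e j) - (\<Sum>k<p. (n k \<bullet> B (e j)) *\<^sub>R n k)"
  have n: "onf p n" and nW: "\<And>i. i < p \<Longrightarrow> n i \<in> W" using f by (auto simp: frame_def)
  have wW: "w \<in> W" unfolding w_def
    by (intro subspace_diff[OF subW] subspace_sum[OF subW] subspace_scale[OF subW] pp_EW[OF B])
      (use frame_inner(5)[OF f j j] nW in auto)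
  have nw: "n i \<bullet> w = 0" if "i < p" for i
    unfolding w_def inner_diff_right onf_inner_sum[OF n that] by simp
  have "w \<bullet> B (e j) = 0" using centraliser_relations(1)[OF f B c j wW nw] l by simp
  moreover have "w \<bullet> (\<Sum>k<p. (n k \<bullet> B (e j)) *\<^sub>R n k) = 0"
    by (simp add: inner_sum_right inner_commute[of w] nw)
  ultimately have "w \<bullet> w = 0" by (subst (2) w_def) (simp add: inner_diff_right)
  then show ?thesis by (simp add: w_def)
qed

text \<open>Positive and pairwise distinct singular values have distinct squares, so
  \<open>centraliser_relations\<close> kills all off-diagonal entries of \<open>B\<close> in the
  frame.\<close>

lemma centraliser_regular:
  assumes f: "frame e n" and l: "\<And>i. i < p \<Longrightarrow> l i > 0" and inj: "\<And>i j. i < p \<Longrightarrow> j < p \<Longrightarrow> i \<noteq> j \<Longrightarrow> l i \<noteq> l j"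
    and B: "B \<in> centraliser (frame_op e n l)"
  shows "\<exists>b. B = frame_op e n b"
proof -
  have Bp: "B \<in> pp" and c: "commuting (frame_op e n l) B" using B by (auto simp: centraliser_def)
  define b where "b i = n i \<bullet> B (e i)" for i
  have oe: "onE e" using f by (simp add: frame_def)
  have "B = frame_op e n b"
  proof (rule pp_eqI[OF Bp frame_op_pp[OF f] oe])
    fix j assume j: "j < p"
    have "n k \<bullet> B (e j) = (if k = j then b j else 0)" if k: "k < p" for k
    proof (cases "k = j")
      case False
      have "l k \<noteq> l j" by (rule inj[OF k j False])
      then have "(l k)\<^sup>2 \<noteq> (l j)\<^sup>2" using l[OF k] l[OF j] by (simp add: power2_eq_iff_nonneg)
      then show ?thesis using centraliser_relations(2)[OF f Bp c k j] False by simp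
    qed (simp add: b_def)
    then have "(\<Sum>k<p. (n k \<bullet> B (e j)) *\<^sub>R n k) = (\<Sum>k<p. if k = j then b j *\<^sub>R n j else 0)"
      by (intro sum.cong) auto
    then show "B (e j) = frame_op e n b (e j)"
      using centraliser_expand[where l=l, OF f Bp c j] l[OF j] frame_op_frame(1)[OF f j, of b] j by simp
  qed
  then show ?thesis by (rule exI[where x=b])
qed

text \<open>When no singular value vanishes, the values of \<open>B\<close> on \<open>E0\<close> are
  confined to the span of the \<open>n k\<close>, so \<open>B\<close> has \<open>p * p\<close>
  coordinates.\<close>

lemma centraliser_fin_dim:
  assumes f: "frame e n" and l: "\<And>i. i < p \<Longrightarrow> l i \<noteq> 0"
  shows "fin_dim (centraliser (frame_op e n l))"
proof -
  let ?F = "(\<lambda>(k, j). sym_dyad (n k) (e j)) ` ({..<p} \<times> {..<p})"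
  have oe: "onE e" using f by (simp add: frame_def)
  have "?F \<subseteq> pp"
  proof
    fix x assume "x \<in> ?F"
    then obtain k j where kj: "k < p" "j < p" "x = sym_dyad (n k) (e j)" by auto
    show "x \<in> pp" unfolding kj(3) by (rule sym_dyad_pp[OF frame_inner(6)[OF f kj(1,1)] frame_inner(5)[OF f kj(2,2)]])
  qed
  moreover have "centraliser (frame_op e n l) \<subseteq> span ?F"
  proof
    fix B assume "B \<in> centraliser (frame_op e n l)"
    then have Bp: "B \<in> pp" and c: "commuting (frame_op e n l) B" by (auto simp: centraliser_def)
    have "B = (\<Sum>j<p. sym_dyad (B (e j)) (e j))" by (rule pp_expand[OF Bp oe])
    also have "\<dots> = (\<Sum>j<p. \<Sum>k<p. (n k \<bullet> B (e j)) *\<^sub>R sym_dyad (n k) (e j))"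
    proof (rule sum.cong[OF refl])
      fix j assume "j \<in> {..<p}"
      then have j: "j < p" by simp
      have "sym_dyad (B (e j)) (e j) = sym_dyad (\<Sum>k<p. (n k \<bullet> B (e j)) *\<^sub>R n k) (e j)"
        by (rule arg_cong[where f="\<lambda>x. sym_dyad x (e j)", OF centraliser_expand[where l=l, OF f Bp c j l[OF j]]])
      then show "sym_dyad (B (e j)) (e j) = (\<Sum>k<p. (n k \<bullet> B (e j)) *\<^sub>R sym_dyad (n k) (e j))" unfolding sym_dyad_sum1 .
    qed
    finally have eq: "B = (\<Sum>j<p. \<Sum>k<p. (n k \<bullet> B (e j)) *\<^sub>R sym_dyad (n k) (e j))" .
    have "(\<Sum>j<p. \<Sum>k<p. (n k \<bullet> B (e j)) *\<^sub>R sym_dyad (n k) (e j)) \<in> span ?F"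
      by (intro span_sum span_scale span_base) auto
    then show "B \<in> span ?F" by (rule back_subst[where P="\<lambda>x. x \<in> span ?F", OF _ eq[symmetric]])
  qed
  ultimately show ?thesis unfolding fin_dim_def by (intro exI[of _ ?F]) simp
qed

text \<open>If \<open>l j = 0\<close>, every \<open>sym_dyad m (e j)\<close> with \<open>m\<close>
  in \<open>W\<close> orthogonal to all \<open>n i\<close> is in the centraliser. Such an
  \<open>m\<close> can also be chosen orthogonal to the values at \<open>e j\<close> of any finite
  candidate for a spanning set.\<close>

lemma centraliser_not_fin_dim:
  assumes f: "frame e n" and j: "j < p" and l: "l j = 0"
  shows "\<not> fin_dim (centraliser (frame_op e n l))"
proof
  assume "fin_dim (centraliser (frame_op e n l))"
  then obtain F where F: "finite F" "centraliser (frame_op e n l) \<subseteq> span F" by (auto simp: fin_dim_def)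
  let ?G = "(\<lambda>B. blinfun_apply B (e j)) ` F"
  have "finite (?G \<union> n ` {..<p})" using F(1) by simp
  from ex_unit_orthogonal[OF this] obtain m where m: "m \<in> W" "norm m = 1" "\<forall>g\<in>?G \<union> n ` {..<p}. g \<bullet> m = 0" by (elim bexE conjE)
  note ej = frame_inner(5)[OF f j j]
  have mm: "m \<bullet> m = 1" using m(2) by (simp add: dot_square_norm)
  let ?A = "frame_op e n l"
  have A: "?A \<in> pp" by (rule frame_op_pp[OF f])
  have "n i \<bullet> m = 0" "e i \<bullet> m = 0" if "i < p" for i
    using m(3) that EW(1)[OF frame_inner(5)[OF f that that] m(1)] by auto
  then have Am: "?A m = 0" by (simp add: frame_op_apply)
  have Ae: "?A (e j) = 0" using frame_op_frame(1)[OF f j, of l] l by simp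
  have "sym_dyad m (e j) \<in> centraliser ?A" unfolding centraliser_def commuting_def
  proof (intro CollectI conjI allI sym_dyad_pp m(1) ej)
    fix x
    have "?A (sym_dyad m (e j) x) = 0" by (simp add: sym_dyad_apply blinfun.add_right blinfun.scaleR_right Am Ae)
    moreover have "sym_dyad m (e j) (?A x) = 0"
      using pp_sym[OF A, of m x] pp_sym[OF A, of "e j" x] by (simp add: sym_dyad_apply Am Ae)
    ultimately show "?A (sym_dyad m (e j) x) = sym_dyad m (e j) (?A x)" by simp
  qed
  then have sp: "sym_dyad m (e j) \<in> span F" using F(2) by (rule subsetD[rotated])
  have "m \<bullet> B (e j) = 0" if "B \<in> span F" for B
    using that
  proof (induction rule: span_induct_alt)
    case (step c B C)
    have "B (e j) \<in> ?G" using step.hyps by (rule imageI)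
    then have "m \<bullet> B (e j) = 0" using m(3) by (simp add: inner_commute[of m])
    then show ?case using step.IH by (simp add: blinfun.add_left blinfun.scaleR_left inner_add_right)
  qed simp
  from this[OF sp] have "m \<bullet> sym_dyad m (e j) (e j) = 0" .
  then show False using mm EW(2)[OF m(1) ej] frame_inner(1)[OF f j j] by (simp add: sym_dyad_apply)
qed

text \<open>Rank one elements are characterised in terms of commutation and the inner product.  Regular
  elements \<open>C\<close> have a finite-dimensional abelian centraliser, consisting of the elements with the
  same singular vectors, and an element of it has an infinite-dimensional centraliser iff one of its
  singular values vanishes.\<close>

definition rank_one :: "('a \<Rightarrow>\<^sub>L 'a) \<Rightarrow> bool" where
  "rank_one A \<longleftrightarrow> (\<exists>C\<in>pp. A \<in> centraliser C \<and> fin_dim (centraliser C) \<and> (\<forall>B\<in>centraliser C. \<forall>B'\<in>centraliser C. commuting B B')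
     \<and> (\<forall>B\<in>centraliser C. inner_pp A B = 0 \<longrightarrow> \<not> fin_dim (centraliser B)))"

text \<open>For an element with the single entry \<open>c\<close> at \<open>j\<close>, orthogonality
  to \<open>B\<close> says that the \<open>j\<close>-th singular value of \<open>B\<close> in the
  frame vanishes, and then \<open>B\<close> has a large centraliser.\<close>

lemma rank_one_single:
  assumes f: "frame e n" and j: "j < p" and c: "c \<noteq> 0"
  shows "rank_one (frame_op e n (\<lambda>i. if i = j then c else 0))"
proof -
  \<comment> \<open>Any positive, pairwise distinct values would serve for \<open>?l\<close>; the
    summand 1 keeps the value at index 0 away from zero.\<close>
  let ?a = "\<lambda>i. if i = j then c else 0" and ?l = "\<lambda>i. real i + 1"
  have reg: "\<exists>b. B = frame_op e n b" if "B \<in> centraliser (frame_op e n ?l)" for B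
    by (rule centraliser_regular[OF f _ _ that]) auto
  show ?thesis unfolding rank_one_def
  proof (intro bexI[of _ "frame_op e n ?l"] conjI ballI impI)
    show "frame_op e n ?l \<in> pp" by (rule frame_op_pp[OF f])
    show "frame_op e n ?a \<in> centraliser (frame_op e n ?l)" by (simp add: centraliser_def frame_op_pp[OF f] commuting_frame_op[OF f])
    show "fin_dim (centraliser (frame_op e n ?l))" by (rule centraliser_fin_dim[OF f]) simp
    fix B assume B: "B \<in> centraliser (frame_op e n ?l)"
    obtain b where b: "B = frame_op e n b" using reg[OF B] by (rule exE)
    show "commuting B B'" if B': "B' \<in> centraliser (frame_op e n ?l)" for B'
    proof -
      obtain b' where b': "B' = frame_op e n b'" using reg[OF B'] by (rule exE)
      show ?thesis unfolding b b' by (rule commuting_frame_op[OF f])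
    qed
    assume "inner_pp (frame_op e n ?a) B = 0"
    then have "(\<Sum>i<p. ?a i * b i) = 0" unfolding b inner_pp_frame_op[OF f] .
    moreover have "(\<Sum>i<p. ?a i * b i) = (\<Sum>i<p. if i = j then c * b j else 0)" by (rule sum.cong) auto
    ultimately have "c * b j = 0" using j by simp
    then have "b j = 0" using c by simp
    then show "\<not> fin_dim (centraliser B)" unfolding b by (rule centraliser_not_fin_dim[OF f j])
  qed
qed

text \<open>Finite dimension of the centraliser makes all singular values of \<open>C\<close>
  positive and commutativity makes them distinct, so \<open>A\<close> is diagonal in the frame of
  \<open>C\<close>. If \<open>A\<close> had two nonzero entries, a vector \<open>b\<close> without
  zero entries could be orthogonal to them, contradicting the last condition of
  \<open>rank_one\<close>.\<close>

lemma rank_one_imp: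
  assumes R: "rank_one A"
  shows "\<exists>n e c. n \<in> W \<and> e \<in> E0 \<and> norm n = 1 \<and> norm e = 1 \<and> c \<noteq> 0 \<and> A = c *\<^sub>R sym_dyad n e"
proof -
  obtain C where C: "C \<in> pp" "A \<in> centraliser C" "fin_dim (centraliser C)" and ab: "\<And>B B'. B \<in> centraliser C \<Longrightarrow> B' \<in> centraliser C \<Longrightarrow> commuting B B'"
    and z: "\<And>B. B \<in> centraliser C \<Longrightarrow> inner_pp A B = 0 \<Longrightarrow> \<not> fin_dim (centraliser B)" using R unfolding rank_one_def by blast
  obtain e n l where f: "frame e n" and l0: "\<And>i. i < p \<Longrightarrow> l i \<ge> 0" and Cs: "C = frame_op e n l" using pp_svd[OF C(1)] by blast
  have l1: "l i > 0" if "i < p" for i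
  proof -
    have "l i \<noteq> 0" using centraliser_not_fin_dim[OF f that, of l] C(3) Cs by blast
    then show ?thesis using l0[OF that] by simp
  qed
  have inj: "l j \<noteq> l k" if j: "j < p" and k: "k < p" and jk: "j \<noteq> k" for j k
  proof
    assume eq: "l j = l k"
    note fj = frame_inner[OF f j j] and fk = frame_inner[OF f k k] and fjk = frame_inner[OF f j k] and fkj = frame_inner[OF f k j]
    \<comment> \<open>For equal singular values the centraliser contains all matrices supported on
      the two indices that are symmetric in the frame. The exchange \<open>B1\<close> and the
      diagonal entry \<open>B2\<close> do not commute.\<close>
    define B1 where "B1 = sym_dyad (n j) (e k) + sym_dyad (n k) (e j)"
    define B2 where "B2 = sym_dyad (n j) (e j)"
    have B1: "B1 x = (e k \<bullet> x) *\<^sub>R n j + (n j \<bullet> x) *\<^sub>R e k + ((e j \<bullet> x) *\<^sub>R n k + (n k \<bullet> x) *\<^sub>R e j)" for x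
      by (simp add: B1_def blinfun.add_left sym_dyad_apply)
    have s: "frame_op e n l (n j) = l k *\<^sub>R e j" "frame_op e n l (e k) = l k *\<^sub>R n k" "frame_op e n l (n k) = l k *\<^sub>R e k" "frame_op e n l (e j) = l k *\<^sub>R n j"
      using frame_op_frame[OF f j, of l] frame_op_frame[OF f k, of l] eq by simp_all
    have i: "e k \<bullet> frame_op e n l x = l k * (n k \<bullet> x)" "n k \<bullet> frame_op e n l x = l k * (e k \<bullet> x)"
       "e j \<bullet> frame_op e n l x = l k * (n j \<bullet> x)" "n j \<bullet> frame_op e n l x = l k * (e j \<bullet> x)" for x
      using frame_op_inner[OF f j, of l x] frame_op_inner[OF f k, of l x] eq by simp_all
    have "B1 \<in> centraliser C" unfolding centraliser_def
    proof (intro CollectI conjI)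
      show "B1 \<in> pp" unfolding B1_def by (intro pp_add sym_dyad_pp fj(6) fk(5) fk(6) fj(5))
      show "commuting C B1" unfolding commuting_def Cs
        by (simp add: B1 blinfun.add_right blinfun.scaleR_right s i scaleR_add_right algebra_simps)
    qed
    moreover have "B2 \<in> centraliser C" unfolding centraliser_def
    proof (intro CollectI conjI)
      show "B2 \<in> pp" unfolding B2_def by (intro sym_dyad_pp fj(6) fj(5))
      show "commuting C B2" unfolding commuting_def Cs B2_def
        by (simp add: sym_dyad_apply blinfun.add_right blinfun.scaleR_right s i algebra_simps)
    qed
    ultimately have "commuting B1 B2" by (rule ab)
    then have "B1 (B2 (e j)) = B2 (B1 (e j))" by (simp add: commuting_def)
    moreover have "B2 (e j) = n j" using fj by (simp add: B2_def sym_dyad_apply)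
    moreover have "B1 (n j) = e k" using fj fk fjk fkj jk by (simp add: B1)
    moreover have "B1 (e j) = n k" using fj fk fjk fkj jk by (simp add: B1)
    moreover have "B2 (n k) = 0" using fj fk fjk fkj jk by (simp add: B2_def sym_dyad_apply)
    ultimately have "e k = 0" by simp
    then show False using fk(1) by simp
  qed
  have "A \<in> centraliser (frame_op e n l)" using C(2) Cs by simp
  from centraliser_regular[where l=l, OF f l1 inj this] obtain a where a: "A = frame_op e n a" by (rule exE)
  have svC: "frame_op e n b \<in> centraliser C" for b unfolding Cs centraliser_def using frame_op_pp[OF f] commuting_frame_op[OF f] by simp
  have zb: "\<exists>i<p. b i = 0" if "(\<Sum>i<p. a i * b i) = 0" for b
  proof (rule ccontr)
    assume "\<not> ?thesis"
    then have "fin_dim (centraliser (frame_op e n b))" by (intro centraliser_fin_dim[OF f]) auto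
    then show False using z[OF svC, of b] that unfolding a inner_pp_frame_op[OF f] by blast
  qed
  have ex: "\<exists>j<p. a j \<noteq> 0"
  proof (rule ccontr)
    assume "\<not> ?thesis"
    then have "(\<Sum>i<p. a i * 1) = 0" by simp
    from zb[OF this] show False by simp
  qed
  then obtain j where j: "j < p" "a j \<noteq> 0" by blast
  have un: "a k = 0" if k: "k < p" "k \<noteq> j" for k
  proof (rule ccontr)
    assume ak: "a k \<noteq> 0"
    \<comment> \<open>The sum of the remaining entries. The vector \<open>b\<close> is to be 1 away
      from \<open>j\<close> and to balance \<open>s\<close> at \<open>j\<close>; this makes all
      entries nonzero unless \<open>s = 0\<close>.\<close>
    define s where "s = (\<Sum>i\<in>{..<p} - {j}. a i)"
    have rem: "(\<Sum>i<p. g i) = g j + (\<Sum>i\<in>{..<p} - {j}. g i)" for g :: "nat \<Rightarrow> real"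
      by (rule sum.remove) (use j(1) in auto)
    show False
    proof (cases "s = 0")
      case False
      define b where "b i = (if i = j then - s / a j else 1)" for i
      have "(\<Sum>i\<in>{..<p} - {j}. a i * b i) = s" unfolding s_def by (rule sum.cong) (auto simp: b_def)
      then have "(\<Sum>i<p. a i * b i) = 0" unfolding rem[of "\<lambda>i. a i * b i"] using j(2) by (simp add: b_def)
      from zb[OF this] show False using False j(2) by (auto simp: b_def split: if_splits)
    next
      case True
      \<comment> \<open>For \<open>s = 0\<close> the weight 2 at \<open>k\<close> changes the sum of
        the other terms from 0 to the nonzero number \<open>a k\<close>, which the entry at
        \<open>j\<close> balances.\<close>
      define b where "b i = (if i = j then - a k / a j else if i = k then 2 else 1)" for i
      have kk: "k \<in> {..<p} - {j}" using k by simp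
      have rem2: "(\<Sum>i\<in>{..<p} - {j}. g i) = g k + (\<Sum>i\<in>{..<p} - {j} - {k}. g i)" for g :: "nat \<Rightarrow> real"
        by (rule sum.remove[OF _ kk]) simp
      have "(\<Sum>i\<in>{..<p} - {j} - {k}. a i * b i) = (\<Sum>i\<in>{..<p} - {j} - {k}. a i)" by (rule sum.cong) (auto simp: b_def)
      then have "(\<Sum>i\<in>{..<p} - {j}. a i * b i) = a k * 2 + (s - a k)"
        unfolding s_def rem2 using k(2) by (simp add: b_def)
      then have "(\<Sum>i<p. a i * b i) = 0" unfolding rem[of "\<lambda>i. a i * b i"] using j(2) True by (simp add: b_def)
      from zb[OF this] show False using ak j(2) by (auto simp: b_def split: if_splits)
    qed
  qed
  have "A = (\<Sum>i<p. if i = j then a j *\<^sub>R sym_dyad (n j) (e j) else 0)"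
    unfolding a frame_op_def by (rule sum.cong) (use un in \<open>auto simp: sym_dyad_def\<close>)
  then have "A = a j *\<^sub>R sym_dyad (n j) (e j)" using j(1) by simp
  moreover have "norm (n j) = 1" "norm (e j) = 1" using frame_inner(1,2)[OF f j(1,1)] by (simp_all add: norm_eq_sqrt_inner)
  ultimately show ?thesis using frame_inner(5,6)[OF f j(1,1)] j(2)
    by (intro exI[of _ "n j"] exI[of _ "e j"] exI[of _ "a j"]) simp
qed

text \<open>In its singular value decomposition every \<open>l i *\<^sub>R n' i\<close> is a
  multiple of \<open>n\<close>, while the \<open>n' i\<close> are orthogonal; so exactly one
  singular value is nonzero.\<close>

lemma rank_one_sym_dyad:
  assumes n: "n \<in> W" "norm n = 1" and e: "e \<in> E0" "norm e = 1"
  shows "rank_one (sym_dyad n e)"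
proof -
  obtain e' n' l where f: "frame e' n'" and As: "sym_dyad n e = frame_op e' n' l" using pp_svd[OF sym_dyad_pp[OF n(1) e(1)]] by blast
  have nn: "n \<bullet> n = 1" using n(2) by (simp add: dot_square_norm)
  have ln: "l i *\<^sub>R n' i = (e \<bullet> e' i) *\<^sub>R n" if i: "i < p" for i
  proof -
    have "l i *\<^sub>R n' i = sym_dyad n e (e' i)" unfolding As by (rule frame_op_frame(1)[OF f i, symmetric])
    then show ?thesis using EW(2)[OF n(1) frame_inner(5)[OF f i i]] by (simp add: sym_dyad_apply)
  qed
  have li: "l i = 0 \<longleftrightarrow> e \<bullet> e' i = 0" if i: "i < p" for i
  proof -
    have "n' i \<noteq> 0" using frame_inner(2)[OF f i i] by auto
    moreover have "n \<noteq> 0" using nn by auto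
    ultimately show ?thesis using ln[OF i] by (metis scaleR_eq_0_iff)
  qed
  have oe: "onE e'" using f by (simp add: frame_def)
  have "\<exists>j<p. l j \<noteq> 0"
  proof (rule ccontr)
    assume "\<not> ?thesis"
    then have "e' i \<bullet> e = 0" if "i < p" for i using li[OF that] that by (simp add: inner_commute)
    then have "e = 0" using E_eq[OF oe e(1)] by simp
    then show False using e(2) by simp
  qed
  then obtain j where j: "j < p" "l j \<noteq> 0" by blast
  have un: "l k = 0" if k: "k < p" "k \<noteq> j" for k
  proof -
    have "(l k *\<^sub>R n' k) \<bullet> (l j *\<^sub>R n' j) = 0" using frame_inner(2)[OF f k(1) j(1)] k(2) by simp
    then have "(e \<bullet> e' k) * (e \<bullet> e' j) = 0" unfolding ln[OF k(1)] ln[OF j(1)] using nn by (simp add: disj_commute)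
    then show ?thesis using li[OF k(1)] li[OF j(1)] j(2) by simp
  qed
  have "frame_op e' n' l = frame_op e' n' (\<lambda>i. if i = j then l j else 0)"
    unfolding frame_op_def by (rule sum.cong) (use un in auto)
  then show ?thesis unfolding As using rank_one_single[where c="l j", OF f j] by simp
qed

text \<open>A sum of two maps of rank one has rank at most one only if the left or the right factors
  are parallel. For unit vectors, parallelism is the equality case of Cauchy-Schwarz, see
  \<open>unit_parallel\<close>.\<close>

lemma sum_sym_dyad_parallel:
  assumes u: "u1 \<in> W" "u2 \<in> W" "u \<in> W" and a: "a1 \<in> E0" "a2 \<in> E0" "a \<in> E0"
    and nu: "norm u1 = 1" "norm u2 = 1" and na: "norm a1 = 1" "norm a2 = 1"
    and eq: "sym_dyad u1 a1 + sym_dyad u2 a2 = sym_dyad u a"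
  shows "(a1 \<bullet> a2)\<^sup>2 = 1 \<or> (u1 \<bullet> u2)\<^sup>2 = 1"
proof (rule disjCI)
  assume ne: "(u1 \<bullet> u2)\<^sup>2 \<noteq> 1"
  show "(a1 \<bullet> a2)\<^sup>2 = 1"
  proof (rule ccontr)
    assume na12: "(a1 \<bullet> a2)\<^sup>2 \<noteq> 1"
    define \<delta> where "\<delta> = 1 - (a1 \<bullet> a2)\<^sup>2"
    have d: "\<delta> \<noteq> 0" using na12 by (simp add: \<delta>_def)
    have aa: "a1 \<bullet> a1 = 1" "a2 \<bullet> a2 = 1" "u1 \<bullet> u1 = 1" "u2 \<bullet> u2 = 1" using na nu by (simp_all add: dot_square_norm)
    have ap: "(a1 \<bullet> x) *\<^sub>R u1 + (a2 \<bullet> x) *\<^sub>R u2 = (a \<bullet> x) *\<^sub>R u" if x: "x \<in> E0" for x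
    proof -
      have "(sym_dyad u1 a1 + sym_dyad u2 a2) x = sym_dyad u a x" unfolding eq ..
      then show ?thesis using EW(2)[OF u(1) x] EW(2)[OF u(2) x] EW(2)[OF u(3) x] by (simp add: blinfun.add_left sym_dyad_apply)
    qed
    \<comment> \<open>Up to the factor \<open>\<delta>\<close>, \<open>x\<close> and
      \<open>y\<close> are the dual basis of \<open>a1\<close> and \<open>a2\<close>, so evaluating
      at them isolates \<open>u1\<close> and \<open>u2\<close>.\<close>
    define x where "x = a1 - (a1 \<bullet> a2) *\<^sub>R a2"
    define y where "y = a2 - (a1 \<bullet> a2) *\<^sub>R a1"
    have xy: "x \<in> E0" "y \<in> E0" unfolding x_def y_def using a subE by (simp_all add: subspace_diff subspace_scale)
    have "a1 \<bullet> x = \<delta>" "a2 \<bullet> x = 0" "a2 \<bullet> y = \<delta>" "a1 \<bullet> y = 0"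
      by (simp_all add: x_def y_def \<delta>_def inner_diff_right aa power2_eq_square inner_commute[of a2 a1])
    then have e: "\<delta> *\<^sub>R u1 = (a \<bullet> x) *\<^sub>R u" "\<delta> *\<^sub>R u2 = (a \<bullet> y) *\<^sub>R u" using ap[OF xy(1)] ap[OF xy(2)] by simp_all
    have "(\<delta> *\<^sub>R u1) \<bullet> (\<delta> *\<^sub>R u1) * ((\<delta> *\<^sub>R u2) \<bullet> (\<delta> *\<^sub>R u2)) = ((\<delta> *\<^sub>R u1) \<bullet> (\<delta> *\<^sub>R u2))\<^sup>2"
      unfolding e by (simp add: power2_eq_square mult_ac)
    then have "\<delta> * \<delta> * (\<delta> * \<delta>) = \<delta> * \<delta> * (\<delta> * \<delta>) * (u1 \<bullet> u2)\<^sup>2" by (simp add: aa power_mult_distrib power2_eq_square mult_ac)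
    then have "(u1 \<bullet> u2)\<^sup>2 = 1" using d by simp
    then show False using ne by simp
  qed
qed

lemma unit_parallel:
  assumes "norm a = 1" "norm b = 1" "(a \<bullet> b)\<^sup>2 = 1" shows "b = (a \<bullet> b) *\<^sub>R (a::'a)"
proof -
  have "a \<bullet> a = 1" "b \<bullet> b = 1" using assms by (simp_all add: dot_square_norm)
  then have "(b - (a \<bullet> b) *\<^sub>R a) \<bullet> (b - (a \<bullet> b) *\<^sub>R a) = 1 - (a \<bullet> b)\<^sup>2"
    by (simp add: inner_diff_left inner_diff_right inner_commute[of b a] power2_eq_square)
  then show ?thesis using assms(3) by simp
qed

end

section \<open>Images of rank one elements under the differential\<close>

context iso_fix
begin

lemma centraliser_T: assumes C: "C \<in> pp" shows "centraliser (T C) = T ` centraliser C"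
proof
  show "centraliser (T C) \<subseteq> T ` centraliser C"
  proof
    fix B' assume B': "B' \<in> centraliser (T C)"
    then obtain B where B: "B \<in> pp" "T B = B'" using T_surj by (auto simp: centraliser_def)
    then have "commuting C B" using B' commuting_T_iff[OF C B(1)] by (simp add: centraliser_def)
    then have "B \<in> centraliser C" using B(1) by (simp add: centraliser_def)
    then show "B' \<in> T ` centraliser C" using B(2) by blast
  qed
  show "T ` centraliser C \<subseteq> centraliser (T C)"
    using T(1) commuting_T[OF C] by (auto simp: centraliser_def)
qed

lemma fin_dim_T: assumes S: "fin_dim S" shows "fin_dim (T ` S)"
proof -
  obtain F where F: "finite F" "F \<subseteq> pp" "S \<subseteq> span F" using S by (auto simp: fin_dim_def)
  have "B \<in> pp \<and> T B \<in> span (T ` F)" if "B \<in> span F" for B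
    using that
  proof (induction rule: span_induct_alt)
    case base then show ?case by (simp add: pp_zero T_0 span_0)
  next
    case (step c x y)
    have x: "x \<in> pp" using step.hyps F(2) by blast
    have "T (c *\<^sub>R x + y) = c *\<^sub>R T x + T y" using T_add[OF pp_scale[OF x]] T_scale[OF x] step.IH by simp
    moreover have "T x \<in> span (T ` F)" by (rule span_base) (use step.hyps in simp)
    ultimately show ?case using step.IH x by (simp add: span_add span_scale pp_add pp_scale)
  qed
  then have "T ` S \<subseteq> span (T ` F)" using F(3) by auto
  moreover have "T ` F \<subseteq> pp" using F(2) T(1) by auto
  ultimately show ?thesis unfolding fin_dim_def using F(1) by (intro exI[of _ "T ` F"]) simp
qed

lemma inv_T: assumes C: "C \<in> pp" shows "iso_fix.T E0 \<Phi> (inv_into X f) (T C) = C"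
proof -
  interpret i: iso_fix E0 \<Phi> p "inv_into X f" by (rule iso_fix_inv)
  show ?thesis
    by (rule i.T_eqI[OF T(1)[OF C] C]) (simp add: T(2)[OF C, symmetric] refl.isometry_inv(2)[OF f ge_X[OF C]])
qed

lemma fin_dim_T_iff: assumes S: "S \<subseteq> pp" shows "fin_dim (T ` S) \<longleftrightarrow> fin_dim S"
proof
  assume a: "fin_dim (T ` S)"
  interpret i: iso_fix E0 \<Phi> p "inv_into X f" by (rule iso_fix_inv)
  have "i.T ` T ` S = id ` S" unfolding image_image by (rule image_cong) (use inv_T S in auto)
  then show "fin_dim S" using i.fin_dim_T[OF a] by simp
qed (rule fin_dim_T)

lemma rank_one_T: assumes A: "A \<in> pp" and R: "rank_one A" shows "rank_one (T A)"
proof -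
  obtain C where C: "C \<in> pp" "A \<in> centraliser C" "fin_dim (centraliser C)" and ab: "\<And>B B'. B \<in> centraliser C \<Longrightarrow> B' \<in> centraliser C \<Longrightarrow> commuting B B'"
    and z: "\<And>B. B \<in> centraliser C \<Longrightarrow> inner_pp A B = 0 \<Longrightarrow> \<not> fin_dim (centraliser B)" using R unfolding rank_one_def by blast
  have cp: "B \<in> pp" if "B \<in> centraliser D" for B D using that by (simp add: centraliser_def)
  show ?thesis unfolding rank_one_def
  proof (intro bexI[of _ "T C"] conjI ballI impI)
    show "T C \<in> pp" by (rule T(1)[OF C(1)])
    show "T A \<in> centraliser (T C)" unfolding centraliser_T[OF C(1)] using C(2) by (rule imageI)
    show "fin_dim (centraliser (T C))" unfolding centraliser_T[OF C(1)] by (rule fin_dim_T[OF C(3)])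
    fix B' assume "B' \<in> centraliser (T C)"
    then obtain B where B: "B \<in> centraliser C" "B' = T B" unfolding centraliser_T[OF C(1)] by blast
    show "commuting B' D'" if "D' \<in> centraliser (T C)" for D'
    proof -
      obtain D where D: "D \<in> centraliser C" "D' = T D" using \<open>D' \<in> centraliser (T C)\<close> unfolding centraliser_T[OF C(1)] by blast
      show ?thesis unfolding B(2) D(2) by (rule commuting_T[OF cp[OF B(1)] cp[OF D(1)] ab[OF B(1) D(1)]])
    qed
    assume "inner_pp (T A) B' = 0"
    then have "inner_pp A B = 0" unfolding B(2) inner_pp_T[OF A cp[OF B(1)]] .
    then have "\<not> fin_dim (centraliser B)" by (rule z[OF B(1)])
    then show "\<not> fin_dim (centraliser B')" unfolding B(2) centraliser_T[OF cp[OF B(1)]]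
      by (subst fin_dim_T_iff) (use cp in auto)
  qed
qed

text \<open>The scalar from \<open>rank_one_imp\<close> is a sign because \<open>T\<close> preserves
  inner products, and the sign is absorbed into \<open>u\<close>.\<close>

lemma T_sym_dyad_unit:
  assumes n: "n \<in> W" "norm n = 1" and e: "e \<in> E0" "norm e = 1"
  shows "\<exists>u a. u \<in> W \<and> a \<in> E0 \<and> norm u = 1 \<and> norm a = 1 \<and> T (sym_dyad n e) = sym_dyad u a"
proof -
  note elp = sym_dyad_pp[OF n(1) e(1)]
  obtain u a c where u: "u \<in> W" "a \<in> E0" "norm u = 1" "norm a = 1" "c \<noteq> 0" "T (sym_dyad n e) = c *\<^sub>R sym_dyad u a"
    using rank_one_imp[OF rank_one_T[OF elp rank_one_sym_dyad[OF n e]]] by blast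
  have one: "x \<bullet> x = 1" if "norm x = 1" for x :: 'a using that by (simp add: dot_square_norm)
  have "inner_pp (T (sym_dyad n e)) (T (sym_dyad n e)) = 1"
    unfolding inner_pp_T[OF elp elp] inner_pp_sym_dyad_sym_dyad[OF n(1) e(1) n(1) e(1)] using one n(2) e(2) by simp
  then have "c * c = 1" unfolding u(6) inner_pp_simps inner_pp_sym_dyad_sym_dyad[OF u(1,2,1,2)] using one u(3,4) by simp
  then have "\<bar>c\<bar> = 1" by (metis abs_1 abs_mult_self_eq abs_square_eq_1 power2_eq_square)
  then have "norm (c *\<^sub>R u) = 1" using u(3) by simp
  moreover have "c *\<^sub>R u \<in> W" using u(1) subW by (simp add: subspace_scale)
  moreover have "T (sym_dyad n e) = sym_dyad (c *\<^sub>R u) a" unfolding u(6) sym_dyad_scale1 ..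
  ultimately show ?thesis using u(2,4) by blast
qed

lemma T_sym_dyad:
  assumes n: "n \<in> W" and e: "e \<in> E0"
  shows "\<exists>u a. u \<in> W \<and> a \<in> E0 \<and> T (sym_dyad n e) = sym_dyad u a"
proof (cases "n = 0 \<or> e = 0")
  case True
  then have "T (sym_dyad n e) = sym_dyad 0 0" using sym_dyad_zero T_0 by auto
  then show ?thesis using subspace_0[OF subW] subspace_0[OF subE] by blast
next
  case False
  define n1 where "n1 = (1 / norm n) *\<^sub>R n"
  define e1 where "e1 = (1 / norm e) *\<^sub>R e"
  have n1: "n1 \<in> W" "norm n1 = 1" "n = norm n *\<^sub>R n1" using False n subW by (simp_all add: n1_def subspace_scale)
  have e1: "e1 \<in> E0" "norm e1 = 1" "e = norm e *\<^sub>R e1" using False e subE by (simp_all add: e1_def subspace_scale)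
  obtain u a where u: "u \<in> W" "a \<in> E0" "T (sym_dyad n1 e1) = sym_dyad u a" using T_sym_dyad_unit[OF n1(1,2) e1(1,2)] by blast
  have "sym_dyad n e = sym_dyad (norm n *\<^sub>R n1) (norm e *\<^sub>R e1)" by (rule arg_cong2[where f=sym_dyad, OF n1(3) e1(3)])
  also have "\<dots> = (norm n * norm e) *\<^sub>R sym_dyad n1 e1" by (simp add: sym_dyad_scale1 sym_dyad_scale2)
  finally have "T (sym_dyad n e) = (norm n * norm e) *\<^sub>R sym_dyad u a" using T_scale[OF sym_dyad_pp[OF n1(1) e1(1)]] u(3) by simp
  then have "T (sym_dyad n e) = sym_dyad ((norm n * norm e) *\<^sub>R u) a" unfolding sym_dyad_scale1 .
  moreover have "(norm n * norm e) *\<^sub>R u \<in> W" using u(1) subW by (simp add: subspace_scale)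
  ultimately show ?thesis using u(2) by blast
qed

section \<open>Reconstruction of the orthogonal operator\<close>

text \<open>With a common right factor \<open>e\<close>, the sum of the two elements is again of
  this kind, hence so is its image; now \<open>sum_sym_dyad_parallel\<close> applies.\<close>

lemma T_sym_dyad_dichotomy:
  assumes m: "m1 \<in> W" "m2 \<in> W" and e: "e \<in> E0"
    and u: "u1 \<in> W" "u2 \<in> W" "norm u1 = 1" "norm u2 = 1" and a: "a1 \<in> E0" "a2 \<in> E0" "norm a1 = 1" "norm a2 = 1"
    and T1: "T (sym_dyad m1 e) = sym_dyad u1 a1" and T2: "T (sym_dyad m2 e) = sym_dyad u2 a2"
  shows "(a1 \<bullet> a2)\<^sup>2 = 1 \<or> (u1 \<bullet> u2)\<^sup>2 = 1"
proof -
  obtain v b where v: "v \<in> W" "b \<in> E0" "T (sym_dyad (m1 + m2) e) = sym_dyad v b"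
    using T_sym_dyad[OF subspace_add[OF subW m] e] by (elim exE conjE)
  have "sym_dyad u1 a1 + sym_dyad u2 a2 = sym_dyad v b"
    using v(3) unfolding sym_dyad_add1 T_add[OF sym_dyad_pp[OF m(1) e] sym_dyad_pp[OF m(2) e]] T1 T2 .
  from sum_sym_dyad_parallel[OF u(1,2) v(1) a(1,2) v(2) u(3,4) a(3,4) this] show ?thesis .
qed

text \<open>Otherwise \<open>u\<^sub>0\<close> and \<open>u\<close> are parallel and then so are the left factors of all images, so that the
  images would span a space of dimension at most \<open>p\<close>, whereas \<^term>\<open>W\<close> is infinite-dimensional.\<close>

lemma T_sym_dyad_parallel:
  assumes m: "m0 \<in> W" "m \<in> W" "m0 \<bullet> m = 0" and e: "e \<in> E0"  "norm e = 1"
    and u: "u0 \<in> W" "u \<in> W" "norm u0 = 1" "norm u = 1" and a: "a0 \<in> E0" "a \<in> E0" "norm a0 = 1" "norm a = 1"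
    and T0: "T (sym_dyad m0 e) = sym_dyad u0 a0" and T1: "T (sym_dyad m e) = sym_dyad u a"
  shows "(a0 \<bullet> a)\<^sup>2 = 1"
proof (rule ccontr)
  assume ne: "(a0 \<bullet> a)\<^sup>2 \<noteq> 1"
  then have uu: "(u0 \<bullet> u)\<^sup>2 = 1" using T_sym_dyad_dichotomy[OF m(1,2) e(1) u a T0 T1] by simp
  have bE: "basis_E0 i \<in> E0" if "i < p" for i using onE_basis_E0 that by (simp add: onE_def)
  have "(u0 \<bullet> u) * (a0 \<bullet> a) = inner_pp (T (sym_dyad m0 e)) (T (sym_dyad m e))" unfolding T0 T1 inner_pp_sym_dyad_sym_dyad[OF u(1) a(1) u(2) a(2)] ..
  also have "\<dots> = 0" unfolding inner_pp_T[OF sym_dyad_pp[OF m(1) e(1)] sym_dyad_pp[OF m(2) e(1)]] inner_pp_sym_dyad_sym_dyad[OF m(1) e(1) m(2) e(1)] m(3) by simp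
  finally have aa: "a0 \<bullet> a = 0" using uu by auto
  \<comment> \<open>The preimages of the elements with left factor \<open>u0\<close>. Choosing
    \<open>m3\<close> orthogonal to every \<open>S i e\<close> makes \<open>sym_dyad m3 e\<close>
    orthogonal to all of them, and this orthogonality survives \<open>T\<close>.\<close>
  define S where "S i = (SOME B. B \<in> pp \<and> T B = sym_dyad u0 (basis_E0 i))" for i
  have S: "S i \<in> pp \<and> T (S i) = sym_dyad u0 (basis_E0 i)" if i: "i < p" for i
  proof -
    have "\<exists>B. B \<in> pp \<and> T B = sym_dyad u0 (basis_E0 i)" using T_surj[OF sym_dyad_pp[OF u(1) bE[OF i]]] by (simp only: Bex_def)
    then show ?thesis unfolding S_def by (rule someI_ex)
  qed
  have "finite ({m0, m} \<union> (\<lambda>i. S i e) ` {..<p})" by simp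
  from ex_unit_orthogonal[OF this] obtain m3 where m3: "m3 \<in> W" "norm m3 = 1"
    and o: "\<forall>f\<in>{m0, m} \<union> (\<lambda>i. S i e) ` {..<p}. f \<bullet> m3 = 0" by (elim bexE conjE)
  obtain u3 a3 where u3: "u3 \<in> W" "a3 \<in> E0" "norm u3 = 1" "norm a3 = 1" "T (sym_dyad m3 e) = sym_dyad u3 a3"
    using T_sym_dyad_unit[OF m3 e] by (elim exE conjE)
  have d0: "(a0 \<bullet> a3)\<^sup>2 = 1 \<or> (u0 \<bullet> u3)\<^sup>2 = 1"
    by (rule T_sym_dyad_dichotomy[OF m(1) m3(1) e(1) u(1) u3(1) u(3) u3(3) a(1) u3(2) a(3) u3(4) T0 u3(5)])
  have d1: "(a \<bullet> a3)\<^sup>2 = 1 \<or> (u \<bullet> u3)\<^sup>2 = 1"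
    by (rule T_sym_dyad_dichotomy[OF m(2) m3(1) e(1) u(2) u3(1) u(4) u3(3) a(2) u3(2) a(4) u3(4) T1 u3(5)])
  \<comment> \<open>Otherwise \<open>a3\<close> would be parallel to \<open>a0\<close>, hence
    orthogonal to \<open>a\<close>; the second dichotomy would then make \<open>u3\<close> parallel
    to \<open>u\<close>, and so to \<open>u0\<close>.\<close>
  have u03: "(u0 \<bullet> u3)\<^sup>2 = 1"
  proof (rule ccontr)
    assume n: "(u0 \<bullet> u3)\<^sup>2 \<noteq> 1"
    then have "(a0 \<bullet> a3)\<^sup>2 = 1" using d0 by simp
    note a3 = unit_parallel[OF a(3) u3(4) this]
    have "a \<bullet> a3 = a \<bullet> ((a0 \<bullet> a3) *\<^sub>R a0)" by (rule arg_cong[where f="\<lambda>x. a \<bullet> x", OF a3])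
    then have "a \<bullet> a3 = 0" using aa by (simp add: inner_commute[of a a0])
    then have 1: "(u \<bullet> u3)\<^sup>2 = 1" using d1 by simp
    have "u \<bullet> u3 = ((u0 \<bullet> u) *\<^sub>R u0) \<bullet> u3"
      by (rule arg_cong[where f="\<lambda>x. x \<bullet> u3", OF unit_parallel[OF u(3,4) uu]])
    then have "(u \<bullet> u3)\<^sup>2 = (u0 \<bullet> u)\<^sup>2 * (u0 \<bullet> u3)\<^sup>2" by (simp add: power_mult_distrib)
    then show False using 1 uu n by simp
  qed
  have "basis_E0 i \<bullet> a3 = 0" if i: "i < p" for i
  proof -
    have "inner_pp (sym_dyad m3 e) (S i) = m3 \<bullet> S i e" by (rule inner_pp_sym_dyad[OF m3(1) e(1)])
    also have "\<dots> = 0" using o i by (simp add: inner_commute[of m3])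
    finally have "inner_pp (T (sym_dyad m3 e)) (T (S i)) = 0"
      unfolding inner_pp_T[OF sym_dyad_pp[OF m3(1) e(1)] conjunct1[OF S[OF i]]] .
    then have "(u3 \<bullet> u0) * (a3 \<bullet> basis_E0 i) = 0"
      unfolding conjunct2[OF S[OF i]] u3(5) inner_pp_sym_dyad_sym_dyad[OF u3(1,2) u(1) bE[OF i]] .
    moreover have "u3 \<bullet> u0 \<noteq> 0" using u03 by (auto simp: inner_commute[of u3])
    ultimately show ?thesis by (simp add: inner_commute[of a3])
  qed
  \<comment> \<open>The image has its left factor parallel to \<open>u0\<close> and is orthogonal to
    everything with left factor \<open>u0\<close>, so nothing is left of its right factor.\<close>
  then have "a3 = 0" using E_eq[OF onE_basis_E0 u3(2)] by simp
  then show False using u3(4) by simp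
qed

text \<open>The right factor found for one \<open>m0\<close> serves all \<open>m\<close>: split
  \<open>m\<close> along \<open>m0\<close> and apply \<open>T_sym_dyad_parallel\<close> to the
  orthogonal part, absorbing the sign into the left factor.\<close>

lemma T_sym_dyad_factor:
  assumes e: "e \<in> E0" "norm e = 1"
  shows "\<exists>a\<in>E0. norm a = 1 \<and> (\<forall>m\<in>W. \<exists>u\<in>W. T (sym_dyad m e) = sym_dyad u a)"
proof -
  obtain m0 where m0: "m0 \<in> W" "norm m0 = 1" using ex_unit_orthogonal[of "{}"] by auto
  have m00: "m0 \<bullet> m0 = 1" using m0(2) by (simp add: dot_square_norm)
  obtain u0 a0 where u0: "u0 \<in> W" "a0 \<in> E0" "norm u0 = 1" "norm a0 = 1" "T (sym_dyad m0 e) = sym_dyad u0 a0"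
    using T_sym_dyad_unit[OF m0 e] by (elim exE conjE)
  have "\<exists>u\<in>W. T (sym_dyad m e) = sym_dyad u a0" if m: "m \<in> W" for m
  proof -
    define c where "c = m0 \<bullet> m"
    define m1 where "m1 = m - c *\<^sub>R m0"
    have m1: "m1 \<in> W" unfolding m1_def by (intro subspace_diff[OF subW] subspace_scale[OF subW] m m0(1))
    have o: "m0 \<bullet> m1 = 0" by (simp add: m1_def c_def inner_diff_right m00)
    have "\<exists>v\<in>W. T (sym_dyad m1 e) = sym_dyad v a0"
    proof (cases "m1 = 0")
      case True
      then have "T (sym_dyad m1 e) = sym_dyad 0 a0" by (simp add: sym_dyad_zero T_0)
      then show ?thesis using subspace_0[OF subW] by (rule bexI)
    next
      case False
      define n where "n = (1 / norm m1) *\<^sub>R m1"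
      have n: "n \<in> W" "norm n = 1" "m1 = norm m1 *\<^sub>R n" "m0 \<bullet> n = 0"
        using False m1 subW o by (simp_all add: n_def subspace_scale)
      obtain u a where u: "u \<in> W" "a \<in> E0" "norm u = 1" "norm a = 1" "T (sym_dyad n e) = sym_dyad u a"
        using T_sym_dyad_unit[OF n(1,2) e] by (elim exE conjE)
      have "(a0 \<bullet> a)\<^sup>2 = 1"
        by (rule T_sym_dyad_parallel[OF m0(1) n(1,4) e u0(1) u(1) u0(3) u(3) u0(2) u(2) u0(4) u(4) u0(5) u(5)])
      then have a: "a = (a0 \<bullet> a) *\<^sub>R a0" by (rule unit_parallel[OF u0(4) u(4)])
      have "sym_dyad m1 e = norm m1 *\<^sub>R sym_dyad n e" unfolding sym_dyad_scale1[symmetric] n(3)[symmetric] ..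
      then have "T (sym_dyad m1 e) = norm m1 *\<^sub>R sym_dyad u a" using T_scale[OF sym_dyad_pp[OF n(1) e(1)]] u(5) by simp
      also have "sym_dyad u a = (a0 \<bullet> a) *\<^sub>R sym_dyad u a0" using arg_cong[where f="sym_dyad u", OF a] unfolding sym_dyad_scale2 .
      finally have "T (sym_dyad m1 e) = sym_dyad ((norm m1 * (a0 \<bullet> a)) *\<^sub>R u) a0" by (simp add: sym_dyad_scale1)
      moreover have "(norm m1 * (a0 \<bullet> a)) *\<^sub>R u \<in> W" by (rule subspace_scale[OF subW u(1)])
      ultimately show ?thesis by (rule bexI)
    qed
    then obtain v where v: "v \<in> W" "T (sym_dyad m1 e) = sym_dyad v a0" by (elim bexE)
    have "sym_dyad m e = c *\<^sub>R sym_dyad m0 e + sym_dyad m1 e" unfolding sym_dyad_scale1[symmetric] sym_dyad_add1[symmetric] by (simp add: m1_def)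
    then have "T (sym_dyad m e) = c *\<^sub>R sym_dyad u0 a0 + sym_dyad v a0"
      using T_add[OF pp_scale[OF sym_dyad_pp[OF m0(1) e(1)]] sym_dyad_pp[OF m1 e(1)]] T_scale[OF sym_dyad_pp[OF m0(1) e(1)]] u0(5) v(2) by simp
    then have "T (sym_dyad m e) = sym_dyad (c *\<^sub>R u0 + v) a0" by (simp add: sym_dyad_scale1 sym_dyad_add1)
    moreover have "c *\<^sub>R u0 + v \<in> W" by (intro subspace_add[OF subW] subspace_scale[OF subW] u0(1) v(1))
    ultimately show ?thesis by (rule bexI)
  qed
  then have all: "\<forall>m\<in>W. \<exists>u\<in>W. T (sym_dyad m e) = sym_dyad u a0" by (rule ballI)
  show ?thesis
  proof (rule bexI)
    show "norm a0 = 1 \<and> (\<forall>m\<in>W. \<exists>u\<in>W. T (sym_dyad m e) = sym_dyad u a0)" by (rule conjI[OF u0(4) all])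
  qed (rule u0(2))
qed

lemma sym_dyad_at: assumes "u \<in> W" "a \<in> E0" "norm a = 1" shows "sym_dyad u a a = u"
proof -
  have "a \<bullet> a = 1" using assms(3) by (simp add: dot_square_norm)
  then show ?thesis using EW(2)[OF assms(1,2)] by (simp add: sym_dyad_apply)
qed

text \<open>Each \<open>basis_E0 i\<close> gets a right factor \<open>a i\<close> and a linear
  isometry \<open>U i\<close> of the left factors. The point is that all \<open>U i\<close> agree up
  to sign; after moving the signs to the right factors, \<open>b\<close> is orthonormal and one
  isometry serves all indices.\<close>

lemma ex_image_basis:
  "\<exists>b. onE b \<and> (\<forall>j<p. \<forall>m\<in>W. T (sym_dyad m (basis_E0 j)) = sym_dyad (T (sym_dyad m (basis_E0 0)) (b 0)) (b j))"
proof -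
  have bE: "basis_E0 i \<in> E0" and nb: "norm (basis_E0 i) = 1" if "i < p" for i
    using onE_basis_E0 onfD[of p basis_E0 i i] that by (simp_all add: onE_def norm_eq_sqrt_inner)
  define a where "a i = (SOME a. a \<in> E0 \<and> norm a = 1 \<and> (\<forall>m\<in>W. \<exists>u\<in>W. T (sym_dyad m (basis_E0 i)) = sym_dyad u a))" for i
  have a': "a i \<in> E0 \<and> norm (a i) = 1 \<and> (\<forall>m\<in>W. \<exists>u\<in>W. T (sym_dyad m (basis_E0 i)) = sym_dyad u (a i))" if i: "i < p" for i
  proof -
    obtain x where x: "x \<in> E0" "norm x = 1 \<and> (\<forall>m\<in>W. \<exists>u\<in>W. T (sym_dyad m (basis_E0 i)) = sym_dyad u x)"
      using T_sym_dyad_factor[OF bE[OF i] nb[OF i]] by (elim bexE)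
    show ?thesis unfolding a_def by (rule someI[where x=x]) (rule conjI[OF x])
  qed
  have aE: "a i \<in> E0" and na: "norm (a i) = 1" if "i < p" for i using a'[OF that] by simp_all
  define U where "U i m = T (sym_dyad m (basis_E0 i)) (a i)" for i m
  have U: "U i m \<in> W" "T (sym_dyad m (basis_E0 i)) = sym_dyad (U i m) (a i)" if i: "i < p" and m: "m \<in> W" for i m
  proof -
    from a'[OF i] m obtain u where u: "u \<in> W" "T (sym_dyad m (basis_E0 i)) = sym_dyad u (a i)" by (elim conjE ballE bexE) auto
    have "U i m = u" unfolding U_def u(2) by (rule sym_dyad_at[OF u(1) aE[OF i] na[OF i]])
    then show "U i m \<in> W" "T (sym_dyad m (basis_E0 i)) = sym_dyad (U i m) (a i)" using u by simp_all
  qed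
  have Uadd: "U i (m + m') = U i m + U i m'" if "i < p" "m \<in> W" "m' \<in> W" for i m m'
    unfolding U_def sym_dyad_add1 T_add[OF sym_dyad_pp[OF that(2) bE[OF that(1)]] sym_dyad_pp[OF that(3) bE[OF that(1)]]] by (simp add: blinfun.add_left)
  have Uscale: "U i (c *\<^sub>R m) = c *\<^sub>R U i m" if "i < p" "m \<in> W" for i m c
    unfolding U_def sym_dyad_scale1 T_scale[OF sym_dyad_pp[OF that(2) bE[OF that(1)]]] by (simp add: blinfun.scaleR_left)
  have UU: "(U i m \<bullet> U j m') * (a i \<bullet> a j) = (m \<bullet> m') * (basis_E0 i \<bullet> basis_E0 j)" if i: "i < p" "j < p" and m: "m \<in> W" "m' \<in> W" for i j m m'
  proof -
    have "(U i m \<bullet> U j m') * (a i \<bullet> a j) = inner_pp (T (sym_dyad m (basis_E0 i))) (T (sym_dyad m' (basis_E0 j)))"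
      unfolding U(2)[OF i(1) m(1)] U(2)[OF i(2) m(2)] by (rule inner_pp_sym_dyad_sym_dyad[OF U(1)[OF i(1) m(1)] aE[OF i(1)] U(1)[OF i(2) m(2)] aE[OF i(2)], symmetric])
    then show ?thesis
      unfolding inner_pp_T[OF sym_dyad_pp[OF m(1) bE[OF i(1)]] sym_dyad_pp[OF m(2) bE[OF i(2)]]] inner_pp_sym_dyad_sym_dyad[OF m(1) bE[OF i(1)] m(2) bE[OF i(2)]] .
  qed
  have aii: "a i \<bullet> a i = 1" if "i < p" for i using na[OF that] by (simp add: dot_square_norm)
  have bb: "basis_E0 i \<bullet> basis_E0 j = (if i = j then 1 else 0)" if "i < p" "j < p" for i j
    using onE_basis_E0 onfD[of p basis_E0 i j] that by (simp add: onE_def)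
  have Uiso: "U i m \<bullet> U i m' = m \<bullet> m'" if "i < p" "m \<in> W" "m' \<in> W" for i m m'
    using UU[OF that(1,1,2,3)] aii[OF that(1)] bb[OF that(1,1)] by simp
  obtain m0 where m0: "m0 \<in> W" "norm m0 = 1" using ex_unit_orthogonal[of "{}"] by auto
  obtain m1 where m1: "m1 \<in> W" "norm m1 = 1" "m0 \<bullet> m1 = 0" using ex_unit_orthogonal[of "{m0}"] by auto
  have m00: "m0 \<bullet> m0 = 1" using m0(2) by (simp add: dot_square_norm)
  \<comment> \<open>Were \<open>a i\<close> and \<open>a j\<close> parallel, the rank two element
    with left factors \<open>m0\<close>, \<open>m1\<close> and right factors
    \<open>basis_E0 i\<close>, \<open>basis_E0 j\<close> would have an image of rank one, and the
    inverse differential would bring it back to rank one.\<close>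
  have indep: "(a i \<bullet> a j)\<^sup>2 \<noteq> 1" if i: "i < p" "j < p" "i \<noteq> j" for i j
  proof
    assume "(a i \<bullet> a j)\<^sup>2 = 1"
    then have aj: "a j = (a i \<bullet> a j) *\<^sub>R a i" by (rule unit_parallel[OF na[OF i(1)] na[OF i(2)]])
    define v where "v = U i m0 + (a i \<bullet> a j) *\<^sub>R U j m1"
    have vW: "v \<in> W" unfolding v_def by (intro subspace_add[OF subW] subspace_scale[OF subW] U i m0 m1)
    note q0 = sym_dyad_pp[OF m0(1) bE[OF i(1)]] and q1 = sym_dyad_pp[OF m1(1) bE[OF i(2)]]
    have "sym_dyad (U j m1) (a j) = (a i \<bullet> a j) *\<^sub>R sym_dyad (U j m1) (a i)"
      using arg_cong[where f="sym_dyad (U j m1)", OF aj] unfolding sym_dyad_scale2 .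
    then have Tv: "T (sym_dyad m0 (basis_E0 i) + sym_dyad m1 (basis_E0 j)) = sym_dyad v (a i)"
      unfolding T_add[OF q0 q1] U(2)[OF i(1) m0(1)] U(2)[OF i(2) m1(1)] v_def by (simp add: sym_dyad_add1 sym_dyad_scale1)
    interpret i: iso_fix E0 \<Phi> p "inv_into X f" by (rule iso_fix_inv)
    obtain w b where w: "w \<in> W" "b \<in> E0" "i.T (sym_dyad v (a i)) = sym_dyad w b" using i.T_sym_dyad[OF vW aE[OF i(1)]] by (elim exE conjE)
    have "sym_dyad m0 (basis_E0 i) + sym_dyad m1 (basis_E0 j) = sym_dyad w b" using inv_T[OF pp_add[OF q0 q1]] unfolding Tv w(3) by simp
    from sum_sym_dyad_parallel[OF m0(1) m1(1) w(1) bE[OF i(1)] bE[OF i(2)] w(2) m0(2) m1(2) nb[OF i(1)] nb[OF i(2)] this]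
    show False using m1(3) bb[OF i(1,2)] i(3) by simp
  qed
  \<comment> \<open>For a common left factor the sum over the indices 0 and \<open>j\<close> has
    rank one. Its image does too, and since \<open>a 0\<close> and \<open>a j\<close> are not
    parallel, the left factors must be.\<close>
  have par: "\<exists>c. U j m = c *\<^sub>R U 0 m" if j: "j < p" "j \<noteq> 0" and m: "m \<in> W" for j m
  proof (cases "m = 0")
    case True
    then have "U j m = 0 *\<^sub>R U 0 m" by (simp add: U_def sym_dyad_zero T_0)
    then show ?thesis by (rule exI)
  next
    case False
    define n where "n = (1 / norm m) *\<^sub>R m"
    have n: "n \<in> W" "norm n = 1" "m = norm m *\<^sub>R n" using False m subW by (simp_all add: n_def subspace_scale)
    have nU: "norm (U i n) = 1" if "i < p" for i
      using Uiso[OF that n(1,1)] n(2) by (simp add: norm_eq_sqrt_inner)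
    obtain v b where v: "v \<in> W" "b \<in> E0" "T (sym_dyad n (basis_E0 0 + basis_E0 j)) = sym_dyad v b"
      using T_sym_dyad[OF n(1) subspace_add[OF subE bE[OF p0] bE[OF j(1)]]] by (elim exE conjE)
    have "sym_dyad (U 0 n) (a 0) + sym_dyad (U j n) (a j) = sym_dyad v b"
      using v(3) unfolding sym_dyad_add2 T_add[OF sym_dyad_pp[OF n(1) bE[OF p0]] sym_dyad_pp[OF n(1) bE[OF j(1)]]]
        U(2)[OF p0 n(1)] U(2)[OF j(1) n(1)] .
    from sum_sym_dyad_parallel[OF U(1)[OF p0 n(1)] U(1)[OF j(1) n(1)] v(1) aE[OF p0] aE[OF j(1)] v(2) nU[OF p0] nU[OF j(1)] na[OF p0] na[OF j(1)] this]
    have "(U 0 n \<bullet> U j n)\<^sup>2 = 1" using indep[OF p0 j(1)] j(2) by simp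
    then have eq: "U j n = (U 0 n \<bullet> U j n) *\<^sub>R U 0 n" by (rule unit_parallel[OF nU[OF p0] nU[OF j(1)]])
    have Um: "U i m = norm m *\<^sub>R U i n" if "i < p" for i using arg_cong[where f="U i", OF n(3)] Uscale[OF that n(1)] by simp
    have "U j m = (U 0 n \<bullet> U j n) *\<^sub>R U 0 m" unfolding Um[OF j(1)] Um[OF p0] using arg_cong[where f="\<lambda>x. norm m *\<^sub>R x", OF eq] by simp
    then show ?thesis by (rule exI)
  qed
  have sgn: "\<exists>s. s\<^sup>2 = 1 \<and> (\<forall>m\<in>W. U j m = s *\<^sub>R U 0 m)" if j: "j < p" for j
  proof (cases "j = 0")
    case True
    then show ?thesis by (intro exI[of _ 1]) simp
  next
    case False
    obtain s where s: "U j m0 = s *\<^sub>R U 0 m0" using par[OF j False m0(1)] by (rule exE)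
    have "s * s = 1" using Uiso[OF j m0(1,1)] Uiso[OF p0 m0(1,1)] m00 by (simp add: s)
    moreover have "U j m = s *\<^sub>R U 0 m" if m: "m \<in> W" for m
    proof -
      define c where "c = m0 \<bullet> m"
      define n where "n = m - c *\<^sub>R m0"
      have n: "n \<in> W" unfolding n_def by (intro subspace_diff[OF subW] subspace_scale[OF subW] m m0(1))
      have o: "m0 \<bullet> n = 0" by (simp add: n_def c_def inner_diff_right m00)
      \<comment> \<open>The factor could still depend on the vector; comparing its values at
        \<open>m0\<close>, \<open>n\<close> and \<open>m0 + n\<close> shows that it is
        \<open>s\<close> throughout.\<close>
      obtain d where d: "U j (m0 + n) = d *\<^sub>R U 0 (m0 + n)" using par[OF j False subspace_add[OF subW m0(1) n]] by (rule exE)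
      then have d': "s *\<^sub>R U 0 m0 + U j n = d *\<^sub>R U 0 m0 + d *\<^sub>R U 0 n"
        unfolding Uadd[OF j m0(1) n] Uadd[OF p0 m0(1) n] s scaleR_add_right .
      obtain c' where c': "U j n = c' *\<^sub>R U 0 n" using par[OF j False n] by (rule exE)
      have "U 0 m0 \<bullet> (s *\<^sub>R U 0 m0 + U j n) = U 0 m0 \<bullet> (d *\<^sub>R U 0 m0 + d *\<^sub>R U 0 n)" unfolding d' ..
      then have "s = d" unfolding c' using Uiso[OF p0 m0(1) n] Uiso[OF p0 m0(1,1)] m00 o by (simp add: inner_add_right)
      then have 1: "U j n = s *\<^sub>R U 0 n" using d' by simp
      have "m = c *\<^sub>R m0 + n" by (simp add: n_def)
      then have Um: "U i m = c *\<^sub>R U i m0 + U i n" if "i < p" for i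
        using Uadd[OF that subspace_scale[OF subW m0(1)] n] Uscale[OF that m0(1)] by simp
      show ?thesis unfolding Um[OF j] Um[OF p0] s 1 by (simp add: scaleR_add_right mult.commute)
    qed
    ultimately show ?thesis by (intro exI[of _ s]) (simp add: power2_eq_square)
  qed
  \<comment> \<open>The sign at index 0 is fixed to 1 so that \<open>b 0 = a 0\<close> and the
    isometry can be evaluated at \<open>b 0\<close>.\<close>
  define s where "s j = (if j = 0 then 1 else SOME s. s\<^sup>2 = 1 \<and> (\<forall>m\<in>W. U j m = s *\<^sub>R U 0 m))" for j
  have s: "(s j)\<^sup>2 = 1 \<and> (\<forall>m\<in>W. U j m = s j *\<^sub>R U 0 m)" if j: "j < p" for j
  proof (cases "j = 0")
    case True
    show ?thesis unfolding s_def True by simp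
  next
    case False
    show ?thesis unfolding s_def if_not_P[OF False] by (rule someI_ex[OF sgn[OF j]])
  qed
  define b where "b j = s j *\<^sub>R a j" for j
  have b0: "b 0 = a 0" by (simp add: b_def s_def)
  have form_iso: "onE b" unfolding onE_def onf_def
  proof (intro conjI allI impI)
    show "b i \<in> E0" if "i < p" for i unfolding b_def by (rule subspace_scale[OF subE aE[OF that]])
    fix i j assume i: "i < p" and j: "j < p"
    show "b i \<bullet> b j = (if i = j then 1 else 0)"
    proof (cases "i = j")
      case True
      then show ?thesis using s[OF j] aii[OF j] by (simp add: b_def power2_eq_square)
    next
      case False
      have "U i m0 \<bullet> U j m0 = s i * s j"
        using s[OF i] s[OF j] m0(1) Uiso[OF p0 m0(1,1)] m00 by simp
      moreover have "s i * s j \<noteq> 0" using s[OF i] s[OF j] by auto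
      ultimately show ?thesis using UU[OF i j m0(1,1)] bb[OF i j] False by (simp add: b_def)
    qed
  qed
  have Tb: "\<forall>j<p. \<forall>m\<in>W. T (sym_dyad m (basis_E0 j)) = sym_dyad (T (sym_dyad m (basis_E0 0)) (b 0)) (b j)"
  proof (intro allI impI ballI)
    fix j m assume j: "j < p" and m: "m \<in> W"
    have "sym_dyad (U j m) (a j) = sym_dyad (s j *\<^sub>R U 0 m) (a j)"
      by (rule arg_cong[where f="\<lambda>x. sym_dyad x (a j)", OF bspec[OF conjunct2[OF s[OF j]] m]])
    then have "T (sym_dyad m (basis_E0 j)) = sym_dyad (U 0 m) (b j)"
      unfolding U(2)[OF j m] b_def[of j] sym_dyad_scale1 sym_dyad_scale2 .
    then show "T (sym_dyad m (basis_E0 j)) = sym_dyad (T (sym_dyad m (basis_E0 0)) (b 0)) (b j)" unfolding b0 U_def[of 0 m] .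
  qed
  show ?thesis by (rule exI[where x=b], rule conjI[OF form_iso Tb])
qed

section \<open>The orthogonal operator determined by the image basis\<close>

context
  fixes b
  assumes b: "onE b"
    and Tb: "\<forall>j<p. \<forall>m\<in>W. T (sym_dyad m (basis_E0 j)) = sym_dyad (T (sym_dyad m (basis_E0 0)) (b 0)) (b j)"
begin

text \<open>The left factor common to all indices \<open>j\<close>; it turns out to be a linear
  isometry of \<open>W\<close> onto itself.\<close>

definition V :: "'a \<Rightarrow> 'a" where "V m = T (sym_dyad m (basis_E0 0)) (b 0)"

lemma basis_E0_E0: "j < p \<Longrightarrow> basis_E0 j \<in> E0" and b_E0: "j < p \<Longrightarrow> b j \<in> E0"
  using onE_basis_E0 b by (simp_all add: onE_def)

lemma onf_b: "onf p b" using b by (simp add: onE_def)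

lemma T_sym_dyad_V: assumes "j < p" "m \<in> W" shows "T (sym_dyad m (basis_E0 j)) = sym_dyad (V m) (b j)"
  unfolding V_def by (rule Tb[rule_format, OF assms])

lemma V_W: assumes "m \<in> W" shows "V m \<in> W"
  unfolding V_def by (rule pp_EW[OF T(1)[OF sym_dyad_pp[OF assms basis_E0_E0[OF p0]]] b_E0[OF p0]])

lemma V_add: assumes "m \<in> W" "m' \<in> W" shows "V (m + m') = V m + V m'"
  unfolding V_def sym_dyad_add1 T_add[OF sym_dyad_pp[OF assms(1) basis_E0_E0[OF p0]] sym_dyad_pp[OF assms(2) basis_E0_E0[OF p0]]]
  by (rule blinfun.add_left)

lemma V_scale: assumes "m \<in> W" shows "V (c *\<^sub>R m) = c *\<^sub>R V m"
  unfolding V_def sym_dyad_scale1 T_scale[OF sym_dyad_pp[OF assms basis_E0_E0[OF p0]]] by (rule blinfun.scaleR_left)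

lemma V_inner: assumes "m \<in> W" "m' \<in> W" shows "V m \<bullet> V m' = m \<bullet> m'"
proof -
  have "(V m \<bullet> V m') * (b 0 \<bullet> b 0) = (m \<bullet> m') * (basis_E0 0 \<bullet> basis_E0 0)"
    unfolding inner_pp_sym_dyad_sym_dyad[OF assms(1) basis_E0_E0[OF p0] assms(2) basis_E0_E0[OF p0], symmetric]
      inner_pp_sym_dyad_sym_dyad[OF V_W[OF assms(1)] b_E0[OF p0] V_W[OF assms(2)] b_E0[OF p0], symmetric]
      T_sym_dyad_V[OF p0 assms(1), symmetric] T_sym_dyad_V[OF p0 assms(2), symmetric]
    by (rule inner_pp_T[OF sym_dyad_pp[OF assms(1) basis_E0_E0[OF p0]] sym_dyad_pp[OF assms(2) basis_E0_E0[OF p0]]])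
  then show ?thesis using onfD[OF onf_b p0 p0] onfD[OF onf_basis_E0 p0 p0] by simp
qed

lemma T_at_b: assumes A: "A \<in> pp" and j: "j < p" shows "T A (b j) = V (A (basis_E0 j))"
proof -
  have AW: "A (basis_E0 i) \<in> W" if "i < p" for i by (rule pp_EW[OF A basis_E0_E0[OF that]])
  have "T A = T (\<Sum>i<p. sym_dyad (A (basis_E0 i)) (basis_E0 i))" by (rule arg_cong[OF pp_expand[OF A onE_basis_E0]])
  also have "\<dots> = (\<Sum>i<p. T (sym_dyad (A (basis_E0 i)) (basis_E0 i)))" by (rule conjunct1[OF T_sum]) (rule sym_dyad_pp[OF AW basis_E0_E0])
  also have "\<dots> = (\<Sum>i<p. sym_dyad (V (A (basis_E0 i))) (b i))" by (rule sum.cong) (simp_all add: T_sym_dyad_V AW)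
  finally have "T A (b j) = (\<Sum>i<p. sym_dyad (V (A (basis_E0 i))) (b i)) (b j)" by (rule arg_cong[where f="\<lambda>B. blinfun_apply B (b j)"])
  also have "\<dots> = (\<Sum>i<p. (b i \<bullet> b j) *\<^sub>R V (A (basis_E0 i)))"
    unfolding blinfun.sum_left by (rule sum.cong) (simp_all add: sym_dyad_apply EW(2)[OF V_W[OF AW] b_E0[OF j]])
  also have "\<dots> = V (A (basis_E0 j))" by (rule onE_delta[OF b j])
  finally show ?thesis .
qed

text \<open>Surjectivity is inherited from \<open>T\<close>: evaluate a preimage of
  \<open>sym_dyad w (b 0)\<close> on the basis.\<close>

lemma V_surj: assumes w: "w \<in> W" shows "\<exists>m\<in>W. V m = w"
proof -
  obtain A where A: "A \<in> pp" "T A = sym_dyad w (b 0)" using T_surj[OF sym_dyad_pp[OF w b_E0[OF p0]]] by (elim bexE)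
  have "V (A (basis_E0 0)) = sym_dyad w (b 0) (b 0)" unfolding T_at_b[OF A(1) p0, symmetric] A(2) ..
  also have "\<dots> = w" by (rule sym_dyad_at[OF w b_E0[OF p0] onf_norm[OF onf_b p0]])
  finally show ?thesis by (rule bexI[OF _ pp_EW[OF A(1) basis_E0_E0[OF p0]]])
qed

definition q where "q x = (\<Sum>j<p. (basis_E0 j \<bullet> x) *\<^sub>R basis_E0 j)"
definition qb where "qb x = (\<Sum>j<p. (basis_E0 j \<bullet> x) *\<^sub>R b j)"
text \<open>The orthogonal operator sought: it sends \<open>basis_E0 j\<close> to \<open>b j\<close>
  and acts as \<open>V\<close> on \<open>W\<close>.\<close>

definition K where "K x = qb x + V (x - q x)"

lemma q_E0: "q x \<in> E0" and qb_E0: "qb x \<in> E0" and q_W: "x - q x \<in> W"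
  unfolding q_def qb_def by (rule sum_in_E[OF onE_basis_E0] sum_in_E[OF b] W_diff[OF onE_basis_E0])+

lemma q_add: "q (x + y) = q x + q y" "qb (x + y) = qb x + qb y"
  by (simp_all add: q_def qb_def inner_add_right scaleR_add_left sum.distrib)

lemma q_scale: "q (c *\<^sub>R x) = c *\<^sub>R q x" "qb (c *\<^sub>R x) = c *\<^sub>R qb x"
  by (simp_all add: q_def qb_def scaleR_sum_right)

lemma K_add: "K (x + y) = K x + K y"
proof -
  have "x + y - q (x + y) = (x - q x) + (y - q y)" by (simp add: q_add)
  then have "V (x + y - q (x + y)) = V (x - q x) + V (y - q y)" by (simp only: V_add[OF q_W q_W])
  then show ?thesis unfolding K_def by (simp add: q_add(2))
qed

lemma K_scale: "K (c *\<^sub>R x) = c *\<^sub>R K x"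
proof -
  have "c *\<^sub>R x - q (c *\<^sub>R x) = c *\<^sub>R (x - q x)" by (simp add: q_scale scaleR_diff_right)
  then show ?thesis unfolding K_def using V_scale[OF q_W, of c x] by (simp add: q_scale scaleR_add_right)
qed

lemma K_inner: "K x \<bullet> K y = x \<bullet> y"
proof -
  have o: "q u \<bullet> (v - q v) = 0" "(v - q v) \<bullet> q u = 0" for u v using EW(1)[OF q_E0 q_W] EW(2)[OF q_W q_E0] by simp_all
  have o': "qb u \<bullet> V (v - q v) = 0" "V (v - q v) \<bullet> qb u = 0" for u v
    using EW(1)[OF qb_E0 V_W[OF q_W]] EW(2)[OF V_W[OF q_W] qb_E0] by simp_all
  have qq: "qb x \<bullet> qb y = q x \<bullet> q y"
    unfolding q_def qb_def onf_inner_sums[OF onf_b] onf_inner_sums[OF onf_basis_E0] ..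
  have "K x \<bullet> K y = q x \<bullet> q y + (x - q x) \<bullet> (y - q y)"
    unfolding K_def inner_add_left inner_add_right o' qq V_inner[OF q_W q_W] by simp
  also have "\<dots> = (q x + (x - q x)) \<bullet> (q y + (y - q y))"
    unfolding inner_add_left inner_add_right o by simp
  finally show ?thesis by simp
qed

lemma K_W: assumes "w \<in> W" shows "K w = V w"
proof -
  have "q w = 0" "qb w = 0" unfolding q_def qb_def
    by (rule sum.neutral, use EW(1)[OF basis_E0_E0 assms] in simp)+
  then show ?thesis by (simp add: K_def)
qed

lemma K_basis_E0: assumes "j < p" shows "K (basis_E0 j) = b j"
proof -
  have "q (basis_E0 j) = basis_E0 j" unfolding q_def by (rule E_eq[OF onE_basis_E0 basis_E0_E0[OF assms], symmetric])
  moreover have "V 0 = 0" using V_scale[OF subspace_0[OF subW], of 0] by simp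
  moreover have "qb (basis_E0 j) = b j" unfolding qb_def by (rule onE_delta[OF onE_basis_E0 assms])
  ultimately show ?thesis by (simp add: K_def)
qed

lemma K_sum: "K (\<Sum>j<(n::nat). c j *\<^sub>R x j) = (\<Sum>j<n. c j *\<^sub>R K (x j))"
proof (induction n)
  case 0 show ?case using K_scale[of 0 0] by simp
next
  case (Suc n) then show ?case by (simp add: K_add K_scale)
qed

lemma K_surj: "\<exists>x. K x = y"
proof -
  obtain m where m: "m \<in> W" "V m = y - (\<Sum>j<p. (b j \<bullet> y) *\<^sub>R b j)" using V_surj[OF W_diff[OF b]] by (rule bexE)
  have "K ((\<Sum>j<p. (b j \<bullet> y) *\<^sub>R basis_E0 j) + m) = (\<Sum>j<p. (b j \<bullet> y) *\<^sub>R b j) + V m"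
    unfolding K_add K_sum K_W[OF m(1)] using K_basis_E0 by simp
  then show ?thesis unfolding m(2) by (intro exI[of _ "(\<Sum>j<p. (b j \<bullet> y) *\<^sub>R basis_E0 j) + m"]) simp
qed

lemma K_Phi: "K (\<Phi> x) = \<Phi> (K x)"
proof -
  have 1: "\<Phi> (q x) = q x" "\<Phi> (qb x) = qb x" using PhiE q_E0 qb_E0 by simp_all
  have 2: "\<Phi> (x - q x) = - (x - q x)" "\<Phi> (V (x - q x)) = - V (x - q x)" using q_W V_W[OF q_W] unfolding W_def by simp_all
  have s: "basis_E0 j \<bullet> \<Phi> x = basis_E0 j \<bullet> x" if "j < p" for j using Phi_sym[of "basis_E0 j" x] PhiE[OF basis_E0_E0[OF that]] by simp
  have 3: "q (\<Phi> x) = q x" "qb (\<Phi> x) = qb x" unfolding q_def qb_def using s by simp_all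
  have "\<Phi> x - q x = - (x - q x)" using 2(1) 1(1) by (simp add: blinfun.diff_right)
  then have "K (\<Phi> x) = qb x + V ((- 1) *\<^sub>R (x - q x))" unfolding K_def 3 by simp
  also have "\<dots> = \<Phi> (K x)" unfolding V_scale[OF q_W] K_def blinfun.add_right 1 2 by simp
  finally show ?thesis .
qed

lemma K_bounded: "bounded_linear K"
  by (rule bounded_linear_intro[OF K_add K_scale, of 1]) (simp add: norm_eq_sqrt_inner K_inner)

lemma K_injective: assumes "K x = K y" shows "x = y"
proof -
  have "K (x - y) = 0" using K_add[of x "(- 1) *\<^sub>R y"] assms by (simp add: K_scale[of "- 1", simplified])
  then have "(x - y) \<bullet> (x - y) = 0" using K_inner[of "x - y" "x - y"] by simp
  then show ?thesis by simp
qed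

text \<open>The conjugate of \<open>A\<close> by \<open>K\<close> lies in \<open>pp\<close> and
  agrees with \<open>T A\<close> on the basis \<open>b\<close> of \<open>E0\<close>, so
  \<open>pp_eqI\<close> identifies the two. Orthogonality and commutation with \<open>\<Phi>\<close>
  together give preservation of the form.\<close>

lemma K_operator: "\<exists>(k :: 'a \<Rightarrow>\<^sub>L 'a) g. form_iso k g \<and> (\<forall>x. k (\<Phi> x) = \<Phi> (k x)) \<and> (\<forall>A\<in>pp. \<forall>x. k (blinfun_apply A x) = T A (k x))"
proof -
  define g where "g y = (SOME x. K x = y)" for y
  have Kg: "K (g y) = y" for y unfolding g_def by (rule someI_ex[OF K_surj])
  have gK: "g (K x) = x" for x by (rule K_injective) (rule Kg)
  have gi: "g x \<bullet> g y = x \<bullet> y" for x y using K_inner[of "g x" "g y"] by (simp add: Kg)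
  have "bounded_linear g"
  proof (rule bounded_linear_intro[of _ 1])
    show "g (x + y) = g x + g y" for x y by (rule K_injective) (simp add: Kg K_add)
    show "g (c *\<^sub>R x) = c *\<^sub>R g x" for c x by (rule K_injective) (simp add: Kg K_scale)
  qed (simp add: norm_eq_sqrt_inner gi)
  then have G: "blinfun_apply (Blinfun g) = g" by (rule bounded_linear_Blinfun_apply)
  have k: "blinfun_apply (Blinfun K) = K" by (rule bounded_linear_Blinfun_apply[OF K_bounded])
  have gP: "g (\<Phi> x) = \<Phi> (g x)" for x by (rule K_injective) (simp add: Kg K_Phi)
  have "form_iso (Blinfun K) (Blinfun g)"
    unfolding form_iso_def k G K_Phi[symmetric] K_inner by (intro conjI allI gK Kg refl)
  moreover have "K (A x) = T A (K x)" if A: "A \<in> pp" for A x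
  proof -
    define B where "B = Blinfun K o\<^sub>L A o\<^sub>L Blinfun g"
    have B: "B y = K (A (g y))" for y by (simp add: B_def k G)
    have Bp: "B \<in> pp" unfolding pp_def
    proof (intro CollectI conjI allI)
      fix x y
      have "B x \<bullet> y = K (A (g x)) \<bullet> K (g y)" by (simp add: B Kg)
      also have "\<dots> = K (g x) \<bullet> K (A (g y))" unfolding K_inner by (rule pp_sym[OF A])
      finally show "B x \<bullet> y = x \<bullet> B y" by (simp add: B Kg)
    next
      fix x
      have "K (A (\<Phi> (g x))) = K ((- 1) *\<^sub>R \<Phi> (A (g x)))" by (simp add: pp_anti[OF A])
      then show "B (\<Phi> x) = - \<Phi> (B x)" unfolding K_scale by (simp add: B gP K_Phi)
    qed
    have "T A = B"
    proof (rule pp_eqI[OF T(1)[OF A] Bp b])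
      fix j assume j: "j < p"
      have "B (b j) = K (A (basis_E0 j))" unfolding B K_basis_E0[OF j, symmetric] gK ..
      also have "\<dots> = T A (b j)" unfolding T_at_b[OF A j] by (rule K_W[OF pp_EW[OF A basis_E0_E0[OF j]]])
      finally show "T A (b j) = B (b j)" by (rule sym)
    qed
    then show ?thesis by (simp add: B gK)
  qed
  ultimately show ?thesis using K_Phi by (intro exI[of _ "Blinfun K"] exI[of _ "Blinfun g"]) (simp add: k)
qed

end

text \<open>Both \<open>f\<close> and \<open>k\<close> carry \<open>ex 1 A\<close>
  E0\<open>to\<close>ex 1 (T A) \<open>E0\<close>, and every point has this form.\<close>

lemma is_action: "\<exists>k g. form_iso k g \<and> (\<forall>E\<in>X. f E = blinfun_apply k ` E)"
proof -
  obtain b where b: "onE b" "\<forall>j<p. \<forall>m\<in>W. T (sym_dyad m (basis_E0 j)) = sym_dyad (T (sym_dyad m (basis_E0 0)) (b 0)) (b j)"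
    using ex_image_basis by (elim exE conjE)
  obtain k g where kg: "form_iso k g" and kP: "\<forall>x. blinfun_apply k (\<Phi> x) = \<Phi> (k x)"
    and kT: "\<forall>A\<in>pp. \<forall>x. blinfun_apply k (blinfun_apply A x) = T A (k x)"
    using K_operator[OF b] by (elim exE conjE)
  have gP: "blinfun_apply g (\<Phi> x) = \<Phi> (g x)" for x using kP form_isoD(1)[OF kg, of "\<Phi> (g x)"] form_isoD(2)[OF kg, of x] by simp
  have kE: "blinfun_apply k ` E0 = E0"
  proof
    show "k ` E0 \<subseteq> E0" 
    proof (rule image_subsetI)
      fix x assume "x \<in> E0"
      then show "k x \<in> E0" unfolding E_iff using spec[OF kP, of x] by simp
    qed
    show "E0 \<subseteq> k ` E0"
    proof
      fix x assume "x \<in> E0"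
      then have "g x \<in> E0" unfolding E_iff using gP[of x] by simp
      then have "k (g x) \<in> k ` E0" by (rule imageI)
      then show "x \<in> k ` E0" unfolding form_isoD(2)[OF kg] .
    qed
  qed
  have "f E = k ` E" if E: "E \<in> X" for E
  proof -
    obtain A where A: "A \<in> pp" "E = ex 1 A ` E0" using X_ex_frame[OF E] by (rule bexE)
    have "k (ex 1 A x) = ex 1 (T A) (k x)" for x
      using ex_intertwine[OF A(1) T(1)[OF A(1)], of k 1 1 x] bspec[OF kT A(1)] by simp
    then have "k ` E = ex 1 (T A) ` k ` E0" unfolding A(2) image_image by simp
    then show ?thesis unfolding kE A(2) T(2)[OF A(1)] by (rule sym)
  qed
  then show ?thesis using kg by (intro exI[of _ k] exI[of _ g]) simp
qed

end

section \<open>The isometry group and the kernel of the action\<close>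

context hilbert_splitting
begin

lemma image_inverse: "form_iso h g \<Longrightarrow> g ` h ` E = E"
  by (simp add: image_image form_isoD)

lemma isometry_image: assumes h: "form_iso h g" shows "refl.isometry ((`) h)"
  unfolding refl.isometry_def
proof (intro conjI ballI)
  show "bij_betw ((`) h) X X"
  proof (rule bij_betw_byWitness[where f'="(`) g"])
    show "\<forall>E\<in>X. g ` h ` E = E" using image_inverse[OF h] by simp
    show "\<forall>E\<in>X. h ` g ` E = E" using image_inverse[OF form_iso_inv[OF h]] by simp
    show "(`) h ` X \<subseteq> X" using image_X[OF h] by (intro image_subsetI)
    show "(`) g ` X \<subseteq> X" using image_X[OF form_iso_inv[OF h]] by (intro image_subsetI)
  qed
qed (rule dX_image[OF h])

text \<open>Transitivity of the group reduces the claim to isometries that fix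
  \<open>E0\<close>.\<close>

lemma isometry_is_action:
  assumes f: "refl.isometry f"
  shows "\<exists>h g. form_iso h g \<and> (\<forall>E\<in>X. f E = blinfun_apply h ` E)"
proof -
  obtain h g where h: "form_iso h g" "f E0 = h ` E0" using X_form_iso[OF refl.isometry_in[OF f E0_X]] .
  interpret i: iso_fix E0 \<Phi> p "(`) g \<circ> f"
  proof
    show "refl.isometry ((`) g \<circ> f)" by (rule refl.isometry_comp[OF isometry_image[OF form_iso_inv[OF h(1)]] f])
    show "((`) g \<circ> f) E0 = E0" unfolding comp_apply h(2) by (rule image_inverse[OF h(1)])
  qed
  obtain k k' where k: "form_iso k k'" "\<forall>E\<in>X. ((`) g \<circ> f) E = k ` E" using i.is_action by (elim exE conjE)
  have "f E = (h o\<^sub>L k) ` E" if E: "E \<in> X" for E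
  proof -
    have "h ` g ` f E = h ` k ` E" using bspec[OF k(2) E] by simp
    then show ?thesis unfolding image_inverse[OF form_iso_inv[OF h(1)]] by (simp add: image_image)
  qed
  then show ?thesis using form_iso_comp[OF h(1) k(1)] by (intro exI[of _ "h o\<^sub>L k"] exI[of _ "k' o\<^sub>L g"]) simp
qed

lemma O_group: "group (O_group \<Phi>)"
proof (rule groupI)
  have m: "x \<otimes>\<^bsub>O_group \<Phi>\<^esub> y = x o\<^sub>L y" "\<one>\<^bsub>O_group \<Phi>\<^esub> = id_blinfun" for x y by (simp_all add: O_group_def)
  show "x \<otimes>\<^bsub>O_group \<Phi>\<^esub> y \<in> carrier (O_group \<Phi>)" if "x \<in> carrier (O_group \<Phi>)" "y \<in> carrier (O_group \<Phi>)" for x y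
    using that form_iso_comp unfolding m O_group_iff by blast
  show "\<one>\<^bsub>O_group \<Phi>\<^esub> \<in> carrier (O_group \<Phi>)" using form_iso_id unfolding m O_group_iff by blast
  show "x \<otimes>\<^bsub>O_group \<Phi>\<^esub> y \<otimes>\<^bsub>O_group \<Phi>\<^esub> z = x \<otimes>\<^bsub>O_group \<Phi>\<^esub> (y \<otimes>\<^bsub>O_group \<Phi>\<^esub> z)" for x y z
    unfolding m by (rule blinfun_eqI) simp
  show "\<one>\<^bsub>O_group \<Phi>\<^esub> \<otimes>\<^bsub>O_group \<Phi>\<^esub> x = x" for x unfolding m by (rule blinfun_eqI) simp
  show "\<exists>y\<in>carrier (O_group \<Phi>). y \<otimes>\<^bsub>O_group \<Phi>\<^esub> x = \<one>\<^bsub>O_group \<Phi>\<^esub>" if x: "x \<in> carrier (O_group \<Phi>)" for x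
  proof -
    obtain g where g: "form_iso x g" using x unfolding O_group_iff by (rule exE)
    have "g o\<^sub>L x = id_blinfun" by (rule blinfun_eqI) (simp add: form_isoD[OF g])
    moreover have "g \<in> carrier (O_group \<Phi>)" using form_iso_inv[OF g] unfolding O_group_iff by (rule exI)
    ultimately show ?thesis unfolding m by (rule bexI)
  qed
qed

text \<open>Elements of \<open>Bij\<close> are extensional functions. The geometric arguments ignore
  values outside the space, so the two conditions are kept apart here and \<open>restrict\<close>
  mediates between them.\<close>

lemma Isom_iff: "f \<in> carrier (Isom_group p E0 \<Phi>) \<longleftrightarrow> f \<in> extensional X \<and> refl.isometry f"
  by (auto simp: Isom_group_def Bij_def refl.isometry_def)

lemma isometry_restrict: assumes f: "refl.isometry f" shows "refl.isometry (restrict f X)"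
proof -
  have "bij_betw (restrict f X) X X \<longleftrightarrow> bij_betw f X X" by (rule bij_betw_cong) simp
  then show ?thesis using f by (simp add: refl.isometry_def)
qed

lemma isometry_compose:
  assumes f: "refl.isometry f" and g: "refl.isometry g" shows "refl.isometry (compose X f g)"
  using isometry_restrict[OF refl.isometry_comp[OF f g]] by (simp add: compose_def comp_def)

lemma Isom_Bij: "f \<in> carrier (Isom_group p E0 \<Phi>) \<Longrightarrow> f \<in> Bij X"
  by (simp add: Isom_group_def)

lemma Isom_mult:
  assumes "f \<in> Bij X" "g \<in> Bij X"
  shows "f \<otimes>\<^bsub>BijGroup X\<^esub> g = compose X f g"
  using assms by (simp add: BijGroup_def)

lemma Isom_group: "group (Isom_group p E0 \<Phi>)"
proof -
  let ?I = "carrier (Isom_group p E0 \<Phi>)"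
  interpret B: group "BijGroup X" by (rule group_BijGroup)
  have "subgroup ?I (BijGroup X)"
  proof
    show "?I \<subseteq> carrier (BijGroup X)" using Isom_Bij by (auto simp: BijGroup_def)
    show "f \<otimes>\<^bsub>BijGroup X\<^esub> g \<in> ?I" if "f \<in> ?I" "g \<in> ?I" for f g
      using that isometry_compose[of f g] unfolding Isom_mult[OF Isom_Bij Isom_Bij, OF that] by (simp add: Isom_iff)
    have "refl.isometry (\<lambda>E\<in>X. E)" 
    proof -
      have "restrict ((`) (blinfun_apply id_blinfun)) X = (\<lambda>E\<in>X. E)" by (rule restrict_ext) simp
      then show ?thesis using isometry_restrict[OF isometry_image[OF form_iso_id]] by (simp only:)
    qed
    then show "\<one>\<^bsub>BijGroup X\<^esub> \<in> ?I" by (simp add: BijGroup_def Isom_iff)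
    show "inv\<^bsub>BijGroup X\<^esub> f \<in> ?I" if "f \<in> ?I" for f
      using that isometry_restrict[OF refl.isometry_inv(1), of f]
      unfolding inv_BijGroup[OF Isom_Bij[OF that]] by (simp add: Isom_iff)
  qed
  moreover have "Isom_group p E0 \<Phi> = BijGroup X \<lparr>carrier := ?I\<rparr>" by (simp add: Isom_group_def)
  ultimately show ?thesis using subgroup.subgroup_is_group[OF _ group_BijGroup] by metis
qed

lemma action_Isom: assumes "form_iso h g" shows "action_hom p \<Phi> h \<in> carrier (Isom_group p E0 \<Phi>)"
  using isometry_restrict[OF isometry_image[OF assms]] by (simp add: Isom_iff action_hom_def)

lemma action_group_hom: "group_hom (O_group \<Phi>) (Isom_group p E0 \<Phi>) (action_hom p \<Phi>)"
proof (intro group_hom.intro group_hom_axioms.intro O_group Isom_group homI)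
  fix h assume "h \<in> carrier (O_group \<Phi>)"
  then obtain g where h: "form_iso h g" unfolding O_group_iff by (rule exE)
  show "action_hom p \<Phi> h \<in> carrier (Isom_group p E0 \<Phi>)" by (rule action_Isom[OF h])
  fix h' assume "h' \<in> carrier (O_group \<Phi>)"
  then obtain g' where h': "form_iso h' g'" unfolding O_group_iff by (rule exE)
  have "action_hom p \<Phi> (h o\<^sub>L h') = compose X (action_hom p \<Phi> h) (action_hom p \<Phi> h')"
    using image_X[OF h'] by (auto simp: action_hom_def compose_def fun_eq_iff restrict_def image_image)
  moreover have "action_hom p \<Phi> h \<otimes>\<^bsub>Isom_group p E0 \<Phi>\<^esub> action_hom p \<Phi> h' = action_hom p \<Phi> h \<otimes>\<^bsub>BijGroup X\<^esub> action_hom p \<Phi> h'"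
    by (simp add: Isom_group_def)
  ultimately show "action_hom p \<Phi> (h \<otimes>\<^bsub>O_group \<Phi>\<^esub> h')
      = action_hom p \<Phi> h \<otimes>\<^bsub>Isom_group p E0 \<Phi>\<^esub> action_hom p \<Phi> h'"
    using Isom_mult[OF Isom_Bij[OF action_Isom[OF h]] Isom_Bij[OF action_Isom[OF h']]] by (simp add: O_group_def)
qed

lemma action_surj: "action_hom p \<Phi> ` carrier (O_group \<Phi>) = carrier (Isom_group p E0 \<Phi>)"
proof
  show "action_hom p \<Phi> ` carrier (O_group \<Phi>) \<subseteq> carrier (Isom_group p E0 \<Phi>)"
    by (rule image_subsetI) (use action_Isom in \<open>auto simp: O_group_iff\<close>)
  show "carrier (Isom_group p E0 \<Phi>) \<subseteq> action_hom p \<Phi> ` carrier (O_group \<Phi>)"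
  proof
    fix f assume "f \<in> carrier (Isom_group p E0 \<Phi>)"
    then have f: "f \<in> extensional X" "refl.isometry f" by (simp_all add: Isom_iff)
    obtain h g where h: "form_iso h g" "\<forall>E\<in>X. f E = h ` E" using isometry_is_action[OF f(2)] by (elim exE conjE)
    have "f = action_hom p \<Phi> h" unfolding action_hom_def
      by (rule extensionalityI[OF f(1) restrict_extensional]) (use h(2) in simp)
    moreover have "h \<in> carrier (O_group \<Phi>)" unfolding O_group_iff using h(1) by (rule exI)
    ultimately show "f \<in> action_hom p \<Phi> ` carrier (O_group \<Phi>)" by (rule image_eqI)
  qed
qed

lemma action_kernel: "kernel (O_group \<Phi>) (Isom_group p E0 \<Phi>) (action_hom p \<Phi>) = {id_blinfun, - id_blinfun}"
proof -
  have k: "h \<in> kernel (O_group \<Phi>) (Isom_group p E0 \<Phi>) (action_hom p \<Phi>)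
      \<longleftrightarrow> (\<exists>g. form_iso h g) \<and> (\<forall>E\<in>X. h ` E = E)" for h
    unfolding kernel_def mem_Collect_eq O_group_iff
    by (auto simp: Isom_group_def BijGroup_def action_hom_def restrict_def fun_eq_iff split: if_splits)
  have sub: "subspace E" if "E \<in> X" for E using that by (simp add: X_space_def)
  have m: "form_iso (- id_blinfun) (- id_blinfun)" by (simp add: form_iso_def blinfun.minus_left blinfun.minus_right)
  have "(- id_blinfun) ` E = E" if E: "E \<in> X" for E
  proof
    show "(- id_blinfun) ` E \<subseteq> E" using subspace_neg[OF sub[OF E]] by (auto simp: blinfun.minus_left)
    show "E \<subseteq> (- id_blinfun) ` E"
    proof
      fix x assume "x \<in> E"
      then have "- x \<in> E" by (rule subspace_neg[OF sub[OF E]])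
      then show "x \<in> (- id_blinfun) ` E" by (rule image_eqI[rotated]) (simp add: blinfun.minus_left)
    qed
  qed
  then have 2: "- id_blinfun \<in> kernel (O_group \<Phi>) (Isom_group p E0 \<Phi>) (action_hom p \<Phi>)"
    unfolding k using m by blast
  have 1: "id_blinfun \<in> kernel (O_group \<Phi>) (Isom_group p E0 \<Phi>) (action_hom p \<Phi>)"
    unfolding k using form_iso_id by auto
  show ?thesis
  proof
    show "kernel (O_group \<Phi>) (Isom_group p E0 \<Phi>) (action_hom p \<Phi>) \<subseteq> {id_blinfun, - id_blinfun}"
    proof
      fix h assume "h \<in> kernel (O_group \<Phi>) (Isom_group p E0 \<Phi>) (action_hom p \<Phi>)"
      then obtain g where g: "form_iso h g" and tr: "\<forall>E\<in>X. h ` E = E" unfolding k by (elim conjE exE)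
      show "h \<in> {id_blinfun, - id_blinfun}" using trivial_action[OF g bspec[OF tr]] by simp
    qed
  qed (use 1 2 in simp)
qed

end

theorem corollary1p6:
  fixes E0 :: "'a::{real_inner, complete_space} set"
    and \<Phi> :: "'a \<Rightarrow>\<^sub>L 'a"
    and p :: nat
  assumes "separable_space (euclidean :: 'a topology)"
    and "infinite_dimensional TYPE('a)"
    and "p > 0"
    and "subspace E0" and "dim E0 = p"
    and "\<And>x. x \<in> E0 \<Longrightarrow> \<Phi> x = x"
    and "\<And>x. x \<in> orthogonal_comp E0 \<Longrightarrow> \<Phi> x = - x"
  shows "group_hom (O_group \<Phi>) (Isom_group p E0 \<Phi>) (action_hom p \<Phi>)
    \<and> action_hom p \<Phi> ` carrier (O_group \<Phi>) = carrier (Isom_group p E0 \<Phi>)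
    \<and> kernel (O_group \<Phi>) (Isom_group p E0 \<Phi>) (action_hom p \<Phi>) = {id_blinfun, - id_blinfun}
    \<and> (\<lambda>C. the_elem (action_hom p \<Phi> ` C)) \<in> iso (PO_group \<Phi>) (Isom_group p E0 \<Phi>)"
proof -
  interpret hilbert_splitting E0 \<Phi> p using assms by unfold_locales
  interpret h: group_hom "O_group \<Phi>" "Isom_group p E0 \<Phi>" "action_hom p \<Phi>" by (rule action_group_hom)
  \<comment> \<open>The first isomorphism theorem; \<open>the_elem\<close> picks the value that the
    action takes on a whole coset.\<close>
  have "(\<lambda>C. the_elem (action_hom p \<Phi> ` C)) \<in> iso (PO_group \<Phi>) (Isom_group p E0 \<Phi>)"
    using h.FactGroup_iso_set[OF action_surj] unfolding action_kernel PO_group_def .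
  then show ?thesis by (intro conjI action_group_hom action_surj action_kernel)
qed

end
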